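(* Let $\mathcal V$ be a descent category and $k$ a natural number. Let $s_k\mathcal V$ be the category of $k$-groupoids in $\mathcal V$ (with all simplicial morphisms as morphisms), equipped with the fibrations as fibrations and the weak equivalences as weak equivalences (as defined below). Then $s_k\mathcal V$ is a category of fibrant objects, and its trivial fibrations (morphisms that are both fibrations and weak equivalences) are exactly the hypercovers.
   Context: A descent category is a small category $\mathcal V$ (whose objects are called spaces) together with a subcategory of morphisms called covers such that: (D1) $\mathcal V$ has finite limits; (D2) the pullback of a cover is a cover; (D3) if $f$ and $g\circ f$ are covers, then $g$ is a cover. A simplicial space is a simplicial object in $\mathcal V$. A finite simplicial set is one with finitely many nondegenerate simplices; for a simplicial space $X$ and a finite simplicial set $T$, $\mathrm{Map}(T,X)$ is the object of $\mathcal V$ (a finite limit) representing simplicial maps $T\to X$; thus $\mathrm{Map}(\Delta^n,X)=X_n$. For a morphism $f:X\to Y$ of simplicial spaces and a simplicial subset $S\subset T$, put $\mathrm{Map}(S\hookrightarrow T,f)=\mathrm{Map}(S,X)\times_{\mathrm{Map}(S,Y)}\mathrm{Map}(T,Y)$, with the natural morphism $\mathrm{Map}(T,X)\to \mathrm{Map}(S\hookrightarrow T,f)$. $\partial\Delta^n$ is the boundary of $\Delta^n$ and $\Lambda^n_i=\bigcup_{j\ne i}\partial_j\Delta^n$ ($0\le i\le n$) is the horn. A $k$-groupoid is a simplicial space $X$ such that $X_n\to\mathrm{Map}(\Lambda^n_i,X)$ is a cover for all $n>0$, $0\le i\le n$, and an isomorphism for $n>k$. A morphism $f:X\to Y$ of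 simplicial spaces is a fibration if $X_n\to\mathrm{Map}(\Lambda^n_i\hookrightarrow\Delta^n,f)$ is a cover for all $n>0$, $0\le i\le n$; it is a hypercover if $X_n\to\mathrm{Map}(\partial\Delta^n\hookrightarrow\Delta^n,f)$ is a cover for all $n\ge0$. For a simplicial space $Y$ let $P_1Y$ be the simplicial space with $(P_1Y)_m=\mathrm{Map}(\Delta^m\times\Delta^1,Y)$, with the two morphisms $P_1Y\to Y$ induced by $\Delta^m\times\{0\}$ and $\Delta^m\times\{1\}$. For $f:X\to Y$ let $P(f)=X\times_YP_1Y$ (pullback along the first of these) and $q(f):P(f)\to Y$ the composite with the second. A morphism $f$ of $k$-groupoids is a weak equivalence if $q(f)$ is a hypercover. A category of fibrant objects is a small category $\mathcal C$ with a subcategory $\mathcal W$ of weak equivalences containing all isomorphisms such that whenever $g\circ f\in\mathcal W$, $f\in\mathcal W$ iff $g\in\mathcal W$, and a subcategory of fibrations, such that (writing trivial fibration for a fibration that is a weak equivalence): (F1) there is a terminal object $e$ and every morphism to $e$ is a fibration; (F2) pullbacks of fibrations exist and are fibrations; (F3) pullbacks of trivial fibrations are trivial fibrations; (F4) every morphism factors as a weak equivalence followed by a fibration. *)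

theory Defs
  imports Main
begin

record ('o,'m) cat =
  cOb   :: "'o set"
  cAr   :: "'m set"
  cDom  :: "'m \<Rightarrow> 'o"
  cCod  :: "'m \<Rightarrow> 'o"
  cId   :: "'o \<Rightarrow> 'm"
  cComp :: "'m \<Rightarrow> 'm \<Rightarrow> 'm"  \<comment> \<open>cComp C g f = g o f\<close>

definition hom :: "('o,'m) cat \<Rightarrow> 'o \<Rightarrow> 'o \<Rightarrow> 'm set" where
  "hom C a b = {f \<in> cAr C. cDom C f = a \<and> cCod C f = b}"

definition category :: "('o,'m) cat \<Rightarrow> bool" where
  "category C \<longleftrightarrow>
     (\<forall>f\<in>cAr C. cDom C f \<in> cOb C \<and> cCod C f \<in> cOb C) \<and>
     (\<forall>a\<in>cOb C. cId C a \<in> hom C a a) \<and>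
     (\<forall>f\<in>cAr C. \<forall>g\<in>cAr C. cCod C f = cDom C g \<longrightarrow>
        cComp C g f \<in> hom C (cDom C f) (cCod C g)) \<and>
     (\<forall>f\<in>cAr C. cComp C f (cId C (cDom C f)) = f \<and> cComp C (cId C (cCod C f)) f = f) \<and>
     (\<forall>f\<in>cAr C. \<forall>g\<in>cAr C. \<forall>h\<in>cAr C. cCod C f = cDom C g \<and> cCod C g = cDom C h \<longrightarrow>
        cComp C h (cComp C g f) = cComp C (cComp C h g) f)"

definition is_iso :: "('o,'m) cat \<Rightarrow> 'm \<Rightarrow> bool" where
  "is_iso C f \<longleftrightarrow> f \<in> cAr C \<and>
     (\<exists>g \<in> hom C (cCod C f) (cDom C f).
        cComp C g f = cId C (cDom C f) \<and> cComp C f g = cId C (cCod C f))"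

definition subcat :: "('o,'m) cat \<Rightarrow> 'm set \<Rightarrow> bool" where
  "subcat C S \<longleftrightarrow> S \<subseteq> cAr C \<and> (\<forall>a\<in>cOb C. cId C a \<in> S) \<and>
     (\<forall>f\<in>S. \<forall>g\<in>S. cCod C f = cDom C g \<longrightarrow> cComp C g f \<in> S)"

definition terminal :: "('o,'m) cat \<Rightarrow> 'o \<Rightarrow> bool" where
  "terminal C e \<longleftrightarrow> e \<in> cOb C \<and> (\<forall>a\<in>cOb C. \<exists>!f. f \<in> hom C a e)"

definition is_pullback :: "('o,'m) cat \<Rightarrow> 'm \<Rightarrow> 'm \<Rightarrow> 'm \<Rightarrow> 'm \<Rightarrow> bool" where
  "is_pullback C f g p q \<longleftrightarrow>
     f \<in> cAr C \<and> g \<in> cAr C \<and> cCod C f = cCod C g \<and>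
     p \<in> cAr C \<and> q \<in> cAr C \<and> cDom C p = cDom C q \<and>
     cCod C p = cDom C f \<and> cCod C q = cDom C g \<and>
     cComp C f p = cComp C g q \<and>
     (\<forall>p' q'. p' \<in> cAr C \<and> q' \<in> cAr C \<and> cDom C p' = cDom C q' \<and>
        cCod C p' = cDom C f \<and> cCod C q' = cDom C g \<and> cComp C f p' = cComp C g q' \<longrightarrow>
        (\<exists>!h. h \<in> hom C (cDom C p') (cDom C p) \<and> cComp C p h = p' \<and> cComp C q h = q'))"

definition is_functor :: "('a,'b) cat \<Rightarrow> ('o,'m) cat \<Rightarrow> ('a \<Rightarrow> 'o) \<Rightarrow> ('b \<Rightarrow> 'm) \<Rightarrow> bool" where
  "is_functor J C Fo Fa \<longleftrightarrow>
     (\<forall>j\<in>cOb J. Fo j \<in> cOb C) \<and>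
     (\<forall>u\<in>cAr J. Fa u \<in> hom C (Fo (cDom J u)) (Fo (cCod J u))) \<and>
     (\<forall>j\<in>cOb J. Fa (cId J j) = cId C (Fo j)) \<and>
     (\<forall>u\<in>cAr J. \<forall>v\<in>cAr J. cCod J u = cDom J v \<longrightarrow> Fa (cComp J v u) = cComp C (Fa v) (Fa u))"

definition is_cone :: "('a,'b) cat \<Rightarrow> ('o,'m) cat \<Rightarrow> ('a \<Rightarrow> 'o) \<Rightarrow> ('b \<Rightarrow> 'm) \<Rightarrow> 'o \<Rightarrow> ('a \<Rightarrow> 'm) \<Rightarrow> bool" where
  "is_cone J C Fo Fa L l \<longleftrightarrow> L \<in> cOb C \<and>
     (\<forall>j\<in>cOb J. l j \<in> hom C L (Fo j)) \<and>
     (\<forall>u\<in>cAr J. cComp C (Fa u) (l (cDom J u)) = l (cCod J u))"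

definition is_limit :: "('a,'b) cat \<Rightarrow> ('o,'m) cat \<Rightarrow> ('a \<Rightarrow> 'o) \<Rightarrow> ('b \<Rightarrow> 'm) \<Rightarrow> 'o \<Rightarrow> ('a \<Rightarrow> 'm) \<Rightarrow> bool" where
  "is_limit J C Fo Fa L l \<longleftrightarrow> is_cone J C Fo Fa L l \<and>
     (\<forall>U m. is_cone J C Fo Fa U m \<longrightarrow>
        (\<exists>!h. h \<in> hom C U L \<and> (\<forall>j\<in>cOb J. cComp C (l j) h = m j)))"

text \<open>Every finite category is isomorphic to one whose objects and arrows are natural numbers.\<close>
definition has_finite_limits :: "('o,'m) cat \<Rightarrow> bool" where
  "has_finite_limits C \<longleftrightarrow>
     (\<forall>J :: (nat,nat) cat. category J \<and> finite (cOb J) \<and> finite (cAr J) \<longrightarrow>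
       (\<forall>Fo Fa. is_functor J C Fo Fa \<longrightarrow> (\<exists>L l. is_limit J C Fo Fa L l)))"

definition descent_category :: "('o,'m) cat \<Rightarrow> 'm set \<Rightarrow> bool" where
  "descent_category C Cov \<longleftrightarrow>
     category C \<and> subcat C Cov \<and>
     has_finite_limits C \<and>
     (\<forall>f\<in>Cov. \<forall>g\<in>cAr C. \<forall>p q. cCod C g = cCod C f \<and> is_pullback C f g p q \<longrightarrow> q \<in> Cov) \<and>
     (\<forall>f\<in>Cov. \<forall>g\<in>cAr C. cCod C f = cDom C g \<and> cComp C g f \<in> Cov \<longrightarrow> g \<in> Cov)"

text \<open>Monotone maps [m] -> [n], represented by functions nat => nat that vanish above m.\<close>
definition delta_hom :: "nat \<Rightarrow> nat \<Rightarrow> (nat \<Rightarrow> nat) \<Rightarrow> bool" where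
  "delta_hom m n \<theta> \<longleftrightarrow> (\<forall>i\<le>m. \<theta> i \<le> n) \<and> (\<forall>i j. i \<le> j \<and> j \<le> m \<longrightarrow> \<theta> i \<le> \<theta> j) \<and>
     (\<forall>i>m. \<theta> i = 0)"

definition delta_id :: "nat \<Rightarrow> nat \<Rightarrow> nat" where
  "delta_id m = (\<lambda>i. if i \<le> m then i else 0)"

definition dcomp :: "nat \<Rightarrow> (nat \<Rightarrow> nat) \<Rightarrow> (nat \<Rightarrow> nat) \<Rightarrow> nat \<Rightarrow> nat" where
  "dcomp l \<theta> \<psi> = (\<lambda>i. if i \<le> l then \<theta> (\<psi> i) else 0)"

text \<open>sM X m n \<theta> : X_n -> X_m is the structure morphism X(\<theta>) for \<theta> : [m] -> [n].\<close>
record ('o,'m) sobj =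
  sO :: "nat \<Rightarrow> 'o"
  sM :: "nat \<Rightarrow> nat \<Rightarrow> (nat \<Rightarrow> nat) \<Rightarrow> 'm"

definition simplicial_object :: "('o,'m) cat \<Rightarrow> ('o,'m) sobj \<Rightarrow> bool" where
  "simplicial_object C X \<longleftrightarrow>
     (\<forall>n. sO X n \<in> cOb C) \<and>
     (\<forall>m n \<theta>. delta_hom m n \<theta> \<longrightarrow> sM X m n \<theta> \<in> hom C (sO X n) (sO X m)) \<and>
     (\<forall>m n \<theta>. \<not> delta_hom m n \<theta> \<longrightarrow> sM X m n \<theta> = undefined) \<and>
     (\<forall>n. sM X n n (delta_id n) = cId C (sO X n)) \<and>
     (\<forall>l m n \<theta> \<psi>. delta_hom m n \<theta> \<and> delta_hom l m \<psi> \<longrightarrow>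
        sM X l n (dcomp l \<theta> \<psi>) = cComp C (sM X l m \<psi>) (sM X m n \<theta>))"

definition smor :: "('o,'m) cat \<Rightarrow> ('o,'m) sobj \<Rightarrow> ('o,'m) sobj \<Rightarrow> (nat \<Rightarrow> 'm) \<Rightarrow> bool" where
  "smor C X Y f \<longleftrightarrow>
     (\<forall>n. f n \<in> hom C (sO X n) (sO Y n)) \<and>
     (\<forall>m n \<theta>. delta_hom m n \<theta> \<longrightarrow>
        cComp C (sM Y m n \<theta>) (f n) = cComp C (f m) (sM X m n \<theta>))"

text \<open>Smp T m: the m-simplices; Act T m n \<theta> : T_n -> T_m for \<theta> : [m] -> [n].\<close>
record 'a sset =
  Smp :: "nat \<Rightarrow> 'a set"
  Act :: "nat \<Rightarrow> nat \<Rightarrow> (nat \<Rightarrow> nat) \<Rightarrow> 'a \<Rightarrow> 'a"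

definition std_simplex :: "nat \<Rightarrow> (nat \<Rightarrow> nat) sset" where
  "std_simplex n = \<lparr>Smp = (\<lambda>m. {\<theta>. delta_hom m n \<theta>}),
                    Act = (\<lambda>m k \<psi> \<theta>. dcomp m \<theta> \<psi>)\<rparr>"

definition boundary :: "nat \<Rightarrow> (nat \<Rightarrow> nat) sset" where
  "boundary n = \<lparr>Smp = (\<lambda>m. {\<theta>. delta_hom m n \<theta> \<and> \<not> {0..n} \<subseteq> \<theta> ` {0..m}}),
                 Act = (\<lambda>m k \<psi> \<theta>. dcomp m \<theta> \<psi>)\<rparr>"

text \<open>Horn: union of the faces d_j Delta^n (simplices missing vertex j) for j /= i.\<close>
definition horn :: "nat \<Rightarrow> nat \<Rightarrow> (nat \<Rightarrow> nat) sset" where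
  "horn n i = \<lparr>Smp = (\<lambda>m. {\<theta>. delta_hom m n \<theta> \<and> (\<exists>j\<le>n. j \<noteq> i \<and> j \<notin> \<theta> ` {0..m})}),
               Act = (\<lambda>m k \<psi> \<theta>. dcomp m \<theta> \<psi>)\<rparr>"

definition prism :: "nat \<Rightarrow> ((nat \<Rightarrow> nat) \<times> (nat \<Rightarrow> nat)) sset" where
  "prism m = \<lparr>Smp = (\<lambda>k. {(\<alpha>, \<phi>). delta_hom k m \<alpha> \<and> delta_hom k 1 \<phi>}),
              Act = (\<lambda>k l \<psi> (\<alpha>, \<phi>). (dcomp k \<alpha> \<psi>, dcomp k \<phi> \<psi>))\<rparr>"

text \<open>A simplicial map T -> Hom(U, X_-), i.e. a U-valued point of Map(T,X).\<close>
definition is_point :: "('o,'m) cat \<Rightarrow> 'a sset \<Rightarrow> ('o,'m) sobj \<Rightarrow> 'o \<Rightarrow> (nat \<Rightarrow> 'a \<Rightarrow> 'm) \<Rightarrow> bool" where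
  "is_point C T X U x \<longleftrightarrow>
     (\<forall>n. \<forall>t\<in>Smp T n. x n t \<in> hom C U (sO X n)) \<and>
     (\<forall>m n \<theta>. \<forall>t\<in>Smp T n. delta_hom m n \<theta> \<longrightarrow>
        cComp C (sM X m n \<theta>) (x n t) = x m (Act T m n \<theta> t))"

definition rep_Map :: "('o,'m) cat \<Rightarrow> 'a sset \<Rightarrow> ('o,'m) sobj \<Rightarrow> 'o \<Rightarrow> (nat \<Rightarrow> 'a \<Rightarrow> 'm) \<Rightarrow> bool" where
  "rep_Map C T X M \<tau> \<longleftrightarrow> M \<in> cOb C \<and> is_point C T X M \<tau> \<and>
     (\<forall>U\<in>cOb C. \<forall>\<sigma>. is_point C T X U \<sigma> \<longrightarrow>
        (\<exists>!u. u \<in> hom C U M \<and> (\<forall>n. \<forall>t\<in>Smp T n. cComp C (\<tau> n t) u = \<sigma> n t)))"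

text \<open>(B, \<sigma>0, \<rho>0) represents Map(S \<hookrightarrow> T, f) = Map(S,X) x_{Map(S,Y)} Map(T,Y), for f : X -> Y.\<close>
definition rep_rel :: "('o,'m) cat \<Rightarrow> 'a sset \<Rightarrow> 'a sset \<Rightarrow> ('o,'m) sobj \<Rightarrow> ('o,'m) sobj \<Rightarrow> (nat \<Rightarrow> 'm)
     \<Rightarrow> 'o \<Rightarrow> (nat \<Rightarrow> 'a \<Rightarrow> 'm) \<Rightarrow> (nat \<Rightarrow> 'a \<Rightarrow> 'm) \<Rightarrow> bool" where
  "rep_rel C S T X Y f B \<sigma>0 \<rho>0 \<longleftrightarrow> B \<in> cOb C \<and> is_point C S X B \<sigma>0 \<and> is_point C T Y B \<rho>0 \<and>
     (\<forall>n. \<forall>t\<in>Smp S n. cComp C (f n) (\<sigma>0 n t) = \<rho>0 n t) \<and>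
     (\<forall>U\<in>cOb C. \<forall>\<sigma> \<rho>. is_point C S X U \<sigma> \<and> is_point C T Y U \<rho> \<and>
        (\<forall>n. \<forall>t\<in>Smp S n. cComp C (f n) (\<sigma> n t) = \<rho> n t) \<longrightarrow>
        (\<exists>!u. u \<in> hom C U B \<and> (\<forall>n. \<forall>t\<in>Smp S n. cComp C (\<sigma>0 n t) u = \<sigma> n t) \<and>
                              (\<forall>n. \<forall>t\<in>Smp T n. cComp C (\<rho>0 n t) u = \<rho> n t)))"

text \<open>The canonical morphism Map(T,X) -> Map(S,X) (S a simplicial subset of T) has property P.\<close>
definition restr_has :: "('o,'m) cat \<Rightarrow> ('m \<Rightarrow> bool) \<Rightarrow> 'a sset \<Rightarrow> 'a sset \<Rightarrow> ('o,'m) sobj \<Rightarrow> bool" where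
  "restr_has C P S T X \<longleftrightarrow>
     (\<forall>M \<tau> L \<mu> c. rep_Map C T X M \<tau> \<and> rep_Map C S X L \<mu> \<and> c \<in> hom C M L \<and>
        (\<forall>n. \<forall>t\<in>Smp S n. cComp C (\<mu> n t) c = \<tau> n t) \<longrightarrow> P c)"

definition rel_restr_has :: "('o,'m) cat \<Rightarrow> ('m \<Rightarrow> bool) \<Rightarrow> 'a sset \<Rightarrow> 'a sset
     \<Rightarrow> ('o,'m) sobj \<Rightarrow> ('o,'m) sobj \<Rightarrow> (nat \<Rightarrow> 'm) \<Rightarrow> bool" where
  "rel_restr_has C P S T X Y f \<longleftrightarrow>
     (\<forall>M \<tau> B \<sigma>0 \<rho>0 c. rep_Map C T X M \<tau> \<and> rep_rel C S T X Y f B \<sigma>0 \<rho>0 \<and> c \<in> hom C M B \<and>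
        (\<forall>n. \<forall>t\<in>Smp S n. cComp C (\<sigma>0 n t) c = \<tau> n t) \<and>
        (\<forall>n. \<forall>t\<in>Smp T n. cComp C (\<rho>0 n t) c = cComp C (f n) (\<tau> n t)) \<longrightarrow> P c)"

definition kgroupoid :: "('o,'m) cat \<Rightarrow> 'm set \<Rightarrow> nat \<Rightarrow> ('o,'m) sobj \<Rightarrow> bool" where
  "kgroupoid C Cov k X \<longleftrightarrow> simplicial_object C X \<and>
     (\<forall>n i. 0 < n \<and> i \<le> n \<longrightarrow> restr_has C (\<lambda>c. c \<in> Cov) (horn n i) (std_simplex n) X) \<and>
     (\<forall>n i. k < n \<and> i \<le> n \<longrightarrow> restr_has C (is_iso C) (horn n i) (std_simplex n) X)"

definition fibration :: "('o,'m) cat \<Rightarrow> 'm set \<Rightarrow> ('o,'m) sobj \<Rightarrow> ('o,'m) sobj \<Rightarrow> (nat \<Rightarrow> 'm) \<Rightarrow> bool" where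
  "fibration C Cov X Y f \<longleftrightarrow>
     (\<forall>n i. 0 < n \<and> i \<le> n \<longrightarrow> rel_restr_has C (\<lambda>c. c \<in> Cov) (horn n i) (std_simplex n) X Y f)"

definition hypercover :: "('o,'m) cat \<Rightarrow> 'm set \<Rightarrow> ('o,'m) sobj \<Rightarrow> ('o,'m) sobj \<Rightarrow> (nat \<Rightarrow> 'm) \<Rightarrow> bool" where
  "hypercover C Cov X Y f \<longleftrightarrow>
     (\<forall>n. rel_restr_has C (\<lambda>c. c \<in> Cov) (boundary n) (std_simplex n) X Y f)"

text \<open>(Q, \<epsilon>) is a path space P_1 Y: Q_m represents Map(Delta^m x Delta^1, Y) via \<epsilon> m,
  and the simplicial structure of Q is the induced one.\<close>
definition path_space :: "('o,'m) cat \<Rightarrow> ('o,'m) sobj \<Rightarrow> ('o,'m) sobj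
     \<Rightarrow> (nat \<Rightarrow> nat \<Rightarrow> (nat \<Rightarrow> nat) \<times> (nat \<Rightarrow> nat) \<Rightarrow> 'm) \<Rightarrow> bool" where
  "path_space C Y Q \<epsilon> \<longleftrightarrow> simplicial_object C Q \<and>
     (\<forall>m. rep_Map C (prism m) Y (sO Q m) (\<epsilon> m)) \<and>
     (\<forall>l m \<theta>. delta_hom l m \<theta> \<longrightarrow>
        (\<forall>k. \<forall>(\<alpha>, \<phi>)\<in>Smp (prism l) k.
           cComp C (\<epsilon> l k (\<alpha>, \<phi>)) (sM Q l m \<theta>) = \<epsilon> m k (dcomp k \<theta> \<alpha>, \<phi>)))"

text \<open>The two evaluations P_1 Y -> Y induced by Delta^m x {0} and Delta^m x {1}.\<close>
definition ev0 :: "(nat \<Rightarrow> nat \<Rightarrow> (nat \<Rightarrow> nat) \<times> (nat \<Rightarrow> nat) \<Rightarrow> 'm) \<Rightarrow> nat \<Rightarrow> 'm" where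
  "ev0 \<epsilon> m = \<epsilon> m m (delta_id m, (\<lambda>i. 0))"

definition ev1 :: "(nat \<Rightarrow> nat \<Rightarrow> (nat \<Rightarrow> nat) \<times> (nat \<Rightarrow> nat) \<Rightarrow> 'm) \<Rightarrow> nat \<Rightarrow> 'm" where
  "ev1 \<epsilon> m = \<epsilon> m m (delta_id m, (\<lambda>i. if i \<le> m then 1 else 0))"

text \<open>f is a weak equivalence: for the path space P_1 Y and P(f) = X x_Y P_1 Y (a levelwise
  pullback along ev0, with projections p1, p2), q(f) = ev1 o p2 is a hypercover.\<close>
definition weak_equiv :: "('o,'m) cat \<Rightarrow> 'm set \<Rightarrow> ('o,'m) sobj \<Rightarrow> ('o,'m) sobj \<Rightarrow> (nat \<Rightarrow> 'm) \<Rightarrow> bool" where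
  "weak_equiv C Cov X Y f \<longleftrightarrow>
     (\<forall>Q \<epsilon> P p1 p2. path_space C Y Q \<epsilon> \<and> simplicial_object C P \<and>
        smor C P X p1 \<and> smor C P Q p2 \<and>
        (\<forall>m. is_pullback C (f m) (ev0 \<epsilon> m) (p1 m) (p2 m)) \<longrightarrow>
        hypercover C Cov P Y (\<lambda>m. cComp C (ev1 \<epsilon> m) (p2 m)))"

type_synonym ('o,'m) smorph = "('o,'m) sobj \<times> ('o,'m) sobj \<times> (nat \<Rightarrow> 'm)"

definition skV :: "('o,'m) cat \<Rightarrow> 'm set \<Rightarrow> nat \<Rightarrow> (('o,'m) sobj, ('o,'m) smorph) cat" where
  "skV C Cov k = \<lparr>cOb = {X. kgroupoid C Cov k X},
     cAr = {(X, Y, f). kgroupoid C Cov k X \<and> kgroupoid C Cov k Y \<and> smor C X Y f},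
     cDom = (\<lambda>(X, Y, f). X),
     cCod = (\<lambda>(X, Y, f). Y),
     cId = (\<lambda>X. (X, X, (\<lambda>n. cId C (sO X n)))),
     cComp = (\<lambda>(Y', Z, g) (X, Y, f). (X, Z, (\<lambda>n. cComp C (g n) (f n))))\<rparr>"

definition skFib :: "('o,'m) cat \<Rightarrow> 'm set \<Rightarrow> nat \<Rightarrow> ('o,'m) smorph set" where
  "skFib C Cov k = {(X, Y, f) \<in> cAr (skV C Cov k). fibration C Cov X Y f}"

definition skW :: "('o,'m) cat \<Rightarrow> 'm set \<Rightarrow> nat \<Rightarrow> ('o,'m) smorph set" where
  "skW C Cov k = {(X, Y, f) \<in> cAr (skV C Cov k). weak_equiv C Cov X Y f}"

definition cat_fibrant_objects :: "('o,'m) cat \<Rightarrow> 'm set \<Rightarrow> 'm set \<Rightarrow> bool" where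
  "cat_fibrant_objects C W F \<longleftrightarrow>
     category C \<and> subcat C W \<and> (\<forall>f\<in>cAr C. is_iso C f \<longrightarrow> f \<in> W) \<and>
     (\<forall>f\<in>cAr C. \<forall>g\<in>cAr C. cCod C f = cDom C g \<and> cComp C g f \<in> W \<longrightarrow> (f \<in> W \<longleftrightarrow> g \<in> W)) \<and>
     subcat C F \<and>
     (\<exists>e. terminal C e \<and> (\<forall>f\<in>cAr C. cCod C f = e \<longrightarrow> f \<in> F)) \<and>
     (\<forall>p\<in>F. \<forall>g\<in>cAr C. cCod C g = cCod C p \<longrightarrow>
        (\<exists>a b. is_pullback C p g a b) \<and> (\<forall>a b. is_pullback C p g a b \<longrightarrow> b \<in> F)) \<and>
     (\<forall>p\<in>F \<inter> W. \<forall>g\<in>cAr C. \<forall>a b. cCod C g = cCod C p \<and> is_pullback C p g a b \<longrightarrow> b \<in> F \<inter> W) \<and>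
     (\<forall>f\<in>cAr C. \<exists>w p. w \<in> W \<and> p \<in> F \<and> cCod C w = cDom C p \<and> cComp C p w = f)"

end

theory Submission
  imports Defs
begin

text \<open>
  A simplicial object is studied through its functor of points, a simplicial presheaf. A map of
  presheaves is called a cover when all its fibres over generalized elements are representable and
  the structure arrow of each fibre is a cover; this notion is stable under pointwise pullback and
  composition and inherits the cancellation axiom (D3). Lifting conditions for \<open>S \<subseteq> T\<close> therefore
  pass to cell attachments, to products with the interval, and along pullbacks of simplicial
  presheaves, where path spaces and mapping path spaces exist on the nose.

  Write \<open>q f : P f \<rightarrow> Y\<close> for the map that defines weak equivalences. For a fibration \<open>f\<close> between
  Kan objects the gap map from the path space of \<open>X\<close> to \<open>P f\<close> is a hypercover, so by (D3) \<open>f\<close> is a hypercover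
  iff \<open>q f\<close> is one. If \<open>t\<close> is a hypercover then \<open>f\<close> is a weak equivalence iff \<open>f \<circ> t\<close> is, and iff
  \<open>t \<circ> f\<close> is (when composable); hence weak equivalences are invariant under homotopy, and a section
  of a hypercover may be cancelled on the right. Writing \<open>f\<close> as \<open>q f\<close> after a section of the hypercover
  \<open>P f \<rightarrow> X\<close> then gives both the factorization axiom and the two-out-of-three property.
\<close>

section \<open>Pullbacks and covers\<close>

text \<open>Lifts through a cover exist only after base change, and (D3) speaks of an arrow only
  once that arrow is given. So no homotopy inverse and no lifted homotopy can be chosen in the base
  category; the argument composes, pulls back and cancels covers instead. The price of each
  cancellation is representability of the mapping presheaves Map(T, X) for finite T, a property that
  pullbacks and path spaces preserve. Covers are one value of a class parameter K. With isomorphisms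
  as K and only dimensions above k, the same lifting lemmas show that k-groupoids are closed under
  pullbacks of fibrations and under mapping path spaces, because a map of k-groupoids has unique
  relative fillers above k. For this a lower bound N on dimensions is carried along: every horn used
  on the prism over Delta[n] has dimension at least n. The gap map is a hypercover for a
  combinatorial reason: the boundary times the interval, together with one end, expands to the whole
  prism by horn fillings. Encoding vertices of a prism as numbers keeps cylinders among the same
  ordered complexes as simplices.\<close>

abbreviation isos :: "('o,'m) cat \<Rightarrow> 'm set" where
  "isos C \<equiv> {f. is_iso C f}"

text \<open>These are the closure properties needed to start, compose and pull back lifting
  conditions. Three classes are used: the covers, the isomorphisms for the truncation condition on a
  k-groupoid, and all arrows, where only the existence of representing objects is recorded.\<close>

definition stable_class :: "('o,'m) cat \<Rightarrow> 'm set \<Rightarrow> bool" where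
  "stable_class C K \<longleftrightarrow> K \<subseteq> cAr C \<and> isos C \<subseteq> K \<and>
     (\<forall>f\<in>K. \<forall>g\<in>K. cCod C f = cDom C g \<longrightarrow> cComp C g f \<in> K) \<and>
     (\<forall>f\<in>K. \<forall>g p q. is_pullback C f g p q \<longrightarrow> q \<in> K)"

locale cat_loc =
  fixes C :: "('o,'m) cat"
  assumes cat: "category C"
begin

abbreviation comp (infixr \<open>\<cdot>\<close> 75) where "g \<cdot> f \<equiv> cComp C g f"
abbreviation "Ob \<equiv> cOb C"
abbreviation "H \<equiv> hom C"
abbreviation "ID \<equiv> cId C"

lemma hom_compI: "f \<in> H a b \<Longrightarrow> g \<in> H b c \<Longrightarrow> g \<cdot> f \<in> H a c"
  using cat unfolding category_def hom_def by auto

lemma hom_IdI: "a \<in> Ob \<Longrightarrow> ID a \<in> H a a"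
  using cat unfolding category_def by auto

lemma comp_Id: "f \<in> H a b \<Longrightarrow> f \<cdot> ID a = f" and Id_comp: "f \<in> H a b \<Longrightarrow> ID b \<cdot> f = f"
  using cat unfolding category_def hom_def by auto

lemma comp_assoc: "f \<in> H a b \<Longrightarrow> g \<in> H b c \<Longrightarrow> h \<in> H c d \<Longrightarrow> (h \<cdot> g) \<cdot> f = h \<cdot> (g \<cdot> f)"
  using cat unfolding category_def hom_def by auto

lemma hom_dom: "f \<in> H a b \<Longrightarrow> a \<in> Ob" and hom_cod: "f \<in> H a b \<Longrightarrow> b \<in> Ob"
  using cat unfolding category_def hom_def by auto

lemma hom_arrow: "f \<in> H a b \<Longrightarrow> f \<in> cAr C \<and> cDom C f = a \<and> cCod C f = b"
  unfolding hom_def by auto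

lemma is_isoI: "f \<in> H a b \<Longrightarrow> g \<in> H b a \<Longrightarrow> g \<cdot> f = ID a \<Longrightarrow> f \<cdot> g = ID b \<Longrightarrow> is_iso C f"
  unfolding is_iso_def hom_def by auto

lemma is_isoE:
  assumes "is_iso C f" "f \<in> H a b"
  obtains g where "g \<in> H b a" "g \<cdot> f = ID a" "f \<cdot> g = ID b"
  using assms unfolding is_iso_def hom_def by auto

lemma Id_iso: "a \<in> Ob \<Longrightarrow> is_iso C (ID a)"
  using is_isoI[OF hom_IdI hom_IdI] comp_Id hom_IdI by metis

lemma iso_comp:
  assumes "is_iso C f" "is_iso C g" "f \<in> H a b" "g \<in> H b c" shows "is_iso C (g \<cdot> f)"
proof -
  obtain f' where f': "f' \<in> H b a" "f' \<cdot> f = ID a" "f \<cdot> f' = ID b" using is_isoE assms by metis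
  obtain g' where g': "g' \<in> H c b" "g' \<cdot> g = ID b" "g \<cdot> g' = ID c" using is_isoE assms by metis
  show ?thesis
  proof (rule is_isoI)
    show "g \<cdot> f \<in> H a c" "f' \<cdot> g' \<in> H c a" using assms f' g' hom_compI by blast+
    show "(f' \<cdot> g') \<cdot> g \<cdot> f = ID a"
      using comp_assoc[OF hom_compI[OF assms(3,4)] g'(1) f'(1)] comp_assoc[OF assms(3,4) g'(1)]
        Id_comp[OF assms(3)] f' g' by simp
    show "(g \<cdot> f) \<cdot> f' \<cdot> g' = ID c"
      using comp_assoc[OF hom_compI[OF g'(1) f'(1)] assms(3,4)] comp_assoc[OF g'(1) f'(1) assms(3)]
        Id_comp[OF g'(1)] f' g' by simp
  qed
qed

lemma pullback_hom:
  assumes "is_pullback C f g p q" "f \<in> H a c" "g \<in> H b c"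
  shows "p \<in> H (cDom C p) a" "q \<in> H (cDom C p) b" "f \<cdot> p = g \<cdot> q"
  using assms unfolding is_pullback_def hom_def by auto

lemma pullback_univ:
  assumes "is_pullback C f g p q" "f \<in> H a c" "g \<in> H b c" "p' \<in> H v a" "q' \<in> H v b" "f \<cdot> p' = g \<cdot> q'"
  shows "\<exists>!h. h \<in> H v (cDom C p) \<and> p \<cdot> h = p' \<and> q \<cdot> h = q'"
proof -
  have "p' \<in> cAr C \<and> q' \<in> cAr C \<and> cDom C p' = cDom C q' \<and>
        cCod C p' = cDom C f \<and> cCod C q' = cDom C g \<and> f \<cdot> p' = g \<cdot> q'"
    using assms unfolding hom_def by auto
  moreover have "\<forall>p' q'. p' \<in> cAr C \<and> q' \<in> cAr C \<and> cDom C p' = cDom C q' \<and>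
        cCod C p' = cDom C f \<and> cCod C q' = cDom C g \<and> f \<cdot> p' = g \<cdot> q' \<longrightarrow>
        (\<exists>!h. h \<in> H (cDom C p') (cDom C p) \<and> p \<cdot> h = p' \<and> q \<cdot> h = q')"
    using assms(1) unfolding is_pullback_def by blast
  ultimately have "\<exists>!h. h \<in> hom C (cDom C p') (cDom C p) \<and> p \<cdot> h = p' \<and> q \<cdot> h = q'"
    by simp
  moreover have "cDom C p' = v" using assms(4) hom_arrow by blast
  ultimately show ?thesis by simp
qed

lemma is_pullbackI:
  assumes "f \<in> H a c" "g \<in> H b c" "p \<in> H P a" "q \<in> H P b" "f \<cdot> p = g \<cdot> q"
    and "\<And>v p' q'. p' \<in> H v a \<Longrightarrow> q' \<in> H v b \<Longrightarrow> f \<cdot> p' = g \<cdot> q' \<Longrightarrow>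
           \<exists>!h. h \<in> H v P \<and> p \<cdot> h = p' \<and> q \<cdot> h = q'"
  shows "is_pullback C f g p q"
  unfolding is_pullback_def
proof (intro conjI allI impI)
  fix p' q'
  assume *: "p' \<in> cAr C \<and> q' \<in> cAr C \<and> cDom C p' = cDom C q' \<and>
        cCod C p' = cDom C f \<and> cCod C q' = cDom C g \<and> f \<cdot> p' = g \<cdot> q'"
  then have "p' \<in> H (cDom C p') a" "q' \<in> H (cDom C p') b" using assms unfolding hom_def by auto
  moreover have "cDom C p = P" using assms hom_arrow by blast
  ultimately show "\<exists>!h. h \<in> hom C (cDom C p') (cDom C p) \<and> p \<cdot> h = p' \<and> q \<cdot> h = q'"
    using assms(6)[of p' "cDom C p'" q'] * by simp
qed (use assms(1-5) in \<open>auto simp: hom_def\<close>)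

lemma stable_isos: "stable_class C (isos C)"
  unfolding stable_class_def
proof (intro conjI ballI allI impI)
  show "isos C \<subseteq> cAr C" by (auto simp: is_iso_def)
  fix f g assume "f \<in> isos C" "g \<in> isos C" "cCod C f = cDom C g"
  then show "g \<cdot> f \<in> isos C"
    using iso_comp[of f g "cDom C f" "cCod C f" "cCod C g"] by (auto simp: is_iso_def hom_def)
next
  fix f g p q assume f: "f \<in> isos C" and pb: "is_pullback C f g p q"
  define a b c P where "a = cDom C f" "b = cDom C g" "c = cCod C f" "P = cDom C p"
  have h: "f \<in> H a c" "g \<in> H b c" using pb unfolding is_pullback_def a_b_c_P_def hom_def by auto
  note h = h pullback_hom[OF pb h, folded a_b_c_P_def]
  obtain f' where f': "f' \<in> H c a" "f' \<cdot> f = ID a" "f \<cdot> f' = ID c" using is_isoE f h by blast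
  have ob: "b \<in> Ob" "P \<in> Ob" using h hom_dom by blast+
  have fg: "f' \<cdot> g \<in> H b a" using f' h hom_compI by blast
  have "f \<cdot> (f' \<cdot> g) = g \<cdot> ID b" using comp_assoc[OF h(2) f'(1) h(1)] f'(3) Id_comp[OF h(2)] comp_Id[OF h(2)] by simp
  \<comment> \<open>The inverse of q is induced by the inverse of f after g and by the
    identity.\<close>
  then obtain s where s: "s \<in> H b P" "p \<cdot> s = f' \<cdot> g" "q \<cdot> s = ID b"
    using pullback_univ[OF pb h(1,2) fg hom_IdI[OF ob(1)]] a_b_c_P_def by blast
  have sq: "s \<cdot> q \<in> H P P" using s h hom_compI by blast
  have "p \<cdot> (s \<cdot> q) = (p \<cdot> s) \<cdot> q" using comp_assoc[OF h(4) s(1) h(3)] by simp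
  also have "\<dots> = f' \<cdot> (g \<cdot> q)" using s comp_assoc[OF h(4) h(2) f'(1)] by simp
  also have "\<dots> = p" using h(5) f'(2) Id_comp[OF h(3)] comp_assoc[OF h(3) h(1) f'(1)] by simp
  finally have 1: "p \<cdot> (s \<cdot> q) = p" .
  have 2: "q \<cdot> (s \<cdot> q) = q" using s(3) Id_comp[OF h(4)] comp_assoc[OF h(4) s(1) h(4)] by simp
  have "\<exists>!h. h \<in> H P P \<and> p \<cdot> h = p \<and> q \<cdot> h = q"
    using pullback_univ[OF pb h(1,2) h(3,4,5)] a_b_c_P_def by simp
  moreover have "ID P \<in> H P P \<and> p \<cdot> ID P = p \<and> q \<cdot> ID P = q"
    using h ob hom_IdI comp_Id by blast
  ultimately have "s \<cdot> q = ID P" using sq 1 2 by blast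
  then show "q \<in> isos C" using is_isoI[OF h(4) s(1)] s by simp
qed auto

lemma stable_arrows: "stable_class C (cAr C)"
  unfolding stable_class_def
proof (intro conjI ballI allI impI)
  show "isos C \<subseteq> cAr C" by (auto simp: is_iso_def)
  fix f g assume "f \<in> cAr C" "g \<in> cAr C" "cCod C f = cDom C g"
  then show "g \<cdot> f \<in> cAr C" using hom_compI[of f _ _ g] by (auto simp: hom_def)
qed (auto simp: is_pullback_def)

end

section \<open>Finite limits and covers in a descent category\<close>

locale descent = cat_loc C for C :: "('o,'m) cat" +
  fixes Cov :: "'m set"
  assumes D: "descent_category C Cov"
begin

text \<open>The limit of the empty diagram.\<close>

lemma ex_terminal: "\<exists>e. terminal C e"
proof -
  define J :: "(nat,nat) cat" where
    "J = \<lparr>cOb = {}, cAr = {}, cDom = id, cCod = id, cId = id, cComp = (\<lambda>_ _. 0)\<rparr>"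
  have J: "category J" "finite (cOb J)" "finite (cAr J)" "is_functor J C undefined undefined"
    by (auto simp: J_def category_def is_functor_def)
  then obtain L l where L: "is_limit J C undefined undefined L l"
    using D unfolding descent_category_def has_finite_limits_def by meson
  have "terminal C L" using L unfolding is_limit_def is_cone_def terminal_def
    by (auto simp: J_def)
  then show ?thesis by blast
qed

lemma ex_pullback:
  assumes f: "f \<in> H a c" and g: "g \<in> H b c"
  shows "\<exists>p q. is_pullback C f g p q"
proof -
  \<comment> \<open>The cospan as a category on numbers: 0, 1, 2 are the objects and also their
    identities, 3 and 4 are the legs into 2. Of two composable arrows at least one is an identity,
    which gives the composition rule.\<close>
  define J :: "(nat,nat) cat" where
    "J = \<lparr>cOb = {..<3}, cAr = {..<5}, cDom = (\<lambda>i. if i = 3 then 0 else if i = 4 then 1 else i),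
      cCod = (\<lambda>i. if i = 3 \<or> i = 4 then 2 else i), cId = id, cComp = (\<lambda>u v. if u < 3 then v else u)\<rparr>"
  define Fo where "Fo = (\<lambda>i::nat. if i = 0 then a else if i = 1 then b else c)"
  define Fa where "Fa = (\<lambda>i::nat. if i = 0 then ID a else if i = 1 then ID b else if i = 2 then ID c
     else if i = 3 then f else g)"
  have ob: "a \<in> Ob" "b \<in> Ob" "c \<in> Ob" using f g hom_dom hom_cod by blast+
  have cOb: "cOb J = {0,1,2}" and cAr: "cAr J = {0,1,2,3,4}" by (auto simp: J_def)
  have J: "cDom J = (\<lambda>i. if i = 3 then 0 else if i = 4 then 1 else i)"
    "cCod J = (\<lambda>i. if i = 3 \<or> i = 4 then 2 else i)" "cId J = id" "cComp J = (\<lambda>u v. if u < 3 then v else u)"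
    by (auto simp: J_def)
  have "category J" unfolding category_def by (auto simp: J_def hom_def split: if_splits)
  moreover have "finite (cOb J)" "finite (cAr J)" by (auto simp: J_def)
  moreover have "is_functor J C Fo Fa"
    unfolding is_functor_def cOb cAr J Fo_def Fa_def
    using f g ob by (auto simp add: hom_IdI comp_Id[OF f] comp_Id[OF g] Id_comp[OF f] Id_comp[OF g]
      comp_Id[OF hom_IdI[OF ob(1)]] comp_Id[OF hom_IdI[OF ob(2)]] comp_Id[OF hom_IdI[OF ob(3)]])
  ultimately obtain L l where L: "is_limit J C Fo Fa L l"
    using D unfolding descent_category_def has_finite_limits_def by meson
  then have cone: "is_cone J C Fo Fa L l" unfolding is_limit_def by blast
  have l: "l 0 \<in> H L a" "l 1 \<in> H L b" "l 2 \<in> H L c" "f \<cdot> l 0 = l 2" "g \<cdot> l 1 = l 2"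
    using cone unfolding is_cone_def cOb cAr J Fo_def Fa_def by auto
  have "is_pullback C f g (l 0) (l 1)"
  proof (rule is_pullbackI[OF f g l(1,2)])
    fix v p' q' assume h: "p' \<in> H v a" "q' \<in> H v b" "f \<cdot> p' = g \<cdot> q'"
    define m where "m = (\<lambda>i::nat. if i = 0 then p' else if i = 1 then q' else f \<cdot> p')"
    have fp: "f \<cdot> p' \<in> H v c" using h f hom_compI by blast
    have "is_cone J C Fo Fa v m"
      unfolding is_cone_def cOb cAr J Fo_def Fa_def m_def
      using h fp hom_dom[OF h(1)] by (auto simp: Id_comp[OF h(1)] Id_comp[OF h(2)] Id_comp[OF fp] Id_comp[OF fp[unfolded h(3)]])
    then have ex: "\<exists>!h. h \<in> H v L \<and> (\<forall>j\<in>cOb J. l j \<cdot> h = m j)"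
      using L unfolding is_limit_def by blast
    have "(\<forall>j\<in>cOb J. l j \<cdot> h = m j) \<longleftrightarrow> l 0 \<cdot> h = p' \<and> l 1 \<cdot> h = q'" if "h \<in> H v L" for h
    proof -
      have "l 2 \<cdot> h = f \<cdot> (l 0 \<cdot> h)" using that l f comp_assoc[of h v L "l 0" a f c] by simp
      then show ?thesis by (auto simp: cOb m_def)
    qed
    then show "\<exists>!h. h \<in> H v L \<and> l 0 \<cdot> h = p' \<and> l 1 \<cdot> h = q'" using ex by metis
  qed (use l in simp)
  then show ?thesis by blast
qed

lemma pullback_cov:
  assumes "f \<in> Cov" "is_pullback C f g p q" shows "q \<in> Cov"
proof -
  have "g \<in> cAr C" "cCod C g = cCod C f" using assms(2) unfolding is_pullback_def by auto
  moreover have "\<forall>f\<in>Cov. \<forall>g\<in>cAr C. \<forall>p q. cCod C g = cCod C f \<and> is_pullback C f g p q \<longrightarrow> q \<in> Cov"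
    using D unfolding descent_category_def by blast
  ultimately show ?thesis using assms by simp
qed

text \<open>An isomorphism f into b is both projections of a pullback of the identity of b along
  itself, and identities are covers because covers form a subcategory.\<close>

lemma isos_cov: "is_iso C f \<Longrightarrow> f \<in> Cov"
proof -
  assume i: "is_iso C f"
  define a b where "a = cDom C f" "b = cCod C f"
  have f: "f \<in> H a b" using i unfolding is_iso_def a_b_def hom_def by auto
  have ob: "b \<in> Ob" using f hom_cod by blast
  obtain g where g: "g \<in> H b a" "g \<cdot> f = ID a" "f \<cdot> g = ID b" using is_isoE i f by blast
  have "is_pullback C (ID b) (ID b) f f"
  proof (rule is_pullbackI[OF hom_IdI hom_IdI f f])
    fix v p' q' assume h: "p' \<in> H v b" "q' \<in> H v b" "ID b \<cdot> p' = ID b \<cdot> q'"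
    then have "p' = q'" by (simp add: Id_comp)
    show "\<exists>!h. h \<in> H v a \<and> f \<cdot> h = p' \<and> f \<cdot> h = q'"
    proof (rule ex1I[of _ "g \<cdot> p'"])
      have "f \<cdot> g \<cdot> p' = p'" using comp_assoc[OF h(1) g(1) f] g(3) Id_comp[OF h(1)] by simp
      then show "g \<cdot> p' \<in> H v a \<and> f \<cdot> g \<cdot> p' = p' \<and> f \<cdot> g \<cdot> p' = q'"
        using \<open>p' = q'\<close> hom_compI h(1) g(1) by blast
      fix x assume x: "x \<in> H v a \<and> f \<cdot> x = p' \<and> f \<cdot> x = q'"
      then have xh: "x \<in> H v a" and fx: "f \<cdot> x = p'" by auto
      have "g \<cdot> (f \<cdot> x) = x"
        unfolding comp_assoc[OF xh f g(1), symmetric] g(2) by (rule Id_comp[OF xh])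
      then show "x = g \<cdot> p'" unfolding fx by (rule sym)
    qed
  qed (use ob in auto)
  moreover have "ID b \<in> Cov" using D ob unfolding descent_category_def subcat_def by blast
  ultimately show ?thesis using pullback_cov by metis
qed

lemma stable_Cov: "stable_class C Cov"
proof -
  have "Cov \<subseteq> cAr C" "\<forall>f\<in>Cov. \<forall>g\<in>Cov. cCod C f = cDom C g \<longrightarrow> g \<cdot> f \<in> Cov"
    using D unfolding descent_category_def subcat_def by blast+
  moreover have "\<forall>f\<in>Cov. \<forall>g p q. is_pullback C f g p q \<longrightarrow> q \<in> Cov" using pullback_cov by metis
  moreover have "isos C \<subseteq> Cov" using isos_cov by auto
  ultimately show ?thesis unfolding stable_class_def by simp
qed

lemma cov_cancel:
  assumes "f \<in> Cov" "f \<in> H a b" "g \<in> H b c" "g \<cdot> f \<in> Cov" shows "g \<in> Cov"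
proof -
  have "\<forall>f\<in>Cov. \<forall>g\<in>cAr C. cCod C f = cDom C g \<and> g \<cdot> f \<in> Cov \<longrightarrow> g \<in> Cov"
    using D unfolding descent_category_def by blast
  then show ?thesis using assms by (simp add: hom_def)
qed

end

section \<open>Presheaves and maps with representable fibres\<close>

record ('o,'m,'x) presheaf =
  PE :: "'o \<Rightarrow> 'x set"
  PR :: "'m \<Rightarrow> 'x \<Rightarrow> 'x"

context cat_loc begin

definition psh :: "('o,'m,'x) presheaf \<Rightarrow> bool" where
  "psh F \<longleftrightarrow> (\<forall>U V u x. u \<in> H V U \<longrightarrow> x \<in> PE F U \<longrightarrow> PR F u x \<in> PE F V) \<and>
     (\<forall>U x. U \<in> Ob \<longrightarrow> x \<in> PE F U \<longrightarrow> PR F (ID U) x = x) \<and>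
     (\<forall>U V W u v x. u \<in> H V U \<longrightarrow> v \<in> H W V \<longrightarrow> x \<in> PE F U \<longrightarrow> PR F (u \<cdot> v) x = PR F v (PR F u x))"

definition pmap :: "('o,'m,'x) presheaf \<Rightarrow> ('o,'m,'y) presheaf \<Rightarrow> ('x \<Rightarrow> 'y) \<Rightarrow> bool" where
  "pmap F G \<phi> \<longleftrightarrow> (\<forall>U x. U \<in> Ob \<longrightarrow> x \<in> PE F U \<longrightarrow> \<phi> x \<in> PE G U) \<and>
     (\<forall>U V u x. u \<in> H V U \<longrightarrow> x \<in> PE F U \<longrightarrow> \<phi> (PR F u x) = PR G u (\<phi> x))"

text \<open>With y read as a map from the presheaf of arrows into U to G, the object A with
  projections c to U and a to F is its pullback along \<phi>. Only c is tested against K.\<close>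

definition fibre :: "'m set \<Rightarrow> ('o,'m,'x) presheaf \<Rightarrow> ('o,'m,'y) presheaf \<Rightarrow> ('x \<Rightarrow> 'y) \<Rightarrow> 'o \<Rightarrow> 'y
    \<Rightarrow> 'o \<Rightarrow> 'm \<Rightarrow> 'x \<Rightarrow> bool" where
  "fibre K F G \<phi> U y A c a \<longleftrightarrow> c \<in> K \<and> c \<in> H A U \<and> a \<in> PE F A \<and> \<phi> a = PR G c y \<and>
     (\<forall>V u x. u \<in> H V U \<longrightarrow> x \<in> PE F V \<longrightarrow> \<phi> x = PR G u y \<longrightarrow> (\<exists>v. v \<in> H V A \<and> c \<cdot> v = u \<and> PR F v a = x)) \<and>
     (\<forall>V v w. v \<in> H V A \<longrightarrow> w \<in> H V A \<longrightarrow> c \<cdot> v = c \<cdot> w \<longrightarrow> PR F v a = PR F w a \<longrightarrow> v = w)"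

text \<open>A map of presheaves is relatively representable by arrows of \<open>K\<close>.\<close>
definition pcov :: "'m set \<Rightarrow> ('o,'m,'x) presheaf \<Rightarrow> ('o,'m,'y) presheaf \<Rightarrow> ('x \<Rightarrow> 'y) \<Rightarrow> bool" where
  "pcov K F G \<phi> \<longleftrightarrow> (\<forall>U y. U \<in> Ob \<longrightarrow> y \<in> PE G U \<longrightarrow> (\<exists>A c a. fibre K F G \<phi> U y A c a))"

definition rep :: "('o,'m,'x) presheaf \<Rightarrow> 'o \<Rightarrow> 'x \<Rightarrow> bool" where
  "rep F A a \<longleftrightarrow> A \<in> Ob \<and> a \<in> PE F A \<and>
     (\<forall>V x. V \<in> Ob \<longrightarrow> x \<in> PE F V \<longrightarrow> (\<exists>v. v \<in> H V A \<and> PR F v a = x)) \<and>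
     (\<forall>V v w. v \<in> H V A \<longrightarrow> w \<in> H V A \<longrightarrow> PR F v a = PR F w a \<longrightarrow> v = w)"

definition representable :: "('o,'m,'x) presheaf \<Rightarrow> bool" where
  "representable F \<longleftrightarrow> (\<exists>A a. rep F A a)"

lemma psh_res: "psh F \<Longrightarrow> u \<in> H V U \<Longrightarrow> x \<in> PE F U \<Longrightarrow> PR F u x \<in> PE F V"
  by (simp add: psh_def)
lemma psh_id: "psh F \<Longrightarrow> U \<in> Ob \<Longrightarrow> x \<in> PE F U \<Longrightarrow> PR F (ID U) x = x"
  by (simp add: psh_def)
lemma psh_comp: "psh F \<Longrightarrow> u \<in> H V U \<Longrightarrow> v \<in> H W V \<Longrightarrow> x \<in> PE F U \<Longrightarrow> PR F (u \<cdot> v) x = PR F v (PR F u x)"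
  unfolding psh_def by blast
lemma pmap_in: "pmap F G \<phi> \<Longrightarrow> U \<in> Ob \<Longrightarrow> x \<in> PE F U \<Longrightarrow> \<phi> x \<in> PE G U"
  by (simp add: pmap_def)
lemma pmap_nat: "pmap F G \<phi> \<Longrightarrow> u \<in> H V U \<Longrightarrow> x \<in> PE F U \<Longrightarrow> \<phi> (PR F u x) = PR G u (\<phi> x)"
  by (simp add: pmap_def)

lemma pmap_comp: "pmap F G \<phi> \<Longrightarrow> pmap G H' \<psi> \<Longrightarrow> pmap F H' (\<lambda>x. \<psi> (\<phi> x))"
  unfolding pmap_def using hom_cod by metis

lemma fibre_dom: "fibre K F G \<phi> U y A c a \<Longrightarrow> A \<in> Ob"
  unfolding fibre_def using hom_dom by blast

lemma fibreD:
  assumes "fibre K F G \<phi> U y A c a"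
  shows "c \<in> K" "c \<in> H A U" "a \<in> PE F A" "\<phi> a = PR G c y"
  using assms unfolding fibre_def by auto

lemma fibre_lift:
  assumes "fibre K F G \<phi> U y A c a" "u \<in> H V U" "x \<in> PE F V" "\<phi> x = PR G u y"
  obtains v where "v \<in> H V A" "c \<cdot> v = u" "PR F v a = x"
  using assms unfolding fibre_def by blast

lemma fibre_eq:
  assumes "fibre K F G \<phi> U y A c a" "v \<in> H V A" "w \<in> H V A" "c \<cdot> v = c \<cdot> w" "PR F v a = PR F w a"
  shows "v = w"
  using assms unfolding fibre_def by blast

lemma fibreI:
  assumes "c \<in> K" "c \<in> H A U" "a \<in> PE F A" "\<phi> a = PR G c y"
    and "\<And>V u x. u \<in> H V U \<Longrightarrow> x \<in> PE F V \<Longrightarrow> \<phi> x = PR G u y \<Longrightarrow> \<exists>v. v \<in> H V A \<and> c \<cdot> v = u \<and> PR F v a = x"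
    and "\<And>V v w. v \<in> H V A \<Longrightarrow> w \<in> H V A \<Longrightarrow> c \<cdot> v = c \<cdot> w \<Longrightarrow> PR F v a = PR F w a \<Longrightarrow> v = w"
  shows "fibre K F G \<phi> U y A c a"
  using assms unfolding fibre_def by blast

lemma fibre_change: "fibre K F G \<phi> U y A c a \<Longrightarrow> c \<in> K' \<Longrightarrow> fibre K' F G \<phi> U y A c a"
  unfolding fibre_def by blast

lemma pcovD:
  assumes "pcov K F G \<phi>" "U \<in> Ob" "y \<in> PE G U" obtains A c a where "fibre K F G \<phi> U y A c a"
  using assms unfolding pcov_def by blast

lemma pcovI: "(\<And>U y. U \<in> Ob \<Longrightarrow> y \<in> PE G U \<Longrightarrow> \<exists>A c a. fibre K F G \<phi> U y A c a) \<Longrightarrow> pcov K F G \<phi>"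
  unfolding pcov_def by blast

lemma repD:
  assumes "rep F A a" shows "A \<in> Ob" "a \<in> PE F A"
  using assms unfolding rep_def by auto

lemma rep_lift:
  assumes "rep F A a" "V \<in> Ob" "x \<in> PE F V" obtains v where "v \<in> H V A" "PR F v a = x"
  using assms unfolding rep_def by blast

lemma rep_eq:
  assumes "rep F A a" "v \<in> H V A" "w \<in> H V A" "PR F v a = PR F w a" shows "v = w"
  using assms unfolding rep_def by blast

lemma repI:
  assumes "A \<in> Ob" "a \<in> PE F A"
    and "\<And>V x. V \<in> Ob \<Longrightarrow> x \<in> PE F V \<Longrightarrow> \<exists>v. v \<in> H V A \<and> PR F v a = x"
    and "\<And>V v w. v \<in> H V A \<Longrightarrow> w \<in> H V A \<Longrightarrow> PR F v a = PR F w a \<Longrightarrow> v = w"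
  shows "rep F A a"
  using assms unfolding rep_def by blast

text \<open>The maps a and b run horizontally, \<phi>' and \<phi> vertically. The pullback property
  is asked at each object, as existence together with joint injectivity, so that no pairing has to
  be named.\<close>

definition pb_square :: "('o,'m,'w) presheaf \<Rightarrow> ('o,'m,'x) presheaf \<Rightarrow> ('o,'m,'z) presheaf \<Rightarrow> ('o,'m,'y) presheaf
    \<Rightarrow> ('w \<Rightarrow> 'x) \<Rightarrow> ('z \<Rightarrow> 'y) \<Rightarrow> ('w \<Rightarrow> 'z) \<Rightarrow> ('x \<Rightarrow> 'y) \<Rightarrow> bool" where
  "pb_square F' F G' G a b \<phi>' \<phi> \<longleftrightarrow> psh F' \<and> psh G' \<and> pmap F' F a \<and> pmap G' G b \<and> pmap F' G' \<phi>' \<and>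
     (\<forall>U x. U \<in> Ob \<longrightarrow> x \<in> PE F' U \<longrightarrow> \<phi> (a x) = b (\<phi>' x)) \<and>
     (\<forall>U g x. U \<in> Ob \<longrightarrow> g \<in> PE G' U \<longrightarrow> x \<in> PE F U \<longrightarrow> \<phi> x = b g \<longrightarrow> (\<exists>x'. x' \<in> PE F' U \<and> a x' = x \<and> \<phi>' x' = g)) \<and>
     (\<forall>U x y. U \<in> Ob \<longrightarrow> x \<in> PE F' U \<longrightarrow> y \<in> PE F' U \<longrightarrow> a x = a y \<longrightarrow> \<phi>' x = \<phi>' y \<longrightarrow> x = y)"

lemma pb_squareI:
  assumes "psh F'" "psh G'" "pmap F' F a" "pmap G' G b" "pmap F' G' \<phi>'"
    and "\<And>U x. U \<in> Ob \<Longrightarrow> x \<in> PE F' U \<Longrightarrow> \<phi> (a x) = b (\<phi>' x)"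
    and "\<And>U g x. U \<in> Ob \<Longrightarrow> g \<in> PE G' U \<Longrightarrow> x \<in> PE F U \<Longrightarrow> \<phi> x = b g \<Longrightarrow> \<exists>x'. x' \<in> PE F' U \<and> a x' = x \<and> \<phi>' x' = g"
    and "\<And>U x y. U \<in> Ob \<Longrightarrow> x \<in> PE F' U \<Longrightarrow> y \<in> PE F' U \<Longrightarrow> a x = a y \<Longrightarrow> \<phi>' x = \<phi>' y \<Longrightarrow> x = y"
  shows "pb_square F' F G' G a b \<phi>' \<phi>"
  unfolding pb_square_def using assms by (intro conjI allI impI) auto

lemma pb_squareD:
  assumes "pb_square F' F G' G a b \<phi>' \<phi>"
  shows "psh F'" "psh G'" "pmap F' F a" "pmap G' G b" "pmap F' G' \<phi>'"
    and "\<And>U x. U \<in> Ob \<Longrightarrow> x \<in> PE F' U \<Longrightarrow> \<phi> (a x) = b (\<phi>' x)"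
    and "\<And>U g x. U \<in> Ob \<Longrightarrow> g \<in> PE G' U \<Longrightarrow> x \<in> PE F U \<Longrightarrow> \<phi> x = b g \<Longrightarrow> \<exists>x'. x' \<in> PE F' U \<and> a x' = x \<and> \<phi>' x' = g"
    and "\<And>U x y. U \<in> Ob \<Longrightarrow> x \<in> PE F' U \<Longrightarrow> y \<in> PE F' U \<Longrightarrow> a x = a y \<Longrightarrow> \<phi>' x = \<phi>' y \<Longrightarrow> x = y"
  using assms unfolding pb_square_def by simp_all

text \<open>The fibre of \<phi>' over y is the fibre of \<phi> over b y: object and structure arrow
  stay the same, and only the universal element has to be lifted.\<close>

lemma pcov_pullback:
  assumes sq: "pb_square F' F G' G a b \<phi>' \<phi>" and cov: "pcov K F G \<phi>"
  shows "pcov K F' G' \<phi>'"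
proof (rule pcovI)
  note s = pb_squareD[OF sq]
  fix U y assume U: "U \<in> Ob" and y: "y \<in> PE G' U"
  obtain A c x where f: "fibre K F G \<phi> U (b y) A c x" using pcovD[OF cov U pmap_in[OF s(4) U y]] .
  note fD = fibreD[OF f] and A = fibre_dom[OF f]
  have yc: "PR G' c y \<in> PE G' A" using psh_res[OF s(2) fD(2) y] .
  have "\<phi> x = b (PR G' c y)" using fD(4) pmap_nat[OF s(4) fD(2) y] by simp
  then obtain x' where x': "x' \<in> PE F' A" "a x' = x" "\<phi>' x' = PR G' c y"
    using s(7)[OF A yc fD(3)] by blast
  have "fibre K F' G' \<phi>' U y A c x'"
  proof (rule fibreI[where \<phi> = \<phi>' and G = G', OF fD(1,2) x'(1,3)])
    fix V u z assume u: "u \<in> H V U" and z: "z \<in> PE F' V" and e: "\<phi>' z = PR G' u y"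
    have V: "V \<in> Ob" using u hom_dom by blast
    have "\<phi> (a z) = PR G u (b y)" using s(6)[OF V z] e pmap_nat[OF s(4) u y] by simp
    then obtain v where v: "v \<in> H V A" "c \<cdot> v = u" "PR F v x = a z"
      using fibre_lift[OF f u pmap_in[OF s(3) V z]] by blast
    have "a (PR F' v x') = a z" using pmap_nat[OF s(3) v(1) x'(1)] x'(2) v(3) by simp
    moreover have "\<phi>' (PR F' v x') = \<phi>' z"
      using pmap_nat[OF s(5) v(1) x'(1)] x'(3) psh_comp[OF s(2) fD(2) v(1) y] v(2) e by simp
    ultimately have "PR F' v x' = z" using s(8)[OF V psh_res[OF s(1) v(1) x'(1)] z] by blast
    then show "\<exists>v. v \<in> H V A \<and> c \<cdot> v = u \<and> PR F' v x' = z" using v by blast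
  next
    fix V v w assume h: "v \<in> H V A" "w \<in> H V A" "c \<cdot> v = c \<cdot> w" "PR F' v x' = PR F' w x'"
    have "PR F v x = PR F w x"
      using h(4) pmap_nat[OF s(3) h(1) x'(1)] pmap_nat[OF s(3) h(2) x'(1)] x'(2) by simp
    then show "v = w" using fibre_eq[OF f h(1-3)] by blast
  qed
  then show "\<exists>A c a. fibre K F' G' \<phi>' U y A c a" by blast
qed

text \<open>Fibres compose: take the fibre of \<psi> over y, then the fibre of \<phi> over the
  universal element found there. K1 and K2 stay independent so that a fibre merely known to exist
  can be combined with one whose arrow is a cover.\<close>

lemma fibre_comp:
  assumes K: "stable_class C K" and F: "psh F" "psh G" "psh H'" "pmap F G \<phi>" "pmap G H' \<psi>"
    and y: "y \<in> PE H' U" and f1: "fibre K1 G H' \<psi> U y B d b" and f2: "fibre K2 F G \<phi> B b A c a" and dc: "d \<cdot> c \<in> K"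
  shows "fibre K F H' (\<lambda>x. \<psi> (\<phi> x)) U y A (d \<cdot> c) a"
proof -
  note d1 = fibreD[OF f1] and d2 = fibreD[OF f2] and A = fibre_dom[OF f2]
  show ?thesis
  proof (rule fibreI[where \<phi> = "\<lambda>x. \<psi> (\<phi> x)" and G = H', OF dc hom_compI[OF d2(2) d1(2)] d2(3)])
    show "\<psi> (\<phi> a) = PR H' (d \<cdot> c) y"
      using d2(4) pmap_nat[OF F(5) d2(2) d1(3)] d1(4) psh_comp[OF F(3) d1(2) d2(2) y] by simp
  next
    fix V u x assume u: "u \<in> H V U" and x: "x \<in> PE F V" and e: "\<psi> (\<phi> x) = PR H' u y"
    have V: "V \<in> Ob" using u hom_dom by blast
    obtain v where v: "v \<in> H V B" "d \<cdot> v = u" "PR G v b = \<phi> x"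
      using fibre_lift[OF f1 u pmap_in[OF F(4) V x] e] .
    obtain w where w: "w \<in> H V A" "c \<cdot> w = v" "PR F w a = x"
      using fibre_lift[OF f2 v(1) x v(3)[symmetric]] .
    have "(d \<cdot> c) \<cdot> w = u" using comp_assoc[OF w(1) d2(2) d1(2)] w v by simp
    then show "\<exists>v. v \<in> H V A \<and> (d \<cdot> c) \<cdot> v = u \<and> PR F v a = x" using w by blast
  next
    fix V v w assume h: "v \<in> H V A" "w \<in> H V A" "(d \<cdot> c) \<cdot> v = (d \<cdot> c) \<cdot> w" "PR F v a = PR F w a"
    have 1: "d \<cdot> (c \<cdot> v) = d \<cdot> (c \<cdot> w)"
      using h(3) comp_assoc[OF h(1) d2(2) d1(2)] comp_assoc[OF h(2) d2(2) d1(2)] by simp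
    have "PR G v (\<phi> a) = PR G w (\<phi> a)"
      using h(4) pmap_nat[OF F(4) h(1) d2(3)] pmap_nat[OF F(4) h(2) d2(3)] by simp
    then have "PR G (c \<cdot> v) b = PR G (c \<cdot> w) b"
      using d2(4) psh_comp[OF F(2) d2(2) h(1) d1(3)] psh_comp[OF F(2) d2(2) h(2) d1(3)] by simp
    then have "c \<cdot> v = c \<cdot> w"
      using fibre_eq[OF f1 hom_compI[OF h(1) d2(2)] hom_compI[OF h(2) d2(2)] 1] by blast
    then show "v = w" using fibre_eq[OF f2 h(1,2) _ h(4)] by blast
  qed
qed

lemma stable_comp: "stable_class C K \<Longrightarrow> f \<in> K \<Longrightarrow> g \<in> K \<Longrightarrow> f \<in> H a b \<Longrightarrow> g \<in> H b c \<Longrightarrow> g \<cdot> f \<in> K"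
  unfolding stable_class_def by (simp add: hom_def)

lemma stable_Id: "stable_class C K \<Longrightarrow> a \<in> Ob \<Longrightarrow> ID a \<in> K"
  unfolding stable_class_def using Id_iso by blast

lemma stable_pb: "stable_class C K \<Longrightarrow> is_pullback C f g p q \<Longrightarrow> f \<in> K \<Longrightarrow> q \<in> K"
  unfolding stable_class_def by simp

lemma pcov_comp:
  assumes K: "stable_class C K" and F: "psh F" "psh G" "psh H'" "pmap F G \<phi>" "pmap G H' \<psi>"
    and c: "pcov K F G \<phi>" "pcov K G H' \<psi>"
  shows "pcov K F H' (\<lambda>x. \<psi> (\<phi> x))"
proof (rule pcovI)
  fix U y assume U: "U \<in> Ob" and y: "y \<in> PE H' U"
  obtain B d b where f1: "fibre K G H' \<psi> U y B d b" using pcovD[OF c(2) U y] .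
  obtain A c a where f2: "fibre K F G \<phi> B b A c a" using pcovD[OF c(1) fibre_dom[OF f1] fibreD(3)[OF f1]] .
  have "d \<cdot> c \<in> K" using stable_comp[OF K fibreD(1)[OF f2] fibreD(1)[OF f1] fibreD(2)[OF f2] fibreD(2)[OF f1]] .
  then show "\<exists>A c a. fibre K F H' (\<lambda>x. \<psi> (\<phi> x)) U y A c a" using fibre_comp[OF K F y f1 f2] by blast
qed

text \<open>Over an element of G(U) the fibre is U itself with the identity arrow.\<close>

lemma pcov_bij:
  assumes K: "stable_class C K" and F: "psh F" "pmap F G \<phi>" "psh G"
    and bij: "\<And>U y. U \<in> Ob \<Longrightarrow> y \<in> PE G U \<Longrightarrow> \<exists>x. x \<in> PE F U \<and> \<phi> x = y"
      "\<And>U x y. U \<in> Ob \<Longrightarrow> x \<in> PE F U \<Longrightarrow> y \<in> PE F U \<Longrightarrow> \<phi> x = \<phi> y \<Longrightarrow> x = y"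
  shows "pcov K F G \<phi>"
proof (rule pcovI)
  fix U y assume U: "U \<in> Ob" and y: "y \<in> PE G U"
  obtain x where x: "x \<in> PE F U" "\<phi> x = y" using bij(1)[OF U y] by blast
  have "fibre K F G \<phi> U y U (ID U) x"
  proof (rule fibreI[where \<phi> = \<phi> and G = G, OF stable_Id[OF K U] hom_IdI[OF U] x(1)])
    show "\<phi> x = PR G (ID U) y" using psh_id[OF F(3) U y] x by simp
  next
    fix V u z assume u: "u \<in> H V U" and z: "z \<in> PE F V" and e: "\<phi> z = PR G u y"
    have "\<phi> (PR F u x) = \<phi> z" using pmap_nat[OF F(2) u x(1)] e x(2) by simp
    then have "PR F u x = z" using bij(2)[OF hom_dom[OF u] psh_res[OF F(1) u x(1)] z] by blast
    then show "\<exists>v. v \<in> H V U \<and> ID U \<cdot> v = u \<and> PR F v x = z" using u Id_comp[OF u] by blast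
  next
    fix V v w assume h: "v \<in> H V U" "w \<in> H V U" "ID U \<cdot> v = ID U \<cdot> w"
    then show "v = w" using Id_comp[OF h(1)] Id_comp[OF h(2)] by simp
  qed
  then show "\<exists>A c a. fibre K F G \<phi> U y A c a" by blast
qed

text \<open>Universality makes two presentations isomorphic over U even if they come from different
  classes. This moves membership in a class from one structure arrow to another.\<close>

lemma fibre_unique:
  assumes F: "psh F" "psh G" "pmap F G \<phi>" and y: "y \<in> PE G U"
    and f1: "fibre K1 F G \<phi> U y A c a" and f2: "fibre K2 F G \<phi> U y B d b"
  obtains i where "i \<in> H A B" "is_iso C i" "d \<cdot> i = c"
proof -
  note d1 = fibreD[OF f1] and d2 = fibreD[OF f2]
  obtain i where i: "i \<in> H A B" "d \<cdot> i = c" "PR F i b = a" using fibre_lift[OF f2 d1(2,3,4)] .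
  obtain j where j: "j \<in> H B A" "c \<cdot> j = d" "PR F j a = b" using fibre_lift[OF f1 d2(2,3,4)] .
  have ob: "A \<in> Ob" "B \<in> Ob" using i hom_dom hom_cod by blast+
  have "j \<cdot> i = ID A"
  proof (rule fibre_eq[OF f1 hom_compI[OF i(1) j(1)] hom_IdI[OF ob(1)]])
    show "c \<cdot> j \<cdot> i = c \<cdot> ID A" using comp_assoc[OF i(1) j(1) d1(2)] i j comp_Id[OF d1(2)] by simp
    show "PR F (j \<cdot> i) a = PR F (ID A) a"
      using psh_comp[OF F(1) j(1) i(1) d1(3)] i j psh_id[OF F(1) ob(1) d1(3)] by simp
  qed
  moreover have "i \<cdot> j = ID B"
  proof (rule fibre_eq[OF f2 hom_compI[OF j(1) i(1)] hom_IdI[OF ob(2)]])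
    show "d \<cdot> i \<cdot> j = d \<cdot> ID B" using comp_assoc[OF j(1) i(1) d2(2)] i j comp_Id[OF d2(2)] by simp
    show "PR F (i \<cdot> j) b = PR F (ID B) b"
      using psh_comp[OF F(1) i(1) j(1) d2(3)] i j psh_id[OF F(1) ob(2) d2(3)] by simp
  qed
  ultimately show thesis using that[OF i(1) is_isoI[OF i(1) j(1)] i(2)] by blast
qed

end

section \<open>Cancellation of covers and representability of presheaves\<close>

context descent begin

text \<open>The last covering condition supplies the fibre of \<psi> as an arrow d. Composing with a
  fibre of \<phi> yields a fibre of the composite, so d after a cover agrees up to isomorphism with
  a cover, and (D3) makes d a cover.\<close>

lemma pcov_cancel:
  assumes F: "psh F" "psh G" "psh H'" "pmap F G \<phi>" "pmap G H' \<psi>"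
    and c: "pcov Cov F G \<phi>" "pcov Cov F H' (\<lambda>x. \<psi> (\<phi> x))" "pcov (cAr C) G H' \<psi>"
  shows "pcov Cov G H' \<psi>"
proof (rule pcovI)
  fix U y assume U: "U \<in> Ob" and y: "y \<in> PE H' U"
  obtain B d b where f1: "fibre (cAr C) G H' \<psi> U y B d b" using pcovD[OF c(3) U y] .
  obtain A c' a where f2: "fibre Cov F G \<phi> B b A c' a" using pcovD[OF c(1) fibre_dom[OF f1] fibreD(3)[OF f1]] .
  have "d \<cdot> c' \<in> cAr C" using hom_compI[OF fibreD(2)[OF f2] fibreD(2)[OF f1]] hom_arrow by blast
  from fibre_comp[OF stable_arrows F y f1 f2 this]
  have f3: "fibre (cAr C) F H' (\<lambda>x. \<psi> (\<phi> x)) U y A (d \<cdot> c') a" .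
  obtain A' e a' where f4: "fibre Cov F H' (\<lambda>x. \<psi> (\<phi> x)) U y A' e a'" using pcovD[OF c(2) U y] .
  obtain i where i: "i \<in> H A A'" "is_iso C i" "e \<cdot> i = d \<cdot> c'"
    using fibre_unique[OF F(1,3) pmap_comp[OF F(4,5)] y f3 f4] .
  have "e \<cdot> i \<in> Cov" using stable_comp[OF stable_Cov isos_cov[OF i(2)] fibreD(1)[OF f4] i(1) fibreD(2)[OF f4]] .
  then have "d \<in> Cov" using cov_cancel[OF fibreD(1)[OF f2] fibreD(2)[OF f2] fibreD(2)[OF f1]] i(3) by simp
  then show "\<exists>A c a. fibre Cov G H' \<psi> U y A c a" using fibre_change[OF f1] by blast
qed

text \<open>An element y is the restriction of the universal element \<beta> along an arrow u, and
  the fibre over y is the pullback of c along u.\<close>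

lemma pcov_rep_aux:
  assumes K: "stable_class C K" and F: "psh F" "psh G" "pmap F G \<phi>"
    and r: "rep F M \<tau>" "rep G B \<beta>" and c: "c \<in> H M B" "\<phi> \<tau> = PR G c \<beta>" "c \<in> K"
  shows "pcov K F G \<phi>"
proof (rule pcovI)
  fix U y assume U: "U \<in> Ob" and y: "y \<in> PE G U"
  note rF = repD[OF r(1)] and rG = repD[OF r(2)]
  obtain u where u: "u \<in> H U B" "PR G u \<beta> = y" using rep_lift[OF r(2) U y] .
  obtain p q where pq: "is_pullback C c u p q" using ex_pullback[OF c(1) u(1)] by blast
  define P where "P = cDom C p"
  note ph = pullback_hom[OF pq c(1) u(1), folded P_def]
  have "fibre K F G \<phi> U y P q (PR F p \<tau>)"
  proof (rule fibreI[where \<phi> = \<phi> and G = G, OF stable_pb[OF K pq c(3)] ph(2) psh_res[OF F(1) ph(1) rF(2)]])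
    show "\<phi> (PR F p \<tau>) = PR G q y"
      using pmap_nat[OF F(3) ph(1) rF(2)] c(2) psh_comp[OF F(2) c(1) ph(1) rG(2)] ph(3)
        psh_comp[OF F(2) u(1) ph(2) rG(2)] u(2) by simp
  next
    fix V v x assume v: "v \<in> H V U" and x: "x \<in> PE F V" and e: "\<phi> x = PR G v y"
    have V: "V \<in> Ob" using v hom_dom by blast
    obtain w where w: "w \<in> H V M" "PR F w \<tau> = x" using rep_lift[OF r(1) V x] .
    have "PR G (c \<cdot> w) \<beta> = PR G (u \<cdot> v) \<beta>"
      using psh_comp[OF F(2) c(1) w(1) rG(2)] psh_comp[OF F(2) u(1) v rG(2)] c(2) u(2) e w(2)
        pmap_nat[OF F(3) w(1) rF(2)] by simp
    then have "c \<cdot> w = u \<cdot> v" using rep_eq[OF r(2) hom_compI[OF w(1) c(1)] hom_compI[OF v u(1)]] by blast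
    then obtain h where h: "h \<in> H V P" "p \<cdot> h = w" "q \<cdot> h = v"
      using pullback_univ[OF pq c(1) u(1) w(1) v] P_def by blast
    have "PR F h (PR F p \<tau>) = x" using psh_comp[OF F(1) ph(1) h(1) rF(2)] h w by simp
    then show "\<exists>w. w \<in> H V P \<and> q \<cdot> w = v \<and> PR F w (PR F p \<tau>) = x" using h by blast
  next
    fix V v w assume h: "v \<in> H V P" "w \<in> H V P" "q \<cdot> v = q \<cdot> w" "PR F v (PR F p \<tau>) = PR F w (PR F p \<tau>)"
    have "PR F (p \<cdot> v) \<tau> = PR F (p \<cdot> w) \<tau>"
      using h(4) psh_comp[OF F(1) ph(1) h(1) rF(2)] psh_comp[OF F(1) ph(1) h(2) rF(2)] by simp
    then have e: "p \<cdot> v = p \<cdot> w" using rep_eq[OF r(1) hom_compI[OF h(1) ph(1)] hom_compI[OF h(2) ph(1)]] by blast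
    have "c \<cdot> (p \<cdot> w) = u \<cdot> (q \<cdot> w)"
      using comp_assoc[OF h(2) ph(1) c(1)] comp_assoc[OF h(2) ph(2) u(1)] ph(3) by simp
    from pullback_univ[OF pq c(1) u(1) hom_compI[OF h(2) ph(1)] hom_compI[OF h(2) ph(2)] this, folded P_def]
    obtain z where z: "\<And>t. t \<in> H V P \<Longrightarrow> p \<cdot> t = p \<cdot> w \<Longrightarrow> q \<cdot> t = q \<cdot> w \<Longrightarrow> t = z" by metis
    show "v = w" using z[OF h(1) e h(3)] z[OF h(2)] by simp
  qed
  then show "\<exists>A c a. fibre K F G \<phi> U y A c a" by blast
qed

text \<open>The arrow c is itself the fibre over \<beta>, and any other fibre over \<beta> is
  isomorphic to it. A single arrow thus decides a condition on all fibres.\<close>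

lemma rep_pcov_iff:
  assumes K: "stable_class C K" and F: "psh F" "psh G" "pmap F G \<phi>"
    and r: "rep F M \<tau>" "rep G B \<beta>" and c: "c \<in> H M B" "\<phi> \<tau> = PR G c \<beta>"
  shows "pcov K F G \<phi> \<longleftrightarrow> c \<in> K"
proof
  assume p: "pcov K F G \<phi>"
  note rF = repD[OF r(1)] and rG = repD[OF r(2)]
  obtain A d a where f: "fibre K F G \<phi> B \<beta> A d a" using pcovD[OF p rG] .
  have f2: "fibre (cAr C) F G \<phi> B \<beta> M c \<tau>"
  proof (rule fibreI[where \<phi> = \<phi> and G = G, OF _ c(1) rF(2) c(2)])
    show "c \<in> cAr C" using c hom_arrow by blast
  next
    fix V u x assume u: "u \<in> H V B" and x: "x \<in> PE F V" and e: "\<phi> x = PR G u \<beta>"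
    obtain v where v: "v \<in> H V M" "PR F v \<tau> = x" using rep_lift[OF r(1) hom_dom[OF u] x] .
    have "PR G (c \<cdot> v) \<beta> = PR G u \<beta>"
      using psh_comp[OF F(2) c(1) v(1) rG(2)] c(2) e v(2) pmap_nat[OF F(3) v(1) rF(2)] by simp
    then have "c \<cdot> v = u" using rep_eq[OF r(2) hom_compI[OF v(1) c(1)] u] by blast
    then show "\<exists>v. v \<in> H V M \<and> c \<cdot> v = u \<and> PR F v \<tau> = x" using v by blast
  qed (use rep_eq[OF r(1)] in blast)
  obtain i where i: "i \<in> H M A" "is_iso C i" "d \<cdot> i = c" using fibre_unique[OF F rG(2) f2 f] .
  have "i \<in> K" using i(2) K unfolding stable_class_def by auto
  then show "c \<in> K" using stable_comp[OF K _ fibreD(1)[OF f] i(1) fibreD(2)[OF f]] i(3) by simp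
qed (rule pcov_rep_aux[OF K F r c])

lemma rep_map:
  assumes F: "pmap F G \<phi>" and r: "rep F M \<tau>" "rep G B \<beta>"
  obtains c where "c \<in> H M B" "\<phi> \<tau> = PR G c \<beta>"
  using rep_lift[OF r(2) repD(1)[OF r(1)] pmap_in[OF F repD[OF r(1)]]] by metis

lemma pcov_arrows:
  assumes F: "psh F" "psh G" "pmap F G \<phi>" and r: "representable F" "representable G"
  shows "pcov (cAr C) F G \<phi>"
proof -
  obtain M \<tau> B \<beta> where r': "rep F M \<tau>" "rep G B \<beta>" using r unfolding representable_def by blast
  obtain c where c: "c \<in> H M B" "\<phi> \<tau> = PR G c \<beta>" using rep_map[OF F(3) r'] .
  have "c \<in> cAr C" using c hom_arrow by blast
  then show ?thesis using pcov_rep_aux[OF stable_arrows F r' c] by blast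
qed

text \<open>The fibre over the universal element of G represents F.\<close>

lemma representable_pcov:
  assumes F: "psh F" "psh G" "pmap F G \<phi>" and cov: "pcov K F G \<phi>" and r: "representable G"
  shows "representable F"
proof -
  obtain B \<beta> where r': "rep G B \<beta>" using r unfolding representable_def by blast
  obtain A c a where f: "fibre K F G \<phi> B \<beta> A c a" using pcovD[OF cov repD[OF r']] .
  note fD = fibreD[OF f]
  have "rep F A a"
  proof (rule repI[OF fibre_dom[OF f] fD(3)])
    fix V x assume V: "V \<in> Ob" and x: "x \<in> PE F V"
    obtain u where u: "u \<in> H V B" "PR G u \<beta> = \<phi> x" using rep_lift[OF r' V pmap_in[OF F(3) V x]] .
    show "\<exists>v. v \<in> H V A \<and> PR F v a = x" using fibre_lift[OF f u(1) x u(2)[symmetric]] by metis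
  next
    fix V v w assume h: "v \<in> H V A" "w \<in> H V A" "PR F v a = PR F w a"
    have "PR G (c \<cdot> v) \<beta> = PR G (c \<cdot> w) \<beta>"
      using psh_comp[OF F(2) fD(2) h(1) repD(2)[OF r']] psh_comp[OF F(2) fD(2) h(2) repD(2)[OF r']] fD(4) h(3)
        pmap_nat[OF F(3) h(1) fD(3)] pmap_nat[OF F(3) h(2) fD(3)] by simp
    then have "c \<cdot> v = c \<cdot> w" using rep_eq[OF r' hom_compI[OF h(1) fD(2)] hom_compI[OF h(2) fD(2)]] by blast
    then show "v = w" using fibre_eq[OF f h(1,2)] h(3) by blast
  qed
  then show ?thesis unfolding representable_def by blast
qed

lemma representable_pullback:
  assumes sq: "pb_square F' F G' G a b \<phi>' \<phi>" and F: "psh F" "psh G" "pmap F G \<phi>"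
    and r: "representable F" "representable G" "representable G'"
  shows "representable F'"
  using representable_pcov[OF _ _ _ pcov_pullback[OF sq pcov_arrows[OF F r(1,2)]] r(3)] pb_squareD[OF sq] by blast

end

section \<open>Maps from finite complexes into simplicial presheaves\<close>

text \<open>Values above m are fixed to 0 as in \<open>delta_hom\<close>, so for a standard simplex
  these are literally the maps satisfying \<open>delta_hom\<close>. Degenerate simplices are the
  ones that repeat vertices.\<close>

definition simplices :: "nat set set \<Rightarrow> nat \<Rightarrow> (nat \<Rightarrow> nat) set" where
  "simplices S m = {t. (\<forall>i j. i \<le> j \<and> j \<le> m \<longrightarrow> t i \<le> t j) \<and> (\<forall>i>m. t i = 0) \<and> t ` {..m} \<in> S}"

text \<open>Simplicial sets are given by finite ordered simplicial complexes with vertices in \<open>nat\<close>,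
  as downward closed families of vertex sets. The empty set is included as a member; no simplex has it as image.\<close>
definition fin_complex :: "nat set set \<Rightarrow> bool" where
  "fin_complex S \<longleftrightarrow> {} \<in> S \<and> finite S \<and> (\<forall>V\<in>S. finite V) \<and> (\<forall>V\<in>S. \<forall>W. W \<subseteq> V \<longrightarrow> W \<in> S)"

text \<open>Monotonicity is required inside each face only: maps of prisms such as
  \<open>prism_map\<close> need not preserve the order of encoded vertices that share no
  face.\<close>

definition vertex_map :: "(nat \<Rightarrow> nat) \<Rightarrow> nat set set \<Rightarrow> nat set set \<Rightarrow> bool" where
  "vertex_map e S S' \<longleftrightarrow> (\<forall>V\<in>S. e ` V \<in> S' \<and> (\<forall>v\<in>V. \<forall>w\<in>V. v \<le> w \<longrightarrow> e v \<le> e w))"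

lemma cx_Un: "fin_complex S \<Longrightarrow> fin_complex R \<Longrightarrow> fin_complex (S \<union> R)" and cx_Int: "fin_complex S \<Longrightarrow> fin_complex R \<Longrightarrow> fin_complex (S \<inter> R)"
  unfolding fin_complex_def by auto

lemma delta_hom_Sx: "delta_hom m n \<theta> \<longleftrightarrow> \<theta> \<in> simplices (Pow {..n}) m"
  unfolding delta_hom_def simplices_def by auto

lemma Sx_mono: "S \<subseteq> T \<Longrightarrow> t \<in> simplices S m \<Longrightarrow> t \<in> simplices T m"
  unfolding simplices_def by auto

lemma Sx_Un: "t \<in> simplices (S \<union> T) m \<longleftrightarrow> t \<in> simplices S m \<or> t \<in> simplices T m"
  and Sx_Int: "t \<in> simplices (S \<inter> T) m \<longleftrightarrow> t \<in> simplices S m \<and> t \<in> simplices T m"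
  unfolding simplices_def by auto

lemma Sx_empty: "t \<notin> simplices {{}} m"
  unfolding simplices_def by auto

lemma dcomp_image: "(\<forall>i\<le>m. \<theta> i \<le> n) \<Longrightarrow> dcomp m t \<theta> ` {..m} \<subseteq> t ` {..n}"
  unfolding dcomp_def by auto

lemma dcomp_Sx:
  assumes "fin_complex S" "t \<in> simplices S n" "delta_hom m n \<theta>" shows "dcomp m t \<theta> \<in> simplices S m"
proof -
  have th: "\<forall>i\<le>m. \<theta> i \<le> n" "\<And>i j. i \<le> j \<Longrightarrow> j \<le> m \<Longrightarrow> \<theta> i \<le> \<theta> j"
    using assms(3) unfolding delta_hom_def by auto
  have t: "\<And>i j. i \<le> j \<Longrightarrow> j \<le> n \<Longrightarrow> t i \<le> t j" "t ` {..n} \<in> S"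
    using assms(2) unfolding simplices_def by auto
  have "dcomp m t \<theta> ` {..m} \<in> S"
    using assms(1) t(2) dcomp_image[OF th(1), of t] unfolding fin_complex_def by simp
  moreover have "dcomp m t \<theta> i \<le> dcomp m t \<theta> j" if "i \<le> j" "j \<le> m" for i j
    using that th t(1)[OF th(2)[OF that]] by (simp add: dcomp_def)
  ultimately show ?thesis unfolding simplices_def by (auto simp: dcomp_def)
qed

lemma dcomp_delta: "delta_hom m n \<theta> \<Longrightarrow> delta_hom l m \<psi> \<Longrightarrow> delta_hom l n (dcomp l \<theta> \<psi>)"
  unfolding delta_hom_def dcomp_def by auto

lemma delta_id_hom: "delta_hom n n (delta_id n)"
  unfolding delta_hom_def delta_id_def by auto

lemma vmap_Sx:
  assumes "vertex_map e S S'" "t \<in> simplices S m" shows "dcomp m e t \<in> simplices S' m"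
proof -
  have "dcomp m e t ` {..m} = e ` (t ` {..m})" unfolding dcomp_def by auto
  moreover have "t ` {..m} \<in> S" using assms(2) unfolding simplices_def by auto
  moreover have "e (t i) \<le> e (t j)" if "i \<le> j" "j \<le> m" for i j
  proof -
    have "t i \<le> t j" "t i \<in> t ` {..m}" "t j \<in> t ` {..m}" using that assms(2) unfolding simplices_def by auto
    moreover have "\<forall>v\<in>t ` {..m}. \<forall>w\<in>t ` {..m}. v \<le> w \<longrightarrow> e v \<le> e w"
      using assms(1) \<open>t ` {..m} \<in> S\<close> unfolding vertex_map_def by simp
    ultimately show ?thesis by blast
  qed
  moreover have "e ` (t ` {..m}) \<in> S'" using assms(1) \<open>t ` {..m} \<in> S\<close> unfolding vertex_map_def by simp
  ultimately show ?thesis unfolding simplices_def by (auto simp: dcomp_def)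
qed

lemma dcomp_swap: "delta_hom m n \<theta> \<Longrightarrow> dcomp m (dcomp n e t) \<theta> = dcomp m e (dcomp m t \<theta>)"
  unfolding delta_hom_def dcomp_def by auto

section \<open>Simplicial presheaves and presheaves of maps from complexes\<close>

record ('o,'m,'x) spsh =
  SE :: "nat \<Rightarrow> ('o,'m,'x) presheaf"
  SA :: "nat \<Rightarrow> nat \<Rightarrow> (nat \<Rightarrow> nat) \<Rightarrow> 'x \<Rightarrow> 'x"

text \<open>Restriction to S and composition with g in one operation. The value
  \<open>undefined\<close> off the simplices of S lets elements of \<open>Maps\<close> be compared
  by equality of functions.\<close>

definition post :: "nat set set \<Rightarrow> (nat \<Rightarrow> 'x \<Rightarrow> 'y) \<Rightarrow> (nat \<Rightarrow> (nat \<Rightarrow> nat) \<Rightarrow> 'x) \<Rightarrow> nat \<Rightarrow> (nat \<Rightarrow> nat) \<Rightarrow> 'y" where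
  "post S g \<sigma> = (\<lambda>m t. if t \<in> simplices S m then g m (\<sigma> m t) else undefined)"

abbreviation "restr S \<equiv> post S (\<lambda>m x. x)"

definition reindex :: "(nat \<Rightarrow> nat) \<Rightarrow> nat set set \<Rightarrow> (nat \<Rightarrow> (nat \<Rightarrow> nat) \<Rightarrow> 'x) \<Rightarrow> nat \<Rightarrow> (nat \<Rightarrow> nat) \<Rightarrow> 'x" where
  "reindex e S \<sigma> = (\<lambda>m t. if t \<in> simplices S m then \<sigma> m (dcomp m e t) else undefined)"

lemma post_post: "S \<subseteq> T \<Longrightarrow> post S g (post T h \<sigma>) = post S (\<lambda>m x. g m (h m x)) \<sigma>"
  unfolding post_def using Sx_mono by (intro ext) auto

definition Maps :: "nat set set \<Rightarrow> ('o,'m,'x) spsh \<Rightarrow> ('o,'m,nat \<Rightarrow> (nat \<Rightarrow> nat) \<Rightarrow> 'x) presheaf" where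
  "Maps S X = \<lparr>PE = (\<lambda>U. {\<sigma>. (\<forall>m t. t \<in> simplices S m \<longrightarrow> \<sigma> m t \<in> PE (SE X m) U) \<and>
       (\<forall>m n \<theta> t. t \<in> simplices S n \<longrightarrow> delta_hom m n \<theta> \<longrightarrow> SA X m n \<theta> (\<sigma> n t) = \<sigma> m (dcomp m t \<theta>)) \<and>
       (\<forall>m t. t \<notin> simplices S m \<longrightarrow> \<sigma> m t = undefined)}),
     PR = (\<lambda>u. post S (\<lambda>m. PR (SE X m) u))\<rparr>"

definition psh_pb :: "('o,'m,'x) presheaf \<Rightarrow> ('o,'m,'y) presheaf \<Rightarrow> ('x \<Rightarrow> 'z) \<Rightarrow> ('y \<Rightarrow> 'z) \<Rightarrow> ('o,'m,'x \<times> 'y) presheaf" where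
  "psh_pb F G \<phi> \<psi> = \<lparr>PE = (\<lambda>U. {p. fst p \<in> PE F U \<and> snd p \<in> PE G U \<and> \<phi> (fst p) = \<psi> (snd p)}),
     PR = (\<lambda>u p. (PR F u (fst p), PR G u (snd p)))\<rparr>"

definition RelMaps :: "nat set set \<Rightarrow> nat set set \<Rightarrow> ('o,'m,'x) spsh \<Rightarrow> ('o,'m,'y) spsh \<Rightarrow> (nat \<Rightarrow> 'x \<Rightarrow> 'y)
    \<Rightarrow> ('o,'m,(nat \<Rightarrow> (nat \<Rightarrow> nat) \<Rightarrow> 'x) \<times> (nat \<Rightarrow> (nat \<Rightarrow> nat) \<Rightarrow> 'y)) presheaf" where
  "RelMaps S T X Y f = psh_pb (Maps S X) (Maps T Y) (post S f) (restr S)"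

lemma Mp_iff: "\<sigma> \<in> PE (Maps S X) U \<longleftrightarrow> (\<forall>m t. t \<in> simplices S m \<longrightarrow> \<sigma> m t \<in> PE (SE X m) U) \<and>
       (\<forall>m n \<theta> t. t \<in> simplices S n \<longrightarrow> delta_hom m n \<theta> \<longrightarrow> SA X m n \<theta> (\<sigma> n t) = \<sigma> m (dcomp m t \<theta>)) \<and>
       (\<forall>m t. t \<notin> simplices S m \<longrightarrow> \<sigma> m t = undefined)"
  unfolding Maps_def by simp

lemma MpI:
  assumes "\<And>m t. t \<in> simplices S m \<Longrightarrow> \<sigma> m t \<in> PE (SE X m) U"
    "\<And>m n \<theta> t. t \<in> simplices S n \<Longrightarrow> delta_hom m n \<theta> \<Longrightarrow> SA X m n \<theta> (\<sigma> n t) = \<sigma> m (dcomp m t \<theta>)"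
    "\<And>m t. t \<notin> simplices S m \<Longrightarrow> \<sigma> m t = undefined"
  shows "\<sigma> \<in> PE (Maps S X) U"
  using assms unfolding Mp_iff by blast

lemma MpD:
  assumes "\<sigma> \<in> PE (Maps S X) U"
  shows "t \<in> simplices S m \<Longrightarrow> \<sigma> m t \<in> PE (SE X m) U"
    "t \<in> simplices S n \<Longrightarrow> delta_hom m n \<theta> \<Longrightarrow> SA X m n \<theta> (\<sigma> n t) = \<sigma> m (dcomp m t \<theta>)"
    "t \<notin> simplices S m \<Longrightarrow> \<sigma> m t = undefined"
  using assms unfolding Mp_iff by blast+

lemma Mp_ext:
  assumes "\<sigma> \<in> PE (Maps S X) U" "\<tau> \<in> PE (Maps S Y) V" "\<And>m t. t \<in> simplices S m \<Longrightarrow> \<sigma> m t = \<tau> m t"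
  shows "\<sigma> = \<tau>"
  using assms unfolding Mp_iff by (intro ext) metis

lemma PR_Mp: "PR (Maps S X) u = post S (\<lambda>m. PR (SE X m) u)"
  unfolding Maps_def by simp

lemma rst_id: "\<sigma> \<in> PE (Maps S X) U \<Longrightarrow> restr S \<sigma> = \<sigma>"
  unfolding Mp_iff post_def by (intro ext) auto

lemma post_eq_iff: "post S g \<sigma> = post S h \<tau> \<longleftrightarrow> (\<forall>m t. t \<in> simplices S m \<longrightarrow> g m (\<sigma> m t) = h m (\<tau> m t))"
  unfolding post_def fun_eq_iff by auto

lemma post_app: "t \<in> simplices S m \<Longrightarrow> post S g \<sigma> m t = g m (\<sigma> m t)"
  unfolding post_def by simp

lemma re_app: "t \<in> simplices S m \<Longrightarrow> reindex e S \<sigma> m t = \<sigma> m (dcomp m e t)"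
  unfolding reindex_def by simp

lemma PE_PBp: "p \<in> PE (psh_pb F G \<phi> \<psi>) U \<longleftrightarrow> fst p \<in> PE F U \<and> snd p \<in> PE G U \<and> \<phi> (fst p) = \<psi> (snd p)"
  and PR_PBp: "PR (psh_pb F G \<phi> \<psi>) u p = (PR F u (fst p), PR G u (snd p))"
  unfolding psh_pb_def by auto

lemma PE_Rel: "p \<in> PE (RelMaps S T X Y f) U \<longleftrightarrow> fst p \<in> PE (Maps S X) U \<and> snd p \<in> PE (Maps T Y) U \<and>
    post S f (fst p) = restr S (snd p)"
  and PR_Rel: "PR (RelMaps S T X Y f) u p = (PR (Maps S X) u (fst p), PR (Maps T Y) u (snd p))"
  unfolding RelMaps_def PE_PBp PR_PBp by auto

context cat_loc begin

definition simp_psh :: "('o,'m,'x) spsh \<Rightarrow> bool" where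
  "simp_psh X \<longleftrightarrow> (\<forall>n. psh (SE X n)) \<and>
     (\<forall>m n \<theta>. delta_hom m n \<theta> \<longrightarrow> pmap (SE X n) (SE X m) (SA X m n \<theta>)) \<and>
     (\<forall>n U x. U \<in> Ob \<longrightarrow> x \<in> PE (SE X n) U \<longrightarrow> SA X n n (delta_id n) x = x) \<and>
     (\<forall>l m n \<theta> \<psi> U x. delta_hom m n \<theta> \<longrightarrow> delta_hom l m \<psi> \<longrightarrow> U \<in> Ob \<longrightarrow> x \<in> PE (SE X n) U \<longrightarrow>
        SA X l n (dcomp l \<theta> \<psi>) x = SA X l m \<psi> (SA X m n \<theta> x))"

definition smap :: "('o,'m,'x) spsh \<Rightarrow> ('o,'m,'y) spsh \<Rightarrow> (nat \<Rightarrow> 'x \<Rightarrow> 'y) \<Rightarrow> bool" where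
  "smap X Y f \<longleftrightarrow> (\<forall>n. pmap (SE X n) (SE Y n) (f n)) \<and>
     (\<forall>m n \<theta> U x. delta_hom m n \<theta> \<longrightarrow> U \<in> Ob \<longrightarrow> x \<in> PE (SE X n) U \<longrightarrow>
        f m (SA X m n \<theta> x) = SA Y m n \<theta> (f n x))"

lemma spsD:
  assumes "simp_psh X"
  shows "psh (SE X n)" "delta_hom m n \<theta> \<Longrightarrow> pmap (SE X n) (SE X m) (SA X m n \<theta>)"
    "U \<in> Ob \<Longrightarrow> x \<in> PE (SE X n) U \<Longrightarrow> SA X n n (delta_id n) x = x"
    "delta_hom m n \<theta> \<Longrightarrow> delta_hom l m \<psi> \<Longrightarrow> U \<in> Ob \<Longrightarrow> x \<in> PE (SE X n) U \<Longrightarrow>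
        SA X l n (dcomp l \<theta> \<psi>) x = SA X l m \<psi> (SA X m n \<theta> x)"
  using assms unfolding simp_psh_def by blast+

lemma smapD:
  assumes "smap X Y f"
  shows "pmap (SE X n) (SE Y n) (f n)"
    "delta_hom m n \<theta> \<Longrightarrow> U \<in> Ob \<Longrightarrow> x \<in> PE (SE X n) U \<Longrightarrow> f m (SA X m n \<theta> x) = SA Y m n \<theta> (f n x)"
  using assms unfolding smap_def by blast+

lemma smap_comp:
  assumes f: "smap X Y f" and g: "smap Y Z g" shows "smap X Z (\<lambda>n x. g n (f n x))"
  unfolding smap_def
proof (intro conjI allI impI)
  fix n show "pmap (SE X n) (SE Z n) (\<lambda>x. g n (f n x))"
    using pmap_comp[OF smapD(1)[OF f] smapD(1)[OF g]] .
next
  fix m n \<theta> U x assume "delta_hom m n \<theta>" "U \<in> Ob" "x \<in> PE (SE X n) U"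
  then show "g m (f m (SA X m n \<theta> x)) = SA Z m n \<theta> (g n (f n x))"
    using smapD(2)[OF f] smapD(2)[OF g] pmap_in[OF smapD(1)[OF f]] by metis
qed

lemma smap_id: "simp_psh X \<Longrightarrow> smap X X (\<lambda>n x. x)"
  unfolding smap_def pmap_def by simp

lemma pmap_id: "pmap F F (\<lambda>x. x)" unfolding pmap_def by simp

lemma psh_Mp:
  assumes X: "simp_psh X" and S: "fin_complex S" shows "psh (Maps S X)"
  unfolding psh_def
proof (intro conjI allI impI)
  fix U V u \<sigma> assume u: "u \<in> H V U" and s: "\<sigma> \<in> PE (Maps S X) U"
  have ob: "U \<in> Ob" "V \<in> Ob" using u hom_dom hom_cod by blast+
  show "PR (Maps S X) u \<sigma> \<in> PE (Maps S X) V"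
  proof (rule MpI)
    fix m t assume t: "t \<in> simplices S m"
    show "PR (Maps S X) u \<sigma> m t \<in> PE (SE X m) V"
      unfolding PR_Mp post_app[OF t] using psh_res[OF spsD(1)[OF X] u MpD(1)[OF s t]] .
  next
    fix m n \<theta> t assume t: "t \<in> simplices S n" and \<theta>: "delta_hom m n \<theta>"
    show "SA X m n \<theta> (PR (Maps S X) u \<sigma> n t) = PR (Maps S X) u \<sigma> m (dcomp m t \<theta>)"
      unfolding PR_Mp post_app[OF t] post_app[OF dcomp_Sx[OF S t \<theta>]]
      using pmap_nat[OF spsD(2)[OF X \<theta>] u MpD(1)[OF s t]] MpD(2)[OF s t \<theta>] by simp
  qed (simp add: PR_Mp post_def)
next
  fix U \<sigma> assume U: "U \<in> Ob" and s: "\<sigma> \<in> PE (Maps S X) U"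
  have "restr S \<sigma> = post S (\<lambda>m. PR (SE X m) (ID U)) \<sigma>"
    unfolding post_eq_iff using psh_id[OF spsD(1)[OF X] U MpD(1)[OF s]] by simp
  then show "PR (Maps S X) (ID U) \<sigma> = \<sigma>" unfolding PR_Mp using rst_id[OF s] by simp
next
  fix U V W u v \<sigma> assume u: "u \<in> H V U" and v: "v \<in> H W V" and s: "\<sigma> \<in> PE (Maps S X) U"
  show "PR (Maps S X) (u \<cdot> v) \<sigma> = PR (Maps S X) v (PR (Maps S X) u \<sigma>)"
    unfolding PR_Mp post_post[OF order_refl] post_eq_iff
    using psh_comp[OF spsD(1)[OF X] u v MpD(1)[OF s]] by simp
qed

lemma pmap_post:
  assumes f: "smap X Y f" and S: "fin_complex S" "fin_complex T" "S \<subseteq> T"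
  shows "pmap (Maps T X) (Maps S Y) (post S f)"
  unfolding pmap_def
proof (intro conjI allI impI)
  fix U \<sigma> assume U: "U \<in> Ob" and s: "\<sigma> \<in> PE (Maps T X) U"
  show "post S f \<sigma> \<in> PE (Maps S Y) U"
  proof (rule MpI)
    fix m t assume t: "t \<in> simplices S m"
    show "post S f \<sigma> m t \<in> PE (SE Y m) U"
      unfolding post_app[OF t] using pmap_in[OF smapD(1)[OF f] U MpD(1)[OF s Sx_mono[OF S(3) t]]] .
  next
    fix m n \<theta> t assume t: "t \<in> simplices S n" and \<theta>: "delta_hom m n \<theta>"
    note t' = Sx_mono[OF S(3) t]
    show "SA Y m n \<theta> (post S f \<sigma> n t) = post S f \<sigma> m (dcomp m t \<theta>)"
      unfolding post_app[OF t] post_app[OF dcomp_Sx[OF S(1) t \<theta>]]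
      using smapD(2)[OF f \<theta> U MpD(1)[OF s t']] MpD(2)[OF s t' \<theta>] by simp
  qed (simp add: post_def)
next
  fix U V u \<sigma> assume u: "u \<in> H V U" and s: "\<sigma> \<in> PE (Maps T X) U"
  show "post S f (PR (Maps T X) u \<sigma>) = PR (Maps S Y) u (post S f \<sigma>)"
    unfolding PR_Mp post_post[OF S(3)] post_post[OF order_refl] post_eq_iff
    using pmap_nat[OF smapD(1)[OF f] u MpD(1)[OF s Sx_mono[OF S(3)]]] by simp
qed

lemma pmap_rst: "simp_psh X \<Longrightarrow> fin_complex S \<Longrightarrow> fin_complex T \<Longrightarrow> S \<subseteq> T \<Longrightarrow> pmap (Maps T X) (Maps S X) (restr S)"
  by (rule pmap_post[OF smap_id])

lemma re_Mp:
  assumes e: "vertex_map e S S'" and S: "fin_complex S" and s: "\<sigma> \<in> PE (Maps S' X) U"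
  shows "reindex e S \<sigma> \<in> PE (Maps S X) U"
proof (rule MpI)
  fix m t assume t: "t \<in> simplices S m"
  show "reindex e S \<sigma> m t \<in> PE (SE X m) U"
    unfolding re_app[OF t] using MpD(1)[OF s vmap_Sx[OF e t]] .
next
  fix m n \<theta> t assume t: "t \<in> simplices S n" and \<theta>: "delta_hom m n \<theta>"
  show "SA X m n \<theta> (reindex e S \<sigma> n t) = reindex e S \<sigma> m (dcomp m t \<theta>)"
    unfolding re_app[OF t] re_app[OF dcomp_Sx[OF S t \<theta>]] MpD(2)[OF s vmap_Sx[OF e t] \<theta>] dcomp_swap[OF \<theta>] ..
qed (simp add: reindex_def)

lemma re_post: "vertex_map e S S' \<Longrightarrow> reindex e S (post S' g \<sigma>) = post S g (reindex e S \<sigma>)"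
  unfolding reindex_def post_def using vmap_Sx by (intro ext) auto

lemma pmap_re:
  assumes e: "vertex_map e S S'" and S: "fin_complex S"
  shows "pmap (Maps S' X) (Maps S X) (reindex e S)"
  unfolding pmap_def PR_Mp by (simp add: re_Mp[OF e S] re_post[OF e])

lemma psh_PBp:
  assumes F: "psh F" "psh G" "pmap F J \<phi>" "pmap G J \<psi>"
  shows "psh (psh_pb F G \<phi> \<psi>)"
  unfolding psh_def PE_PBp PR_PBp
proof (intro conjI allI impI)
  fix U V u p assume u: "u \<in> H V U" and p: "fst p \<in> PE F U \<and> snd p \<in> PE G U \<and> \<phi> (fst p) = \<psi> (snd p)"
  then show "fst (PR F u (fst p), PR G u (snd p)) \<in> PE F V" "snd (PR F u (fst p), PR G u (snd p)) \<in> PE G V"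
    "\<phi> (fst (PR F u (fst p), PR G u (snd p))) = \<psi> (snd (PR F u (fst p), PR G u (snd p)))"
    using psh_res[OF F(1) u] psh_res[OF F(2) u] pmap_nat[OF F(3) u] pmap_nat[OF F(4) u] by auto
qed (simp_all add: prod_eq_iff psh_id[OF F(1)] psh_id[OF F(2)] psh_comp[OF F(1)] psh_comp[OF F(2)])

lemma psh_Rel:
  assumes "smap X Y f" "simp_psh X" "simp_psh Y" "fin_complex S" "fin_complex T" "S \<subseteq> T"
  shows "psh (RelMaps S T X Y f)"
  unfolding RelMaps_def using psh_PBp[OF psh_Mp psh_Mp pmap_post pmap_rst] assms by blast

lemma pmap_PBp:
  assumes "pmap E F a" "pmap E G b" "\<And>U x. U \<in> Ob \<Longrightarrow> x \<in> PE E U \<Longrightarrow> \<phi> (a x) = \<psi> (b x)"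
  shows "pmap E (psh_pb F G \<phi> \<psi>) (\<lambda>x. (a x, b x))"
  unfolding pmap_def PE_PBp PR_PBp
  using assms pmap_in[OF assms(1)] pmap_in[OF assms(2)] pmap_nat[OF assms(1)] pmap_nat[OF assms(2)] by simp

lemma pmap_fst: "pmap (psh_pb F G \<phi> \<psi>) F fst" and pmap_snd: "pmap (psh_pb F G \<phi> \<psi>) G snd"
  unfolding pmap_def PE_PBp PR_PBp by auto

lemma pmap_to_Rel:
  assumes "smap X Y f" "simp_psh X" "simp_psh Y" "fin_complex S" "fin_complex T" "S \<subseteq> T"
  shows "pmap (Maps T X) (RelMaps S T X Y f) (\<lambda>\<tau>. (restr S \<tau>, post T f \<tau>))"
  unfolding RelMaps_def
proof (rule pmap_PBp)
  show "pmap (Maps T X) (Maps S X) (restr S)" using pmap_rst assms by blast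
  show "pmap (Maps T X) (Maps T Y) (post T f)" using pmap_post assms by blast
  show "post S f (restr S x) = restr S (post T f x)" for x
    unfolding post_post[OF order_refl] post_post[OF assms(6)] ..
qed

text \<open>The map \<open>Map(T, X) \<rightarrow> Map(S \<hookrightarrow> T, f)\<close> belongs to the class \<open>K\<close>.\<close>
definition rel_lift :: "'m set \<Rightarrow> ('o,'m,'x) spsh \<Rightarrow> ('o,'m,'y) spsh \<Rightarrow> (nat \<Rightarrow> 'x \<Rightarrow> 'y) \<Rightarrow> nat set set \<Rightarrow> nat set set \<Rightarrow> bool" where
  "rel_lift K X Y f S T \<longleftrightarrow> pcov K (Maps T X) (RelMaps S T X Y f) (\<lambda>\<tau>. (restr S \<tau>, post T f \<tau>))"

text \<open>Map(W, X) maps to Map(T \<hookrightarrow> W, f) and on to Map(S \<hookrightarrow> W, f).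
  The second map is a base change of the lifting map from Map(T, X) to Map(S \<hookrightarrow> T,
  f).\<close>

lemma lft_trans:
  assumes K: "stable_class C K" and f: "smap X Y f" "simp_psh X" "simp_psh Y"
    and S: "fin_complex S" "fin_complex T" "fin_complex W" "S \<subseteq> T" "T \<subseteq> W"
    and l: "rel_lift K X Y f S T" "rel_lift K X Y f T W"
  shows "rel_lift K X Y f S W"
proof -
  have SW: "S \<subseteq> W" using S by blast
  let ?\<psi> = "\<lambda>p. (restr S (fst p), snd p)"
  note pR = psh_Rel[OF f]
  have 1: "pmap (RelMaps T W X Y f) (Maps T X) fst" unfolding RelMaps_def by (rule pmap_fst)
  have 2: "pmap (RelMaps S W X Y f) (RelMaps S T X Y f) (\<lambda>p. (fst p, restr T (snd p)))"
    unfolding RelMaps_def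
    by (rule pmap_PBp[OF pmap_fst pmap_comp[OF pmap_snd pmap_rst[OF f(3) S(2,3,5)]]])
       (simp add: PE_PBp post_post[OF S(4)])
  have 3: "pmap (RelMaps T W X Y f) (RelMaps S W X Y f) ?\<psi>"
    unfolding RelMaps_def
  proof (rule pmap_PBp[OF pmap_comp[OF pmap_fst pmap_rst[OF f(2) S(1,2,4)]] pmap_snd])
    fix U p assume "U \<in> Ob" "p \<in> PE (psh_pb (Maps T X) (Maps W Y) (post T f) (restr T)) U"
    then have "post S (\<lambda>m x. x) (post T f (fst p)) = restr S (restr T (snd p))" by (simp add: PE_PBp)
    then show "post S f (restr S (fst p)) = restr S (snd p)"
      unfolding post_post[OF S(4)] post_post[OF order_refl] .
  qed
  have "pb_square (RelMaps T W X Y f) (Maps T X) (RelMaps S W X Y f) (RelMaps S T X Y f) fst (\<lambda>p. (fst p, restr T (snd p)))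
      ?\<psi> (\<lambda>\<tau>. (restr S \<tau>, post T f \<tau>))"
  proof (rule pb_squareI[OF pR[OF S(2,3,5)] pR[OF S(1,3) SW] 1 2 3])
    fix U g x assume g: "g \<in> PE (RelMaps S W X Y f) U" and x: "x \<in> PE (Maps T X) U"
      and e: "(restr S x, post T f x) = (fst g, restr T (snd g))"
    show "\<exists>p. p \<in> PE (RelMaps T W X Y f) U \<and> fst p = x \<and> (restr S (fst p), snd p) = g"
      using g x e by (intro exI[of _ "(x, snd g)"]) (auto simp: PE_Rel prod_eq_iff)
  qed (auto simp: PE_Rel prod_eq_iff)
  from pcov_comp[OF K psh_Mp[OF f(2) S(3)] pR[OF S(2,3,5)] pR[OF S(1,3) SW] pmap_to_Rel[OF f S(2,3,5)] 3
      l(2)[unfolded rel_lift_def] pcov_pullback[OF this l(1)[unfolded rel_lift_def]]]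
  show ?thesis unfolding rel_lift_def by (simp add: post_post[OF S(4)])
qed

definition glue :: "nat set set \<Rightarrow> nat set set \<Rightarrow> (nat \<Rightarrow> (nat \<Rightarrow> nat) \<Rightarrow> 'x) \<Rightarrow> (nat \<Rightarrow> (nat \<Rightarrow> nat) \<Rightarrow> 'x) \<Rightarrow> nat \<Rightarrow> (nat \<Rightarrow> nat) \<Rightarrow> 'x" where
  "glue S R \<sigma> \<tau> = (\<lambda>m t. if t \<in> simplices S m then \<sigma> m t else if t \<in> simplices R m then \<tau> m t else undefined)"

lemma glue_app:
  assumes "restr (S \<inter> R) \<sigma> = restr (S \<inter> R) \<tau>"
  shows "t \<in> simplices S m \<Longrightarrow> glue S R \<sigma> \<tau> m t = \<sigma> m t" "t \<in> simplices R m \<Longrightarrow> glue S R \<sigma> \<tau> m t = \<tau> m t"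
  using assms unfolding glue_def post_eq_iff Sx_Int by auto

lemma glue_Mp:
  assumes S: "fin_complex S" "fin_complex R" and s: "\<sigma> \<in> PE (Maps S X) U" and t: "\<tau> \<in> PE (Maps R X) U"
    and e: "restr (S \<inter> R) \<sigma> = restr (S \<inter> R) \<tau>"
  shows "glue S R \<sigma> \<tau> \<in> PE (Maps (S \<union> R) X) U"
proof (rule MpI)
  fix m x assume "x \<in> simplices (S \<union> R) m"
  then consider "x \<in> simplices S m" | "x \<in> simplices R m" unfolding Sx_Un by blast
  then show "glue S R \<sigma> \<tau> m x \<in> PE (SE X m) U"
  proof cases
    case 1 then show ?thesis unfolding glue_app(1)[OF e 1] by (rule MpD(1)[OF s])
  next
    case 2 then show ?thesis unfolding glue_app(2)[OF e 2] by (rule MpD(1)[OF t])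
  qed
next
  fix m n \<theta> x assume x: "x \<in> simplices (S \<union> R) n" and th: "delta_hom m n \<theta>"
  then consider "x \<in> simplices S n" | "x \<in> simplices R n" unfolding Sx_Un by blast
  then show "SA X m n \<theta> (glue S R \<sigma> \<tau> n x) = glue S R \<sigma> \<tau> m (dcomp m x \<theta>)"
  proof cases
    case 1 then show ?thesis
      unfolding glue_app(1)[OF e 1] glue_app(1)[OF e dcomp_Sx[OF S(1) 1 th]] by (rule MpD(2)[OF s _ th])
  next
    case 2 then show ?thesis
      unfolding glue_app(2)[OF e 2] glue_app(2)[OF e dcomp_Sx[OF S(2) 2 th]] by (rule MpD(2)[OF t _ th])
  qed
qed (simp add: glue_def Sx_Un)

text \<open>S \<union> R is the pushout of S and R over S \<inter> R, and mapping out turns it into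
  a pullback: the lifting map of the larger pair is a base change of that of S \<inter> R in R. This
  is how a cell is attached.\<close>

lemma lft_union:
  assumes f: "smap X Y f" "simp_psh X" "simp_psh Y" and S: "fin_complex S" "fin_complex R" and l: "rel_lift K X Y f (S \<inter> R) R"
  shows "rel_lift K X Y f S (S \<union> R)"
proof -
  note I = cx_Int[OF S] and Un = cx_Un[OF S]
  let ?b = "\<lambda>p. (restr (S \<inter> R) (fst p), restr R (snd p))"
  have 1: "pmap (Maps (S \<union> R) X) (Maps R X) (restr R)" using pmap_rst[OF f(2) S(2) Un] by blast
  have 2: "pmap (RelMaps S (S \<union> R) X Y f) (RelMaps (S \<inter> R) R X Y f) ?b"
    unfolding RelMaps_def
  proof (rule pmap_PBp[OF pmap_comp[OF pmap_fst pmap_rst[OF f(2) I S(1)]] pmap_comp[OF pmap_snd pmap_rst[OF f(3) S(2) Un]]])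
    fix U p assume "U \<in> Ob" "p \<in> PE (psh_pb (Maps S X) (Maps (S \<union> R) Y) (post S f) (restr S)) U"
    then have "restr (S \<inter> R) (post S f (fst p)) = restr (S \<inter> R) (restr S (snd p))" by (simp add: PE_PBp)
    then show "post (S \<inter> R) f (restr (S \<inter> R) (fst p)) = restr (S \<inter> R) (restr R (snd p))"
      by (simp add: post_post)
  qed auto
  have "pb_square (Maps (S \<union> R) X) (Maps R X) (RelMaps S (S \<union> R) X Y f) (RelMaps (S \<inter> R) R X Y f) (restr R) ?b
      (\<lambda>\<tau>. (restr S \<tau>, post (S \<union> R) f \<tau>)) (\<lambda>\<tau>. (restr (S \<inter> R) \<tau>, post R f \<tau>))"
  proof (rule pb_squareI[OF psh_Mp[OF f(2) Un] psh_Rel[OF f S(1) Un] 1 2 pmap_to_Rel[OF f S(1) Un]])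
    fix U x show "(restr (S \<inter> R) (restr R x), post R f (restr R x)) = ?b (restr S x, post (S \<union> R) f x)"
      by (simp add: post_post)
  next
    fix U g x assume U: "U \<in> Ob" and g: "g \<in> PE (RelMaps S (S \<union> R) X Y f) U" and x: "x \<in> PE (Maps R X) U"
      and e: "(restr (S \<inter> R) x, post R f x) = ?b g"
    obtain \<sigma> \<rho> where p: "g = (\<sigma>, \<rho>)" by (cases g)
    have s: "\<sigma> \<in> PE (Maps S X) U" "\<rho> \<in> PE (Maps (S \<union> R) Y) U" "post S f \<sigma> = restr S \<rho>" using g p by (auto simp: PE_Rel)
    have e': "restr (S \<inter> R) \<sigma> = restr (S \<inter> R) x" "post R f x = restr R \<rho>" using e p by auto
    note ga = glue_app[OF e'(1)]
    have G: "glue S R \<sigma> x \<in> PE (Maps (S \<union> R) X) U" using glue_Mp[OF S s(1) x e'(1)] .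
    have "restr R (glue S R \<sigma> x) = x" by (rule Mp_ext[OF pmap_in[OF 1 U G] x]) (simp add: post_app ga)
    moreover have "restr S (glue S R \<sigma> x) = \<sigma>"
      by (rule Mp_ext[OF pmap_in[OF pmap_rst[OF f(2) S(1) Un Un_upper1] U G] s(1)]) (simp add: post_app ga)
    moreover have "post (S \<union> R) f (glue S R \<sigma> x) = restr (S \<union> R) \<rho>"
      using s(3) e'(2) ga unfolding post_eq_iff Sx_Un by auto
    ultimately show "\<exists>y. y \<in> PE (Maps (S \<union> R) X) U \<and> restr R y = x \<and> (restr S y, post (S \<union> R) f y) = g"
      using G rst_id[OF s(2)] unfolding p by (intro exI[of _ "glue S R \<sigma> x"] conjI) simp_all
  next
    fix U x y assume h: "x \<in> PE (Maps (S \<union> R) X) U" "y \<in> PE (Maps (S \<union> R) X) U" "restr R x = restr R y"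
      "(restr S x, post (S \<union> R) f x) = (restr S y, post (S \<union> R) f y)"
    show "x = y" by (rule Mp_ext[OF h(1,2)]) (use h(3,4) in \<open>auto simp: Sx_Un post_eq_iff\<close>)
  qed auto
  from pcov_pullback[OF this l[unfolded rel_lift_def]] show ?thesis unfolding rel_lift_def .
qed

lemma re_re:
  assumes "vertex_map e T T'" "vertex_map d T' T" "\<And>V v. V \<in> T' \<Longrightarrow> v \<in> V \<Longrightarrow> e (d v) = v" "\<sigma> \<in> PE (Maps T' X) U"
  shows "reindex d T' (reindex e T \<sigma>) = \<sigma>"
proof (intro ext)
  fix m t
  show "reindex d T' (reindex e T \<sigma>) m t = \<sigma> m t"
  proof (cases "t \<in> simplices T' m")
    case True
    have "dcomp m e (dcomp m d t) = t"
      using True assms(3)[of "t ` {..m}"] unfolding simplices_def dcomp_def by auto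
    then show ?thesis using True vmap_Sx[OF assms(2) True] by (simp add: re_app)
  qed (use MpD(3)[OF assms(4)] in \<open>simp add: reindex_def\<close>)
qed

lemma re_rst: "S \<subseteq> T \<Longrightarrow> restr S (reindex e T \<sigma>) = reindex e S \<sigma>"
  unfolding reindex_def post_def using Sx_mono by (intro ext) auto

lemma re_rst': "vertex_map e S S' \<Longrightarrow> S' \<subseteq> T' \<Longrightarrow> reindex e S (restr S' \<sigma>) = reindex e S \<sigma>"
  unfolding reindex_def post_def using vmap_Sx by (intro ext) auto

text \<open>The vertex maps e and d, inverse to each other on faces, relabel one pair as the other.
  This carries a condition on a standard simplex to a cell with arbitrary vertices.\<close>

lemma lft_transport:
  assumes f: "smap X Y f" "simp_psh X" "simp_psh Y" and S: "fin_complex S" "fin_complex T" "S \<subseteq> T" "fin_complex S'" "fin_complex T'" "S' \<subseteq> T'"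
    and e: "vertex_map e T T'" "vertex_map e S S'" "vertex_map d T' T" "vertex_map d S' S"
      "\<And>V v. V \<in> T' \<Longrightarrow> v \<in> V \<Longrightarrow> e (d v) = v" "\<And>V v. V \<in> T \<Longrightarrow> v \<in> V \<Longrightarrow> d (e v) = v"
    and l: "rel_lift K X Y f S T"
  shows "rel_lift K X Y f S' T'"
proof -
  let ?b = "\<lambda>p. (reindex e S (fst p), reindex e T (snd p))"
  have 2: "pmap (RelMaps S' T' X Y f) (RelMaps S T X Y f) ?b"
    unfolding RelMaps_def
  proof (rule pmap_PBp[OF pmap_comp[OF pmap_fst pmap_re[OF e(2) S(1)]] pmap_comp[OF pmap_snd pmap_re[OF e(1) S(2)]]])
    fix U p assume "U \<in> Ob" "p \<in> PE (psh_pb (Maps S' X) (Maps T' Y) (post S' f) (restr S')) U"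
    then have "reindex e S (post S' f (fst p)) = reindex e S (restr S' (snd p))" by (simp add: PE_PBp)
    then show "post S f (reindex e S (fst p)) = restr S (reindex e T (snd p))"
      by (simp add: re_post[OF e(2)] re_rst[OF S(3)] re_rst[OF order_refl] re_rst'[OF e(2) S(6)] re_rst'[OF e(2) order_refl])
  qed
  have "pb_square (Maps T' X) (Maps T X) (RelMaps S' T' X Y f) (RelMaps S T X Y f) (reindex e T) ?b
      (\<lambda>\<tau>. (restr S' \<tau>, post T' f \<tau>)) (\<lambda>\<tau>. (restr S \<tau>, post T f \<tau>))"
  proof (rule pb_squareI[OF psh_Mp[OF f(2) S(5)] psh_Rel[OF f S(4,5,6)] pmap_re[OF e(1) S(2)] 2 pmap_to_Rel[OF f S(4-6)]])
    fix U x show "(restr S (reindex e T x), post T f (reindex e T x)) = ?b (restr S' x, post T' f x)"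
      by (simp add: re_post[OF e(1)] re_rst[OF S(3)] re_rst'[OF e(2) S(6)])
  next
    fix U g x assume U: "U \<in> Ob" and g: "g \<in> PE (RelMaps S' T' X Y f) U" and x: "x \<in> PE (Maps T X) U"
      and h: "(restr S x, post T f x) = ?b g"
    obtain \<sigma> \<rho> where p: "g = (\<sigma>, \<rho>)" by (cases g)
    have s: "\<sigma> \<in> PE (Maps S' X) U" "\<rho> \<in> PE (Maps T' Y) U" using g p by (auto simp: PE_Rel)
    have h': "restr S x = reindex e S \<sigma>" "post T f x = reindex e T \<rho>" using h p by auto
    have r1: "reindex e T (reindex d T' x) = x" using re_re[OF e(3,1,6) x] .
    have r2: "restr S' (reindex d T' x) = \<sigma>"
    proof -
      have "restr S' (reindex d T' x) = reindex d S' (restr S x)" unfolding re_rst[OF S(6)] re_rst'[OF e(4) S(3)] ..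
      also have "\<dots> = \<sigma>" unfolding h'(1) by (rule re_re[OF e(2,4) _ s(1)]) (use e(5) S(6) in blast)
      finally show ?thesis .
    qed
    have r3: "post T' f (reindex d T' x) = \<rho>"
      using re_re[OF e(1,3,5) s(2)] unfolding h'(2)[symmetric] re_post[OF e(3)] .
    show "\<exists>y. y \<in> PE (Maps T' X) U \<and> reindex e T y = x \<and> (restr S' y, post T' f y) = g"
      unfolding p by (rule exI[of _ "reindex d T' x"], unfold r1 r2 r3, rule conjI[OF re_Mp[OF e(3) S(5) x] conjI[OF refl refl]])
  next
    fix U x y assume h: "x \<in> PE (Maps T' X) U" "y \<in> PE (Maps T' X) U" "reindex e T x = reindex e T y"
    have "reindex d T' (reindex e T x) = reindex d T' (reindex e T y)" using h(3) by (rule arg_cong)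
    then show "x = y" by (simp only: re_re[OF e(1,3,5) h(1)] re_re[OF e(1,3,5) h(2)])
  qed
  from pcov_pullback[OF this l[unfolded rel_lift_def]] show ?thesis unfolding rel_lift_def .
qed

section \<open>Lifting conditions under pullback, composition and cancellation of maps\<close>

definition spb :: "('o,'m,'w) spsh \<Rightarrow> ('o,'m,'x) spsh \<Rightarrow> ('o,'m,'z) spsh \<Rightarrow> ('o,'m,'y) spsh
    \<Rightarrow> (nat \<Rightarrow> 'w \<Rightarrow> 'x) \<Rightarrow> (nat \<Rightarrow> 'z \<Rightarrow> 'y) \<Rightarrow> (nat \<Rightarrow> 'w \<Rightarrow> 'z) \<Rightarrow> (nat \<Rightarrow> 'x \<Rightarrow> 'y) \<Rightarrow> bool" where
  "spb X' X Y' Y a b f' f \<longleftrightarrow> simp_psh X' \<and> simp_psh X \<and> simp_psh Y' \<and> simp_psh Y \<and> smap X' X a \<and> smap Y' Y b \<and> smap X' Y' f' \<and> smap X Y f \<and>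
     (\<forall>n. pb_square (SE X' n) (SE X n) (SE Y' n) (SE Y n) (a n) (b n) (f' n) (f n))"

text \<open>Mapping out of a complex commutes with limits, so a levelwise pullback square stays one
  on relative mapping presheaves.\<close>

lemma spb_Mp:
  assumes "spb X' X Y' Y a b f' f" and S: "fin_complex S" "fin_complex T" "S \<subseteq> T"
  shows "pb_square (Maps T X') (Maps T X) (RelMaps S T X' Y' f') (RelMaps S T X Y f) (post T a)
      (\<lambda>p. (post S a (fst p), post T b (snd p))) (\<lambda>\<tau>. (restr S \<tau>, post T f' \<tau>)) (\<lambda>\<tau>. (restr S \<tau>, post T f \<tau>))"
proof -
  have s: "simp_psh X'" "simp_psh X" "simp_psh Y'" "simp_psh Y" "smap X' X a" "smap Y' Y b" "smap X' Y' f'" "smap X Y f"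
    and "\<And>n. pb_square (SE X' n) (SE X n) (SE Y' n) (SE Y n) (a n) (b n) (f' n) (f n)"
    using assms unfolding spb_def by blast+
  note q = pb_squareD[OF this(9)]
  have 2: "pmap (RelMaps S T X' Y' f') (RelMaps S T X Y f) (\<lambda>p. (post S a (fst p), post T b (snd p)))"
    unfolding RelMaps_def
  proof (rule pmap_PBp[OF pmap_comp[OF pmap_fst pmap_post[OF s(5) S(1) S(1) order_refl]] pmap_comp[OF pmap_snd pmap_post[OF s(6) S(2) S(2) order_refl]]])
    fix U p assume U: "U \<in> Ob" and p: "p \<in> PE (psh_pb (Maps S X') (Maps T Y') (post S f') (restr S)) U"
    then have p': "fst p \<in> PE (Maps S X') U" "post S f' (fst p) = restr S (snd p)" by (auto simp: PE_PBp)
    show "post S f (post S a (fst p)) = restr S (post T b (snd p))"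
      unfolding post_post[OF order_refl] post_post[OF S(3)] post_eq_iff
      using p'(2) q(6)[OF U MpD(1)[OF p'(1)]] unfolding post_eq_iff by simp
  qed
  show ?thesis
  proof (rule pb_squareI[OF psh_Mp[OF s(1) S(2)] psh_Rel[OF s(7,1,3) S] pmap_post[OF s(5) S(2,2) order_refl] 2 pmap_to_Rel[OF s(7,1,3) S]])
    fix U x assume U: "U \<in> Ob" and x: "x \<in> PE (Maps T X') U"
    show "(restr S (post T a x), post T f (post T a x)) = (post S a (fst (restr S x, post T f' x)), post T b (snd (restr S x, post T f' x)))"
      using q(6)[OF U MpD(1)[OF x]] by (simp add: post_post S(3) post_eq_iff)
  next
    fix U g x assume U: "U \<in> Ob" and g: "g \<in> PE (RelMaps S T X' Y' f') U" and x: "x \<in> PE (Maps T X) U"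
      and h: "(restr S x, post T f x) = (post S a (fst g), post T b (snd g))"
    obtain \<sigma> \<rho> where p: "g = (\<sigma>, \<rho>)" by (cases g)
    have gg: "\<sigma> \<in> PE (Maps S X') U" "\<rho> \<in> PE (Maps T Y') U" "post S f' \<sigma> = restr S \<rho>" using g p by (auto simp: PE_Rel)
    have h': "restr S x = post S a \<sigma>" "post T f x = post T b \<rho>" using h p by auto
    have "\<exists>z. z \<in> PE (SE X' m) U \<and> a m z = x m t \<and> f' m z = \<rho> m t" if t: "t \<in> simplices T m" for m t
      using q(7)[OF U MpD(1)[OF gg(2) t] MpD(1)[OF x t]] h'(2) t unfolding post_eq_iff by blast
    note ex = this
    \<comment> \<open>Components are chosen simplex by simplex. Compatibility with the simplicial
      operators comes from joint injectivity in the square.\<close>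
    define z where "z m t = (SOME z. z \<in> PE (SE X' m) U \<and> a m z = x m t \<and> f' m z = \<rho> m t)" for m t
    have z: "z m t \<in> PE (SE X' m) U \<and> a m (z m t) = x m t \<and> f' m (z m t) = \<rho> m t" if "t \<in> simplices T m" for m t
      unfolding z_def using someI_ex[OF ex[OF that]] .
    define y where "y = restr T z"
    have y: "y \<in> PE (Maps T X') U"
    proof (rule MpI)
      fix m n \<theta> t assume t: "t \<in> simplices T n" and th: "delta_hom m n \<theta>"
      note t' = dcomp_Sx[OF S(2) t th]
      have "SA X' m n \<theta> (z n t) = z m (dcomp m t \<theta>)"
      proof (rule q(8)[OF U])
        show "SA X' m n \<theta> (z n t) \<in> PE (SE X' m) U" using pmap_in[OF spsD(2)[OF s(1) th] U] z[OF t] by blast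
        show "z m (dcomp m t \<theta>) \<in> PE (SE X' m) U" using z[OF t'] by blast
        show "a m (SA X' m n \<theta> (z n t)) = a m (z m (dcomp m t \<theta>))"
          using smapD(2)[OF s(5) th U] z[OF t] z[OF t'] MpD(2)[OF x t th] by simp
        show "f' m (SA X' m n \<theta> (z n t)) = f' m (z m (dcomp m t \<theta>))"
          using smapD(2)[OF s(7) th U] z[OF t] z[OF t'] MpD(2)[OF gg(2) t th] by simp
      qed
      then show "SA X' m n \<theta> (y n t) = y m (dcomp m t \<theta>)"
        unfolding y_def post_app[OF t] post_app[OF t'] .
    qed (use z in \<open>simp_all add: y_def post_def\<close>)
    have "post T a y = restr T x" "post T f' y = restr T \<rho>"
      unfolding y_def post_post[OF order_refl] post_eq_iff using z by auto
    then have e1: "post T a y = x" "post T f' y = \<rho>" using rst_id[OF x] rst_id[OF gg(2)] by auto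
    have "restr S y = restr S \<sigma>"
      unfolding post_eq_iff
    proof (intro allI impI)
      fix m t assume t: "t \<in> simplices S m"
      note t' = Sx_mono[OF S(3) t]
      show "y m t = \<sigma> m t"
      proof (rule q(8)[OF U])
        show "y m t \<in> PE (SE X' m) U" "\<sigma> m t \<in> PE (SE X' m) U" using MpD(1)[OF y t'] MpD(1)[OF gg(1) t] by auto
        show "a m (y m t) = a m (\<sigma> m t)" using h'(1) t z[OF t'] unfolding post_eq_iff y_def post_app[OF t'] by simp
        show "f' m (y m t) = f' m (\<sigma> m t)" using gg(3) t z[OF t'] unfolding post_eq_iff y_def post_app[OF t'] by simp
      qed
    qed
    then show "\<exists>y. y \<in> PE (Maps T X') U \<and> post T a y = x \<and> (restr S y, post T f' y) = g"
      using y e1 rst_id[OF gg(1)] unfolding p by (intro exI[of _ y] conjI) simp_all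
  next
    fix U x y assume U: "U \<in> Ob" and h: "x \<in> PE (Maps T X') U" "y \<in> PE (Maps T X') U" "post T a x = post T a y"
      "(restr S x, post T f' x) = (restr S y, post T f' y)"
    show "x = y"
    proof (rule Mp_ext[OF h(1,2)])
      fix m t assume t: "t \<in> simplices T m"
      show "x m t = y m t"
        by (rule q(8)[OF U MpD(1)[OF h(1) t] MpD(1)[OF h(2) t]]) (use h(3,4) t in \<open>auto simp: post_eq_iff\<close>)
    qed
  qed
qed

lemma lft_pullback:
  assumes "spb X' X Y' Y a b f' f" "fin_complex S" "fin_complex T" "S \<subseteq> T" "rel_lift K X Y f S T"
  shows "rel_lift K X' Y' f' S T"
  using pcov_pullback[OF spb_Mp[OF assms(1-4)]] assms(5) unfolding rel_lift_def by blast

text \<open>Map(T, X) reaches the relative object of the composite through Map(S \<hookrightarrow>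
  T, f), and the second step is a base change of the lifting map of g.\<close>

lemma lft_comp:
  assumes K: "stable_class C K" and f: "smap X Y f" "smap Y Z g" "simp_psh X" "simp_psh Y" "simp_psh Z"
    and S: "fin_complex S" "fin_complex T" "S \<subseteq> T"
    and l: "rel_lift K X Y f S T" "rel_lift K Y Z g S T"
  shows "rel_lift K X Z (\<lambda>n x. g n (f n x)) S T"
proof -
  note gf = smap_comp[OF f(1,2)]
  let ?gf = "\<lambda>n x. g n (f n x)"
  let ?b = "\<lambda>p. (post S f (fst p), snd p)" and ?\<psi> = "\<lambda>p. (fst p, post T g (snd p))"
  have 1: "pmap (RelMaps S T X Y f) (Maps T Y) snd" unfolding RelMaps_def by (rule pmap_snd)
  have 2: "pmap (RelMaps S T X Z ?gf) (RelMaps S T Y Z g) ?b"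
    unfolding RelMaps_def by (rule pmap_PBp[OF pmap_comp[OF pmap_fst pmap_post[OF f(1) S(1,1) order_refl]] pmap_snd])
      (simp add: PE_PBp post_post)
  have 3: "pmap (RelMaps S T X Y f) (RelMaps S T X Z ?gf) ?\<psi>"
    unfolding RelMaps_def
  proof (rule pmap_PBp[OF pmap_fst pmap_comp[OF pmap_snd pmap_post[OF f(2) S(2,2) order_refl]]])
    fix U p assume "p \<in> PE (psh_pb (Maps S X) (Maps T Y) (post S f) (restr S)) U"
    then have "post S g (post S f (fst p)) = post S g (restr S (snd p))" by (simp add: PE_PBp)
    then show "post S ?gf (fst p) = restr S (post T g (snd p))" by (simp add: post_post S(3))
  qed
  have "pb_square (RelMaps S T X Y f) (Maps T Y) (RelMaps S T X Z ?gf) (RelMaps S T Y Z g) snd ?b ?\<psi> (\<lambda>\<tau>. (restr S \<tau>, post T g \<tau>))"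
  proof (rule pb_squareI[OF psh_Rel[OF f(1,3,4) S] psh_Rel[OF gf f(3,5) S] 1 2 3])
    fix U h x assume "h \<in> PE (RelMaps S T X Z ?gf) U" "x \<in> PE (Maps T Y) U" "(restr S x, post T g x) = ?b h"
    then show "\<exists>y. y \<in> PE (RelMaps S T X Y f) U \<and> snd y = x \<and> ?\<psi> y = h"
      by (intro exI[of _ "(fst h, x)"]) (auto simp: PE_Rel prod_eq_iff)
  qed (auto simp: PE_Rel prod_eq_iff)
  from pcov_comp[OF K psh_Mp[OF f(3) S(2)] psh_Rel[OF f(1,3,4) S] psh_Rel[OF gf f(3,5) S] pmap_to_Rel[OF f(1,3,4) S] 3
      l(1)[unfolded rel_lift_def] pcov_pullback[OF this l(2)[unfolded rel_lift_def]]]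
  show ?thesis unfolding rel_lift_def by (simp add: post_post)
qed

lemma lft_id:
  assumes K: "stable_class C K" and X: "simp_psh X" and S: "fin_complex S" "fin_complex T" "S \<subseteq> T"
  shows "rel_lift K X X (\<lambda>n x. x) S T"
  unfolding rel_lift_def
proof (rule pcov_bij[OF K psh_Mp[OF X S(2)] pmap_to_Rel[OF smap_id[OF X] X X S] psh_Rel[OF smap_id[OF X] X X S]])
  fix U y assume "y \<in> PE (RelMaps S T X X (\<lambda>n x. x)) U"
  then show "\<exists>x. x \<in> PE (Maps T X) U \<and> (restr S x, restr T x) = y"
    by (intro exI[of _ "snd y"]) (auto simp: PE_Rel prod_eq_iff rst_id)
next
  fix U x y assume "x \<in> PE (Maps T X) U" "y \<in> PE (Maps T X) U" "(restr S x, restr T x) = (restr S y, restr T y)"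
  then show "x = y" by (simp add: rst_id)
qed

lemma lft_refl:
  assumes K: "stable_class C K" and f: "smap X Y f" "simp_psh X" "simp_psh Y" and S: "fin_complex S"
  shows "rel_lift K X Y f S S"
  unfolding rel_lift_def
proof (rule pcov_bij[OF K psh_Mp[OF f(2) S] pmap_to_Rel[OF f S S order_refl] psh_Rel[OF f S S order_refl]])
  fix U y assume "y \<in> PE (RelMaps S S X Y f) U"
  then show "\<exists>x. x \<in> PE (Maps S X) U \<and> (restr S x, post S f x) = y"
    by (intro exI[of _ "fst y"]) (auto simp: PE_Rel prod_eq_iff rst_id)
next
  fix U x y assume "x \<in> PE (Maps S X) U" "y \<in> PE (Maps S X) U" "(restr S x, post S f x) = (restr S y, post S f y)"
  then show "x = y" by (simp add: rst_id)
qed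

definition sbij :: "('o,'m,'x) spsh \<Rightarrow> ('o,'m,'y) spsh \<Rightarrow> (nat \<Rightarrow> 'x \<Rightarrow> 'y) \<Rightarrow> bool" where
  "sbij X Y f \<longleftrightarrow> smap X Y f \<and> (\<forall>n U. U \<in> Ob \<longrightarrow> bij_betw (f n) (PE (SE X n) U) (PE (SE Y n) U))"

text \<open>A levelwise bijection is a pullback of the identity of Y.\<close>

lemma lft_sbij:
  assumes K: "stable_class C K" and f: "sbij X Y f" "simp_psh X" "simp_psh Y" and S: "fin_complex S" "fin_complex T" "S \<subseteq> T"
  shows "rel_lift K X Y f S T"
proof -
  have const_path: "smap X Y f" and bij: "\<And>n U. U \<in> Ob \<Longrightarrow> bij_betw (f n) (PE (SE X n) U) (PE (SE Y n) U)"
    using f unfolding sbij_def by auto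
  have "spb X Y Y Y f (\<lambda>n x. x) f (\<lambda>n x. x)"
    unfolding spb_def
  proof (intro conjI allI)
    show "simp_psh X" "simp_psh Y" "simp_psh Y" "simp_psh Y" "smap X Y f" "smap Y Y (\<lambda>n x. x)" "smap X Y f" "smap Y Y (\<lambda>n x. x)"
      using f const_path smap_id by blast+
    fix n show "pb_square (SE X n) (SE Y n) (SE Y n) (SE Y n) (f n) (\<lambda>x. x) (f n) (\<lambda>x. x)"
    proof (rule pb_squareI[OF spsD(1)[OF f(2)] spsD(1)[OF f(3)] smapD(1)[OF const_path] pmap_id smapD(1)[OF const_path]])
      fix U g x assume h: "U \<in> Ob" "g \<in> PE (SE Y n) U" "x \<in> PE (SE Y n) U" "x = g"
      then have "x \<in> f n ` PE (SE X n) U" using bij[OF h(1)] unfolding bij_betw_def by simp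
      then show "\<exists>x'. x' \<in> PE (SE X n) U \<and> f n x' = x \<and> f n x' = g" unfolding h(4) by blast
    next
      fix U x y assume h: "U \<in> Ob" "x \<in> PE (SE X n) U" "y \<in> PE (SE X n) U" "f n x = f n y"
      then show "x = y" using bij[OF h(1)] inj_onD[OF _ h(4,2,3)] unfolding bij_betw_def by simp
    qed auto
  qed
  from lft_pullback[OF this S lft_id[OF K f(3) S]] show ?thesis .
qed

text \<open>The complex \<open>{{}}\<close> has no simplices, so it imposes no condition, and the
  relative object is Map(T, Y).\<close>

lemma lft_empty:
  assumes K: "stable_class C K" and f: "smap X Y f" "simp_psh X" "simp_psh Y" and S: "fin_complex T"
    and l: "rel_lift K X Y f {{}} T"
  shows "pcov K (Maps T X) (Maps T Y) (post T f)"
proof -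
  have E: "fin_complex {{}}" "{{}} \<subseteq> T" using S unfolding fin_complex_def by auto
  have "pcov K (RelMaps {{}} T X Y f) (Maps T Y) snd"
  proof (rule pcov_bij[OF K psh_Rel[OF f E(1) S E(2)] _ psh_Mp[OF f(3) S]])
    show "pmap (RelMaps {{}} T X Y f) (Maps T Y) snd" unfolding RelMaps_def by (rule pmap_snd)
  next
    fix U y assume "y \<in> PE (Maps T Y) U"
    then show "\<exists>x. x \<in> PE (RelMaps {{}} T X Y f) U \<and> snd x = y"
      by (intro exI[of _ "(\<lambda>_ _. undefined, y)"]) (auto simp: PE_Rel Mp_iff Sx_empty post_def)
  next
    fix U x y assume "x \<in> PE (RelMaps {{}} T X Y f) U" "y \<in> PE (RelMaps {{}} T X Y f) U" "snd x = snd y"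
    then show "x = y" by (auto simp: PE_Rel Mp_iff Sx_empty prod_eq_iff fun_eq_iff)
  qed
  from pcov_comp[OF K psh_Mp[OF f(2) S] psh_Rel[OF f E(1) S E(2)] psh_Mp[OF f(3) S] pmap_to_Rel[OF f E(1) S E(2)] _
      l[unfolded rel_lift_def] this] show ?thesis by (simp add: RelMaps_def pmap_snd)
qed

end

context descent begin

text \<open>By base change from Map(S, X) over Map(S, Y), the relative object of the composite
  covers that of g. Hence Map(T, X) covers the relative object of g. This cover factors through the
  cover of Map(T, Y) by Map(T, X), and cancellation for presheaves applies.\<close>

lemma lft_cancel:
  assumes f: "smap X Y f" "smap Y Z g" "simp_psh X" "simp_psh Y" "simp_psh Z"
    and S: "fin_complex S" "fin_complex T" "S \<subseteq> T"
    and l: "rel_lift Cov X Y f {{}} S" "rel_lift Cov X Y f {{}} T" "rel_lift Cov X Z (\<lambda>n x. g n (f n x)) S T" "rel_lift (cAr C) Y Z g S T"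
  shows "rel_lift Cov Y Z g S T"
proof -
  note gf = smap_comp[OF f(1,2)] and K = stable_Cov
  let ?gf = "\<lambda>n x. g n (f n x)" and ?b = "\<lambda>p. (post S f (fst p), snd p)"
  have 2: "pmap (RelMaps S T X Z ?gf) (RelMaps S T Y Z g) ?b"
    unfolding RelMaps_def by (rule pmap_PBp[OF pmap_comp[OF pmap_fst pmap_post[OF f(1) S(1,1) order_refl]] pmap_snd])
      (simp add: PE_PBp post_post)
  have "pb_square (RelMaps S T X Z ?gf) (Maps S X) (RelMaps S T Y Z g) (Maps S Y) fst fst ?b (post S f)"
  proof (rule pb_squareI[OF psh_Rel[OF gf f(3,5) S] psh_Rel[OF f(2,4,5) S] _ _ 2])
    show "pmap (RelMaps S T X Z ?gf) (Maps S X) fst" "pmap (RelMaps S T Y Z g) (Maps S Y) fst" unfolding RelMaps_def by (rule pmap_fst)+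
    fix U h x assume "h \<in> PE (RelMaps S T Y Z g) U" "x \<in> PE (Maps S X) U" and e: "post S f x = fst h"
    then show "\<exists>y. y \<in> PE (RelMaps S T X Z ?gf) U \<and> fst y = x \<and> ?b y = h"
      using post_post[OF order_refl, of S g f x] by (intro exI[of _ "(x, snd h)"]) (auto simp: PE_Rel prod_eq_iff)
  qed (auto simp: PE_Rel prod_eq_iff)
  from pcov_comp[OF K psh_Mp[OF f(3) S(2)] psh_Rel[OF gf f(3,5) S] psh_Rel[OF f(2,4,5) S] pmap_to_Rel[OF gf f(3,5) S] 2
      l(3)[unfolded rel_lift_def] pcov_pullback[OF this lft_empty[OF K f(1,3,4) S(1) l(1)]]]
  have "pcov Cov (Maps T X) (RelMaps S T Y Z g) (\<lambda>\<tau>. (restr S (post T f \<tau>), post T g (post T f \<tau>)))"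
    by (simp add: post_post S(3))
  from pcov_cancel[OF psh_Mp[OF f(3) S(2)] psh_Mp[OF f(4) S(2)] psh_Rel[OF f(2,4,5) S] pmap_post[OF f(1) S(2,2) order_refl]
    pmap_to_Rel[OF f(2,4,5) S] lft_empty[OF K f(1,3,4) S(2) l(2)] this l(4)[unfolded rel_lift_def]]
  show ?thesis unfolding rel_lift_def .
qed

end

section \<open>Cell attachment and expansions\<close>

abbreviation "simplex_cx n \<equiv> Pow {..n::nat}"

definition bdry :: "nat \<Rightarrow> nat set set" where
  "bdry n = {V. V \<subseteq> {..n} \<and> V \<noteq> {..n}}"

definition horn_cx :: "nat \<Rightarrow> nat \<Rightarrow> nat set set" where
  "horn_cx n i = {V. V \<subseteq> {..n} \<and> (\<exists>j\<le>n. j \<noteq> i \<and> j \<notin> V)}"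

text \<open>The product of \<open>S\<close> with an interval: the vertex \<open>(v, \<epsilon>)\<close> is encoded as \<open>2 * v + \<epsilon>\<close>.\<close>
definition cylinder :: "nat set set \<Rightarrow> nat set set" where
  "cylinder S = {V. finite V \<and> (\<lambda>v. v div 2) ` V \<in> S \<and> (\<forall>v\<in>V. \<forall>w\<in>V. v \<le> w \<longrightarrow> v mod 2 \<le> w mod 2)}"

abbreviation "prism_cx n \<equiv> cylinder (simplex_cx n)"

text \<open>The part of the prism that lies over the vertices \<open>E\<close> of the interval.\<close>
definition levels :: "nat set \<Rightarrow> nat \<Rightarrow> nat set set" where
  "levels E n = (\<Union>\<epsilon>\<in>E. Pow ((\<lambda>i. 2 * i + \<epsilon>) ` {..n}))"

lemma cx_Pow:
  assumes "finite V" shows "fin_complex (Pow V)"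
proof -
  have "\<forall>W\<in>Pow V. finite W" using rev_finite_subset[OF assms] by simp
  then show ?thesis using assms unfolding fin_complex_def by auto
qed

lemma cx_subset:
  assumes T: "fin_complex T" "S \<subseteq> T" and S: "{} \<in> S" "\<And>V W. V \<in> S \<Longrightarrow> W \<subseteq> V \<Longrightarrow> W \<in> S" shows "fin_complex S"
proof -
  have "finite S" "\<forall>V\<in>S. finite V" using T finite_subset[OF T(2)] unfolding fin_complex_def by auto
  then show ?thesis using S unfolding fin_complex_def by simp
qed

lemma cx_bd: "fin_complex (bdry n)"
  by (rule cx_subset[OF cx_Pow[of "{..n}"]]) (auto simp: bdry_def)

text \<open>The empty set is a member only if some j \<le> n differs from i; for n = 0 and i = 0
  there is none.\<close>

lemma cx_hn: "0 < n \<Longrightarrow> fin_complex (horn_cx n i)"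
proof (rule cx_subset[OF cx_Pow[of "{..n}"]])
  assume "0 < n"
  then have "\<exists>j\<le>n. j \<noteq> i" by (cases "i = 0") auto
  then show "{} \<in> horn_cx n i" unfolding horn_cx_def by simp
qed (auto simp: horn_cx_def)

lemma cx_finite: "fin_complex S \<Longrightarrow> V \<in> S \<Longrightarrow> finite V" and cx_down: "fin_complex S \<Longrightarrow> V \<in> S \<Longrightarrow> W \<subseteq> V \<Longrightarrow> W \<in> S"
  and cx_fin: "fin_complex S \<Longrightarrow> finite S" and cx_empty: "fin_complex S \<Longrightarrow> {} \<in> S"
  unfolding fin_complex_def by simp_all

lemma cx_Xi:
  assumes "fin_complex S" shows "fin_complex (cylinder S)"
  unfolding fin_complex_def
proof (intro conjI ballI allI impI)
  show "{} \<in> cylinder S" using cx_empty[OF assms] by (simp add: cylinder_def)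
  let ?B = "\<Union>S"
  have B: "finite ?B" using cx_fin[OF assms] cx_finite[OF assms] by blast
  have "cylinder S \<subseteq> Pow ((\<lambda>v. v div 2) -` ?B)" unfolding cylinder_def by auto
  moreover have "(\<lambda>v::nat. v div 2) -` ?B \<subseteq> {..2 * Max ?B + 1}"
  proof
    fix v :: nat assume "v \<in> (\<lambda>v. v div 2) -` ?B"
    then have "v div 2 \<le> Max ?B" using B by (intro Max_ge) auto
    then show "v \<in> {..2 * Max ?B + 1}" by simp
  qed
  ultimately have "cylinder S \<subseteq> Pow {..2 * Max ?B + 1}" by blast
  then show "finite (cylinder S)" by (rule finite_subset) simp
next
  fix V assume V: "V \<in> cylinder S"
  then show "finite V" by (simp add: cylinder_def)
  fix W assume W: "W \<subseteq> V"
  have "(\<lambda>v. v div 2) ` W \<subseteq> (\<lambda>v. v div 2) ` V" using W by blast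
  then have "(\<lambda>v. v div 2) ` W \<in> S" using V cx_down[OF assms] unfolding cylinder_def by blast
  moreover have "finite W" using V W finite_subset unfolding cylinder_def by blast
  moreover have "\<forall>v\<in>W. \<forall>w\<in>W. v \<le> w \<longrightarrow> v mod 2 \<le> w mod 2" using V W unfolding cylinder_def by blast
  ultimately show "W \<in> cylinder S" unfolding cylinder_def by simp
qed

lemma Xi_mono: "S \<subseteq> T \<Longrightarrow> cylinder S \<subseteq> cylinder T"
  unfolding cylinder_def by auto

text \<open>On encoded vertices v \<le> w already implies v div 2 \<le> w div 2, so the last
  condition makes V a chain for the product order on the prism.\<close>

lemma Pr_iff: "V \<in> prism_cx n \<longleftrightarrow> finite V \<and> (\<forall>v\<in>V. v div 2 \<le> n) \<and> (\<forall>v\<in>V. \<forall>w\<in>V. v \<le> w \<longrightarrow> v mod 2 \<le> w mod 2)"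
  unfolding cylinder_def by auto

lemma Lv_Pr: assumes "E \<subseteq> {0,1}" shows "levels E n \<subseteq> prism_cx n"
proof
  fix V assume "V \<in> levels E n"
  then obtain \<epsilon> where e: "\<epsilon> \<in> E" "V \<subseteq> (\<lambda>i. 2 * i + \<epsilon>) ` {..n}" unfolding levels_def by blast
  then have "\<epsilon> = 0 \<or> \<epsilon> = 1" using assms by blast
  then have d: "\<forall>v\<in>V. v div 2 \<le> n \<and> v mod 2 = \<epsilon>" using e(2) by auto
  moreover have "finite V" using e(2) finite_subset by blast
  ultimately show "V \<in> prism_cx n" unfolding Pr_iff by simp
qed

lemma cx_Lv:
  assumes "\<epsilon> \<in> E" "finite E" shows "fin_complex (levels E n)"
  unfolding fin_complex_def
proof (intro conjI ballI allI impI)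
  show "{} \<in> levels E n" "finite (levels E n)" using assms by (auto simp: levels_def)
  fix V assume "V \<in> levels E n"
  then obtain e where e: "e \<in> E" "V \<subseteq> (\<lambda>i. 2 * i + e) ` {..n}" unfolding levels_def by blast
  then show "finite V" by (rule_tac finite_subset) auto
  fix W assume "W \<subseteq> V"
  then show "W \<in> levels E n" using e unfolding levels_def by auto
qed

lemma cx_XiLv: "fin_complex S \<Longrightarrow> finite E \<Longrightarrow> fin_complex (cylinder S \<union> levels E n)"
  by (cases "E = {}") (auto simp: levels_def[of "{}"] intro: cx_Xi cx_Un cx_Lv)

lemma enum_strict:
  fixes V :: "nat set"
  assumes "finite V" "card V = Suc k"
  shows "\<exists>e. bij_betw e {..k} V \<and> (\<forall>i j. i < j \<longrightarrow> j \<le> k \<longrightarrow> e i < e j)"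
proof -
  let ?xs = "sorted_list_of_set V"
  have len: "length ?xs = Suc k" using assms by simp
  have "bij_betw ((!) ?xs) {..<length ?xs} (set ?xs)" by (rule bij_betw_nth) simp_all
  then have "bij_betw ((!) ?xs) {..k} V" using assms len by (simp add: lessThan_Suc_atMost)
  moreover have "?xs ! i < ?xs ! j" if "i < j" "j \<le> k" for i j
    using sorted_wrt_nth_less[of "(<)" ?xs i j] strict_sorted_list_of_set[of V] that len by simp
  ultimately show ?thesis by blast
qed

context cat_loc begin

text \<open>The monotone enumeration e identifies the standard k-simplex with the full simplex on V;
  the subcomplex is S relabelled by e.\<close>

lemma lft_cell:
  assumes f: "smap X Y f" "simp_psh X" "simp_psh Y" and V: "finite V"
    and e: "bij_betw e {..k} V" "\<And>i j. i < j \<Longrightarrow> j \<le> k \<Longrightarrow> e i < e j"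
    and S: "fin_complex S" "S \<subseteq> simplex_cx k" and l: "rel_lift K X Y f S (simplex_cx k)"
  shows "rel_lift K X Y f {W. W \<subseteq> V \<and> inv_into {..k} e ` W \<in> S} (Pow V)"
proof -
  let ?d = "inv_into {..k} e"
  have inj: "inj_on e {..k}" and im: "e ` {..k} = V" using e(1) unfolding bij_betw_def by auto
  have ed: "e (?d v) = v" "?d v \<le> k" if "v \<in> V" for v
    using that f_inv_into_f[of v e "{..k}"] inv_into_into[of v e "{..k}"] im by auto
  have de: "?d (e i) = i" if "i \<le> k" for i using inv_into_f_f[OF inj] that by simp
  have dm: "?d v \<le> ?d w" if "v \<in> V" "w \<in> V" "v \<le> w" for v w
    using e(2)[of "?d w" "?d v"] ed[OF that(1)] ed[OF that(2)] that(3) by force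
  have em: "e i \<le> e j" if "i \<le> j" "j \<le> k" for i j using e(2)[of i j] that by (cases "i = j") auto
  have deW: "?d ` e ` W = W" if "W \<subseteq> {..k}" for W
    using that de by (force simp: image_image)
  let ?S' = "{W. W \<subseteq> V \<and> ?d ` W \<in> S}"
  have cS': "fin_complex ?S'"
  proof (rule cx_subset[OF cx_Pow[OF V]])
    show "{} \<in> ?S'" using cx_empty[OF S(1)] by simp
    fix A B assume "A \<in> ?S'" "B \<subseteq> A"
    then show "B \<in> ?S'" using cx_down[OF S(1), of "?d ` A" "?d ` B"] by auto
  qed auto
  have eV: "e ` W \<subseteq> V" if "W \<subseteq> {..k}" for W using that im by blast
  have dV: "?d ` W \<subseteq> {..k}" if "W \<subseteq> V" for W using that ed(2) by auto
  show ?thesis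
  proof (rule lft_transport[OF f S(1) cx_Pow S(2) cS' cx_Pow[OF V] _ _ _ _ _ _ _ l])
    show "vertex_map e (simplex_cx k) (Pow V)" unfolding vertex_map_def using eV em by auto
    show "vertex_map e S ?S'" unfolding vertex_map_def
    proof (intro ballI conjI impI)
      fix W assume W: "W \<in> S"
      then have "W \<subseteq> {..k}" using S(2) by blast
      then show "e ` W \<in> ?S'" using W deW[of W] eV[of W] by simp
      fix v w assume "v \<in> W" "w \<in> W" "v \<le> w"
      then show "e v \<le> e w" using em W S(2) by auto
    qed
    show "vertex_map ?d (Pow V) (simplex_cx k)" unfolding vertex_map_def using dV dm by blast
    show "vertex_map ?d ?S' S" unfolding vertex_map_def using dm by blast
  qed (use ed de in auto)
qed

definition hcover :: "'m set \<Rightarrow> ('o,'m,'x) spsh \<Rightarrow> ('o,'m,'y) spsh \<Rightarrow> (nat \<Rightarrow> 'x \<Rightarrow> 'y) \<Rightarrow> bool" where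
  "hcover K X Y f \<longleftrightarrow> (\<forall>n. rel_lift K X Y f (bdry n) (simplex_cx n))"

text \<open>With \<open>K\<close> the covers and \<open>N = 0\<close> this is the notion of fibration; with \<open>K\<close> the isomorphisms and
  \<open>N = k + 1\<close>, applied to the map to a point, it is the extra condition on a \<open>k\<close>-groupoid.\<close>
definition fibr :: "'m set \<Rightarrow> nat \<Rightarrow> ('o,'m,'x) spsh \<Rightarrow> ('o,'m,'y) spsh \<Rightarrow> (nat \<Rightarrow> 'x \<Rightarrow> 'y) \<Rightarrow> bool" where
  "fibr K N X Y f \<longleftrightarrow> (\<forall>n i. 0 < n \<longrightarrow> N \<le> n \<longrightarrow> i \<le> n \<longrightarrow> rel_lift K X Y f (horn_cx n i) (simplex_cx n))"

lemma hcov_cell: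
  assumes f: "smap X Y f" "simp_psh X" "simp_psh Y" and h: "hcover K X Y f" and V: "finite V" "V \<noteq> {}"
  shows "rel_lift K X Y f (Pow V - {V}) (Pow V)"
proof -
  obtain k where k: "card V = Suc k" using V by (metis card_gt_0_iff gr0_implies_Suc)
  obtain e where e: "bij_betw e {..k} V" "\<And>i j. i < j \<Longrightarrow> j \<le> k \<Longrightarrow> e i < e j" using enum_strict[OF V(1) k] by blast
  have bdry: "bij_betw (inv_into {..k} e) V {..k}" using bij_betw_inv_into[OF e(1)] .
  have "inv_into {..k} e ` W = {..k} \<longleftrightarrow> W = V" if "W \<subseteq> V" for W
    using bdry that unfolding bij_betw_def by (metis inj_on_image_eq_iff order_refl)
  moreover have "inv_into {..k} e ` W \<subseteq> {..k}" if "W \<subseteq> V" for W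
    using bdry that unfolding bij_betw_def by blast
  ultimately have "{W. W \<subseteq> V \<and> inv_into {..k} e ` W \<in> bdry k} = Pow V - {V}" unfolding bdry_def by blast
  moreover have "bdry k \<subseteq> simplex_cx k" unfolding bdry_def by blast
  ultimately show ?thesis
    using lft_cell[OF f V(1) e cx_bd[of k]] h[unfolded hcover_def] by simp
qed

text \<open>V spans a simplex of dimension \<open>card V - 1\<close>, so \<open>N < card V\<close>
  is the bound N on dimensions. The two deleted faces are V itself and the face opposite to v, and
  what remains is a horn.\<close>

lemma fibr_cell:
  assumes f: "smap X Y f" "simp_psh X" "simp_psh Y" and h: "fibr K N X Y f" and V: "finite V" "v \<in> V" "V \<noteq> {v}"
    and N: "N < card V"
  shows "rel_lift K X Y f (Pow V - {V, V - {v}}) (Pow V)"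
proof -
  obtain k where k: "card V = Suc k" using V by (metis card_gt_0_iff gr0_implies_Suc empty_iff)
  have k0: "0 < k" using V k by (metis card_1_singletonE One_nat_def gr0I singletonD)
  obtain e where e: "bij_betw e {..k} V" "\<And>i j. i < j \<Longrightarrow> j \<le> k \<Longrightarrow> e i < e j" using enum_strict[OF V(1) k] by blast
  let ?d = "inv_into {..k} e"
  have inj: "inj_on e {..k}" and im: "e ` {..k} = V" using e(1) unfolding bij_betw_def by auto
  have ed: "e (?d v) = v" "?d v \<le> k" if "v \<in> V" for v
    using that f_inv_into_f[of v e "{..k}"] inv_into_into[of v e "{..k}"] im by auto
  have de: "?d (e i) = i" if "i \<le> k" for i using inv_into_f_f[OF inj] that by simp
  have injd: "inj_on ?d V" using bij_betw_inv_into[OF e(1)] unfolding bij_betw_def by simp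
  have i: "?d v \<le> k" using ed V by blast
  have *: "?d ` W \<in> horn_cx k (?d v) \<longleftrightarrow> W \<noteq> V \<and> W \<noteq> V - {v}" if W: "W \<subseteq> V" for W
  proof -
    have "?d ` W \<in> horn_cx k (?d v) \<longleftrightarrow> (\<exists>j\<le>k. j \<noteq> ?d v \<and> j \<notin> ?d ` W)" using W ed(2) unfolding horn_cx_def by auto
    also have "\<dots> \<longleftrightarrow> (\<exists>w\<in>V. w \<noteq> v \<and> w \<notin> W)"
    proof
      assume "\<exists>j\<le>k. j \<noteq> ?d v \<and> j \<notin> ?d ` W"
      then obtain j where j: "j \<le> k" "j \<noteq> ?d v" "j \<notin> ?d ` W" by blast
      then have ej: "e j \<in> V" "?d (e j) = j" using im de by auto
      then have "e j \<noteq> v" using j(2) by auto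
      moreover have "e j \<notin> W" using j(3) imageI[of "e j" W ?d] ej(2) by auto
      ultimately show "\<exists>w\<in>V. w \<noteq> v \<and> w \<notin> W" using ej(1) by blast
    next
      assume "\<exists>w\<in>V. w \<noteq> v \<and> w \<notin> W"
      then obtain w where w: "w \<in> V" "w \<noteq> v" "w \<notin> W" by blast
      then have "?d w \<le> k" "?d w \<noteq> ?d v" "?d w \<notin> ?d ` W"
        using ed(2)[OF w(1)] inj_on_eq_iff[OF injd w(1) V(2)] inj_on_image_mem_iff[OF injd w(1) W] by simp_all
      then show "\<exists>j\<le>k. j \<noteq> ?d v \<and> j \<notin> ?d ` W" by blast
    qed
    also have "\<dots> \<longleftrightarrow> W \<noteq> V \<and> W \<noteq> V - {v}" using W V(2) by (cases "v \<in> W") auto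
    finally show ?thesis .
  qed
  then have "{W. W \<subseteq> V \<and> ?d ` W \<in> horn_cx k (?d v)} = Pow V - {V, V - {v}}" by blast
  moreover have "horn_cx k (?d v) \<subseteq> simplex_cx k" unfolding horn_cx_def by blast
  moreover have "rel_lift K X Y f (horn_cx k (?d v)) (simplex_cx k)" using h k0 i N k unfolding fibr_def by simp
  ultimately show ?thesis using lft_cell[OF f V(1) e cx_hn[OF k0, of "?d v"]] by simp
qed

text \<open>A missing face of least cardinality has its whole boundary in S, so it is attached by
  one boundary lifting. The induction counts missing faces.\<close>

lemma hcov_lft:
  assumes K: "stable_class C K" and f: "smap X Y f" "simp_psh X" "simp_psh Y" and h: "hcover K X Y f"
  shows "fin_complex S \<Longrightarrow> fin_complex T \<Longrightarrow> S \<subseteq> T \<Longrightarrow> rel_lift K X Y f S T"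
proof (induction "card (T - S)" arbitrary: S rule: less_induct)
  case less
  show ?case
  proof (cases "S = T")
    case True then show ?thesis using lft_refl[OF K f less.prems(1)] by simp
  next
    case False
    define V where "V = arg_min card (\<lambda>V. V \<in> T - S)"
    have ex: "\<exists>V. V \<in> T - S" using False less.prems by blast
    have V: "V \<in> T" "V \<notin> S" using arg_min_natI[of "\<lambda>V. V \<in> T - S" _ card] ex unfolding V_def by blast+
    have min: "card V \<le> card W" if "W \<in> T - S" for W
      using arg_min_nat_le[of "\<lambda>V. V \<in> T - S" W card] that unfolding V_def by blast
    have fV: "finite V" and V0: "V \<noteq> {}" using cx_finite[OF less.prems(2) V(1)] V(2) cx_empty[OF less.prems(1)] by auto
    have "W \<in> S" if "W \<subset> V" for W
      using min[of W] psubset_card_mono[OF fV that] cx_down[OF less.prems(2) V(1), of W] that by fastforce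
    then have "S \<inter> Pow V = Pow V - {V}" using V(2) by blast
    then have 1: "rel_lift K X Y f S (S \<union> Pow V)"
      using lft_union[OF f less.prems(1) cx_Pow[OF fV], of K] hcov_cell[OF f h fV V0] by simp
    have sub: "S \<union> Pow V \<subseteq> T" using less.prems(3) cx_down[OF less.prems(2) V(1)] by blast
    have cU: "fin_complex (S \<union> Pow V)" using cx_Un[OF less.prems(1) cx_Pow[OF fV]] .
    have "T - (S \<union> Pow V) \<subset> T - S" using V by blast
    then have "card (T - (S \<union> Pow V)) < card (T - S)"
      using cx_fin[OF less.prems(2)] by (intro psubset_card_mono) auto
    from less.hyps[OF this cU less.prems(2) sub] show ?thesis
      using lft_trans[OF K f less.prems(1) cU less.prems(2) _ sub 1] by blast
  qed
qed

text \<open>The simplices missing from \<open>S\<close> come in pairs \<open>V - {v}, insert v V\<close>, each of which is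
  adjoined by filling the horn opposite to the face missing \<open>v\<close>.\<close>
lemma cone_lft:
  assumes K: "stable_class C K" and f: "smap X Y f" "simp_psh X" "simp_psh Y" and h: "fibr K N X Y f"
  shows "fin_complex S \<Longrightarrow> fin_complex T \<Longrightarrow> S \<subseteq> T \<Longrightarrow>
    (\<And>V. V \<in> T \<Longrightarrow> V \<notin> S \<Longrightarrow> insert v V \<in> T \<and> V - {v} \<notin> S \<and> N < card (insert v V)) \<Longrightarrow> rel_lift K X Y f S T"
proof (induction "card (T - S)" arbitrary: S rule: less_induct)
  case less
  note tog = less.prems(4)
  show ?case
  proof (cases "S = T")
    case True then show ?thesis using lft_refl[OF K f less.prems(1)] by simp
  next
    case False
    \<comment> \<open>Among the missing faces that contain v, one with fewest vertices is taken.
      Each of its proper faces other than the one opposite to v lies in S, since adding v would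
      otherwise give a smaller choice.\<close>
    define P where "P V \<longleftrightarrow> V \<in> T \<and> V \<notin> S \<and> v \<in> V" for V
    define V where "V = arg_min card P"
    obtain V0 where "V0 \<in> T" "V0 \<notin> S" using False less.prems by blast
    then have "P (insert v V0)" using tog[of V0] cx_down[OF less.prems(1), of "insert v V0" "V0 - {v}"] unfolding P_def by blast
    then have PV: "P V" unfolding V_def by (rule arg_min_natI)
    then have V: "V \<in> T" "V \<notin> S" "v \<in> V" unfolding P_def by auto
    have min: "card V \<le> card W" if "P W" for W unfolding V_def using arg_min_nat_le[of P W card] that by blast
    have fV: "finite V" using cx_finite[OF less.prems(2) V(1)] .
    have Vv: "V - {v} \<notin> S" and N: "N < card V" using tog[OF V(1,2)] V(3) by (auto simp: insert_absorb)
    have Vn: "V \<noteq> {v}" using Vv cx_empty[OF less.prems(1)] by auto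
    have "W \<in> S" if W: "W \<subseteq> V" "W \<noteq> V" "W \<noteq> V - {v}" for W
    proof (rule ccontr)
      assume WS: "W \<notin> S"
      have WT: "W \<in> T" using cx_down[OF less.prems(2) V(1) W(1)] .
      have "insert v W \<notin> S" using cx_down[OF less.prems(1), of "insert v W" W] WS by blast
      then have "P (insert v W)" using tog[OF WT WS] unfolding P_def by blast
      then have "card V \<le> card (insert v W)" by (rule min)
      moreover have "insert v W \<subset> V" using W V(3) by blast
      then have "card (insert v W) < card V" by (rule psubset_card_mono[OF fV])
      ultimately show False by simp
    qed
    then have "S \<inter> Pow V = Pow V - {V, V - {v}}" using V(2) Vv by blast
    then have 1: "rel_lift K X Y f S (S \<union> Pow V)"
      using lft_union[OF f less.prems(1) cx_Pow[OF fV], of K] fibr_cell[OF f h fV V(3) Vn N] by simp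
    have sub: "S \<union> Pow V \<subseteq> T" using less.prems(3) cx_down[OF less.prems(2) V(1)] by blast
    have cU: "fin_complex (S \<union> Pow V)" using cx_Un[OF less.prems(1) cx_Pow[OF fV]] .
    have "T - (S \<union> Pow V) \<subset> T - S" using V by blast
    then have c: "card (T - (S \<union> Pow V)) < card (T - S)"
      using cx_fin[OF less.prems(2)] by (intro psubset_card_mono) auto
    have "rel_lift K X Y f (S \<union> Pow V) T"
    proof (rule less.hyps[OF c cU less.prems(2) sub])
      fix W assume W: "W \<in> T" "W \<notin> S \<union> Pow V"
      then have t: "insert v W \<in> T \<and> W - {v} \<notin> S \<and> N < card (insert v W)" using tog by blast
      moreover have "W - {v} \<notin> Pow V" using W V(3) by blast
      ultimately show "insert v W \<in> T \<and> W - {v} \<notin> S \<union> Pow V \<and> N < card (insert v W)" by blast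
    qed
    then show ?thesis using lft_trans[OF K f less.prems(1) cU less.prems(2) _ sub 1] by blast
  qed
qed

section \<open>Expansions of prisms by horn fillings\<close>

lemma card_Pr:
  assumes "finite V" "A \<subseteq> (\<lambda>v. v div 2) ` V" shows "card A \<le> card (V :: nat set)"
  using assms card_mono[of "(\<lambda>v. v div 2) ` V" A] card_image_le[OF assms(1), of "\<lambda>v. v div 2"] by simp

lemma Xi_bd_iff: "V \<in> cylinder (bdry n) \<longleftrightarrow> V \<in> prism_cx n \<and> (\<lambda>v. v div 2) ` V \<noteq> {..n}"
  unfolding cylinder_def bdry_def by auto

lemma Xi_hn_iff: "V \<in> cylinder (horn_cx n i) \<longleftrightarrow> V \<in> prism_cx n \<and> (\<exists>j\<le>n. j \<noteq> i \<and> j \<notin> (\<lambda>v. v div 2) ` V)"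
  unfolding cylinder_def horn_cx_def by auto

lemma Lv_iff:
  assumes "V \<in> prism_cx n" shows "V \<in> levels {0} n \<longleftrightarrow> (\<forall>v\<in>V. even v)" "V \<in> levels {1} n \<longleftrightarrow> (\<forall>v\<in>V. odd v)"
    "V \<in> levels {0,1} n \<longleftrightarrow> (\<forall>v\<in>V. even v) \<or> (\<forall>v\<in>V. odd v)"
proof -
  have d: "\<forall>v\<in>V. v div 2 \<le> n" using assms unfolding Pr_iff by blast
  have img: "v \<in> (\<lambda>i. 2 * i + v mod 2) ` {..n}" if "v \<in> V" for v
    using d that by (intro image_eqI[of _ _ "v div 2"]) auto
  have 0: "V \<subseteq> (\<lambda>i. 2 * i + 0) ` {..n} \<longleftrightarrow> (\<forall>v\<in>V. even v)"
  proof
    assume "\<forall>v\<in>V. even v" then show "V \<subseteq> (\<lambda>i. 2 * i + 0) ` {..n}" using img by fastforce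
  qed auto
  have 1: "V \<subseteq> (\<lambda>i. 2 * i + 1) ` {..n} \<longleftrightarrow> (\<forall>v\<in>V. odd v)"
  proof
    assume o: "\<forall>v\<in>V. odd v"
    show "V \<subseteq> (\<lambda>i. 2 * i + 1) ` {..n}"
    proof
      fix v assume v: "v \<in> V"
      then have "v mod 2 = 1" using o odd_iff_mod_2_eq_one by blast
      then show "v \<in> (\<lambda>i. 2 * i + 1) ` {..n}" using img[OF v] by simp
    qed
  qed auto
  show "V \<in> levels {0} n \<longleftrightarrow> (\<forall>v\<in>V. even v)" "V \<in> levels {1} n \<longleftrightarrow> (\<forall>v\<in>V. odd v)"
    "V \<in> levels {0,1} n \<longleftrightarrow> (\<forall>v\<in>V. even v) \<or> (\<forall>v\<in>V. odd v)"
    unfolding levels_def using 0 1 by simp_all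
qed

lemma Pr_insert:
  assumes "V \<in> prism_cx n" "v div 2 \<le> n" "\<And>w. w \<in> V \<Longrightarrow> w \<le> v \<Longrightarrow> w mod 2 \<le> v mod 2" "\<And>w. w \<in> V \<Longrightarrow> v \<le> w \<Longrightarrow> v mod 2 \<le> w mod 2"
  shows "insert v V \<in> prism_cx n"
  using assms unfolding Pr_iff by auto

lemma image_minus:
  assumes "g c \<in> g ` (V - {c})" shows "g ` (V - {c}) = g ` V"
proof
  show "g ` V \<subseteq> g ` (V - {c})"
  proof
    fix y assume "y \<in> g ` V"
    then obtain v where v: "v \<in> V" "y = g v" by blast
    show "y \<in> g ` (V - {c})" using assms v by (cases "v = c") auto
  qed
qed auto

lemma Pr_diff: "V \<in> prism_cx n \<Longrightarrow> V - {v} \<in> prism_cx n"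
  using cx_down[OF cx_Xi[OF cx_Pow[of "{..n}"]]] by auto

text \<open>Stage a adds the faces whose lowest vertex on the upper level is (a,1). They project
  onto all of [n], so they have at least n + 1 vertices. They are paired by the vertex (a,0), which
  can be added or removed freely because (a,1) keeps column a occupied. The stages run from a = n
  down to 0.\<close>

lemma prism_bd_0:
  assumes K: "stable_class C K" and f: "smap X Y f" "simp_psh X" "simp_psh Y" and h: "fibr K N X Y f" and N: "N \<le> n"
  shows "rel_lift K X Y f (cylinder (bdry n) \<union> levels {0} n) (prism_cx n)"
proof -
  let ?S = "cylinder (bdry n) \<union> levels {0} n"
  define T where "T a = ?S \<union> {V \<in> prism_cx n. \<forall>v\<in>V. odd v \<longrightarrow> a \<le> v div 2}" for a
  have cP: "fin_complex (prism_cx n)" using cx_Xi[OF cx_Pow] by blast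
  have cS: "fin_complex ?S" by (rule cx_XiLv[OF cx_bd]) simp
  have SP: "?S \<subseteq> prism_cx n" using Lv_Pr[of "{0}" n] by (auto simp: Xi_bd_iff)
  have cT: "fin_complex (T a)" for a
  proof (rule cx_subset[OF cP])
    show "T a \<subseteq> prism_cx n" using SP unfolding T_def by blast
    show "{} \<in> T a" using cx_empty[OF cS] unfolding T_def by blast
    fix V W assume "V \<in> T a" "W \<subseteq> V"
    then show "W \<in> T a" unfolding T_def using cx_down[OF cS, of V W] cx_down[OF cP, of V W] by blast
  qed
  have iff: "V \<in> T a \<and> V \<notin> T (Suc a) \<longleftrightarrow>
      V \<in> prism_cx n \<and> (\<lambda>v. v div 2) ` V = {..n} \<and> 2 * a + 1 \<in> V \<and> (\<forall>v\<in>V. odd v \<longrightarrow> a \<le> v div 2)" for V a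
  proof -
    have "(\<forall>v\<in>V. odd v \<longrightarrow> a \<le> v div 2) \<Longrightarrow> \<not> (\<forall>v\<in>V. odd v \<longrightarrow> Suc a \<le> v div 2) \<longleftrightarrow> 2 * a + 1 \<in> V"
    proof -
      assume le: "\<forall>v\<in>V. odd v \<longrightarrow> a \<le> v div 2"
      have "v = 2 * a + 1" if "v \<in> V" "odd v" "\<not> Suc a \<le> v div 2" for v
      proof -
        have "v div 2 = a" using le that by force
        then show ?thesis using odd_two_times_div_two_succ[OF that(2)] by simp
      qed
      moreover have "odd (2 * a + 1)" "\<not> Suc a \<le> (2 * a + 1) div 2" by auto
      ultimately show ?thesis by metis
    qed
    moreover have "2 * a + 1 \<in> V \<Longrightarrow> V \<in> prism_cx n \<Longrightarrow> V \<notin> levels {0} n" using Lv_iff(1) by fastforce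
    moreover have "V \<in> prism_cx n \<Longrightarrow> (\<forall>v\<in>V. even v) \<Longrightarrow> V \<in> levels {0} n" using Lv_iff(1) by blast
    ultimately show ?thesis unfolding T_def using SP by (auto simp: Xi_bd_iff)
  qed
  have stage: "rel_lift K X Y f (T (Suc a)) (T a)" if a: "a \<le> n" for a
  proof (rule cone_lft[OF K f h cT cT, where v = "2 * a"])
    show "T (Suc a) \<subseteq> T a" unfolding T_def by auto
    fix V assume VT: "V \<in> T a" "V \<notin> T (Suc a)"
    from iff[THEN iffD1, OF conjI[OF VT]] have V: "V \<in> prism_cx n" "(\<lambda>v. v div 2) ` V = {..n}" "2 * a + 1 \<in> V" "\<forall>v\<in>V. odd v \<longrightarrow> a \<le> v div 2"
      by blast+
    have 1: "insert (2 * a) V \<in> prism_cx n"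
    proof (rule Pr_insert[OF V(1)])
      fix w assume w: "w \<in> V" "w \<le> 2 * a"
      have "even w"
      proof (rule ccontr)
        assume "odd w"
        then have "a \<le> w div 2" "w = 2 * (w div 2) + 1" using V(4) w(1) by auto
        then show False using w(2) by linarith
      qed
      then show "w mod 2 \<le> 2 * a mod 2" by simp
    qed (use a in auto)
    have im: "(\<lambda>v. v div 2) ` insert (2 * a) V = {..n}" using V(2) a by auto
    have "(\<lambda>v. v div 2) ` (V - {2 * a}) = {..n}"
    proof -
      have "2 * a div 2 \<in> (\<lambda>v. v div 2) ` (V - {2 * a})" using V(3) by (intro image_eqI[of _ _ "2 * a + 1"]) auto
      from image_minus[OF this] show ?thesis using V(2) by simp
    qed
    then have "V - {2 * a} \<in> T a \<and> V - {2 * a} \<notin> T (Suc a)" unfolding iff using V Pr_diff by auto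
    moreover have "insert (2 * a) V \<in> T a \<and> insert (2 * a) V \<notin> T (Suc a)" unfolding iff using 1 im V by auto
    moreover have "card {..n} \<le> card (insert (2 * a) V)" using 1 im by (intro card_Pr) (auto simp: Pr_iff)
    ultimately show "insert (2 * a) V \<in> T a \<and> V - {2 * a} \<notin> T (Suc a) \<and> N < card (insert (2 * a) V)"
      using N by simp
  qed
  have ST: "?S \<subseteq> T a" for a unfolding T_def by blast
  have "rel_lift K X Y f ?S (T a)" if "a \<le> Suc n" for a
    using that
  proof (induction rule: inc_induct)
    case base
    have "V \<in> ?S" if V: "V \<in> prism_cx n" "\<forall>v\<in>V. odd v \<longrightarrow> Suc n \<le> v div 2" for V
    proof -
      have "even v" if "v \<in> V" for v
      proof (rule ccontr)
        assume "odd v"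
        moreover have "v div 2 \<le> n" using V(1) that unfolding Pr_iff by blast
        ultimately show False using V(2) that by auto
      qed
      then show ?thesis using Lv_iff(1)[OF V(1)] by blast
    qed
    then have "T (Suc n) = ?S" unfolding T_def by blast
    then show ?case using lft_refl[OF K f cS] by simp
  next
    case (step a)
    have "T (Suc a) \<subseteq> T a" unfolding T_def by auto
    moreover have "a \<le> n" using step.hyps by simp
    ultimately show ?case using lft_trans[OF K f cS cT cT ST _ step.IH stage] by blast
  qed
  from this[of 0] show ?thesis unfolding T_def using SP by (simp add: Un_absorb1)
qed

text \<open>The mirror image of the expansion from the lower end: stage a adds the faces whose
  highest vertex on the lower level is (a,0). They are paired by (a,1), and the stages run
  upwards.\<close>

lemma prism_bd_1:
  assumes K: "stable_class C K" and f: "smap X Y f" "simp_psh X" "simp_psh Y" and h: "fibr K N X Y f" and N: "N \<le> n"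
  shows "rel_lift K X Y f (cylinder (bdry n) \<union> levels {1} n) (prism_cx n)"
proof -
  let ?S = "cylinder (bdry n) \<union> levels {1} n"
  define T where "T a = ?S \<union> {V \<in> prism_cx n. \<forall>v\<in>V. even v \<longrightarrow> v div 2 < a}" for a
  have cP: "fin_complex (prism_cx n)" using cx_Xi[OF cx_Pow] by blast
  have cS: "fin_complex ?S" by (rule cx_XiLv[OF cx_bd]) simp
  have SP: "?S \<subseteq> prism_cx n" using Lv_Pr[of "{1}" n] by (auto simp: Xi_bd_iff)
  have cT: "fin_complex (T a)" for a
  proof (rule cx_subset[OF cP])
    show "T a \<subseteq> prism_cx n" using SP unfolding T_def by blast
    show "{} \<in> T a" using cx_empty[OF cS] unfolding T_def by blast
    fix V W assume "V \<in> T a" "W \<subseteq> V"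
    then show "W \<in> T a" unfolding T_def using cx_down[OF cS, of V W] cx_down[OF cP, of V W] by blast
  qed
  have iff: "V \<in> T (Suc a) \<and> V \<notin> T a \<longleftrightarrow>
      V \<in> prism_cx n \<and> (\<lambda>v. v div 2) ` V = {..n} \<and> 2 * a \<in> V \<and> (\<forall>v\<in>V. even v \<longrightarrow> v div 2 < Suc a)" for V a
  proof -
    have "(\<forall>v\<in>V. even v \<longrightarrow> v div 2 < Suc a) \<Longrightarrow> \<not> (\<forall>v\<in>V. even v \<longrightarrow> v div 2 < a) \<longleftrightarrow> 2 * a \<in> V"
    proof -
      assume le: "\<forall>v\<in>V. even v \<longrightarrow> v div 2 < Suc a"
      have "v = 2 * a" if "v \<in> V" "even v" "\<not> v div 2 < a" for v
      proof -
        have "v div 2 = a" using le that by force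
        then show ?thesis using even_two_times_div_two[OF that(2)] by simp
      qed
      moreover have "even (2 * a)" "\<not> (2 * a) div 2 < a" by auto
      ultimately show ?thesis by metis
    qed
    moreover have "2 * a \<in> V \<Longrightarrow> V \<in> prism_cx n \<Longrightarrow> V \<notin> levels {1} n" using Lv_iff(2) by fastforce
    moreover have "V \<in> prism_cx n \<Longrightarrow> (\<forall>v\<in>V. odd v) \<Longrightarrow> V \<in> levels {1} n" using Lv_iff(2) by blast
    ultimately show ?thesis unfolding T_def using SP by (auto simp: Xi_bd_iff)
  qed
  have TT: "T a \<subseteq> T (Suc a)" for a
    unfolding T_def by (intro Un_mono order_refl subsetI) (simp add: less_SucI)
  have stage: "rel_lift K X Y f (T a) (T (Suc a))" if a: "a \<le> n" for a
  proof (rule cone_lft[OF K f h cT cT, where v = "2 * a + 1"])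
    show "T a \<subseteq> T (Suc a)" by (rule TT)
    fix V assume VT: "V \<in> T (Suc a)" "V \<notin> T a"
    from iff[THEN iffD1, OF conjI[OF VT]] have V: "V \<in> prism_cx n" "(\<lambda>v. v div 2) ` V = {..n}" "2 * a \<in> V" "\<forall>v\<in>V. even v \<longrightarrow> v div 2 < Suc a"
      by blast+
    have 1: "insert (2 * a + 1) V \<in> prism_cx n"
    proof (rule Pr_insert[OF V(1)])
      fix w assume w: "w \<in> V" "2 * a + 1 \<le> w"
      have "odd w"
      proof
        assume "even w"
        then have "w div 2 < Suc a" "w = 2 * (w div 2)" using V(4) w(1) by auto
        then show False using w(2) by linarith
      qed
      then show "(2 * a + 1) mod 2 \<le> w mod 2" by (simp add: odd_iff_mod_2_eq_one)
    qed (use a in auto)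
    have im: "(\<lambda>v. v div 2) ` insert (2 * a + 1) V = {..n}" using V(2) a by auto
    have "(\<lambda>v. v div 2) ` (V - {2 * a + 1}) = {..n}"
    proof -
      have "(2 * a + 1) div 2 \<in> (\<lambda>v. v div 2) ` (V - {2 * a + 1})" using V(3) by (intro image_eqI[of _ _ "2 * a"]) auto
      from image_minus[OF this] show ?thesis using V(2) by simp
    qed
    then have "V - {2 * a + 1} \<in> T (Suc a) \<and> V - {2 * a + 1} \<notin> T a" unfolding iff using V Pr_diff by auto
    moreover have "insert (2 * a + 1) V \<in> T (Suc a) \<and> insert (2 * a + 1) V \<notin> T a" unfolding iff using 1 im V by auto
    moreover have "card {..n} \<le> card (insert (2 * a + 1) V)" using 1 im by (intro card_Pr) (auto simp: Pr_iff)
    ultimately show "insert (2 * a + 1) V \<in> T (Suc a) \<and> V - {2 * a + 1} \<notin> T a \<and> N < card (insert (2 * a + 1) V)"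
      using N by simp
  qed
  have ST: "?S \<subseteq> T a" for a unfolding T_def by blast
  have "rel_lift K X Y f ?S (T a)" if "a \<le> Suc n" for a
    using that
  proof (induction a)
    case 0
    have "T 0 = ?S" using Lv_iff(2) unfolding T_def by auto
    then show ?case using lft_refl[OF K f cS] by simp
  next
    case (Suc a)
    show ?case using lft_trans[OF K f cS cT cT ST TT Suc.IH stage] Suc.prems by simp
  qed
  moreover have "T (Suc n) = prism_cx n" unfolding T_def using SP by (auto simp: Pr_iff less_Suc_eq_le)
  ultimately show ?thesis by (metis order_refl)
qed

text \<open>A face outside the cylinder over the horn meets every column except possibly column i,
  and a vertex c in that column leaves the other columns alone. So pairing by c has to respect only
  the extra condition R, and adding c occupies all n + 1 columns.\<close>

lemma prism_hn_stage:
  assumes K: "stable_class C K" and f: "smap X Y f" "simp_psh X" "simp_psh Y" and h: "fibr K N X Y f" and N: "N \<le> n"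
    and i: "i \<le> n" "0 < n" and c: "c = 2 * i \<or> c = 2 * i + 1"
    and A: "fin_complex A" "fin_complex B" "A \<subseteq> B" "B \<subseteq> prism_cx n"
    and A_iff: "\<And>V. V \<in> B \<Longrightarrow> V \<notin> A \<longleftrightarrow> V \<notin> cylinder (horn_cx n i) \<and> R V"
    and R: "\<And>V. V \<in> B \<Longrightarrow> V \<notin> A \<Longrightarrow> insert c V \<in> B \<and> R (V - {c})"
  shows "rel_lift K X Y f A B"
proof (rule cone_lft[OF K f h A(1-3), where v = c])
  fix V assume V: "V \<in> B" "V \<notin> A"
  then have P: "V \<in> prism_cx n" "V \<notin> cylinder (horn_cx n i)" using A A_iff by auto
  then have d: "j \<in> (\<lambda>v. v div 2) ` V" if "j \<le> n" "j \<noteq> i" for j using that unfolding Xi_hn_iff by blast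
  have ci: "c div 2 = i" using c by auto
  have ins: "insert c V \<in> B" and RV: "R (V - {c})" using R[OF V] by auto
  have "j \<in> (\<lambda>v. v div 2) ` (V - {c})" if j: "j \<le> n" "j \<noteq> i" for j
  proof -
    obtain v where "v \<in> V" "v div 2 = j" using d[OF j] by blast
    then show ?thesis using ci j(2) by blast
  qed
  then have "V - {c} \<notin> cylinder (horn_cx n i)" unfolding Xi_hn_iff by blast
  then have "V - {c} \<notin> A" using A_iff RV cx_down[OF A(2) V(1), of "V - {c}"] by blast
  moreover have "j \<in> (\<lambda>v. v div 2) ` insert c V" if "j \<le> n" for j using d[OF that] ci by (cases "j = i") auto
  then have "card {..n} \<le> card (insert c V)" using P by (intro card_Pr) (auto simp: Pr_iff)
  ultimately show "insert c V \<in> B \<and> V - {c} \<notin> A \<and> N < card (insert c V)" using ins N by simp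
qed

text \<open>As both ends are present, a face is missing only if it also has vertices on both levels.
  Q splits the missing faces into two stages, one for each vertex above i. The first stage must find
  a vertex besides c on each level, the second a failure of Q that survives the removal of
  c'.\<close>

lemma prism_hn_01:
  assumes K: "stable_class C K" and f: "smap X Y f" "simp_psh X" "simp_psh Y" and h: "fibr K N X Y f" and N: "N \<le> n"
    and i: "i \<le> n" "0 < n"
  shows "rel_lift K X Y f (cylinder (horn_cx n i) \<union> levels {0,1} n) (prism_cx n)"
proof -
  let ?S = "cylinder (horn_cx n i) \<union> levels {0,1} n"
  \<comment> \<open>For i > 0 column 0 provides the lower vertex that survives the removal of c =
    (i,0). For i = 0 that column is the critical one, so c = (0,1) is used and column n provides a
    surviving upper vertex.\<close>
  define Q where "Q V \<longleftrightarrow> (if i = 0 then \<forall>v\<in>V. even v \<longrightarrow> v div 2 = 0 else \<forall>v\<in>V. odd v \<longrightarrow> i \<le> v div 2)" for V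
  define c where "c = (if i = 0 then 1 else 2 * i)"
  define c' where "c' = (if i = 0 then 0 else 2 * i + 1)"
  let ?T = "?S \<union> {V \<in> prism_cx n. Q V}"
  have cP: "fin_complex (prism_cx n)" using cx_Xi[OF cx_Pow] by blast
  have cS: "fin_complex ?S" by (rule cx_XiLv[OF cx_hn[OF i(2)]]) simp
  have SP: "?S \<subseteq> prism_cx n" using Lv_Pr[of "{0,1}" n] by (auto simp: Xi_hn_iff)
  have cT: "fin_complex ?T"
  proof (rule cx_subset[OF cP])
    show "?T \<subseteq> prism_cx n" using SP by blast
    show "{} \<in> ?T" using cx_empty[OF cS] by blast
    fix V W assume VW: "V \<in> ?T" "W \<subseteq> V"
    moreover have "Q V \<Longrightarrow> Q W" using VW(2) unfolding Q_def by (auto split: if_splits)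
    ultimately show "W \<in> ?T" using cx_down[OF cS, of V W] cx_down[OF cP, of V W] by blast
  qed
  let ?L = "\<lambda>V. (\<exists>v\<in>V. even v) \<and> (\<exists>v\<in>V. odd v)"
  have S_iff: "V \<notin> ?S \<longleftrightarrow> V \<notin> cylinder (horn_cx n i) \<and> ?L V" if "V \<in> prism_cx n" for V
    using Lv_iff(3)[OF that] by auto
  have "rel_lift K X Y f ?S ?T"
  proof (rule prism_hn_stage[OF K f h N i _ cS cT, where c = c and R = ?L])
    show "?T \<subseteq> prism_cx n" using SP by blast
    show "c = 2 * i \<or> c = 2 * i + 1" unfolding c_def by simp
    fix V assume VT: "V \<in> ?T"
    then have VP: "V \<in> prism_cx n" using SP by blast
    then show "V \<notin> ?S \<longleftrightarrow> V \<notin> cylinder (horn_cx n i) \<and> ?L V" by (rule S_iff)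
    assume VS: "V \<notin> ?S"
    then have Q: "Q V" and L: "?L V" and nh: "V \<notin> cylinder (horn_cx n i)" using VT S_iff[OF VP] by blast+
    have d: "\<exists>v\<in>V. v div 2 = j" if "j \<le> n" "j \<noteq> i" for j using that nh VP unfolding Xi_hn_iff by blast
    show "insert c V \<in> ?T \<and> ?L (V - {c})"
    proof (cases "i = 0")
      case True
      have q: "\<forall>v\<in>V. even v \<longrightarrow> v div 2 = 0" using Q True unfolding Q_def by simp
      have c1: "c = 1" using True by (simp add: c_def)
      have "insert c V \<in> prism_cx n" unfolding c1
      proof (rule Pr_insert[OF VP])
        fix w assume w: "w \<in> V" "1 \<le> w"
        have "odd w"
        proof
          assume e: "even w"
          then have "w div 2 = 0" using q w by blast
          then show False using e w(2) by (auto elim!: evenE)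
        qed
        then show "1 mod 2 \<le> w mod 2" by (simp add: odd_iff_mod_2_eq_one)
      qed auto
      then have 1: "insert c V \<in> ?T" using q True unfolding Q_def c1 by simp
      obtain u where u: "u \<in> V" "even u" using L by blast
      obtain v where v: "v \<in> V" "v div 2 = n" using d[of n] i True by auto
      have "odd v"
      proof
        assume "even v"
        then have "v div 2 = 0" using q v(1) by blast
        then show False using v(2) i(2) by simp
      qed
      moreover have "v \<in> V - {c}" using v i(2) unfolding c1 by auto
      moreover have "u \<in> V - {c}" using u unfolding c1 by auto
      ultimately show ?thesis using 1 u(2) by blast
    next
      case False
      have q: "\<forall>v\<in>V. odd v \<longrightarrow> i \<le> v div 2" using Q False unfolding Q_def by simp
      have c1: "c = 2 * i" using False by (simp add: c_def)
      have "insert c V \<in> prism_cx n" unfolding c1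
      proof (rule Pr_insert[OF VP])
        fix w assume w: "w \<in> V" "w \<le> 2 * i"
        have "even w"
        proof (rule ccontr)
          assume "odd w"
          then have "i \<le> w div 2" "w = 2 * (w div 2) + 1" using q w(1) by auto
          then show False using w(2) by linarith
        qed
        then show "w mod 2 \<le> 2 * i mod 2" by simp
      qed (use i in auto)
      then have 1: "insert c V \<in> ?T" using q False unfolding Q_def c1 by simp
      obtain u where u: "u \<in> V" "odd u" using L by blast
      obtain v where v: "v \<in> V" "v div 2 = 0" using d[of 0] False by auto
      have "even v"
      proof (rule ccontr)
        assume "odd v"
        then have "i \<le> v div 2" using q v(1) by blast
        then show False using v(2) False by simp
      qed
      moreover have "v \<in> V - {c}" using v False unfolding c1 by auto
      moreover have "u \<in> V - {c}" using u unfolding c1 by auto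
      ultimately show ?thesis using 1 u(2) by blast
    qed
  qed blast
  \<comment> \<open>The vertex c' can be added to any face that violates Q: for i = 0 it is the
    least vertex of the prism, and for i > 0 every vertex from c' on exceeds an upper vertex u left
    of column i, hence is itself upper. The vertex witnessing the failure of Q differs from
    c'.\<close>
  moreover have "rel_lift K X Y f ?T (prism_cx n)"
  proof (rule prism_hn_stage[OF K f h N i _ cT cP, where c = c' and R = "\<lambda>V. ?L V \<and> \<not> Q V"])
    show "?T \<subseteq> prism_cx n" using SP by blast
    show "c' = 2 * i \<or> c' = 2 * i + 1" unfolding c'_def by simp
    fix V assume VP: "V \<in> prism_cx n"
    then show iff: "V \<notin> ?T \<longleftrightarrow> V \<notin> cylinder (horn_cx n i) \<and> ?L V \<and> \<not> Q V" using S_iff[OF VP] by blast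
    assume "V \<notin> ?T"
    then have Q: "\<not> Q V" and L: "?L V" using iff by blast+
    show "insert c' V \<in> prism_cx n \<and> ?L (V - {c'}) \<and> \<not> Q (V - {c'})"
    proof (cases "i = 0")
      case True
      have c1: "c' = 0" using True by (simp add: c'_def)
      obtain u where u: "u \<in> V" "even u" "u div 2 \<noteq> 0" using Q True unfolding Q_def by auto
      obtain w where w: "w \<in> V" "odd w" using L by blast
      have "u \<noteq> 0" "w \<noteq> 0" using u(3) w(2) by (auto intro!: gr0I)
      then have "u \<in> V - {c'}" "w \<in> V - {c'}" using u w unfolding c1 by auto
      moreover have "insert c' V \<in> prism_cx n" unfolding c1 by (rule Pr_insert[OF VP]) auto
      moreover have "\<not> Q (V - {c'})" using u \<open>u \<in> V - {c'}\<close> True unfolding Q_def by auto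
      ultimately show ?thesis using u w by blast
    next
      case False
      have c1: "c' = 2 * i + 1" using False by (simp add: c'_def)
      obtain u where u: "u \<in> V" "odd u" "u div 2 < i" using Q False unfolding Q_def by (auto simp: not_le)
      obtain w where w: "w \<in> V" "even w" using L by blast
      have "u \<in> V - {c'}" "w \<in> V - {c'}" using u w unfolding c1 by auto
      moreover have "insert c' V \<in> prism_cx n" unfolding c1
      proof (rule Pr_insert[OF VP])
        fix z assume z: "z \<in> V" "2 * i + 1 \<le> z"
        have "u < z" using u(3) z(2) by linarith
        then have "u mod 2 \<le> z mod 2" using VP u(1) z(1) unfolding Pr_iff by auto
        then show "(2 * i + 1) mod 2 \<le> z mod 2" using u(2) by (simp add: odd_iff_mod_2_eq_one)
      qed (use i in auto)
      moreover have "\<not> Q (V - {c'})" using u \<open>u \<in> V - {c'}\<close> False unfolding Q_def by (auto simp: not_le)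
      ultimately show ?thesis using u w by blast
    qed
  qed (use SP in blast)
  ultimately show ?thesis using lft_trans[OF K f cS cT cP _ _] SP by blast
qed

text \<open>The upper copy of the simplex meets the given part in a horn, so it is filled first.
  Then both ends are present, and \<open>prism_hn_01\<close> finishes.\<close>

lemma prism_hn_0:
  assumes K: "stable_class C K" and f: "smap X Y f" "simp_psh X" "simp_psh Y" and h: "fibr K N X Y f" and N: "N \<le> n"
    and i: "i \<le> n" "0 < n"
  shows "rel_lift K X Y f (cylinder (horn_cx n i) \<union> levels {0} n) (prism_cx n)"
proof -
  let ?S = "cylinder (horn_cx n i) \<union> levels {0} n" and ?e = "\<lambda>i::nat. 2 * i + 1"
  let ?V = "?e ` {..n}"
  have inj: "inj_on ?e {..n}" by (auto simp: inj_on_def)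
  have bij: "bij_betw ?e {..n} ?V" using inj by (simp add: bij_betw_def)
  have L1: "levels {1} n = Pow ?V" by (simp add: levels_def)
  have "inv_into {..n} ?e v = v div 2" if "v \<in> ?V" for v using that inv_into_f_f[OF inj] by auto
  then have inv: "inv_into {..n} ?e ` W = (\<lambda>v. v div 2) ` W" if "W \<subseteq> ?V" for W using that by (intro image_cong) auto
  have key: "W \<in> ?S \<longleftrightarrow> (\<lambda>v. v div 2) ` W \<in> horn_cx n i" if W: "W \<subseteq> ?V" for W
  proof -
    have "finite W" using W finite_subset by blast
    moreover have "\<forall>v\<in>W. v mod 2 = 1" using W by auto
    ultimately have 1: "W \<in> cylinder (horn_cx n i) \<longleftrightarrow> (\<lambda>v. v div 2) ` W \<in> horn_cx n i" unfolding cylinder_def by simp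
    have "W = {}" if W0: "W \<in> levels {0} n"
    proof (rule ccontr)
      assume "W \<noteq> {}"
      then obtain x where x: "x \<in> W" by blast
      obtain a where "x = 2 * a" using x W0 unfolding levels_def by auto
      moreover obtain b where "x = 2 * b + 1" using x W by auto
      ultimately show False by presburger
    qed
    then show ?thesis using 1 cx_empty[OF cx_Xi[OF cx_hn[OF i(2)]]] by auto
  qed
  have "W \<in> ?S \<inter> Pow ?V \<longleftrightarrow> W \<subseteq> ?V \<and> inv_into {..n} ?e ` W \<in> horn_cx n i" for W
  proof (cases "W \<subseteq> ?V")
    case True then show ?thesis using key[OF True] inv[OF True] by simp
  qed auto
  then have "?S \<inter> levels {1} n = {W. W \<subseteq> ?V \<and> inv_into {..n} ?e ` W \<in> horn_cx n i}" unfolding L1 by blast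
  moreover have "rel_lift K X Y f {W. W \<subseteq> ?V \<and> inv_into {..n} ?e ` W \<in> horn_cx n i} (Pow ?V)"
  proof (rule lft_cell[OF f _ bij _ cx_hn[OF i(2)]])
    show "horn_cx n i \<subseteq> simplex_cx n" unfolding horn_cx_def by blast
    show "rel_lift K X Y f (horn_cx n i) (simplex_cx n)" using h i N unfolding fibr_def by blast
  qed auto
  ultimately have "rel_lift K X Y f (?S \<inter> levels {1} n) (levels {1} n)" unfolding L1 by simp
  moreover have cS: "fin_complex ?S" "fin_complex (levels {1} n)" by (rule cx_XiLv[OF cx_hn[OF i(2)]], simp, rule cx_Lv[of 1], simp_all)
  ultimately have 1: "rel_lift K X Y f ?S (?S \<union> levels {1} n)" using lft_union[OF f cS] by blast
  have "?S \<union> levels {1} n = cylinder (horn_cx n i) \<union> levels {0,1} n" unfolding levels_def by auto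
  then have 2: "rel_lift K X Y f (?S \<union> levels {1} n) (prism_cx n)" using prism_hn_01[OF K f h N i] by simp
  have "?S \<union> levels {1} n \<subseteq> prism_cx n" using Lv_Pr[of "{0}" n] Lv_Pr[of "{1}" n] by (auto simp: Xi_hn_iff)
  then show ?thesis using lft_trans[OF K f cS(1) cx_Un[OF cS] cx_Xi[OF cx_Pow] _ _ 1 2] by blast
qed

end

section \<open>Path spaces\<close>

text \<open>The map s \<times> id of prisms, in the encoding of vertices by numbers.\<close>

definition prism_map :: "(nat \<Rightarrow> nat) \<Rightarrow> nat \<Rightarrow> nat" where
  "prism_map s v = 2 * s (v div 2) + v mod 2"

text \<open>The simplex Delta[m] \<times> {e} of the prism.\<close>

definition lev :: "nat \<Rightarrow> nat \<Rightarrow> nat \<Rightarrow> nat" where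
  "lev e m = (\<lambda>i. if i \<le> m then 2 * i + e else 0)"

abbreviation dv :: "nat \<Rightarrow> (nat \<Rightarrow> nat) \<Rightarrow> nat \<Rightarrow> nat" where
  "dv m t \<equiv> dcomp m (\<lambda>v. v div 2) t"

text \<open>The simplex of the standard prism whose first coordinate is the identity of [m] and
  whose interval coordinate is that of t.\<close>

definition fl :: "nat \<Rightarrow> (nat \<Rightarrow> nat) \<Rightarrow> nat \<Rightarrow> nat" where
  "fl m t = (\<lambda>i. if i \<le> m then 2 * i + t i mod 2 else 0)"

lemma SxD:
  assumes "t \<in> simplices S m"
  shows "i \<le> j \<Longrightarrow> j \<le> m \<Longrightarrow> t i \<le> t j" "m < i \<Longrightarrow> t i = 0" "t ` {..m} \<in> S"
  using assms unfolding simplices_def by auto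

lemma vmap_pv:
  assumes S: "fin_complex S" and s: "s \<in> simplices S m" shows "vertex_map (prism_map s) (prism_cx m) (cylinder S)"
  unfolding vertex_map_def
proof (intro ballI conjI impI)
  fix V assume V: "V \<in> prism_cx m"
  have d: "v div 2 \<le> m" if "v \<in> V" for v using V that unfolding Pr_iff by blast
  have ch: "v mod 2 \<le> w mod 2" if "v \<in> V" "w \<in> V" "v \<le> w" for v w using V that unfolding Pr_iff by blast
  have pd: "prism_map s v div 2 = s (v div 2)" "prism_map s v mod 2 = v mod 2" for v unfolding prism_map_def by auto
  show mono: "prism_map s v \<le> prism_map s w" if "v \<in> V" "w \<in> V" "v \<le> w" for v w
    using SxD(1)[OF s div_le_mono[OF that(3)] d[OF that(2)]] ch[OF that] unfolding prism_map_def by simp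
  have "(\<lambda>v. v div 2) ` prism_map s ` V \<subseteq> s ` {..m}" using d pd(1) by auto
  then have "(\<lambda>v. v div 2) ` prism_map s ` V \<in> S" using cx_down[OF S SxD(3)[OF s]] by blast
  moreover have "finite (prism_map s ` V)" using V unfolding Pr_iff by blast
  moreover have "v mod 2 \<le> w mod 2" if vw: "v \<in> V" "w \<in> V" "prism_map s v \<le> prism_map s w" for v w
  proof (cases "v \<le> w")
    \<comment> \<open>Here w < v. Since s is monotone, the reversed order of the images forces equal
      first coordinates and leaves a comparison of interval coordinates.\<close>
    case False
    then have "w \<le> v" by simp
    then have "s (w div 2) \<le> s (v div 2)" using SxD(1)[OF s div_le_mono d[OF vw(1)]] by blast
    then show ?thesis using vw(3) unfolding prism_map_def by simp
  qed (use ch vw in blast)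
  ultimately show "prism_map s ` V \<in> cylinder S" unfolding cylinder_def by (auto simp: pd(2))
qed

lemma vmap_dv: "vertex_map (\<lambda>v. v div 2) (cylinder S) S"
  unfolding vertex_map_def cylinder_def by (auto intro: div_le_mono)

lemma dv_Sx: "t \<in> simplices (cylinder S) m \<Longrightarrow> dv m t \<in> simplices S m"
  by (rule vmap_Sx[OF vmap_dv])

lemma Sx_Xi_mod:
  assumes "t \<in> simplices (cylinder S) m" "i \<le> j" "j \<le> m" shows "t i mod 2 \<le> t j mod 2"
proof -
  have "t i \<in> t ` {..m}" "t j \<in> t ` {..m}" using assms by auto
  then show ?thesis using SxD(1)[OF assms] SxD(3)[OF assms(1)] unfolding cylinder_def by blast
qed

lemma fl_Sx:
  assumes t: "t \<in> simplices (cylinder S) m" shows "fl m t \<in> simplices (prism_cx m) m"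
proof -
  have mono: "fl m t i \<le> fl m t j" if "i \<le> j" "j \<le> m" for i j
    using Sx_Xi_mod[OF t that] that unfolding fl_def by simp
  have fd: "fl m t i div 2 = i" "fl m t i mod 2 = t i mod 2" if "i \<le> m" for i using that unfolding fl_def by auto
  have "t i mod 2 \<le> t j mod 2" if ij: "i \<le> m" "j \<le> m" "fl m t i \<le> fl m t j" for i j
  proof -
    have "i \<le> j" using div_le_mono[OF ij(3), of 2] fd ij by simp
    then show ?thesis using Sx_Xi_mod[OF t] ij by blast
  qed
  then have "fl m t ` {..m} \<in> prism_cx m" unfolding Pr_iff using fd by auto
  then show ?thesis unfolding simplices_def using mono by (auto simp: fl_def)
qed

lemma lev_Lv:
  assumes "e \<in> E" "s \<in> simplices (simplex_cx n) m" "e = 0 \<or> e = 1"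
  shows "dcomp m (prism_map s) (lev e m) \<in> simplices (levels E n) m"
proof -
  have sn: "s i \<le> n" if "i \<le> m" for i using SxD(3)[OF assms(2)] that by auto
  have v: "dcomp m (prism_map s) (lev e m) i = 2 * s i + e" if "i \<le> m" for i
    using assms(3) that unfolding dcomp_def prism_map_def lev_def by auto
  have "dcomp m (prism_map s) (lev e m) ` {..m} \<in> levels E n" unfolding levels_def using v sn assms(1) by auto
  moreover have "s i \<le> s j" if "i \<le> j" "j \<le> m" for i j using SxD(1)[OF assms(2) that] .
  ultimately show ?thesis unfolding simplices_def using v by (auto simp: dcomp_def[of m "prism_map s"])
qed

lemma dv_pv_lev:
  assumes "e = 0 \<or> e = 1" "s \<in> simplices S m"
  shows "dv m (dcomp m (prism_map s) (lev e m)) = s" "dcomp m (prism_map s) (lev e m) 0 mod 2 = e"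
  using assms SxD(2)[OF assms(2)] unfolding dcomp_def prism_map_def lev_def by (auto simp: fun_eq_iff)

lemma lev_eq: "e = 0 \<or> e = 1 \<Longrightarrow> dcomp m (prism_map (delta_id m)) (lev e m) = lev e m"
  unfolding dcomp_def prism_map_def lev_def delta_id_def by auto

lemma lev_Sx: "e = 0 \<or> e = 1 \<Longrightarrow> lev e m \<in> simplices (prism_cx m) m"
proof -
  assume e: "e = 0 \<or> e = 1"
  then have "lev e m \<in> simplices (levels {e} m) m"
    using lev_Lv[of e "{e}" "delta_id m" m m] lev_eq[OF e, of m] delta_id_hom[of m] delta_hom_Sx by simp
  then show ?thesis using Sx_mono[OF Lv_Pr[of "{e}" m]] e by auto
qed

lemma Lv_parity:
  assumes "t \<in> simplices (levels E n) m" "E \<subseteq> {0,1}"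
  shows "t 0 mod 2 \<in> E" "i \<le> m \<Longrightarrow> t i mod 2 = t 0 mod 2"
proof -
  obtain e where e: "e \<in> E" "t ` {..m} \<subseteq> (\<lambda>i. 2 * i + e) ` {..n}" using SxD(3)[OF assms(1)] unfolding levels_def by blast
  have e01: "e = 0 \<or> e = 1" using e assms by blast
  have *: "t i mod 2 = e" if "i \<le> m" for i
  proof -
    have "t i \<in> (\<lambda>i. 2 * i + e) ` {..n}" using e(2) that by blast
    then obtain j where "t i = 2 * j + e" by blast
    then show ?thesis using e01 by auto
  qed
  show "t 0 mod 2 \<in> E" "i \<le> m \<Longrightarrow> t i mod 2 = t 0 mod 2" using * e by simp_all
qed

lemma fl_lev:
  assumes "t \<in> simplices (levels E n) m" "E \<subseteq> {0,1}" shows "fl m t = lev (t 0 mod 2) m"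
proof
  fix i show "fl m t i = lev (t 0 mod 2) m i"
    unfolding fl_def lev_def using Lv_parity(2)[OF assms, of i] by simp
qed

text \<open>A simplex of a cylinder factors through the prism over its own dimension: first the
  graph of its interval coordinate, then the map induced by its first coordinate. Hence maps out of
  a cylinder are determined on prisms.\<close>

lemma pv_fl: "t \<in> simplices S m \<Longrightarrow> dcomp m (prism_map (dv m t)) (fl m t) = t"
  unfolding dcomp_def prism_map_def fl_def using SxD(2) by (intro ext) auto

definition PathSp :: "('o,'m,'x) spsh \<Rightarrow> ('o,'m,nat \<Rightarrow> (nat \<Rightarrow> nat) \<Rightarrow> 'x) spsh" where
  "PathSp X = \<lparr>SE = (\<lambda>m. Maps (prism_cx m) X), SA = (\<lambda>l m \<theta>. reindex (prism_map \<theta>) (prism_cx l))\<rparr>"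

definition evp :: "nat \<Rightarrow> nat \<Rightarrow> (nat \<Rightarrow> (nat \<Rightarrow> nat) \<Rightarrow> 'x) \<Rightarrow> 'x" where
  "evp e m \<sigma> = \<sigma> m (lev e m)"

definition P1m :: "(nat \<Rightarrow> 'x \<Rightarrow> 'y) \<Rightarrow> nat \<Rightarrow> (nat \<Rightarrow> (nat \<Rightarrow> nat) \<Rightarrow> 'x) \<Rightarrow> nat \<Rightarrow> (nat \<Rightarrow> nat) \<Rightarrow> 'y" where
  "P1m f m = post (prism_cx m) f"

text \<open>The constant path at x: the projection of the prism to Delta[m], followed by x.\<close>

definition cst :: "('o,'m,'x) spsh \<Rightarrow> nat \<Rightarrow> 'x \<Rightarrow> nat \<Rightarrow> (nat \<Rightarrow> nat) \<Rightarrow> 'x" where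
  "cst X m x = (\<lambda>k t. if t \<in> simplices (prism_cx m) k then SA X k m (dv k t) x else undefined)"

definition Pull :: "('o,'m,'x) spsh \<Rightarrow> ('o,'m,'z) spsh \<Rightarrow> (nat \<Rightarrow> 'x \<Rightarrow> 'y) \<Rightarrow> (nat \<Rightarrow> 'z \<Rightarrow> 'y) \<Rightarrow> ('o,'m,'x \<times> 'z) spsh" where
  "Pull X Z f g = \<lparr>SE = (\<lambda>n. psh_pb (SE X n) (SE Z n) (f n) (g n)),
     SA = (\<lambda>m n \<theta> p. (SA X m n \<theta> (fst p), SA Z m n \<theta> (snd p)))\<rparr>"

text \<open>Indexing by a set E of ends of the interval lets one argument treat path spaces with one
  end lifted and with both ends lifted.\<close>

definition Powers :: "nat set \<Rightarrow> ('o,'m,'x) spsh \<Rightarrow> ('o,'m,nat \<Rightarrow> 'x) spsh" where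
  "Powers E X = \<lparr>SE = (\<lambda>n. \<lparr>PE = (\<lambda>U. {\<xi>. (\<forall>e\<in>E. \<xi> e \<in> PE (SE X n) U) \<and> (\<forall>e. e \<notin> E \<longrightarrow> \<xi> e = undefined)}),
       PR = (\<lambda>u \<xi> e. if e \<in> E then PR (SE X n) u (\<xi> e) else undefined)\<rparr>),
     SA = (\<lambda>m n \<theta> \<xi> e. if e \<in> E then SA X m n \<theta> (\<xi> e) else undefined)\<rparr>"

definition pwm :: "nat set \<Rightarrow> (nat \<Rightarrow> 'x \<Rightarrow> 'y) \<Rightarrow> nat \<Rightarrow> (nat \<Rightarrow> 'x) \<Rightarrow> nat \<Rightarrow> 'y" where
  "pwm E f n \<xi> = (\<lambda>e. if e \<in> E then f n (\<xi> e) else undefined)"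

definition evE :: "nat set \<Rightarrow> nat \<Rightarrow> (nat \<Rightarrow> (nat \<Rightarrow> nat) \<Rightarrow> 'x) \<Rightarrow> nat \<Rightarrow> 'x" where
  "evE E n \<gamma> = (\<lambda>e. if e \<in> E then evp e n \<gamma> else undefined)"

text \<open>Pairs of a path in \<open>Y\<close> and lifts to \<open>X\<close> of its ends in \<open>E\<close>; \<open>PathSp X\<close> maps to it by \<open>gap\<close>.\<close>
abbreviation "PathRel X Y f E \<equiv> Pull (Powers E X) (PathSp Y) (pwm E f) (evE E)"

definition gap :: "nat set \<Rightarrow> (nat \<Rightarrow> 'x \<Rightarrow> 'y) \<Rightarrow> nat \<Rightarrow> (nat \<Rightarrow> (nat \<Rightarrow> nat) \<Rightarrow> 'x) \<Rightarrow> (nat \<Rightarrow> 'x) \<times> (nat \<Rightarrow> (nat \<Rightarrow> nat) \<Rightarrow> 'y)" where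
  "gap E f n \<gamma> = (evE E n \<gamma>, P1m f n \<gamma>)"

lemma P1_simps: "SE (PathSp X) m = Maps (prism_cx m) X" "SA (PathSp X) l m \<theta> = reindex (prism_map \<theta>) (prism_cx l)"
  unfolding PathSp_def by auto

lemma Pb_simps: "SE (Pull X Z f g) n = psh_pb (SE X n) (SE Z n) (f n) (g n)"
  "SA (Pull X Z f g) m n \<theta> p = (SA X m n \<theta> (fst p), SA Z m n \<theta> (snd p))"
  unfolding Pull_def by auto

lemma Pw_simps: "\<xi> \<in> PE (SE (Powers E X) n) U \<longleftrightarrow> (\<forall>e\<in>E. \<xi> e \<in> PE (SE X n) U) \<and> (\<forall>e. e \<notin> E \<longrightarrow> \<xi> e = undefined)"
  "PR (SE (Powers E X) n) u \<xi> = (\<lambda>e. if e \<in> E then PR (SE X n) u (\<xi> e) else undefined)"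
  "SA (Powers E X) m n \<theta> \<xi> = (\<lambda>e. if e \<in> E then SA X m n \<theta> (\<xi> e) else undefined)"
  unfolding Powers_def by auto

lemma cx_Pr: "fin_complex (prism_cx n)"
  by (rule cx_Xi[OF cx_Pow]) simp

lemma delta_Sx: "delta_hom m n \<theta> \<Longrightarrow> \<theta> \<in> simplices (simplex_cx n) m"
  using delta_hom_Sx by blast

lemma re_pv:
  assumes "delta_hom k m \<theta>"
  shows "reindex (prism_map \<theta>) (prism_cx k) (reindex (prism_map s) (prism_cx m) h) = reindex (prism_map (dcomp k s \<theta>)) (prism_cx k) h"
proof (intro ext)
  fix j t
  show "reindex (prism_map \<theta>) (prism_cx k) (reindex (prism_map s) (prism_cx m) h) j t = reindex (prism_map (dcomp k s \<theta>)) (prism_cx k) h j t"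
  proof (cases "t \<in> simplices (prism_cx k) j")
    case True
    have "t i div 2 \<le> k" if "i \<le> j" for i using SxD(3)[OF True] that unfolding Pr_iff by auto
    then have "dcomp j (prism_map s) (dcomp j (prism_map \<theta>) t) = dcomp j (prism_map (dcomp k s \<theta>)) t"
      unfolding dcomp_def prism_map_def by (intro ext) auto
    then show ?thesis
      using True vmap_Sx[OF vmap_pv[OF cx_Pow delta_Sx[OF assms]] True] by (simp add: re_app)
  qed (simp add: reindex_def)
qed

section \<open>Path spaces, pullbacks and powers of simplicial presheaves\<close>

context cat_loc begin

lemma vmap_delta: "delta_hom l m \<theta> \<Longrightarrow> vertex_map (prism_map \<theta>) (prism_cx l) (prism_cx m)"
  by (rule vmap_pv[OF cx_Pow delta_Sx]) simp_all

lemma sps_P1: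
  assumes X: "simp_psh X" shows "simp_psh (PathSp X)"
  unfolding simp_psh_def P1_simps
proof (intro conjI allI impI)
  show "psh (Maps (prism_cx n) X)" for n by (rule psh_Mp[OF X cx_Pr])
  show "pmap (Maps (prism_cx n) X) (Maps (prism_cx m) X) (reindex (prism_map \<theta>) (prism_cx m))" if "delta_hom m n \<theta>" for m n \<theta>
    by (rule pmap_re[OF vmap_delta[OF that] cx_Pr])
  show "reindex (prism_map (delta_id n)) (prism_cx n) x = x" if "x \<in> PE (Maps (prism_cx n) X) U" for n U x
  proof (rule Mp_ext[OF re_Mp[OF vmap_delta[OF delta_id_hom] cx_Pr that] that])
    fix m t assume t: "t \<in> simplices (prism_cx n) m"
    have "t i div 2 \<le> n" if "i \<le> m" for i using SxD(3)[OF t] that unfolding Pr_iff by auto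
    then have "dcomp m (prism_map (delta_id n)) t = t"
      using SxD(2)[OF t] unfolding dcomp_def prism_map_def delta_id_def by (intro ext) auto
    then show "reindex (prism_map (delta_id n)) (prism_cx n) x m t = x m t" using t by (simp add: re_app)
  qed
  show "reindex (prism_map (dcomp l \<theta> \<psi>)) (prism_cx l) x = reindex (prism_map \<psi>) (prism_cx l) (reindex (prism_map \<theta>) (prism_cx m) x)"
    if "delta_hom l m \<psi>" for l m \<theta> \<psi> x by (rule re_pv[OF that, symmetric])
qed

lemma smapI:
  assumes "\<And>n. pmap (SE X n) (SE Y n) (f n)"
    "\<And>m n \<theta> U x. delta_hom m n \<theta> \<Longrightarrow> U \<in> Ob \<Longrightarrow> x \<in> PE (SE X n) U \<Longrightarrow> f m (SA X m n \<theta> x) = SA Y m n \<theta> (f n x)"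
  shows "smap X Y f"
  using assms unfolding smap_def by simp

lemma pmapI:
  assumes "\<And>U x. U \<in> Ob \<Longrightarrow> x \<in> PE F U \<Longrightarrow> f x \<in> PE G U"
    "\<And>U V u x. u \<in> H V U \<Longrightarrow> x \<in> PE F U \<Longrightarrow> f (PR F u x) = PR G u (f x)"
  shows "pmap F G f"
  using assms unfolding pmap_def by simp

lemma smap_evp:
  assumes e: "e = 0 \<or> e = 1" shows "smap (PathSp X) X (evp e)"
proof (rule smapI)
  show "pmap (SE (PathSp X) n) (SE X n) (evp e n)" for n
    unfolding P1_simps evp_def
    by (rule pmapI) (simp_all add: MpD(1)[OF _ lev_Sx[OF e]] PR_Mp post_app[OF lev_Sx[OF e]])
  fix m n \<theta> U x assume th: "delta_hom m n \<theta>" and x: "x \<in> PE (SE (PathSp X) n) U"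
  have "dcomp m (prism_map \<theta>) (lev e m) = dcomp m (lev e n) \<theta>"
    using e th unfolding dcomp_def prism_map_def lev_def delta_hom_def by (intro ext) auto
  then show "evp e m (SA (PathSp X) m n \<theta> x) = SA X m n \<theta> (evp e n x)"
    using MpD(2)[OF x[unfolded P1_simps] lev_Sx[OF e] th] unfolding P1_simps evp_def by (simp add: re_app[OF lev_Sx[OF e]])
qed

lemma smap_P1m:
  assumes f: "smap X Y f" shows "smap (PathSp X) (PathSp Y) (P1m f)"
proof (rule smapI)
  show "pmap (SE (PathSp X) n) (SE (PathSp Y) n) (P1m f n)" for n
    unfolding P1_simps P1m_def by (rule pmap_post[OF f cx_Pr cx_Pr order_refl])
  show "P1m f m (SA (PathSp X) m n \<theta> x) = SA (PathSp Y) m n \<theta> (P1m f n x)" if "delta_hom m n \<theta>" for m n \<theta> x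
    unfolding P1_simps P1m_def by (rule re_post[OF vmap_delta[OF that], symmetric])
qed

lemma evp_P1m: "e = 0 \<or> e = 1 \<Longrightarrow> evp e n (P1m f n \<gamma>) = f n (evp e n \<gamma>)"
  unfolding evp_def P1m_def by (simp add: post_app[OF lev_Sx])

lemma dv_delta: "t \<in> simplices (prism_cx m) k \<Longrightarrow> delta_hom k m (dv k t)"
  using dv_Sx delta_hom_Sx by blast

lemma smap_cst:
  assumes X: "simp_psh X" shows "smap X (PathSp X) (cst X)"
proof (rule smapI)
  have in1: "cst X n x \<in> PE (Maps (prism_cx n) X) U" if U: "U \<in> Ob" and x: "x \<in> PE (SE X n) U" for n U x
  proof (rule MpI)
    fix m t assume t: "t \<in> simplices (prism_cx n) m"
    show "cst X n x m t \<in> PE (SE X m) U"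
      unfolding cst_def using t pmap_in[OF spsD(2)[OF X dv_delta[OF t]] U x] by simp
  next
    fix m k \<theta> t assume t: "t \<in> simplices (prism_cx n) k" and th: "delta_hom m k \<theta>"
    show "SA X m k \<theta> (cst X n x k t) = cst X n x m (dcomp m t \<theta>)"
      using t dcomp_Sx[OF cx_Pr t th] spsD(4)[OF X dv_delta[OF t] th U x] dcomp_swap[OF th, of "\<lambda>v. v div 2" t]
      unfolding cst_def by simp
  qed (simp add: cst_def)
  show "pmap (SE X n) (SE (PathSp X) n) (cst X n)" for n
    unfolding P1_simps
  proof (rule pmapI[OF in1])
    fix U V u x assume u: "u \<in> H V U" and x: "x \<in> PE (SE X n) U"
    show "cst X n (PR (SE X n) u x) = PR (Maps (prism_cx n) X) u (cst X n x)"
      unfolding PR_Mp post_def cst_def using pmap_nat[OF spsD(2)[OF X dv_delta] u x] by (intro ext) simp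
  qed
  fix m n \<theta> U x assume th: "delta_hom m n \<theta>" and U: "U \<in> Ob" and x: "x \<in> PE (SE X n) U"
  show "cst X m (SA X m n \<theta> x) = SA (PathSp X) m n \<theta> (cst X n x)"
    unfolding P1_simps
  proof (intro ext)
    fix k t
    show "cst X m (SA X m n \<theta> x) k t = reindex (prism_map \<theta>) (prism_cx m) (cst X n x) k t"
    proof (cases "t \<in> simplices (prism_cx m) k")
      case True
      have "dv k (dcomp k (prism_map \<theta>) t) = dcomp k \<theta> (dv k t)" unfolding dcomp_def prism_map_def by (intro ext) auto
      then show ?thesis
        using True vmap_Sx[OF vmap_delta[OF th] True] spsD(4)[OF X th dv_delta[OF True] U x]
        by (simp add: re_app cst_def)
    qed (simp add: cst_def reindex_def)
  qed
qed

lemma evp_cst: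
  assumes e: "e = 0 \<or> e = 1" and X: "simp_psh X" and x: "U \<in> Ob" "x \<in> PE (SE X n) U"
  shows "evp e n (cst X n x) = x"
proof -
  have "dv n (lev e n) = delta_id n" using e unfolding dcomp_def lev_def delta_id_def by (intro ext) auto
  then show ?thesis unfolding evp_def cst_def using lev_Sx[OF e] spsD(3)[OF X x] by simp
qed

lemma sps_Pb:
  assumes X: "simp_psh X" "simp_psh Z" and f: "smap X Y f" "smap Z Y g"
  shows "simp_psh (Pull X Z f g)"
  unfolding simp_psh_def Pb_simps
proof (intro conjI allI impI)
  show "psh (psh_pb (SE X n) (SE Z n) (f n) (g n))" for n
    by (rule psh_PBp[OF spsD(1)[OF X(1)] spsD(1)[OF X(2)] smapD(1)[OF f(1)] smapD(1)[OF f(2)]])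
  fix m n \<theta> assume th: "delta_hom m n \<theta>"
  show "pmap (psh_pb (SE X n) (SE Z n) (f n) (g n)) (psh_pb (SE X m) (SE Z m) (f m) (g m)) (\<lambda>p. (SA X m n \<theta> (fst p), SA Z m n \<theta> (snd p)))"
    by (rule pmap_PBp[OF pmap_comp[OF pmap_fst spsD(2)[OF X(1) th]] pmap_comp[OF pmap_snd spsD(2)[OF X(2) th]]])
       (simp add: PE_PBp smapD(2)[OF f(1) th] smapD(2)[OF f(2) th])
qed (auto simp: PE_PBp spsD(3)[OF X(1)] spsD(3)[OF X(2)] spsD(4)[OF X(1)] spsD(4)[OF X(2)] prod_eq_iff)

lemma smap_fst: "smap (Pull X Z f g) X (\<lambda>n. fst)" and smap_snd: "smap (Pull X Z f g) Z (\<lambda>n. snd)"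
  by (rule smapI, simp_all add: Pb_simps pmap_fst pmap_snd)+

lemma smap_Pb:
  assumes "smap W X a" "smap W Z b" "\<And>n U w. U \<in> Ob \<Longrightarrow> w \<in> PE (SE W n) U \<Longrightarrow> f n (a n w) = g n (b n w)"
  shows "smap W (Pull X Z f g) (\<lambda>n w. (a n w, b n w))"
proof (rule smapI)
  show "pmap (SE W n) (SE (Pull X Z f g) n) (\<lambda>w. (a n w, b n w))" for n
    unfolding Pb_simps by (rule pmap_PBp[OF smapD(1)[OF assms(1)] smapD(1)[OF assms(2)]]) (rule assms(3))
qed (simp add: Pb_simps smapD(2)[OF assms(1)] smapD(2)[OF assms(2)])

lemma spb_Pb:
  assumes X: "simp_psh X" "simp_psh Z" "simp_psh Y" and f: "smap X Y f" "smap Z Y g"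
  shows "spb (Pull X Z f g) X Z Y (\<lambda>n. fst) g (\<lambda>n. snd) f"
  unfolding spb_def
proof (intro conjI allI sps_Pb[OF X(1,2) f] X f smap_fst smap_snd)
  fix n show "pb_square (SE (Pull X Z f g) n) (SE X n) (SE Z n) (SE Y n) fst (g n) snd (f n)"
    unfolding Pb_simps
  proof (rule pb_squareI[OF psh_PBp[OF spsD(1)[OF X(1)] spsD(1)[OF X(2)] smapD(1)[OF f(1)] smapD(1)[OF f(2)]] spsD(1)[OF X(2)] pmap_fst smapD(1)[OF f(2)] pmap_snd])
    fix U h x assume "h \<in> PE (SE Z n) U" "x \<in> PE (SE X n) U" "f n x = g n h"
    then show "\<exists>p. p \<in> PE (psh_pb (SE X n) (SE Z n) (f n) (g n)) U \<and> fst p = x \<and> snd p = h"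
      by (intro exI[of _ "(x, h)"]) (simp add: PE_PBp)
  qed (auto simp: PE_PBp prod_eq_iff)
qed

lemma sps_Pw:
  assumes X: "simp_psh X" shows "simp_psh (Powers E X)"
  unfolding simp_psh_def
proof (intro conjI allI impI)
  show "psh (SE (Powers E X) n)" for n
    unfolding psh_def Pw_simps using psh_res[OF spsD(1)[OF X]] psh_id[OF spsD(1)[OF X]] psh_comp[OF spsD(1)[OF X]]
    by (auto simp: fun_eq_iff)
  show "pmap (SE (Powers E X) n) (SE (Powers E X) m) (SA (Powers E X) m n \<theta>)" if "delta_hom m n \<theta>" for m n \<theta>
    unfolding pmap_def Pw_simps using pmap_in[OF spsD(2)[OF X that]] pmap_nat[OF spsD(2)[OF X that]] by (auto simp: fun_eq_iff)
qed (auto simp: Pw_simps spsD(3)[OF X] spsD(4)[OF X] fun_eq_iff)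

lemma smap_pwm:
  assumes f: "smap X Y f" shows "smap (Powers E X) (Powers E Y) (pwm E f)"
proof (rule smapI)
  show "pmap (SE (Powers E X) n) (SE (Powers E Y) n) (pwm E f n)" for n
    unfolding pmap_def Pw_simps pwm_def using pmap_in[OF smapD(1)[OF f]] pmap_nat[OF smapD(1)[OF f]] by (auto simp: fun_eq_iff)
qed (auto simp: Pw_simps pwm_def smapD(2)[OF f] fun_eq_iff)

lemma smap_evE:
  assumes E: "E \<subseteq> {0,1}" shows "smap (PathSp X) (Powers E X) (evE E)"
proof (rule smapI)
  have e01: "e = 0 \<or> e = 1" if "e \<in> E" for e using E that by blast
  note s = smap_evp[OF e01, of _ X]
  show "pmap (SE (PathSp X) n) (SE (Powers E X) n) (evE E n)" for n
    unfolding pmap_def Pw_simps evE_def using pmap_in[OF smapD(1)[OF s]] pmap_nat[OF smapD(1)[OF s]] by (auto simp: fun_eq_iff)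
  show "evE E m (SA (PathSp X) m n \<theta> x) = SA (Powers E X) m n \<theta> (evE E n x)" if "delta_hom m n \<theta>" "U \<in> Ob" "x \<in> PE (SE (PathSp X) n) U" for m n \<theta> U x
    unfolding Pw_simps evE_def using smapD(2)[OF s that] by (auto simp: fun_eq_iff)
qed

lemma sps_BE: "simp_psh X \<Longrightarrow> simp_psh Y \<Longrightarrow> smap X Y f \<Longrightarrow> E \<subseteq> {0,1} \<Longrightarrow> simp_psh (PathRel X Y f E)"
  by (rule sps_Pb[OF sps_Pw sps_P1 smap_pwm smap_evE])

lemma smap_pp:
  assumes f: "smap X Y f" and E: "E \<subseteq> {0,1}" shows "smap (PathSp X) (PathRel X Y f E) (gap E f)"
  unfolding gap_def
proof (rule smap_Pb[OF smap_evE[OF E] smap_P1m[OF f]])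
  have e01: "e = 0 \<or> e = 1" if "e \<in> E" for e using E that by blast
  show "pwm E f n (evE E n w) = evE E n (P1m f n w)" for n w
    unfolding pwm_def evE_def by (intro ext) (simp add: evp_P1m[OF e01])
qed

text \<open>Maps from \<open>S\<close> to a path space correspond to maps from the cylinder on \<open>S\<close>: a simplex \<open>t\<close> of the
  cylinder is read off on the graph \<open>fl m t\<close> of its interval coordinate.\<close>
definition flat :: "nat set set \<Rightarrow> (nat \<Rightarrow> (nat \<Rightarrow> nat) \<Rightarrow> nat \<Rightarrow> (nat \<Rightarrow> nat) \<Rightarrow> 'x) \<Rightarrow> nat \<Rightarrow> (nat \<Rightarrow> nat) \<Rightarrow> 'x" where
  "flat S \<sigma> = (\<lambda>m t. if t \<in> simplices (cylinder S) m then \<sigma> m (dv m t) m (fl m t) else undefined)"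

definition sharp :: "nat set set \<Rightarrow> (nat \<Rightarrow> (nat \<Rightarrow> nat) \<Rightarrow> 'x) \<Rightarrow> nat \<Rightarrow> (nat \<Rightarrow> nat) \<Rightarrow> nat \<Rightarrow> (nat \<Rightarrow> nat) \<Rightarrow> 'x" where
  "sharp S h = (\<lambda>m s. if s \<in> simplices S m then reindex (prism_map s) (prism_cx m) h else undefined)"

lemma flat_app: "t \<in> simplices (cylinder S) m \<Longrightarrow> flat S \<sigma> m t = \<sigma> m (dv m t) m (fl m t)"
  unfolding flat_def by simp

lemma sharp_app: "s \<in> simplices S m \<Longrightarrow> sharp S h m s = reindex (prism_map s) (prism_cx m) h"
  unfolding sharp_def by simp

lemma pmap_flat:
  assumes S: "fin_complex S" shows "pmap (Maps S (PathSp X)) (Maps (cylinder S) X) (flat S)"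
proof (rule pmapI)
  fix U \<sigma> assume s: "\<sigma> \<in> PE (Maps S (PathSp X)) U"
  show "flat S \<sigma> \<in> PE (Maps (cylinder S) X) U"
  proof (rule MpI)
    fix m t assume t: "t \<in> simplices (cylinder S) m"
    show "flat S \<sigma> m t \<in> PE (SE X m) U"
      unfolding flat_app[OF t] using MpD(1)[OF MpD(1)[OF s dv_Sx[OF t], unfolded P1_simps] fl_Sx[OF t]] .
  next
    fix k m \<theta> t assume t: "t \<in> simplices (cylinder S) m" and th: "delta_hom k m \<theta>"
    note t' = dcomp_Sx[OF cx_Xi[OF S] t th]
    have 1: "SA X k m \<theta> (flat S \<sigma> m t) = \<sigma> m (dv m t) k (dcomp k (fl m t) \<theta>)"
      unfolding flat_app[OF t] using MpD(2)[OF MpD(1)[OF s dv_Sx[OF t], unfolded P1_simps] fl_Sx[OF t] th] .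
    have "\<sigma> k (dcomp k (dv m t) \<theta>) = reindex (prism_map \<theta>) (prism_cx k) (\<sigma> m (dv m t))"
      using MpD(2)[OF s dv_Sx[OF t] th] by (simp add: P1_simps)
    moreover have "dcomp k (dv m t) \<theta> = dv k (dcomp k t \<theta>)" by (rule dcomp_swap[OF th])
    moreover have "dcomp k (prism_map \<theta>) (fl k (dcomp k t \<theta>)) = dcomp k (fl m t) \<theta>"
      using th unfolding dcomp_def prism_map_def fl_def delta_hom_def by (intro ext) auto
    ultimately have "flat S \<sigma> k (dcomp k t \<theta>) = \<sigma> m (dv m t) k (dcomp k (fl m t) \<theta>)"
      unfolding flat_app[OF t'] using fl_Sx[OF t'] by (simp add: re_app)
    then show "SA X k m \<theta> (flat S \<sigma> m t) = flat S \<sigma> k (dcomp k t \<theta>)" using 1 by simp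
  qed (simp add: flat_def)
next
  fix U V u \<sigma> assume "\<sigma> \<in> PE (Maps S (PathSp X)) U"
  show "flat S (PR (Maps S (PathSp X)) u \<sigma>) = PR (Maps (cylinder S) X) u (flat S \<sigma>)"
    unfolding PR_Mp P1_simps flat_def post_def using dv_Sx fl_Sx by (intro ext) simp
qed

lemma sharp_Mp:
  assumes S: "fin_complex S" and h: "h \<in> PE (Maps (cylinder S) X) U" shows "sharp S h \<in> PE (Maps S (PathSp X)) U"
proof (rule MpI)
  fix m s assume s: "s \<in> simplices S m"
  show "sharp S h m s \<in> PE (SE (PathSp X) m) U"
    unfolding sharp_app[OF s] P1_simps by (rule re_Mp[OF vmap_pv[OF S s] cx_Pr h])
next
  fix k m \<theta> s assume s: "s \<in> simplices S m" and th: "delta_hom k m \<theta>"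
  show "SA (PathSp X) k m \<theta> (sharp S h m s) = sharp S h k (dcomp k s \<theta>)"
    unfolding sharp_app[OF s] sharp_app[OF dcomp_Sx[OF S s th]] P1_simps by (rule re_pv[OF th])
qed (simp add: sharp_def)

lemma flat_sharp:
  fixes X :: "('o,'m,'x) spsh"
  assumes S: "fin_complex S" and U: "U \<in> Ob" and h: "h \<in> PE (Maps (cylinder S) X) U" shows "flat S (sharp S h) = h"
proof (rule Mp_ext[OF pmap_in[OF pmap_flat[OF S] U sharp_Mp[OF S h]] h])
  fix m t assume t: "t \<in> simplices (cylinder S) m"
  show "flat S (sharp S h) m t = h m t"
    unfolding flat_app[OF t] sharp_app[OF dv_Sx[OF t]] re_app[OF fl_Sx[OF t]] pv_fl[OF t] ..
qed

lemma sharp_flat: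
  fixes X :: "('o,'m,'x) spsh"
  assumes S: "fin_complex S" and U: "U \<in> Ob" and s: "\<sigma> \<in> PE (Maps S (PathSp X)) U" shows "sharp S (flat S \<sigma>) = \<sigma>"
proof (rule Mp_ext[OF sharp_Mp[OF S pmap_in[OF pmap_flat[OF S] U s]] s])
  fix m x assume x: "x \<in> simplices S m"
  have m: "\<sigma> m x \<in> PE (Maps (prism_cx m) X) U" using MpD(1)[OF s x] unfolding P1_simps .
  show "sharp S (flat S \<sigma>) m x = \<sigma> m x"
    unfolding sharp_app[OF x]
  proof (rule Mp_ext[OF re_Mp[OF vmap_pv[OF S x] cx_Pr pmap_in[OF pmap_flat[OF S] U s]] m])
    fix k t assume t: "t \<in> simplices (prism_cx m) k"
    have t': "dcomp k (prism_map x) t \<in> simplices (cylinder S) k" by (rule vmap_Sx[OF vmap_pv[OF S x] t])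
    have "dv k (dcomp k (prism_map x) t) = dcomp k x (dv k t)" "fl k (dcomp k (prism_map x) t) = fl k t"
      unfolding dcomp_def prism_map_def fl_def by (intro ext, simp)+
    \<comment> \<open>Here \<sigma> enters as a simplicial map: its value on the simplex obtained
      from x by an operator is a reindexing of its value on x.\<close>
    moreover have "\<sigma> k (dcomp k x (dv k t)) = reindex (prism_map (dv k t)) (prism_cx k) (\<sigma> m x)"
      using MpD(2)[OF s x dv_delta[OF t]] unfolding P1_simps by simp
    ultimately show "reindex (prism_map x) (prism_cx m) (flat S \<sigma>) k t = \<sigma> m x k t"
      unfolding re_app[OF t] flat_app[OF t'] by (simp add: re_app[OF fl_Sx[OF t]] pv_fl[OF t])
  qed
qed

lemma flat_inj:
  fixes X :: "('o,'m,'x) spsh"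
  assumes "fin_complex S" "U \<in> Ob" "\<sigma> \<in> PE (Maps S (PathSp X)) U" "\<tau> \<in> PE (Maps S (PathSp X)) U" "flat S \<sigma> = flat S \<tau>"
  shows "\<sigma> = \<tau>"
proof -
  have "sharp S (flat S \<sigma>) = sharp S (flat S \<tau>)" using assms(5) by (rule arg_cong)
  then show ?thesis by (simp only: sharp_flat[OF assms(1-3)] sharp_flat[OF assms(1,2,4)])
qed

lemma flat_post: "flat S (post S (P1m f) \<sigma>) = post (cylinder S) f (flat S \<sigma>)"
  unfolding flat_def post_def P1m_def using dv_Sx fl_Sx by (intro ext) simp

lemma flat_rst: "S \<subseteq> T \<Longrightarrow> flat S (restr S \<sigma>) = restr (cylinder S) (flat T \<sigma>)"
  unfolding flat_def post_def using dv_Sx Sx_mono[OF Xi_mono] by (intro ext) simp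

text \<open>A simplex of \<open>levels E n\<close> lies over a single end, read off as the parity of
  its first vertex. Its value is the lift that \<rho> assigns to this end on the projected
  simplex.\<close>

definition lvl :: "nat set \<Rightarrow> nat \<Rightarrow> (nat \<Rightarrow> (nat \<Rightarrow> nat) \<Rightarrow> (nat \<Rightarrow> 'x) \<times> 'z) \<Rightarrow> nat \<Rightarrow> (nat \<Rightarrow> nat) \<Rightarrow> 'x" where
  "lvl E n \<rho> = (\<lambda>m t. if t \<in> simplices (levels E n) m then fst (\<rho> m (dv m t)) (t 0 mod 2) else undefined)"

lemma Lv_dv: "E \<subseteq> {0,1} \<Longrightarrow> t \<in> simplices (levels E n) m \<Longrightarrow> dv m t \<in> simplices (simplex_cx n) m"
  using dv_Sx Sx_mono[OF Lv_Pr] by blast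

lemma pmap_lvl:
  assumes E: "E \<subseteq> {0,1}" and L: "fin_complex (levels E n)"
  shows "pmap (Maps (simplex_cx n) (Pull (Powers E X) Z f g)) (Maps (levels E n) X) (lvl E n)"
proof (rule pmapI)
  fix U \<rho> assume r: "\<rho> \<in> PE (Maps (simplex_cx n) (Pull (Powers E X) Z f g)) U"
  have mem: "fst (\<rho> m s) \<in> PE (SE (Powers E X) m) U" if "s \<in> simplices (simplex_cx n) m" for m s
    using MpD(1)[OF r that] unfolding Pb_simps PE_PBp by simp
  show "lvl E n \<rho> \<in> PE (Maps (levels E n) X) U"
  proof (rule MpI)
    fix m t assume t: "t \<in> simplices (levels E n) m"
    show "lvl E n \<rho> m t \<in> PE (SE X m) U"
      using mem[OF Lv_dv[OF E t]] Lv_parity(1)[OF t E] t unfolding Pw_simps lvl_def by simp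
  next
    fix k m \<theta> t assume t: "t \<in> simplices (levels E n) m" and th: "delta_hom k m \<theta>"
    note t' = dcomp_Sx[OF L t th]
    have p: "dcomp k t \<theta> 0 mod 2 = t 0 mod 2"
      using Lv_parity(2)[OF t E, of "\<theta> 0"] th unfolding dcomp_def delta_hom_def by simp
    have "SA (Pull (Powers E X) Z f g) k m \<theta> (\<rho> m (dv m t)) = \<rho> k (dv k (dcomp k t \<theta>))"
      using MpD(2)[OF r Lv_dv[OF E t] th] dcomp_swap[OF th, of "\<lambda>v. v div 2" t] by simp
    then have "SA (Powers E X) k m \<theta> (fst (\<rho> m (dv m t))) = fst (\<rho> k (dv k (dcomp k t \<theta>)))"
      unfolding Pb_simps prod_eq_iff by simp
    from fun_cong[OF this, of "t 0 mod 2"]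
    have "SA X k m \<theta> (fst (\<rho> m (dv m t)) (t 0 mod 2)) = fst (\<rho> k (dv k (dcomp k t \<theta>))) (t 0 mod 2)"
      unfolding Pw_simps(3) using Lv_parity(1)[OF t E] by simp
    then show "SA X k m \<theta> (lvl E n \<rho> m t) = lvl E n \<rho> k (dcomp k t \<theta>)"
      using t t' p unfolding lvl_def by simp
  qed (simp add: lvl_def)
next
  fix U V u \<rho>
  show "lvl E n (PR (Maps (simplex_cx n) (Pull (Powers E X) Z f g)) u \<rho>) = PR (Maps (levels E n) X) u (lvl E n \<rho>)"
    unfolding PR_Mp lvl_def post_def Pb_simps PR_PBp Pw_simps using Lv_dv[OF E] Lv_parity(1)[OF _ E] by (intro ext) simp
qed

lemma glue_post: "post (S \<union> R) g (glue S R \<sigma> \<tau>) = glue S R (post S g \<sigma>) (post R g \<tau>)"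
  unfolding glue_def post_def Sx_Un by (intro ext) simp

lemma rst_glue: "restr (S \<union> R) \<sigma> = glue S R (restr S \<sigma>) (restr R \<sigma>)"
  unfolding glue_def post_def Sx_Un by (intro ext) simp

text \<open>Lifting a map of path spaces against \<open>S \<subseteq> \<Delta>[n]\<close> is the same as lifting \<open>f\<close> against the pushout product
  of \<open>S \<subseteq> \<Delta>[n]\<close> with the inclusion of \<open>E\<close> into the interval.\<close>
lemma leibniz:
  assumes f: "smap X Y f" and X: "simp_psh X" "simp_psh Y" and E: "E \<subseteq> {0,1}" and Sn: "S \<subseteq> simplex_cx n" and S: "fin_complex S"
    and l: "rel_lift K X Y f (cylinder S \<union> levels E n) (prism_cx n)" and En: "E \<noteq> {}"
  shows "rel_lift K (PathSp X) (PathRel X Y f E) (gap E f) S (simplex_cx n)"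
proof -
  have e01: "e = 0 \<or> e = 1" if "e \<in> E" for e using E that by blast
  obtain e0 where "e0 \<in> E" using En by blast
  then have cL: "fin_complex (levels E n)" using cx_Lv[of e0 E n] finite_subset[OF E] by simp
  note cS = cx_Xi[OF S]
  have cU: "fin_complex (cylinder S \<union> levels E n)" by (rule cx_Un[OF cS cL])
  have UP: "cylinder S \<union> levels E n \<subseteq> prism_cx n" using Xi_mono[OF Sn] Lv_Pr[OF E] by blast
  have D: "fin_complex (simplex_cx n)" by (rule cx_Pow) simp
  let ?B = "PathRel X Y f E"
  note sB = sps_BE[OF X f E] and sP = sps_P1[OF X(1)] and mp = smap_pp[OF f E]
  \<comment> \<open>The uncurried data: ?b1 is the partial map to X on the cylinder of S and on the
    ends in E, and ?b2 is the map to Y on the whole prism.\<close>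
  let ?b1 = "\<lambda>p. glue (cylinder S) (levels E n) (flat S (fst p)) (lvl E n (snd p))"
  let ?b2 = "\<lambda>p. flat (simplex_cx n) (post (simplex_cx n) (\<lambda>m. snd) (snd p))"
  \<comment> \<open>On the overlap both values are an end of the path that p assigns over S, by the
    equation linking the two components of p.\<close>
  have agree: "restr (cylinder S \<inter> levels E n) (flat S (fst p)) = restr (cylinder S \<inter> levels E n) (lvl E n (snd p))"
    if p: "p \<in> PE (RelMaps S (simplex_cx n) (PathSp X) ?B (gap E f)) U" for p U
    unfolding post_eq_iff Sx_Int
  proof (intro allI impI, elim conjE)
    fix m t assume t: "t \<in> simplices (cylinder S) m" "t \<in> simplices (levels E n) m"
    have "post S (gap E f) (fst p) = restr S (snd p)" using p unfolding PE_Rel by simp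
    then have "gap E f m (fst p m (dv m t)) = snd p m (dv m t)" using dv_Sx[OF t(1)] unfolding post_eq_iff by simp
    then have "fst (snd p m (dv m t)) = evE E m (fst p m (dv m t))" unfolding gap_def prod_eq_iff by simp
    then show "flat S (fst p) m t = lvl E n (snd p) m t"
      using t Lv_parity(1)[OF t(2) E] fl_lev[OF t(2) E] unfolding flat_def lvl_def evE_def evp_def by simp
  qed
  have snd_in: "post (simplex_cx n) (\<lambda>m. snd) \<rho> \<in> PE (Maps (simplex_cx n) (PathSp Y)) U" if "\<rho> \<in> PE (Maps (simplex_cx n) ?B) U" "U \<in> Ob" for \<rho> U
    using pmap_in[OF pmap_post[OF smap_snd D D order_refl] that(2,1)] .
  have 1: "pmap (RelMaps S (simplex_cx n) (PathSp X) ?B (gap E f)) (Maps (cylinder S \<union> levels E n) X) ?b1"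
  proof (rule pmapI)
    fix U p assume U: "U \<in> Ob" and p: "p \<in> PE (RelMaps S (simplex_cx n) (PathSp X) ?B (gap E f)) U"
    have q: "fst p \<in> PE (Maps S (PathSp X)) U" "snd p \<in> PE (Maps (simplex_cx n) ?B) U" using p unfolding PE_Rel by auto
    show "?b1 p \<in> PE (Maps (cylinder S \<union> levels E n) X) U"
      by (rule glue_Mp[OF cS cL pmap_in[OF pmap_flat[OF S] U q(1)] pmap_in[OF pmap_lvl[OF E cL] U q(2)] agree[OF p]])
  next
    fix U V u p assume u: "u \<in> H V U" and p: "p \<in> PE (RelMaps S (simplex_cx n) (PathSp X) ?B (gap E f)) U"
    then have "fst p \<in> PE (Maps S (PathSp X)) U" "snd p \<in> PE (Maps (simplex_cx n) ?B) U" unfolding PE_Rel by auto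
    note n = pmap_nat[OF pmap_flat[OF S] u this(1)] pmap_nat[OF pmap_lvl[OF E cL] u this(2)]
    show "?b1 (PR (RelMaps S (simplex_cx n) (PathSp X) ?B (gap E f)) u p) = PR (Maps (cylinder S \<union> levels E n) X) u (?b1 p)"
      unfolding PR_Rel fst_conv snd_conv n unfolding PR_Mp glue_post ..
  qed
  have 2: "pmap (RelMaps S (simplex_cx n) (PathSp X) ?B (gap E f)) (Maps (prism_cx n) Y) ?b2"
    unfolding RelMaps_def
    by (rule pmap_comp[OF pmap_comp[OF pmap_snd pmap_post[OF smap_snd D D order_refl]] pmap_flat[OF D]])
  have 3: "pmap (RelMaps S (simplex_cx n) (PathSp X) ?B (gap E f)) (RelMaps (cylinder S \<union> levels E n) (prism_cx n) X Y f) (\<lambda>p. (?b1 p, ?b2 p))"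
    unfolding RelMaps_def[of "cylinder S \<union> levels E n"]
  proof (rule pmap_PBp[OF 1 2])
    fix U p assume U: "U \<in> Ob" and p: "p \<in> PE (RelMaps S (simplex_cx n) (PathSp X) ?B (gap E f)) U"
    have r: "snd p \<in> PE (Maps (simplex_cx n) ?B) U" "post S (gap E f) (fst p) = restr S (snd p)" using p unfolding PE_Rel by auto
    have "post (cylinder S) f (flat S (fst p)) = restr (cylinder S) (?b2 p)"
      unfolding post_eq_iff
    proof (intro allI impI)
      fix m t assume t: "t \<in> simplices (cylinder S) m"
      note t' = Sx_mono[OF Xi_mono[OF Sn] t]
      have "gap E f m (fst p m (dv m t)) = snd p m (dv m t)" using r(2) dv_Sx[OF t] unfolding post_eq_iff by simp
      then have "snd (snd p m (dv m t)) = P1m f m (fst p m (dv m t))" unfolding gap_def prod_eq_iff by simp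
      then show "f m (flat S (fst p) m t) = ?b2 p m t"
        unfolding flat_app[OF t] flat_app[OF t'] post_app[OF dv_Sx[OF t']] using fl_Sx[OF t] unfolding P1m_def by (simp add: post_app)
    qed
    moreover have "post (levels E n) f (lvl E n (snd p)) = restr (levels E n) (?b2 p)"
      unfolding post_eq_iff
    proof (intro allI impI)
      fix m t assume t: "t \<in> simplices (levels E n) m"
      note t' = Sx_mono[OF Lv_Pr[OF E] t] and s = Lv_dv[OF E t] and eE = Lv_parity(1)[OF t E]
      have "pwm E f m (fst (snd p m (dv m t))) = evE E m (snd (snd p m (dv m t)))"
        using MpD(1)[OF r(1) s] unfolding Pb_simps PE_PBp by simp
      from fun_cong[OF this, of "t 0 mod 2"]
      have "f m (fst (snd p m (dv m t)) (t 0 mod 2)) = evp (t 0 mod 2) m (snd (snd p m (dv m t)))"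
        using eE unfolding pwm_def evE_def by simp
      then show "f m (lvl E n (snd p) m t) = ?b2 p m t"
        unfolding flat_app[OF t'] post_app[OF s] using t fl_lev[OF t E] unfolding lvl_def evp_def by simp
    qed
    ultimately show "post (cylinder S \<union> levels E n) f (?b1 p) = restr (cylinder S \<union> levels E n) (?b2 p)"
      unfolding glue_post rst_glue by simp
  qed
  have "pb_square (Maps (simplex_cx n) (PathSp X)) (Maps (prism_cx n) X) (RelMaps S (simplex_cx n) (PathSp X) ?B (gap E f)) (RelMaps (cylinder S \<union> levels E n) (prism_cx n) X Y f)
      (flat (simplex_cx n)) (\<lambda>p. (?b1 p, ?b2 p)) (\<lambda>\<tau>. (restr S \<tau>, post (simplex_cx n) (gap E f) \<tau>)) (\<lambda>\<tau>. (restr (cylinder S \<union> levels E n) \<tau>, post (prism_cx n) f \<tau>))"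
  proof (rule pb_squareI[OF psh_Mp[OF sP D] psh_Rel[OF mp sP sB S D Sn] pmap_flat[OF D] 3 pmap_to_Rel[OF mp sP sB S D Sn]])
    fix U x assume U: "U \<in> Ob" and x: "x \<in> PE (Maps (simplex_cx n) (PathSp X)) U"
    have "restr (cylinder S) (flat (simplex_cx n) x) = flat S (restr S x)" by (rule flat_rst[OF Sn, symmetric])
    moreover have "restr (levels E n) (flat (simplex_cx n) x) = lvl E n (post (simplex_cx n) (gap E f) x)"
    proof (intro ext)
      fix m t
      show "restr (levels E n) (flat (simplex_cx n) x) m t = lvl E n (post (simplex_cx n) (gap E f) x) m t"
      proof (cases "t \<in> simplices (levels E n) m")
        case True
        show ?thesis
          unfolding post_app[OF True] flat_app[OF Sx_mono[OF Lv_Pr[OF E] True]]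
          unfolding lvl_def using True Lv_parity(1)[OF True E] fl_lev[OF True E]
          by (simp add: post_app[OF Lv_dv[OF E True]] gap_def evE_def evp_def)
      qed (simp add: post_def lvl_def)
    qed
    moreover have "post (simplex_cx n) (\<lambda>m. snd) (post (simplex_cx n) (gap E f) x) = post (simplex_cx n) (P1m f) x"
      unfolding post_post[OF order_refl] by (simp add: gap_def)
    ultimately show "(restr (cylinder S \<union> levels E n) (flat (simplex_cx n) x), post (prism_cx n) f (flat (simplex_cx n) x)) =
      (?b1 (restr S x, post (simplex_cx n) (gap E f) x), ?b2 (restr S x, post (simplex_cx n) (gap E f) x))"
      unfolding rst_glue fst_conv snd_conv by (simp only: flat_post)
  next
    fix U g x assume U: "U \<in> Ob" and g: "g \<in> PE (RelMaps S (simplex_cx n) (PathSp X) ?B (gap E f)) U" and x: "x \<in> PE (Maps (prism_cx n) X) U"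
      and e: "(restr (cylinder S \<union> levels E n) x, post (prism_cx n) f x) = (?b1 g, ?b2 g)"
    obtain \<sigma> \<rho> where p: "g = (\<sigma>, \<rho>)" by (cases g)
    have r: "\<sigma> \<in> PE (Maps S (PathSp X)) U" "\<rho> \<in> PE (Maps (simplex_cx n) ?B) U" using g unfolding PE_Rel p by auto
    have e1: "restr (cylinder S \<union> levels E n) x = glue (cylinder S) (levels E n) (flat S \<sigma>) (lvl E n \<rho>)"
      and e2: "post (prism_cx n) f x = flat (simplex_cx n) (post (simplex_cx n) (\<lambda>m. snd) \<rho>)" using e unfolding p by auto
    note ga = glue_app[OF agree[OF g, unfolded p fst_conv snd_conv]]
    have xS: "x m t = flat S \<sigma> m t" if "t \<in> simplices (cylinder S) m" for m t
      using fun_cong[OF fun_cong[OF e1, of m], of t] ga(1)[OF that] that by (simp add: post_def Sx_Un)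
    have xL: "x m t = lvl E n \<rho> m t" if "t \<in> simplices (levels E n) m" for m t
      using fun_cong[OF fun_cong[OF e1, of m], of t] ga(2)[OF that] that by (simp add: post_def Sx_Un)
    \<comment> \<open>The curried form of x. Its restriction to S and its image in Y are compared
      after uncurrying; its ends are read off from x on \<open>levels E n\<close>.\<close>
    define y where "y = sharp (simplex_cx n) x"
    have y: "y \<in> PE (Maps (simplex_cx n) (PathSp X)) U" unfolding y_def by (rule sharp_Mp[OF D x])
    have fy: "flat (simplex_cx n) y = x" unfolding y_def by (rule flat_sharp[OF D U x])
    have "restr S y = \<sigma>"
    proof (rule flat_inj[OF S U _ r(1)])
      show "restr S y \<in> PE (Maps S (PathSp X)) U" by (rule pmap_in[OF pmap_rst[OF sP S D Sn] U y])
      have "restr (cylinder S) x = restr (cylinder S) (flat S \<sigma>)" unfolding post_eq_iff using xS by simp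
      then show "flat S (restr S y) = flat S \<sigma>"
        unfolding flat_rst[OF Sn] fy using rst_id[OF pmap_in[OF pmap_flat[OF S] U r(1)]] by simp
    qed
    moreover have "post (simplex_cx n) (gap E f) y = \<rho>"
    proof (rule Mp_ext[OF pmap_in[OF pmap_post[OF mp D D order_refl] U y] r(2)])
      have "post (simplex_cx n) (P1m f) y = post (simplex_cx n) (\<lambda>m. snd) \<rho>"
      proof (rule flat_inj[OF D U _ snd_in[OF r(2) U]])
        show "post (simplex_cx n) (P1m f) y \<in> PE (Maps (simplex_cx n) (PathSp Y)) U"
          by (rule pmap_in[OF pmap_post[OF smap_P1m[OF f] D D order_refl] U y])
        show "flat (simplex_cx n) (post (simplex_cx n) (P1m f) y) = flat (simplex_cx n) (post (simplex_cx n) (\<lambda>m. snd) \<rho>)"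
          unfolding flat_post fy by (rule e2)
      qed
      then have sn: "P1m f m (y m s) = snd (\<rho> m s)" if "s \<in> simplices (simplex_cx n) m" for m s using that unfolding post_eq_iff by simp
      fix m s assume s: "s \<in> simplices (simplex_cx n) m"
      have rho: "fst (\<rho> m s) \<in> PE (SE (Powers E X) m) U" using MpD(1)[OF r(2) s] unfolding Pb_simps PE_PBp by simp
      have "evE E m (y m s) = fst (\<rho> m s)"
      proof (intro ext)
        fix d show "evE E m (y m s) d = fst (\<rho> m s) d"
        proof (cases "d \<in> E")
          case True
          have "evp d m (y m s) = x m (dcomp m (prism_map s) (lev d m))"
            unfolding evp_def y_def sharp_app[OF s] by (rule re_app[OF lev_Sx[OF e01[OF True]]])
          also have "\<dots> = fst (\<rho> m s) d"
            unfolding xL[OF lev_Lv[OF True s e01[OF True]]] lvl_def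
            using lev_Lv[OF True s e01[OF True]] dv_pv_lev[OF e01[OF True] s] by simp
          finally show ?thesis using True unfolding evE_def by simp
        qed (use rho in \<open>simp add: Pw_simps evE_def\<close>)
      qed
      then show "post (simplex_cx n) (gap E f) y m s = \<rho> m s" unfolding post_app[OF s] gap_def using sn[OF s] by simp
    qed
    ultimately show "\<exists>z. z \<in> PE (Maps (simplex_cx n) (PathSp X)) U \<and> flat (simplex_cx n) z = x \<and> (restr S z, post (simplex_cx n) (gap E f) z) = g"
      using y fy unfolding p by (intro exI[of _ y] conjI) simp_all
  next
    fix U x y assume "U \<in> Ob" "x \<in> PE (Maps (simplex_cx n) (PathSp X)) U" "y \<in> PE (Maps (simplex_cx n) (PathSp X)) U" "flat (simplex_cx n) x = flat (simplex_cx n) y"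
    then show "x = y" by (rule flat_inj[OF D])
  qed
  from pcov_pullback[OF this l[unfolded rel_lift_def]] show ?thesis unfolding rel_lift_def .
qed

text \<open>The boundary times the interval with one end attached expands to the prism by horns, so
  a fibration has the lifting that \<open>leibniz\<close> asks for.\<close>

lemma leibniz_fibr_hcov:
  assumes K: "stable_class C K" and f: "smap X Y f" "simp_psh X" "simp_psh Y" and h: "fibr K 0 X Y f" and e: "e = 0 \<or> e = 1"
  shows "hcover K (PathSp X) (PathRel X Y f {e}) (gap {e} f)"
  unfolding hcover_def
proof
  fix n
  have "rel_lift K X Y f (cylinder (bdry n) \<union> levels {e} n) (prism_cx n)"
    using e prism_bd_0[OF K f h] prism_bd_1[OF K f h] by auto
  then show "rel_lift K (PathSp X) (PathRel X Y f {e}) (gap {e} f) (bdry n) (simplex_cx n)"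
    by (intro leibniz[OF f _ _ cx_bd]) (use e in \<open>auto simp: bdry_def\<close>)
qed

text \<open>A hypercover lifts against every inclusion of finite complexes, in particular with both
  ends attached to the cylinder of the boundary.\<close>

lemma leibniz_hcov:
  assumes K: "stable_class C K" and f: "smap X Y f" "simp_psh X" "simp_psh Y" and h: "hcover K X Y f"
  shows "hcover K (PathSp X) (PathRel X Y f {0,1}) (gap {0,1} f)"
  unfolding hcover_def
proof
  fix n
  have "cylinder (bdry n) \<union> levels {0,1} n \<subseteq> prism_cx n" using Lv_Pr[of "{0,1}" n] by (auto simp: Xi_bd_iff)
  then have "rel_lift K X Y f (cylinder (bdry n) \<union> levels {0,1} n) (prism_cx n)"
    by (intro hcov_lft[OF K f h cx_XiLv[OF cx_bd] cx_Pr]) simp_all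
  then show "rel_lift K (PathSp X) (PathRel X Y f {0,1}) (gap {0,1} f) (bdry n) (simplex_cx n)"
    by (intro leibniz[OF f _ _ cx_bd]) (auto simp: bdry_def)
qed

text \<open>The bound N survives because every cell used on the prism over Delta[n] has dimension at
  least n.\<close>

lemma leibniz_fibr:
  assumes K: "stable_class C K" and f: "smap X Y f" "simp_psh X" "simp_psh Y" and h: "fibr K N X Y f"
  shows "fibr K N (PathSp X) (PathRel X Y f {0,1}) (gap {0,1} f)" "fibr K N (PathSp X) (PathRel X Y f {0}) (gap {0} f)"
  unfolding fibr_def
proof (intro allI impI)
  fix n i :: nat assume n: "0 < n" "N \<le> n" "i \<le> n"
  show "rel_lift K (PathSp X) (PathRel X Y f {0,1}) (gap {0,1} f) (horn_cx n i) (simplex_cx n)"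
    by (intro leibniz[OF f _ _ cx_hn[OF n(1)] prism_hn_01[OF K f h n(2,3,1)]]) (auto simp: horn_cx_def)
next
  show "\<forall>n i. 0 < n \<longrightarrow> N \<le> n \<longrightarrow> i \<le> n \<longrightarrow> rel_lift K (PathSp X) (PathRel X Y f {0}) (gap {0} f) (horn_cx n i) (simplex_cx n)"
  proof (intro allI impI)
    fix n i :: nat assume n: "0 < n" "N \<le> n" "i \<le> n"
    show "rel_lift K (PathSp X) (PathRel X Y f {0}) (gap {0} f) (horn_cx n i) (simplex_cx n)"
      by (intro leibniz[OF f _ _ cx_hn[OF n(1)] prism_hn_0[OF K f h n(2,3,1)]]) (auto simp: horn_cx_def)
  qed
qed

end

section \<open>Weak equivalences of simplicial presheaves\<close>

definition point :: "('o,'m,unit) spsh" where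
  "point = \<lparr>SE = (\<lambda>n. \<lparr>PE = (\<lambda>U. {()}), PR = (\<lambda>u x. ())\<rparr>), SA = (\<lambda>m n \<theta> x. ())\<rparr>"

abbreviation bang :: "nat \<Rightarrow> 'x \<Rightarrow> unit" where "bang \<equiv> \<lambda>n x. ()"

abbreviation "PathOver X Y f \<equiv> Pull X (PathSp Y) f (evp 0)"

definition qf :: "nat \<Rightarrow> 'x \<times> (nat \<Rightarrow> (nat \<Rightarrow> nat) \<Rightarrow> 'y) \<Rightarrow> 'y" where
  "qf n p = evp 1 n (snd p)"

text \<open>The section of the projection from P(f) to X through which f factors.\<close>

definition const_path :: "('o,'m,'y) spsh \<Rightarrow> (nat \<Rightarrow> 'x \<Rightarrow> 'y) \<Rightarrow> nat \<Rightarrow> 'x \<Rightarrow> 'x \<times> (nat \<Rightarrow> (nat \<Rightarrow> nat) \<Rightarrow> 'y)" where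
  "const_path Y f n x = (x, cst Y n (f n x))"

definition endpoints :: "(nat \<Rightarrow> 'w \<Rightarrow> 'x) \<Rightarrow> (nat \<Rightarrow> 'w \<Rightarrow> 'x) \<Rightarrow> nat \<Rightarrow> 'w \<Rightarrow> nat \<Rightarrow> 'x" where
  "endpoints a b n w = (\<lambda>e. if e = 0 then a n w else if e = 1 then b n w else undefined)"

context cat_loc begin

lemma sps_pt: "simp_psh point"
  unfolding simp_psh_def point_def psh_def pmap_def by simp

lemma smap_bang: "smap X point bang"
  unfolding smap_def point_def pmap_def by simp

lemma spbI:
  assumes "simp_psh X'" "simp_psh X" "simp_psh Y'" "simp_psh Y" "smap X' X a" "smap Y' Y b" "smap X' Y' f'" "smap X Y f"
    and "\<And>n U x. U \<in> Ob \<Longrightarrow> x \<in> PE (SE X' n) U \<Longrightarrow> f n (a n x) = b n (f' n x)"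
    and "\<And>n U g x. U \<in> Ob \<Longrightarrow> g \<in> PE (SE Y' n) U \<Longrightarrow> x \<in> PE (SE X n) U \<Longrightarrow> f n x = b n g \<Longrightarrow>
      \<exists>x'. x' \<in> PE (SE X' n) U \<and> a n x' = x \<and> f' n x' = g"
    and "\<And>n U x y. U \<in> Ob \<Longrightarrow> x \<in> PE (SE X' n) U \<Longrightarrow> y \<in> PE (SE X' n) U \<Longrightarrow> a n x = a n y \<Longrightarrow> f' n x = f' n y \<Longrightarrow> x = y"
  shows "spb X' X Y' Y a b f' f"
  unfolding spb_def
proof (intro conjI allI assms(1-8))
  fix n show "pb_square (SE X' n) (SE X n) (SE Y' n) (SE Y n) (a n) (b n) (f' n) (f n)"
    by (rule pb_squareI[OF spsD(1)[OF assms(1)] spsD(1)[OF assms(3)] smapD(1)[OF assms(5)] smapD(1)[OF assms(6)] smapD(1)[OF assms(7)]])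
       (fact assms(9-11))+
qed

text \<open>Maps of presheaves are functions on whole types and may differ off the presheaf. The
  identity square replaces one by another that agrees with it on elements.\<close>

lemma spb_cong:
  assumes "simp_psh X" "simp_psh Y" "smap X Y f" "smap X Y g" "\<And>n U x. U \<in> Ob \<Longrightarrow> x \<in> PE (SE X n) U \<Longrightarrow> f n x = g n x"
  shows "spb X X Y Y (\<lambda>n x. x) (\<lambda>n x. x) g f"
proof (rule spbI)
  fix n U h x assume h: "U \<in> Ob" "h \<in> PE (SE Y n) U" "x \<in> PE (SE X n) U" "f n x = h"
  then show "\<exists>x'. x' \<in> PE (SE X n) U \<and> x' = x \<and> g n x' = h" using assms(5)[OF h(1,3)] by simp
qed (use assms smap_id in simp_all)

lemma spb_Pb':
  assumes X: "simp_psh X" "simp_psh Z" "simp_psh Y" and f: "smap X Y f" "smap Z Y g"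
  shows "spb (Pull X Z f g) Z X Y (\<lambda>n. snd) f (\<lambda>n. fst) g"
proof (rule spbI[OF sps_Pb[OF X(1,2) f] X(2,1,3) smap_snd f(1) smap_fst f(2)])
  fix n U h x assume "h \<in> PE (SE X n) U" "x \<in> PE (SE Z n) U" "g n x = f n h"
  then show "\<exists>p. p \<in> PE (SE (Pull X Z f g) n) U \<and> snd p = x \<and> fst p = h"
    by (intro exI[of _ "(h, x)"]) (simp add: Pb_simps PE_PBp)
qed (auto simp: Pb_simps PE_PBp prod_eq_iff)

lemma hcovD: "hcover K X Y f \<Longrightarrow> rel_lift K X Y f (bdry n) (simplex_cx n)"
  unfolding hcover_def by blast

lemma bd_Dl: "bdry n \<subseteq> simplex_cx n" and hn_Dl: "horn_cx n i \<subseteq> simplex_cx n"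
  unfolding bdry_def horn_cx_def by auto

lemma cx_Dl: "fin_complex (simplex_cx n)" by (rule cx_Pow) simp

lemma hcov_pullback: "spb X' X Y' Y a b f' f \<Longrightarrow> hcover K X Y f \<Longrightarrow> hcover K X' Y' f'"
  unfolding hcover_def using lft_pullback[OF _ cx_bd cx_Dl bd_Dl] by blast

lemma fibr_pullback: "spb X' X Y' Y a b f' f \<Longrightarrow> fibr K N X Y f \<Longrightarrow> fibr K N X' Y' f'"
  unfolding fibr_def using lft_pullback[OF _ cx_hn cx_Dl hn_Dl] by blast

lemma hcov_cong:
  assumes "hcover K X Y f" "simp_psh X" "simp_psh Y" "smap X Y f" "smap X Y g" "\<And>n U x. U \<in> Ob \<Longrightarrow> x \<in> PE (SE X n) U \<Longrightarrow> f n x = g n x"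
  shows "hcover K X Y g"
  using hcov_pullback[OF spb_cong[OF assms(2-6)] assms(1)] .

lemma fibr_cong:
  assumes "fibr K N X Y f" "simp_psh X" "simp_psh Y" "smap X Y f" "smap X Y g" "\<And>n U x. U \<in> Ob \<Longrightarrow> x \<in> PE (SE X n) U \<Longrightarrow> f n x = g n x"
  shows "fibr K N X Y g"
  using fibr_pullback[OF spb_cong[OF assms(2-6)] assms(1)] .

lemma hcov_comp:
  assumes "stable_class C K" "smap X Y f" "smap Y Z g" "simp_psh X" "simp_psh Y" "simp_psh Z" "hcover K X Y f" "hcover K Y Z g"
  shows "hcover K X Z (\<lambda>n x. g n (f n x))"
  unfolding hcover_def using lft_comp[OF assms(1-6) cx_bd cx_Dl bd_Dl hcovD[OF assms(7)] hcovD[OF assms(8)]] by blast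

lemma fibr_comp:
  assumes "stable_class C K" "smap X Y f" "smap Y Z g" "simp_psh X" "simp_psh Y" "simp_psh Z" "fibr K N X Y f" "fibr K N Y Z g"
  shows "fibr K N X Z (\<lambda>n x. g n (f n x))"
  unfolding fibr_def
proof (intro allI impI)
  fix n i :: nat assume n: "0 < n" "N \<le> n" "i \<le> n"
  show "rel_lift K X Z (\<lambda>n x. g n (f n x)) (horn_cx n i) (simplex_cx n)"
    using lft_comp[OF assms(1-6) cx_hn[OF n(1)] cx_Dl hn_Dl] assms(7,8) n unfolding fibr_def by simp
qed

lemma hcov_sbij:
  assumes "stable_class C K" "sbij X Y f" "simp_psh X" "simp_psh Y" shows "hcover K X Y f"
  unfolding hcover_def using lft_sbij[OF assms cx_bd cx_Dl bd_Dl] by blast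

lemma fibr_sbij:
  assumes "stable_class C K" "sbij X Y f" "simp_psh X" "simp_psh Y" shows "fibr K N X Y f"
  unfolding fibr_def using lft_sbij[OF assms cx_hn cx_Dl hn_Dl] by blast

lemma sbijI:
  assumes "smap X Y f"
    and "\<And>n U y. U \<in> Ob \<Longrightarrow> y \<in> PE (SE Y n) U \<Longrightarrow> \<exists>x. x \<in> PE (SE X n) U \<and> f n x = y"
    and "\<And>n U x y. U \<in> Ob \<Longrightarrow> x \<in> PE (SE X n) U \<Longrightarrow> y \<in> PE (SE X n) U \<Longrightarrow> f n x = f n y \<Longrightarrow> x = y"
  shows "sbij X Y f"
  unfolding sbij_def
proof (intro conjI assms(1) allI impI)
  fix n U assume U: "U \<in> Ob"
  show "bij_betw (f n) (PE (SE X n) U) (PE (SE Y n) U)"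
    unfolding bij_betw_def
  proof
    show "inj_on (f n) (PE (SE X n) U)" using assms(3)[OF U] by (rule inj_onI)
    show "f n ` PE (SE X n) U = PE (SE Y n) U"
      using pmap_in[OF smapD(1)[OF assms(1)] U] assms(2)[OF U] by (auto simp: image_iff) metis
  qed
qed

lemma sbij_id: "simp_psh X \<Longrightarrow> sbij X X (\<lambda>n x. x)"
  unfolding sbij_def using smap_id by (auto simp: bij_betw_def)

lemma hcov_fibr:
  assumes "stable_class C K" "smap X Y f" "simp_psh X" "simp_psh Y" "hcover K X Y f" shows "fibr K N X Y f"
  unfolding fibr_def using hcov_lft[OF assms cx_hn cx_Dl hn_Dl] by blast

lemma smap_pr:
  assumes "smap W X a" "smap W X b" shows "smap W (Powers {0,1} X) (endpoints a b)"
proof (rule smapI)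
  show "pmap (SE W n) (SE (Powers {0,1} X) n) (endpoints a b n)" for n
    by (rule pmapI) (auto simp: Pw_simps endpoints_def pmap_in[OF smapD(1)[OF assms(1)]] pmap_in[OF smapD(1)[OF assms(2)]]
      pmap_nat[OF smapD(1)[OF assms(1)]] pmap_nat[OF smapD(1)[OF assms(2)]] fun_eq_iff)
qed (auto simp: Pw_simps endpoints_def smapD(2)[OF assms(1)] smapD(2)[OF assms(2)] fun_eq_iff)

lemma Mp_pt: "\<gamma> \<in> PE (Maps S point) U"
  by (rule MpI) (auto simp: point_def)

lemma unit_fun: "(\<gamma> :: nat \<Rightarrow> (nat \<Rightarrow> nat) \<Rightarrow> unit) = \<delta>"
  by (intro ext) simp

lemma BE_iff: "p \<in> PE (SE (PathRel X Y f E) n) U \<longleftrightarrow> (\<forall>e\<in>E. fst p e \<in> PE (SE X n) U) \<and> (\<forall>e. e \<notin> E \<longrightarrow> fst p e = undefined) \<and>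
    snd p \<in> PE (SE (PathSp Y) n) U \<and> (\<forall>e\<in>E. f n (fst p e) = evp e n (snd p))"
  unfolding Pb_simps PE_PBp Pw_simps pwm_def evE_def fun_eq_iff by auto

lemma sbij_BE_single:
  assumes f: "smap X Y f" "simp_psh X" "simp_psh Y" and e: "e = 0 \<or> e = 1"
  shows "sbij (PathRel X Y f {e}) (Pull X (PathSp Y) f (evp e)) (\<lambda>n p. (fst p e, snd p))"
proof (rule sbijI)
  have ev: "smap (Powers {e} X) X (\<lambda>n \<xi>. \<xi> e)"
    by (rule smapI, rule pmapI) (simp_all add: Pw_simps)
  show "smap (PathRel X Y f {e}) (Pull X (PathSp Y) f (evp e)) (\<lambda>n p. (fst p e, snd p))"
    by (rule smap_Pb[OF smap_comp[OF smap_fst ev] smap_snd]) (simp add: BE_iff)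
  fix n U y assume "y \<in> PE (SE (Pull X (PathSp Y) f (evp e)) n) U"
  then have "fst y \<in> PE (SE X n) U" "snd y \<in> PE (SE (PathSp Y) n) U" "f n (fst y) = evp e n (snd y)"
    by (simp_all add: Pb_simps PE_PBp)
  then show "\<exists>x. x \<in> PE (SE (PathRel X Y f {e}) n) U \<and> (fst x e, snd x) = y"
    unfolding BE_iff by (intro exI[of _ "(\<lambda>d. if d = e then fst y else undefined, snd y)"]) simp
next
  fix n U x y assume "x \<in> PE (SE (PathRel X Y f {e}) n) U" "y \<in> PE (SE (PathRel X Y f {e}) n) U" "(fst x e, snd x) = (fst y e, snd y)"
  then show "x = y" unfolding BE_iff by (auto simp: prod_eq_iff fun_eq_iff) metis
qed

text \<open>A path in the point carries no data.\<close>

lemma sbij_Pb_pt: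
  fixes X :: "('o,'m,'x) spsh"
  assumes X: "simp_psh X"
  shows "sbij (Pull X (PathSp point) bang (evp e)) X (\<lambda>n p. fst p)"
proof (rule sbijI[OF smap_fst])
  fix n U y assume "y \<in> PE (SE X n) U"
  then show "\<exists>x. x \<in> PE (SE (Pull X (PathSp point) bang (evp e)) n) U \<and> fst x = y"
    by (intro exI[of _ "(y, \<lambda>_ _. ())"]) (simp add: Pb_simps PE_PBp P1_simps Mp_pt)
next
  fix x y :: "'x \<times> (nat \<Rightarrow> (nat \<Rightarrow> nat) \<Rightarrow> unit)"
  assume "fst x = fst y" then show "x = y" by (intro prod_eqI unit_fun)
qed

lemma sps_Pf: "smap X Y f \<Longrightarrow> simp_psh X \<Longrightarrow> simp_psh Y \<Longrightarrow> simp_psh (PathOver X Y f)"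
  by (rule sps_Pb[OF _ sps_P1 _ smap_evp]) simp_all

lemma smap_qf: "smap (PathOver X Y f) Y qf"
  unfolding qf_def by (rule smap_comp[OF smap_snd smap_evp]) simp

text \<open>The gap map for a single end e, with the power indexed by {e} replaced by X
  itself.\<close>

lemma hcov_gap:
  assumes K: "stable_class C K" and f: "smap X Y f" "simp_psh X" "simp_psh Y" and h: "fibr K 0 X Y f" and e: "e = 0 \<or> e = 1"
  shows "hcover K (PathSp X) (Pull X (PathSp Y) f (evp e)) (\<lambda>n \<gamma>. (evp e n \<gamma>, P1m f n \<gamma>))"
proof -
  have E: "{e} \<subseteq> {0,1}" using e by auto
  note s = sps_BE[OF f(2,3,1) E] sps_Pb[OF f(2) sps_P1[OF f(3)] f(1) smap_evp[OF e]] sbij_BE_single[OF f e]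
  have "hcover K (PathSp X) (Pull X (PathSp Y) f (evp e)) (\<lambda>n \<gamma>. (fst (gap {e} f n \<gamma>) e, snd (gap {e} f n \<gamma>)))"
    using hcov_comp[OF K smap_pp[OF f(1) E] _ sps_P1[OF f(2)] s(1,2) leibniz_fibr_hcov[OF K f h e] hcov_sbij[OF K s(3,1,2)]]
      s(3)[unfolded sbij_def] by blast
  then show ?thesis by (simp add: gap_def evE_def)
qed

text \<open>This is the gap map of X over the point, whose target is X up to a levelwise
  bijection.\<close>

lemma hcov_evp:
  assumes K: "stable_class C K" and X: "simp_psh X" and h: "fibr K 0 X point bang" and e: "e = 0 \<or> e = 1"
  shows "hcover K (PathSp X) X (evp e)"
proof -
  note s = sps_Pb[OF X sps_P1[OF sps_pt] smap_bang smap_evp[OF e]]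
  have m: "smap (PathSp X) (Pull X (PathSp point) bang (evp e)) (\<lambda>n \<gamma>. (evp e n \<gamma>, P1m bang n \<gamma>))"
    by (rule smap_Pb[OF smap_evp[OF e] smap_P1m[OF smap_bang]]) simp
  show ?thesis
    using hcov_comp[OF K m smap_fst sps_P1[OF X] s X hcov_gap[OF K smap_bang X sps_pt h e] hcov_sbij[OF K sbij_Pb_pt[OF X] s X]]
    by simp
qed

text \<open>P(f) is pulled back along \<open>evp 0\<close>, so this transfers the fillers of Y to
  the projection from P(f) to X.\<close>

lemma fibr_evp0:
  assumes K: "stable_class C K" and X: "simp_psh X" and h: "fibr K N X point bang"
  shows "fibr K N (PathSp X) X (evp 0)"
proof -
  have E: "{0} \<subseteq> {0::nat,1}" by simp
  have e: "0 = (0::nat) \<or> 0 = (1::nat)" by simp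
  note s = sps_BE[OF X sps_pt smap_bang E] sps_Pb[OF X sps_P1[OF sps_pt] smap_bang smap_evp[OF e]]
  note b = sbij_BE_single[OF smap_bang X sps_pt e] sbij_Pb_pt[OF X, of 0]
  note m = b(1)[unfolded sbij_def, THEN conjunct1] b(2)[unfolded sbij_def, THEN conjunct1]
  note 1 = fibr_comp[OF K smap_pp[OF smap_bang E] m(1) sps_P1[OF X] s leibniz_fibr(2)[OF K smap_bang X sps_pt h] fibr_sbij[OF K b(1) s]]
  from fibr_comp[OF K smap_comp[OF smap_pp[OF smap_bang E] m(1)] m(2) sps_P1[OF X] s(2) X 1 fibr_sbij[OF K b(2) s(2) X]]
  show ?thesis by (simp add: gap_def evE_def)
qed

lemma fibr_fst_Pf:
  assumes K: "stable_class C K" and f: "smap X Y f" "simp_psh X" "simp_psh Y" and h: "fibr K N Y point bang"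
  shows "fibr K N (PathOver X Y f) X (\<lambda>n. fst)"
  by (rule fibr_pullback[OF spb_Pb'[OF f(2) sps_P1[OF f(3)] f(3) f(1) smap_evp] fibr_evp0[OF K f(3) h]]) simp

lemma hcov_fst_Pf:
  assumes K: "stable_class C K" and f: "smap X Y f" "simp_psh X" "simp_psh Y" and h: "fibr K 0 Y point bang"
  shows "hcover K (PathOver X Y f) X (\<lambda>n. fst)"
  by (rule hcov_pullback[OF spb_Pb'[OF f(2) sps_P1[OF f(3)] f(3) f(1) smap_evp] hcov_evp[OF K f(3) h]]) simp_all

text \<open>Fillers for the projection to X are composed with those of X. With covers this makes
  P(f) Kan; with isomorphisms and N = k + 1 it gives the truncation condition of a
  k-groupoid.\<close>

lemma fibr_Pf:
  assumes K: "stable_class C K" and f: "smap X Y f" "simp_psh X" "simp_psh Y" and h: "fibr K N Y point bang" "fibr K N X point bang"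
  shows "fibr K N (PathOver X Y f) point bang"
  using fibr_comp[OF K smap_fst smap_bang sps_Pf[OF f] f(2) sps_pt fibr_fst_Pf[OF K f h(1)] h(2)] .

text \<open>The map factors as \<open>PathOver X Y f \<rightarrow> X \<times> Y \<rightarrow> Y\<close>, where the first map is pulled back from
  the fibration of the path space of \<open>Y\<close> over \<open>Y \<times> Y\<close>.\<close>
lemma fibr_qf:
  assumes K: "stable_class C K" and f: "smap X Y f" "simp_psh X" "simp_psh Y" and h: "fibr K N Y point bang" "fibr K N X point bang"
  shows "fibr K N (PathOver X Y f) Y qf"
proof -
  let ?Q = "Pull X Y bang bang" and ?B = "PathRel Y point bang {0,1}"
  have e: "0 = (0::nat) \<or> 0 = (1::nat)" "1 = (0::nat) \<or> 1 = (1::nat)" by simp_all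
  note sQ = sps_Pb[OF f(2,3) smap_bang smap_bang]
  \<comment> \<open>Over the point, \<open>PathRel\<close> with both ends amounts to Y \<times> Y,
    and ?b is f \<times> id into it.\<close>
  let ?b = "\<lambda>n p. (endpoints (\<lambda>n p. f n (fst p)) (\<lambda>n. snd) n p, \<lambda>k t. ())" and ?v = "\<lambda>n p. (fst p, qf n p)"
  have b: "smap ?Q ?B ?b"
  proof (rule smap_Pb[OF smap_pr[OF smap_comp[OF smap_fst f(1)] smap_snd]])
    show "smap ?Q (PathSp point) (\<lambda>n p k t. ())"
      by (rule smapI, rule pmapI) (simp_all add: P1_simps Mp_pt unit_fun)
  qed (simp add: pwm_def evE_def fun_eq_iff)
  have v: "smap (PathOver X Y f) ?Q ?v" by (rule smap_Pb[OF smap_fst smap_qf]) simp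
  have "spb (PathOver X Y f) (PathSp Y) ?Q ?B (\<lambda>n. snd) ?b ?v (gap {0,1} bang)"
  proof (rule spbI[OF sps_Pf[OF f] sps_P1[OF f(3)] sQ sps_BE[OF f(3) sps_pt smap_bang order_refl] smap_snd b v smap_pp[OF smap_bang order_refl]])
    fix n U p assume "p \<in> PE (SE (PathOver X Y f) n) U"
    then have "evp 0 n (snd p) = f n (fst p)" by (simp add: Pb_simps PE_PBp)
    then show "gap {0,1} bang n (snd p) = ?b n (?v n p)"
      by (auto simp: gap_def evE_def endpoints_def qf_def fun_eq_iff)
  next
    fix n U g x assume g: "g \<in> PE (SE ?Q n) U" and x: "x \<in> PE (SE (PathSp Y) n) U" and h: "gap {0,1} bang n x = ?b n g"
    then have "evE {0,1} n x = endpoints (\<lambda>n p. f n (fst p)) (\<lambda>n. snd) n g" by (simp add: gap_def)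
    from fun_cong[OF this, of 0] fun_cong[OF this, of 1]
    have "evp 0 n x = f n (fst g)" "evp 1 n x = snd g" by (simp_all add: evE_def endpoints_def)
    then show "\<exists>p. p \<in> PE (SE (PathOver X Y f) n) U \<and> snd p = x \<and> (fst p, qf n p) = g"
      using g x by (intro exI[of _ "(fst g, x)"]) (simp add: Pb_simps PE_PBp qf_def)
  qed (auto simp: prod_eq_iff)
  from fibr_pullback[OF this leibniz_fibr(1)[OF K smap_bang f(3) sps_pt h(1)]]
  have 1: "fibr K N (PathOver X Y f) ?Q ?v" .
  have 2: "fibr K N ?Q Y (\<lambda>n. snd)"
    by (rule fibr_pullback[OF spb_Pb[OF f(2,3) sps_pt smap_bang smap_bang] h(2)])
  from fibr_comp[OF K v smap_snd sps_Pf[OF f] sQ f(3) 1 2] show ?thesis by simp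
qed

lemma smap_sf:
  assumes f: "smap X Y f" "simp_psh X" "simp_psh Y" shows "smap X (PathOver X Y f) (const_path Y f)"
  unfolding const_path_def
  by (rule smap_Pb[OF smap_id[OF f(2)] smap_comp[OF f(1) smap_cst[OF f(3)]]])
     (simp add: evp_cst[OF _ f(3) _ pmap_in[OF smapD(1)[OF f(1)]]])

lemma qf_sf:
  assumes f: "smap X Y f" "simp_psh Y" and x: "U \<in> Ob" "x \<in> PE (SE X n) U"
  shows "qf n (const_path Y f n x) = f n x"
  unfolding qf_def const_path_def using evp_cst[OF _ f(2) x(1) pmap_in[OF smapD(1)[OF f(1)] x]] by simp

text \<open>This supplies the arrows to which (D3) is applied when hypercovers are
  cancelled.\<close>

definition srep :: "('o,'m,'x) spsh \<Rightarrow> bool" where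
  "srep X \<longleftrightarrow> (\<forall>T. fin_complex T \<longrightarrow> representable (Maps T X))"

definition good :: "('o,'m,'x) spsh \<Rightarrow> bool" where
  "good X \<longleftrightarrow> simp_psh X \<and> srep X"

end

context descent begin

lemma representable_PBp:
  assumes F: "psh F" "psh G" "psh J" "pmap F J \<phi>" "pmap G J \<psi>"
    and r: "representable F" "representable G" "representable J"
  shows "representable (psh_pb F G \<phi> \<psi>)"
proof (rule representable_pullback[OF _ F(1,3,4) r(1,3,2)])
  show "pb_square (psh_pb F G \<phi> \<psi>) F G J fst \<psi> snd \<phi>"
  proof (rule pb_squareI[OF psh_PBp[OF F(1,2,4,5)] F(2) pmap_fst F(5) pmap_snd])
    fix U g x assume "g \<in> PE G U" "x \<in> PE F U" "\<phi> x = \<psi> g"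
    then show "\<exists>p. p \<in> PE (psh_pb F G \<phi> \<psi>) U \<and> fst p = x \<and> snd p = g" by (intro exI[of _ "(x, g)"]) (simp add: PE_PBp)
  qed (auto simp: PE_PBp prod_eq_iff)
qed

lemma srepD: "srep X \<Longrightarrow> fin_complex T \<Longrightarrow> representable (Maps T X)"
  unfolding srep_def by blast

lemma representable_Rel:
  assumes f: "smap X Y f" "simp_psh X" "simp_psh Y" and r: "srep X" "srep Y" and S: "fin_complex S" "fin_complex T" "S \<subseteq> T"
  shows "representable (RelMaps S T X Y f)"
  unfolding RelMaps_def
  by (rule representable_PBp[OF psh_Mp[OF f(2) S(1)] psh_Mp[OF f(3) S(2)] psh_Mp[OF f(3) S(1)] pmap_post[OF f(1) S(1,1) order_refl]
    pmap_rst[OF f(3) S] srepD[OF r(1) S(1)] srepD[OF r(2) S(2)] srepD[OF r(2) S(1)]])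

lemma lft_arrows:
  assumes f: "smap X Y f" "simp_psh X" "simp_psh Y" and r: "srep X" "srep Y" and S: "fin_complex S" "fin_complex T" "S \<subseteq> T"
  shows "rel_lift (cAr C) X Y f S T"
  unfolding rel_lift_def
  by (rule pcov_arrows[OF psh_Mp[OF f(2) S(2)] psh_Rel[OF f S] pmap_to_Rel[OF f S] srepD[OF r(1) S(2)] representable_Rel[OF f r S]])

lemma cx_single: "fin_complex {{}}" unfolding fin_complex_def by simp

text \<open>Lifting from the empty complex with all arrows as class says that Map(T, X) is
  relatively representable over Map(T, Y).\<close>

lemma srep_lft:
  assumes f: "smap X Y f" "simp_psh X" "simp_psh Y" and r: "srep Y" and l: "\<And>T. fin_complex T \<Longrightarrow> rel_lift (cAr C) X Y f {{}} T"
  shows "srep X"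
  unfolding srep_def
proof (intro allI impI)
  fix T assume T: "fin_complex T"
  show "representable (Maps T X)"
    by (rule representable_pcov[OF psh_Mp[OF f(2) T] psh_Mp[OF f(3) T] pmap_post[OF f(1) T T order_refl]
      lft_empty[OF stable_arrows f T l[OF T]] srepD[OF r T]])
qed

lemma srep_pullback:
  assumes q: "spb X' X Y' Y a b f' f" and r: "srep X" "srep Y" "srep Y'"
  shows "srep X'"
proof -
  have s: "simp_psh X'" "simp_psh X" "simp_psh Y'" "simp_psh Y" "smap X' Y' f'" "smap X Y f" using q unfolding spb_def by blast+
  show ?thesis
  proof (rule srep_lft[OF s(5,1,3) r(3)])
    fix T assume T: "fin_complex T"
    have "{{}} \<subseteq> T" using cx_empty[OF T] by blast
    then show "rel_lift (cAr C) X' Y' f' {{}} T"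
      using lft_pullback[OF q cx_single T _ lft_arrows[OF s(6,2,4) r(1,2) cx_single T]] by blast
  qed
qed

lemma srep_sbij:
  assumes "sbij X Y f" "simp_psh X" "simp_psh Y" "srep Y" shows "srep X"
proof (rule srep_lft[OF assms(1)[unfolded sbij_def, THEN conjunct1] assms(2-4)])
  fix T assume T: "fin_complex T"
  show "rel_lift (cAr C) X Y f {{}} T"
    by (rule lft_sbij[OF stable_arrows assms(1-3) cx_single T]) (use cx_empty[OF T] in blast)
qed

lemma good_pullback: "spb X' X Y' Y a b f' f \<Longrightarrow> good X \<Longrightarrow> good Y \<Longrightarrow> good Y' \<Longrightarrow> good X'"
  unfolding good_def using srep_pullback unfolding spb_def by blast

lemma goodD: "good X \<Longrightarrow> simp_psh X" "good X \<Longrightarrow> srep X"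
  unfolding good_def by auto

lemma good_Pb:
  assumes "good X" "good Z" "good Y" "smap X Y f" "smap Z Y g" shows "good (Pull X Z f g)"
  using good_pullback[OF spb_Pb[OF goodD(1)[OF assms(1)] goodD(1)[OF assms(2)] goodD(1)[OF assms(3)] assms(4,5)] assms(1,3,2)] .

text \<open>Maps from T to the path space are maps from the cylinder of T to X, and the cylinder of
  a finite complex is again one.\<close>

lemma good_P1:
  fixes X :: "('o,'m,'x) spsh"
  assumes X: "good X" shows "good (PathSp X)"
  unfolding good_def srep_def
proof (intro conjI allI impI sps_P1[OF goodD(1)[OF X]])
  note sX = goodD(1)[OF X]
  fix T assume T: "fin_complex T"
  note p = psh_Mp[OF sps_P1[OF sX] T] psh_Mp[OF sX cx_Xi[OF T]]
  have "pcov (cAr C) (Maps T (PathSp X)) (Maps (cylinder T) X) (flat T)"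
  proof (rule pcov_bij[OF stable_arrows p(1) pmap_flat[OF T] p(2)])
    fix U y assume U: "U \<in> Ob" and y: "y \<in> PE (Maps (cylinder T) X) U"
    show "\<exists>x. x \<in> PE (Maps T (PathSp X)) U \<and> flat T x = y"
      by (rule exI[of _ "sharp T y"], rule conjI[OF sharp_Mp[OF T y] flat_sharp[OF T U y]])
  next
    fix U x y assume "U \<in> Ob" "x \<in> PE (Maps T (PathSp X)) U" "y \<in> PE (Maps T (PathSp X)) U" "flat T x = flat T y"
    then show "x = y" by (rule flat_inj[OF T])
  qed
  then show "representable (Maps T (PathSp X))"
    by (rule representable_pcov[OF p pmap_flat[OF T] _ srepD[OF goodD(2)[OF X] cx_Xi[OF T]]])
qed

lemma good_Pf: "smap X Y f \<Longrightarrow> good X \<Longrightarrow> good Y \<Longrightarrow> good (PathOver X Y f)"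
  by (rule good_Pb[OF _ good_P1 _ _ smap_evp]) simp_all

lemma good_pt: "good (point :: ('o,'m,unit) spsh)"
proof -
  obtain t where t: "t \<in> Ob" "\<And>a. a \<in> Ob \<Longrightarrow> \<exists>!f. f \<in> H a t" using ex_terminal unfolding terminal_def by blast
  have "rep (Maps T point) t (\<lambda>_ _. ())" for T :: "nat set set"
  proof (rule repI[OF t(1) Mp_pt])
    fix V and x :: "nat \<Rightarrow> (nat \<Rightarrow> nat) \<Rightarrow> unit" assume "V \<in> Ob"
    then obtain v where "v \<in> H V t" using t(2) by blast
    then show "\<exists>v. v \<in> H V t \<and> PR (Maps T point) v (\<lambda>_ _. ()) = x" using unit_fun by blast
  next
    fix V v w assume vw: "v \<in> H V t" "w \<in> H V t"
    show "v = w" using t(2)[OF hom_dom[OF vw(1)]] vw by blast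
  qed
  then show ?thesis unfolding good_def srep_def representable_def using sps_pt by blast
qed

lemma good_Pw:
  fixes A :: "('o,'m,'x) spsh"
  assumes A: "good A" shows "good (Powers {0,1} A)"
proof -
  note sA = goodD(1)[OF A]
  have "sbij (Powers {0,1} A) (Pull A A bang bang) (\<lambda>n \<xi>. (\<xi> 0, \<xi> 1))"
  proof (rule sbijI)
    have "smap (Powers {0,1} A) A (\<lambda>n \<xi>. \<xi> e)" if "e = 0 \<or> e = 1" for e :: nat
      by (rule smapI, rule pmapI) (use that in \<open>auto simp add: Pw_simps\<close>)
    then show "smap (Powers {0,1} A) (Pull A A bang bang) (\<lambda>n \<xi>. (\<xi> 0, \<xi> 1))" by (intro smap_Pb) simp_all
    fix n U y assume "y \<in> PE (SE (Pull A A bang bang) n) U"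
    then show "\<exists>x. x \<in> PE (SE (Powers {0,1} A) n) U \<and> (x 0, x 1) = y"
      by (intro exI[of _ "\<lambda>e. if e = 0 then fst y else if e = 1 then snd y else undefined"]) (simp add: Pw_simps Pb_simps PE_PBp)
  next
    fix n U and x y :: "nat \<Rightarrow> 'x"
    assume a: "x \<in> PE (SE (Powers {0,1} A) n) U" "y \<in> PE (SE (Powers {0,1} A) n) U" "(x 0, x 1) = (y 0, y 1)"
    show "x = y"
    proof
      fix e show "x e = y e" using a by (cases "e \<in> {0,1}") (auto simp: Pw_simps)
    qed
  qed
  moreover have "good (Pull A A bang bang)" by (rule good_Pb[OF A A good_pt smap_bang smap_bang])
  ultimately show ?thesis
    unfolding good_def using srep_sbij[OF _ sps_Pw[OF sA] sps_Pb[OF sA sA smap_bang smap_bang]] sps_Pw[OF sA] by blast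
qed

text \<open>A hypercover lifts from the empty complex to every finite complex; this gives the two
  absolute covers that \<open>lft_cancel\<close> asks for, and goodness provides the arrows.\<close>

lemma hcov_cancel:
  assumes f: "smap X Y f" "smap Y Z g" "good X" "good Y" "good Z"
    and h: "hcover Cov X Y f" "hcover Cov X Z (\<lambda>n x. g n (f n x))"
  shows "hcover Cov Y Z g"
  unfolding hcover_def
proof
  fix n
  note s = goodD(1)[OF f(3)] goodD(1)[OF f(4)] goodD(1)[OF f(5)]
  have e: "{{}} \<subseteq> bdry n" "{{}} \<subseteq> simplex_cx n" using cx_empty[OF cx_bd] by auto
  show "rel_lift Cov Y Z g (bdry n) (simplex_cx n)"
    by (rule lft_cancel[OF f(1,2) s cx_bd cx_Dl bd_Dl hcov_lft[OF stable_Cov f(1) s(1,2) h(1) cx_single cx_bd e(1)]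
      hcov_lft[OF stable_Cov f(1) s(1,2) h(1) cx_single cx_Dl e(2)] hcovD[OF h(2)]
      lft_arrows[OF f(2) s(2,3) goodD(2)[OF f(4)] goodD(2)[OF f(5)] cx_bd cx_Dl bd_Dl]])
qed

section \<open>Calculus of weak equivalences between Kan objects\<close>

abbreviation "Kan X \<equiv> fibr Cov 0 X point bang"

definition W :: "('o,'m,'x) spsh \<Rightarrow> ('o,'m,'y) spsh \<Rightarrow> (nat \<Rightarrow> 'x \<Rightarrow> 'y) \<Rightarrow> bool" where
  "W X Y f \<longleftrightarrow> hcover Cov (PathOver X Y f) Y qf"

text \<open>The projection from P(f) to the path space of Y is a base change of f, and q f is this
  projection followed by evaluation at 1, a hypercover because Y is Kan.\<close>

lemma W_hcov:
  assumes f: "smap X Y f" "simp_psh X" "simp_psh Y" and Y: "Kan Y" and h: "hcover Cov X Y f"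
  shows "W X Y f"
proof -
  have e: "0 = (0::nat) \<or> 0 = (1::nat)" "1 = (0::nat) \<or> 1 = (1::nat)" by simp_all
  have "hcover Cov (PathOver X Y f) (PathSp Y) (\<lambda>n. snd)"
    by (rule hcov_pullback[OF spb_Pb[OF f(2) sps_P1[OF f(3)] f(3) f(1) smap_evp[OF e(1)]] h])
  from hcov_comp[OF stable_Cov smap_snd smap_evp[OF e(2)] sps_Pf[OF f] sps_P1[OF f(3)] f(3) this hcov_evp[OF stable_Cov f(3) Y e(2)]]
  show ?thesis unfolding W_def qf_def .
qed

text \<open>The gap map followed by q f equals f after evaluation at 1. The left side is a composite
  of hypercovers, and evaluation at 1 is a hypercover that can be cancelled on the right.\<close>

lemma W_fibr_hcov:
  assumes f: "smap X Y f" "good X" "good Y" and X: "Kan X" and h: "fibr Cov 0 X Y f" and w: "W X Y f"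
  shows "hcover Cov X Y f"
proof -
  note s = goodD(1)[OF f(2)] goodD(1)[OF f(3)]
  have e: "0 = (0::nat) \<or> 0 = (1::nat)" "1 = (0::nat) \<or> 1 = (1::nat)" by simp_all
  have m: "smap (PathSp X) (PathOver X Y f) (\<lambda>n \<gamma>. (evp 0 n \<gamma>, P1m f n \<gamma>))"
    by (rule smap_Pb[OF smap_evp[OF e(1)] smap_P1m[OF f(1)]]) (simp add: evp_P1m)
  from hcov_comp[OF stable_Cov m smap_qf sps_P1[OF s(1)] sps_Pf[OF f(1) s] s(2) hcov_gap[OF stable_Cov f(1) s h e(1)] w[unfolded W_def]]
  have "hcover Cov (PathSp X) Y (\<lambda>n \<gamma>. f n (evp 1 n \<gamma>))" by (simp add: qf_def evp_P1m)
  from hcov_cancel[OF smap_evp[OF e(2)] f(1) good_P1[OF f(2)] f(2,3) hcov_evp[OF stable_Cov s(1) X e(2)] this]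
  show ?thesis .
qed

text \<open>P(f t) is the base change of P(f) along t, so the two maps q differ by a preceding
  hypercover, which can be added by composition and removed by cancellation. The composite enters
  through a pointwise equation so that it may be given in any form.\<close>

lemma W_pre:
  assumes t: "smap X' X t" "hcover Cov X' X t" and f: "smap X Y f" "smap X' Y f'" and g: "good X'" "good X" "good Y"
    and eq: "\<And>n U x. U \<in> Ob \<Longrightarrow> x \<in> PE (SE X' n) U \<Longrightarrow> f' n x = f n (t n x)"
  shows "W X' Y f' \<longleftrightarrow> W X Y f"
proof -
  note s = goodD(1)[OF g(1)] goodD(1)[OF g(2)] goodD(1)[OF g(3)]
  let ?u = "\<lambda>n p. (t n (fst p), snd p)"
  have u: "smap (PathOver X' Y f') (PathOver X Y f) ?u"
  proof (rule smap_Pb[OF smap_comp[OF smap_fst t(1)] smap_snd])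
    fix n U w assume "U \<in> Ob" "w \<in> PE (SE (PathOver X' Y f') n) U"
    then show "f n (t n (fst w)) = evp 0 n (snd w)" using eq[of U "fst w" n] by (simp add: Pb_simps PE_PBp)
  qed
  have "spb (PathOver X' Y f') X' (PathOver X Y f) X (\<lambda>n. fst) (\<lambda>n. fst) ?u t"
  proof (rule spbI[OF sps_Pf[OF f(2) s(1,3)] s(1) sps_Pf[OF f(1) s(2,3)] s(2) smap_fst smap_fst u t(1)])
    fix n U h x assume "U \<in> Ob" "h \<in> PE (SE (PathOver X Y f) n) U" "x \<in> PE (SE X' n) U" "t n x = fst h"
    then show "\<exists>p. p \<in> PE (SE (PathOver X' Y f') n) U \<and> fst p = x \<and> ?u n p = h"
      using eq[of U x n] by (intro exI[of _ "(x, snd h)"]) (simp add: Pb_simps PE_PBp)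
  qed (auto simp: prod_eq_iff)
  note hu = hcov_pullback[OF this t(2)]
  have q: "(\<lambda>n x. qf n (?u n x)) = qf" unfolding qf_def by simp
  show ?thesis unfolding W_def
  proof
    assume "hcover Cov (PathOver X' Y f') Y qf"
    then show "hcover Cov (PathOver X Y f) Y qf"
      using hcov_cancel[OF u smap_qf good_Pf[OF f(2) g(1,3)] good_Pf[OF f(1) g(2,3)] g(3) hu] unfolding q by blast
  next
    assume "hcover Cov (PathOver X Y f) Y qf"
    from hcov_comp[OF stable_Cov u smap_qf sps_Pf[OF f(2) s(1,3)] sps_Pf[OF f(1) s(2,3)] s(3) hu this]
    show "hcover Cov (PathOver X' Y f') Y qf" unfolding q .
  qed
qed

lemma W_cong:
  assumes f: "smap X Y f" "smap X Y f'" and g: "good X" "good Y"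
    and eq: "\<And>n U x. U \<in> Ob \<Longrightarrow> x \<in> PE (SE X n) U \<Longrightarrow> f' n x = f n x"
  shows "W X Y f' \<longleftrightarrow> W X Y f"
  by (rule W_pre[OF smap_id[OF goodD(1)[OF g(1)]] hcov_sbij[OF stable_Cov sbij_id] f g(1,1,2) eq])
     (use goodD(1)[OF g(1)] in simp_all)

text \<open>P(f) is compared with the pullback D of q(g f) along g. The map from P(f) to D is a base
  change of the gap map of g with both ends, hence a hypercover. So the projection from D to Y is a
  hypercover iff q f is; by base change along g and cancellation it is one iff q(g f) is.\<close>

lemma W_post:
  assumes gg: "smap Y Z g" "hcover Cov Y Z g" and f: "smap X Y f" and G: "good X" "good Y" "good Z"
  shows "W X Z (\<lambda>n x. g n (f n x)) \<longleftrightarrow> W X Y f"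
proof -
  note s = goodD(1)[OF G(1)] goodD(1)[OF G(2)] goodD(1)[OF G(3)]
  let ?gf = "\<lambda>n x. g n (f n x)"
  note gf = smap_comp[OF f gg(1)]
  let ?P = "PathOver X Z ?gf" let ?D = "Pull ?P Y qf g" and ?B = "PathRel Y Z g {0,1}"
  have e: "0 = (0::nat) \<or> 0 = (1::nat)" "1 = (0::nat) \<or> 1 = (1::nat)" by simp_all
  note gP = good_Pf[OF gf G(1,3)]
  note gD = good_Pb[OF gP G(2,3) smap_qf gg(1)]
  note sP = goodD(1)[OF gP] and sD = goodD(1)[OF gD] and sF = sps_Pf[OF f s(1,2)]
  let ?v = "\<lambda>n p. ((fst p, P1m g n (snd p)), evp 1 n (snd p))"
  let ?b = "\<lambda>n p. (endpoints (\<lambda>n p. f n (fst (fst p))) (\<lambda>n. snd) n p, snd (fst p))"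
  have v1: "smap (PathOver X Y f) ?P (\<lambda>n p. (fst p, P1m g n (snd p)))"
    by (rule smap_Pb[OF smap_fst smap_comp[OF smap_snd smap_P1m[OF gg(1)]]]) (simp add: evp_P1m Pb_simps PE_PBp)
  have v: "smap (PathOver X Y f) ?D ?v"
    by (rule smap_Pb[OF v1 smap_comp[OF smap_snd smap_evp[OF e(2)]]]) (simp add: qf_def evp_P1m)
  have b: "smap ?D ?B ?b"
  proof (rule smap_Pb[OF smap_pr[OF smap_comp[OF smap_comp[OF smap_fst smap_fst] f] smap_snd] smap_comp[OF smap_fst smap_snd]])
    fix n U w assume "w \<in> PE (SE ?D n) U"
    then have "g n (f n (fst (fst w))) = evp 0 n (snd (fst w))" "evp 1 n (snd (fst w)) = g n (snd w)"
      by (simp_all add: Pb_simps PE_PBp qf_def)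
    then show "pwm {0,1} g n (endpoints (\<lambda>n p. f n (fst (fst p))) (\<lambda>n. snd) n w) = evE {0,1} n (snd (fst w))"
      by (auto simp: pwm_def endpoints_def evE_def fun_eq_iff)
  qed
  have "spb (PathOver X Y f) (PathSp Y) ?D ?B (\<lambda>n. snd) ?b ?v (gap {0,1} g)"
  proof (rule spbI[OF sF sps_P1[OF s(2)] sD sps_BE[OF s(2,3) gg(1) order_refl] smap_snd b v smap_pp[OF gg(1) order_refl]])
    fix n U p assume "p \<in> PE (SE (PathOver X Y f) n) U"
    then have "evp 0 n (snd p) = f n (fst p)" by (simp add: Pb_simps PE_PBp)
    then show "gap {0,1} g n (snd p) = ?b n (?v n p)" by (auto simp: gap_def evE_def endpoints_def fun_eq_iff)
  next
    fix n U h x assume h: "h \<in> PE (SE ?D n) U" and x: "x \<in> PE (SE (PathSp Y) n) U" and q: "gap {0,1} g n x = ?b n h"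
    have q1: "evE {0,1} n x = endpoints (\<lambda>n p. f n (fst (fst p))) (\<lambda>n. snd) n h" and q2: "P1m g n x = snd (fst h)"
      using q by (simp_all add: gap_def)
    have "evp 0 n x = f n (fst (fst h))" "evp 1 n x = snd h"
      using fun_cong[OF q1, of 0] fun_cong[OF q1, of 1] by (simp_all add: evE_def endpoints_def)
    then show "\<exists>p. p \<in> PE (SE (PathOver X Y f) n) U \<and> snd p = x \<and> ?v n p = h"
      using h x q2 by (intro exI[of _ "(fst (fst h), x)"]) (simp add: Pb_simps PE_PBp prod_eq_iff)
  qed (auto simp: prod_eq_iff)
  note hv = hcov_pullback[OF this leibniz_hcov[OF stable_Cov gg(1) s(2,3) gg(2)]]
  have q: "(\<lambda>n x. snd (?v n x)) = qf" unfolding qf_def by simp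
  have "hcover Cov ?P Z qf \<longleftrightarrow> hcover Cov ?D Y (\<lambda>n. snd)"
  proof
    assume "hcover Cov ?P Z qf"
    then show "hcover Cov ?D Y (\<lambda>n. snd)"
      by (rule hcov_pullback[OF spb_Pb[OF sP s(2,3) smap_qf gg(1)]])
  next
    assume "hcover Cov ?D Y (\<lambda>n. snd)"
    note 1 = hcov_comp[OF stable_Cov smap_snd gg(1) sD s(2,3) this gg(2)]
    have "hcover Cov ?D Z (\<lambda>n x. qf n (fst x))"
      by (rule hcov_cong[OF 1 sD s(3) smap_comp[OF smap_snd gg(1)] smap_comp[OF smap_fst smap_qf]]) (simp add: Pb_simps PE_PBp)
    moreover have "hcover Cov ?D ?P (\<lambda>n. fst)" by (rule hcov_pullback[OF spb_Pb'[OF sP s(2,3) smap_qf gg(1)] gg(2)])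
    ultimately show "hcover Cov ?P Z qf" using hcov_cancel[OF smap_fst smap_qf gD gP G(3)] by blast
  qed
  moreover have "hcover Cov ?D Y (\<lambda>n. snd) \<longleftrightarrow> hcover Cov (PathOver X Y f) Y qf"
  proof
    assume "hcover Cov ?D Y (\<lambda>n. snd)"
    from hcov_comp[OF stable_Cov v smap_snd sF sD s(2) hv this] show "hcover Cov (PathOver X Y f) Y qf" unfolding q .
  next
    assume "hcover Cov (PathOver X Y f) Y qf"
    then show "hcover Cov ?D Y (\<lambda>n. snd)"
      using hcov_cancel[OF v smap_snd good_Pf[OF f G(1,2)] gD G(2) hv] unfolding q by blast
  qed
  ultimately show ?thesis unfolding W_def by blast
qed

text \<open>A section \<open>s\<close> of a hypercover \<open>r\<close> is also a left inverse up to a homotopy that exists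
  after passing to a further hypercover \<open>P' \<rightarrow> P\<close>.\<close>
lemma W_section:
  assumes r: "smap P X r" "hcover Cov P X r" and s: "smap X P s" and h: "smap P Z h"
    and G: "good P" "good X" "good Z" and Z: "Kan Z"
    and rs: "\<And>n U x. U \<in> Ob \<Longrightarrow> x \<in> PE (SE X n) U \<Longrightarrow> r n (s n x) = x"
  shows "W X Z (\<lambda>n x. h n (s n x)) \<longleftrightarrow> W P Z h"
proof -
  note sp = goodD(1)[OF G(1)] goodD(1)[OF G(2)] goodD(1)[OF G(3)]
  have e: "0 = (0::nat) \<or> 0 = (1::nat)" "1 = (0::nat) \<or> 1 = (1::nat)" by simp_all
  let ?B = "PathRel P X r {0,1}"
  \<comment> \<open>A point p goes to the ends s (r p) and p with the constant path at r p; both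
    ends lie over r p because s is a section. An element of the pullback ?P' is then a path in P
    from s (r p) to p over this constant path.\<close>
  let ?\<phi> = "\<lambda>n p. (endpoints (\<lambda>n p. s n (r n p)) (\<lambda>n p. p) n p, cst X n (r n p))"
  note gg = pmap_in[OF smapD(1)[OF r(1)]]
  have phi: "smap P ?B ?\<phi>"
  proof (rule smap_Pb[OF smap_pr[OF smap_comp[OF r(1) s] smap_id[OF sp(1)]] smap_comp[OF r(1) smap_cst[OF sp(2)]]])
    fix n U w assume U: "U \<in> Ob" and w: "w \<in> PE (SE P n) U"
    have "evp 0 n (cst X n (r n w)) = r n w" "evp 1 n (cst X n (r n w)) = r n w" "r n (s n (r n w)) = r n w"
      using evp_cst[OF e(1) sp(2) U gg[OF U w]] evp_cst[OF e(2) sp(2) U gg[OF U w]] rs[OF U gg[OF U w]] by auto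
    then show "pwm {0,1} r n (endpoints (\<lambda>n p. s n (r n p)) (\<lambda>n p. p) n w) = evE {0,1} n (cst X n (r n w))"
      by (auto simp: pwm_def endpoints_def evE_def fun_eq_iff)
  qed
  note mpp = smap_pp[OF r(1) order_refl]
  note sB = sps_BE[OF sp(1,2) r(1) order_refl]
  let ?P' = "Pull P (PathSp P) ?\<phi> (gap {0,1} r)"
  have hh: "smap (PathSp P) (PathSp Z) (P1m h)" by (rule smap_P1m[OF h])
  have ht: "hcover Cov ?P' P (\<lambda>n. fst)"
    by (rule hcov_pullback[OF spb_Pb'[OF sp(1) sps_P1[OF sp(1)] sB phi mpp] leibniz_hcov[OF stable_Cov r(1) sp(1,2) r(2)]])
  have gB: "good ?B"
    by (rule good_Pb[OF good_Pw[OF G(1)] good_P1[OF G(2)] good_Pw[OF G(2)] smap_pwm[OF r(1)] smap_evE]) simp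
  note gP' = good_Pb[OF G(1) good_P1[OF G(1)] gB phi mpp]
  have ev: "evp 0 n (snd p) = s n (r n (fst p))" "evp 1 n (snd p) = fst p" if "p \<in> PE (SE ?P' n) U" for n p U
  proof -
    have q: "endpoints (\<lambda>n p. s n (r n p)) (\<lambda>n p. p) n (fst p) = evE {0,1} n (snd p)"
      using that by (simp add: Pb_simps PE_PBp gap_def)
    show "evp 0 n (snd p) = s n (r n (fst p))" "evp 1 n (snd p) = fst p"
      using fun_cong[OF q, of 0] fun_cong[OF q, of 1] by (simp_all add: evE_def endpoints_def)
  qed
  note sH = smap_comp[OF smap_snd hh]
  note hs = smap_comp[OF s h]
  \<comment> \<open>Hypercovers in front are removed by \<open>W_pre\<close>. Behind, the two
    evaluations of the path space of Z are hypercovers, and passing from one to the other replaces h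
    at the end p by h at the end s (r p).\<close>
  have "W P Z h \<longleftrightarrow> W ?P' Z (\<lambda>n x. evp 1 n (P1m h n (snd x)))"
    by (rule W_pre[OF smap_fst ht h smap_comp[OF sH smap_evp[OF e(2)]] gP' G(1,3), symmetric]) (simp add: evp_P1m ev del: One_nat_def)
  also have "\<dots> \<longleftrightarrow> W ?P' (PathSp Z) (\<lambda>n x. P1m h n (snd x))"
    by (rule W_post[OF smap_evp[OF e(2)] hcov_evp[OF stable_Cov sp(3) Z e(2)] sH gP' good_P1[OF G(3)] G(3)])
  also have "\<dots> \<longleftrightarrow> W ?P' Z (\<lambda>n x. evp 0 n (P1m h n (snd x)))"
    by (rule W_post[OF smap_evp[OF e(1)] hcov_evp[OF stable_Cov sp(3) Z e(1)] sH gP' good_P1[OF G(3)] G(3), symmetric])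
  also have "\<dots> \<longleftrightarrow> W P Z (\<lambda>n x. h n (s n (r n x)))"
    by (rule W_pre[OF smap_fst ht smap_comp[OF r(1) hs] smap_comp[OF sH smap_evp[OF e(1)]] gP' G(1,3)]) (simp add: evp_P1m ev del: One_nat_def)
  also have "\<dots> \<longleftrightarrow> W X Z (\<lambda>n x. h n (s n x))"
    by (rule W_pre[OF r hs smap_comp[OF r(1) hs] G]) simp
  finally show ?thesis by blast
qed

text \<open>Followed by the hypercover from P(f) to X, this map becomes the identity.\<close>

lemma W_sf:
  assumes f: "smap X Y f" "good X" "good Y" and K: "Kan X" "Kan Y"
  shows "W X (PathOver X Y f) (const_path Y f)"
proof -
  note s = goodD(1)[OF f(2)] goodD(1)[OF f(3)]
  have "W X X (\<lambda>n x. x)" by (rule W_hcov[OF smap_id[OF s(1)] s(1,1) K(1) hcov_sbij[OF stable_Cov sbij_id[OF s(1)] s(1,1)]])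
  moreover have "W X X (\<lambda>n x. fst (const_path Y f n x)) \<longleftrightarrow> W X (PathOver X Y f) (const_path Y f)"
    by (rule W_post[OF smap_fst hcov_fst_Pf[OF stable_Cov f(1) s K(2)] smap_sf[OF f(1) s] f(2) good_Pf[OF f] f(2)])
  ultimately show ?thesis by (simp add: const_path_def)
qed

text \<open>As q f is a hypercover, g may be tested as g after q f on P(f). Restricting along the
  section of constant paths then turns q f into f.\<close>

lemma W_comp_left:
  assumes f: "smap X Y f" "smap Y Z g" and G: "good X" "good Y" "good Z" and K: "Kan Y" "Kan Z" and w: "W X Y f"
  shows "W X Z (\<lambda>n x. g n (f n x)) \<longleftrightarrow> W Y Z g"
proof -
  note s = goodD(1)[OF G(1)] goodD(1)[OF G(2)] goodD(1)[OF G(3)]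
  note gP = good_Pf[OF f(1) G(1,2)] and sS = smap_sf[OF f(1) s(1,2)] and gq = smap_comp[OF smap_qf f(2), of X f]
  have "W Y Z g \<longleftrightarrow> W (PathOver X Y f) Z (\<lambda>n x. g n (qf n x))"
    by (rule W_pre[OF smap_qf w[unfolded W_def] f(2) gq gP G(2,3), symmetric]) simp
  also have "\<dots> \<longleftrightarrow> W X Z (\<lambda>n x. g n (qf n (const_path Y f n x)))"
    by (rule W_section[OF smap_fst hcov_fst_Pf[OF stable_Cov f(1) s(1,2) K(1)] sS gq gP G(1,3) K(2), symmetric]) (simp add: const_path_def)
  also have "\<dots> \<longleftrightarrow> W X Z (\<lambda>n x. g n (f n x))"
    by (rule W_cong[OF smap_comp[OF f] smap_comp[OF sS gq] G(1,3)]) (simp add: qf_sf[OF f(1) s(2)])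
  finally show ?thesis by blast
qed

text \<open>Here g is q g after the section into P(g). The hypercover q g is removed, and composing
  with the projection from P(g) to Y leaves f.\<close>

lemma W_comp_right:
  assumes f: "smap X Y f" "smap Y Z g" and G: "good X" "good Y" "good Z" and K: "Kan Y" "Kan Z" and w: "W Y Z g"
  shows "W X Z (\<lambda>n x. g n (f n x)) \<longleftrightarrow> W X Y f"
proof -
  note s = goodD(1)[OF G(1)] goodD(1)[OF G(2)] goodD(1)[OF G(3)]
  note gP = good_Pf[OF f(2) G(2,3)] and sS = smap_comp[OF f(1) smap_sf[OF f(2) s(2,3)]]
  have "W X Z (\<lambda>n x. g n (f n x)) \<longleftrightarrow> W X Z (\<lambda>n x. qf n (const_path Z g n (f n x)))"
    by (rule W_cong[OF smap_comp[OF sS smap_qf] smap_comp[OF f] G(1,3)])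
       (simp add: qf_sf[OF f(2) s(3) _ pmap_in[OF smapD(1)[OF f(1)]]])
  also have "\<dots> \<longleftrightarrow> W X (PathOver Y Z g) (\<lambda>n x. const_path Z g n (f n x))"
    by (rule W_post[OF smap_qf w[unfolded W_def] sS G(1) gP G(3)])
  also have "\<dots> \<longleftrightarrow> W X Y (\<lambda>n x. fst (const_path Z g n (f n x)))"
    by (rule W_post[OF smap_fst hcov_fst_Pf[OF stable_Cov f(2) s(2,3) K(2)] sS G(1) gP G(2), symmetric])
  finally show ?thesis by (simp add: const_path_def)
qed

end

section \<open>Simplicial objects as representable simplicial presheaves\<close>

definition ym :: "('o,'m) cat \<Rightarrow> (nat \<Rightarrow> 'm) \<Rightarrow> nat \<Rightarrow> 'm \<Rightarrow> 'm" where
  "ym C f n x = cComp C (f n) x"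

definition Yo :: "('o,'m) cat \<Rightarrow> ('o,'m) sobj \<Rightarrow> ('o,'m,'m) spsh" where
  "Yo C X = \<lparr>SE = (\<lambda>n. \<lparr>PE = (\<lambda>U. hom C U (sO X n)), PR = (\<lambda>u x. cComp C x u)\<rparr>),
     SA = (\<lambda>m n \<theta> x. cComp C (sM X m n \<theta>) x)\<rparr>"

lemma Yo_simps: "PE (SE (Yo C X) n) U = hom C U (sO X n)" "PR (SE (Yo C X) n) u x = cComp C x u"
  "SA (Yo C X) m n \<theta> x = cComp C (sM X m n \<theta>) x"
  unfolding Yo_def by auto

text \<open>The map from the standard k-simplex that classifies the simplex x.\<close>

definition yon :: "('o,'m,'x) spsh \<Rightarrow> nat \<Rightarrow> 'x \<Rightarrow> nat \<Rightarrow> (nat \<Rightarrow> nat) \<Rightarrow> 'x" where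
  "yon X k x = (\<lambda>m t. if t \<in> simplices (simplex_cx k) m then SA X m k t x else undefined)"

context cat_loc begin

lemma soD:
  assumes "simplicial_object C X"
  shows "sO X n \<in> Ob" "delta_hom m n \<theta> \<Longrightarrow> sM X m n \<theta> \<in> H (sO X n) (sO X m)"
    "\<not> delta_hom m n \<theta> \<Longrightarrow> sM X m n \<theta> = undefined"
    "sM X n n (delta_id n) = ID (sO X n)"
    "delta_hom m n \<theta> \<Longrightarrow> delta_hom l m \<psi> \<Longrightarrow> sM X l n (dcomp l \<theta> \<psi>) = sM X l m \<psi> \<cdot> sM X m n \<theta>"
  using assms unfolding simplicial_object_def by blast+

lemma smorD:
  assumes "smor C X Y f"
  shows "f n \<in> H (sO X n) (sO Y n)" "delta_hom m n \<theta> \<Longrightarrow> sM Y m n \<theta> \<cdot> f n = f m \<cdot> sM X m n \<theta>"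
  using assms unfolding smor_def by blast+

lemma sps_Yo:
  assumes X: "simplicial_object C X" shows "simp_psh (Yo C X)"
  unfolding simp_psh_def psh_def pmap_def Yo_simps
proof (intro conjI allI impI)
  fix n U V W u v x assume u: "u \<in> H V U" and v: "v \<in> H W V" and x: "x \<in> H U (sO X n)"
  show "x \<cdot> u \<cdot> v = (x \<cdot> u) \<cdot> v" by (rule comp_assoc[OF v u x, symmetric])
next
  fix m n \<theta> U V u x assume t: "delta_hom m n \<theta>" and u: "u \<in> H V U" and x: "x \<in> H U (sO X n)"
  show "sM X m n \<theta> \<cdot> (x \<cdot> u) = (sM X m n \<theta> \<cdot> x) \<cdot> u" by (rule comp_assoc[OF u x soD(2)[OF X t], symmetric])
next
  fix n U x assume "x \<in> H U (sO X n)"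
  then show "sM X n n (delta_id n) \<cdot> x = x" unfolding soD(4)[OF X] by (rule Id_comp)
next
  fix l m n \<theta> \<psi> U x assume t: "delta_hom m n \<theta>" "delta_hom l m \<psi>" and x: "x \<in> H U (sO X n)"
  show "sM X l n (dcomp l \<theta> \<psi>) \<cdot> x = sM X l m \<psi> \<cdot> (sM X m n \<theta> \<cdot> x)"
    unfolding soD(5)[OF X t] by (rule comp_assoc[OF x soD(2)[OF X t(1)] soD(2)[OF X t(2)]])
qed (auto intro: hom_compI comp_Id soD(2)[OF X])

lemma smap_ym:
  assumes X: "simplicial_object C X" "simplicial_object C Y" and f: "smor C X Y f" shows "smap (Yo C X) (Yo C Y) (ym C f)"
proof (rule smapI)
  show "pmap (SE (Yo C X) n) (SE (Yo C Y) n) (ym C f n)" for n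
    by (rule pmapI) (simp_all add: Yo_simps ym_def hom_compI[OF _ smorD(1)[OF f]] comp_assoc[OF _ _ smorD(1)[OF f]])
  fix m n \<theta> U x assume t: "delta_hom m n \<theta>" and "x \<in> PE (SE (Yo C X) n) U"
  then have x: "x \<in> H U (sO X n)" by (simp add: Yo_simps)
  show "ym C f m (SA (Yo C X) m n \<theta> x) = SA (Yo C Y) m n \<theta> (ym C f n x)"
    unfolding ym_def Yo_simps
    using comp_assoc[OF x soD(2)[OF X(1) t] smorD(1)[OF f]] comp_assoc[OF x smorD(1)[OF f] soD(2)[OF X(2) t]] smorD(2)[OF f t] by simp
qed

text \<open>By Yoneda, w n is the preimage of \<psi> at the identity of the n-th level. Naturality
  gives its effect on all elements, and injectivity of \<Phi> its compatibility with the
  operators.\<close>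

lemma lift_smor:
  assumes X: "simplicial_object C X" "simplicial_object C P" and b: "sbij (Yo C P) F \<Phi>" and p: "smap (Yo C X) F \<psi>"
  obtains w where "smor C X P w" "\<And>n U x. x \<in> H U (sO X n) \<Longrightarrow> \<Phi> n (w n \<cdot> x) = \<psi> n x"
proof -
  have const_path: "smap (Yo C P) F \<Phi>" and bij: "\<And>n U. U \<in> Ob \<Longrightarrow> bij_betw (\<Phi> n) (H U (sO P n)) (PE (SE F n) U)"
    using b unfolding sbij_def Yo_simps by auto
  note i = hom_IdI[OF soD(1)[OF X(1)]]
  have "\<exists>v. v \<in> H (sO X n) (sO P n) \<and> \<Phi> n v = \<psi> n (ID (sO X n))" for n
  proof -
    have "\<psi> n (ID (sO X n)) \<in> PE (SE F n) (sO X n)"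
      by (rule pmap_in[OF smapD(1)[OF p] soD(1)[OF X(1)]]) (simp add: Yo_simps i)
    then have "\<psi> n (ID (sO X n)) \<in> \<Phi> n ` H (sO X n) (sO P n)" using bij[OF soD(1)[OF X(1), of n], of n] unfolding bij_betw_def by simp
    then show ?thesis by force
  qed
  then obtain w where w: "\<And>n. w n \<in> H (sO X n) (sO P n)" "\<And>n. \<Phi> n (w n) = \<psi> n (ID (sO X n))" by metis
  have 1: "\<Phi> n (w n \<cdot> x) = \<psi> n x" if x: "x \<in> H U (sO X n)" for n U x
  proof -
    have "\<Phi> n (w n \<cdot> x) = PR (SE F n) x (\<Phi> n (w n))"
      using pmap_nat[OF smapD(1)[OF const_path, of n] x, of "w n"] w(1)[of n] by (simp add: Yo_simps)
    also have "\<dots> = \<psi> n (ID (sO X n) \<cdot> x)"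
      using pmap_nat[OF smapD(1)[OF p, of n] x, of "ID (sO X n)"] w(2)[of n] i[of n] by (simp add: Yo_simps)
    finally show ?thesis using Id_comp[OF x] by simp
  qed
  have "smor C X P w" unfolding smor_def
  proof (intro conjI allI impI w(1))
    fix m n \<theta> assume t: "delta_hom m n \<theta>"
    note h = soD(2)[OF X(1) t] soD(2)[OF X(2) t]
    have "\<Phi> m (sM P m n \<theta> \<cdot> w n) = SA F m n \<theta> (\<psi> n (ID (sO X n)))"
      using smapD(2)[OF const_path t soD(1)[OF X(1), of n], of "w n"] w[of n] by (simp add: Yo_simps)
    also have "\<dots> = \<psi> m (sM X m n \<theta> \<cdot> ID (sO X n))"
      using smapD(2)[OF p t soD(1)[OF X(1), of n], of "ID (sO X n)"] i[of n] by (simp add: Yo_simps)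
    also have "\<dots> = \<Phi> m (w m \<cdot> sM X m n \<theta>)" using 1[OF h(1)] comp_Id[OF h(1)] by simp
    finally show "sM P m n \<theta> \<cdot> w n = w m \<cdot> sM X m n \<theta>"
      using inj_onD[OF bij_betw_imp_inj_on[OF bij[OF soD(1)[OF X(1), of n]]] _ hom_compI[OF w(1) h(2)] hom_compI[OF h(1) w(1)]] by blast
  qed
  then show thesis using that 1 by blast
qed

lemma yoneda:
  assumes X: "simplicial_object C X" "simplicial_object C Y" and p: "smap (Yo C X) (Yo C Y) \<phi>"
  obtains f where "smor C X Y f" "\<And>n U x. x \<in> H U (sO X n) \<Longrightarrow> f n \<cdot> x = \<phi> n x"
  using lift_smor[OF X sbij_id[OF sps_Yo[OF X(2)]] p] by metis

lemma pmap_yon: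
  assumes X: "simp_psh X" shows "pmap (SE X k) (Maps (simplex_cx k) X) (yon X k)"
proof (rule pmapI)
  fix U x assume U: "U \<in> Ob" and x: "x \<in> PE (SE X k) U"
  show "yon X k x \<in> PE (Maps (simplex_cx k) X) U"
  proof (rule MpI)
    fix m t assume t: "t \<in> simplices (simplex_cx k) m"
    then show "yon X k x m t \<in> PE (SE X m) U"
      unfolding yon_def using pmap_in[OF spsD(2)[OF X] U x] delta_hom_Sx by simp
  next
    fix m n \<theta> t assume t: "t \<in> simplices (simplex_cx k) n" and th: "delta_hom m n \<theta>"
    have "delta_hom n k t" using t delta_hom_Sx by blast
    then show "SA X m n \<theta> (yon X k x n t) = yon X k x m (dcomp m t \<theta>)"
      unfolding yon_def using t dcomp_Sx[OF cx_Dl t th] spsD(4)[OF X _ th U x] by simp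
  qed (simp add: yon_def)
next
  fix U V u x assume u: "u \<in> H V U" and x: "x \<in> PE (SE X k) U"
  show "yon X k (PR (SE X k) u x) = PR (Maps (simplex_cx k) X) u (yon X k x)"
    unfolding PR_Mp yon_def post_def using pmap_nat[OF spsD(2)[OF X] u x] delta_hom_Sx by (intro ext) simp
qed

lemma delta_id_Sx: "delta_id k \<in> simplices (simplex_cx k) k"
  using delta_id_hom delta_hom_Sx by blast

lemma pmap_eval: "pmap (Maps (simplex_cx k) X) (SE X k) (\<lambda>\<sigma>. \<sigma> k (delta_id k))"
  by (rule pmapI) (simp_all add: PR_Mp post_app[OF delta_id_Sx] MpD(1)[OF _ delta_id_Sx])

lemma dcomp_id_left: "t \<in> simplices (simplex_cx k) m \<Longrightarrow> dcomp m (delta_id k) t = t"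
proof
  fix i assume t: "t \<in> simplices (simplex_cx k) m"
  show "dcomp m (delta_id k) t i = t i"
    using SxD(2,3)[OF t] unfolding dcomp_def delta_id_def by (cases "i \<le> m") auto
qed

lemma yon_eval:
  assumes X: "simp_psh X"
  shows "U \<in> Ob \<Longrightarrow> x \<in> PE (SE X k) U \<Longrightarrow> yon X k x k (delta_id k) = x"
    "\<sigma> \<in> PE (Maps (simplex_cx k) X) U \<Longrightarrow> yon X k (\<sigma> k (delta_id k)) = \<sigma>"
proof -
  show "U \<in> Ob \<Longrightarrow> x \<in> PE (SE X k) U \<Longrightarrow> yon X k x k (delta_id k) = x"
    unfolding yon_def using delta_id_Sx spsD(3)[OF X] by simp
  assume s: "\<sigma> \<in> PE (Maps (simplex_cx k) X) U"
  show "yon X k (\<sigma> k (delta_id k)) = \<sigma>"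
  proof (intro ext)
    fix m t show "yon X k (\<sigma> k (delta_id k)) m t = \<sigma> m t"
    proof (cases "t \<in> simplices (simplex_cx k) m")
      case True
      then have "delta_hom m k t" using delta_hom_Sx by blast
      from MpD(2)[OF s delta_id_Sx this] show ?thesis using True dcomp_id_left[OF True] by (simp add: yon_def)
    qed (use MpD(3)[OF s] in \<open>simp add: yon_def\<close>)
  qed
qed

text \<open>A fibre whose structure arrow to U is invertible has exactly one element over the
  identity of U. With \<open>pcov_bij\<close> this makes covers by isomorphisms the same as
  pointwise bijections.\<close>

lemma fibre_isos_bij:
  assumes F: "psh F" "psh G" "pmap F G \<phi>" and c: "pcov (isos C) F G \<phi>" and y: "U \<in> Ob" "y \<in> PE G U"
  shows "\<exists>x. x \<in> PE F U \<and> \<phi> x = y \<and> (\<forall>z. z \<in> PE F U \<longrightarrow> \<phi> z = y \<longrightarrow> z = x)"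
proof -
  obtain A c a where f: "fibre (isos C) F G \<phi> U y A c a" using pcovD[OF c y] .
  note fD = fibreD[OF f]
  obtain d where d: "d \<in> H U A" "d \<cdot> c = ID A" "c \<cdot> d = ID U" using is_isoE[of c A U] fD(1,2) by blast
  have "\<phi> (PR F d a) = PR G (c \<cdot> d) y"
    using pmap_nat[OF F(3) d(1) fD(3)] fD(4) psh_comp[OF F(2) fD(2) d(1) y(2)] by simp
  then have 1: "\<phi> (PR F d a) = y" using d(3) psh_id[OF F(2) y] by simp
  have "z = PR F d a" if z: "z \<in> PE F U" "\<phi> z = y" for z
  proof -
    have "\<phi> z = PR G (ID U) y" using z(2) psh_id[OF F(2) y] by simp
    then obtain v where v: "v \<in> H U A" "c \<cdot> v = ID U" "PR F v a = z" using fibre_lift[OF f hom_IdI[OF y(1)] z(1)] by blast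
    have "v = (d \<cdot> c) \<cdot> v" using d(2) Id_comp[OF v(1)] by simp
    also have "\<dots> = d" using comp_assoc[OF v(1) fD(2) d(1)] v(2) comp_Id[OF d(1)] by simp
    finally show ?thesis using v(3) by simp
  qed
  then show ?thesis using 1 psh_res[OF F(1) d(1) fD(3)] by blast
qed

lemma lft_isos_bij:
  fixes A :: "('o,'m,'a) spsh"
  assumes A: "simp_psh A" "rel_lift (isos C) A point bang S T" and S: "fin_complex S" "fin_complex T" "S \<subseteq> T"
    and U: "U \<in> Ob" and s: "\<sigma> \<in> PE (Maps S A) U"
  shows "\<exists>\<tau>. \<tau> \<in> PE (Maps T A) U \<and> restr S \<tau> = \<sigma> \<and> (\<forall>z. z \<in> PE (Maps T A) U \<longrightarrow> restr S z = \<sigma> \<longrightarrow> z = \<tau>)"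
proof -
  have y: "(\<sigma>, \<lambda>_ _. ()) \<in> PE (RelMaps S T A point bang) U"
    unfolding PE_Rel fst_conv snd_conv by (intro conjI s Mp_pt unit_fun)
  have e: "(restr S z, post T bang z) = (\<sigma>, \<lambda>_ _. ()) \<longleftrightarrow> restr S z = \<sigma>" for z :: "nat \<Rightarrow> (nat \<Rightarrow> nat) \<Rightarrow> 'a"
    unfolding prod.inject using unit_fun[of "post T bang z" "\<lambda>_ _. ()"] by simp
  from fibre_isos_bij[OF psh_Mp[OF A(1) S(2)] psh_Rel[OF smap_bang A(1) sps_pt S] pmap_to_Rel[OF smap_bang A(1) sps_pt S]
    A(2)[unfolded rel_lift_def] U y, unfolded e] show ?thesis .
qed

text \<open>Extensions from S to T are unique in X and in Y. The extension in X maps to one in Y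
  with the right restriction, so it already has the prescribed image.\<close>

lemma lft_isos_cancel:
  assumes f: "smap X Y f" "simp_psh X" "simp_psh Y" and S: "fin_complex S" "fin_complex T" "S \<subseteq> T"
    and l: "rel_lift (isos C) X point bang S T" "rel_lift (isos C) Y point bang S T"
  shows "rel_lift (isos C) X Y f S T"
  unfolding rel_lift_def
proof (rule pcov_bij[OF stable_isos psh_Mp[OF f(2) S(2)] pmap_to_Rel[OF f S] psh_Rel[OF f S]])
  fix U p assume U: "U \<in> Ob" and p: "p \<in> PE (RelMaps S T X Y f) U"
  then have r: "fst p \<in> PE (Maps S X) U" "snd p \<in> PE (Maps T Y) U" "post S f (fst p) = restr S (snd p)" unfolding PE_Rel by auto
  obtain \<tau> where t: "\<tau> \<in> PE (Maps T X) U" "restr S \<tau> = fst p" using lft_isos_bij[OF f(2) l(1) S U r(1)] by blast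
  have 1: "restr S (post T f \<tau>) = restr S (snd p)"
    unfolding r(3)[symmetric] t(2)[symmetric] post_post[OF S(3)] post_post[OF order_refl] ..
  have 2: "post T f \<tau> \<in> PE (Maps T Y) U" by (rule pmap_in[OF pmap_post[OF f(1) S(2,2) order_refl] U t(1)])
  obtain \<rho> where "\<forall>z. z \<in> PE (Maps T Y) U \<longrightarrow> restr S z = restr S (snd p) \<longrightarrow> z = \<rho>"
    using lft_isos_bij[OF f(3) l(2) S U pmap_in[OF pmap_rst[OF f(3) S] U r(2)]] by blast
  then have "post T f \<tau> = \<rho>" "snd p = \<rho>" using 1 2 r(2) by blast+
  then show "\<exists>x. x \<in> PE (Maps T X) U \<and> (restr S x, post T f x) = p" using t by (intro exI[of _ \<tau>]) (simp add: prod_eq_iff)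
next
  fix U x y assume U: "U \<in> Ob" and h: "x \<in> PE (Maps T X) U" "y \<in> PE (Maps T X) U" "(restr S x, post T f x) = (restr S y, post T f y)"
  obtain \<tau> where t: "\<And>z. z \<in> PE (Maps T X) U \<Longrightarrow> restr S z = restr S y \<Longrightarrow> z = \<tau>"
    using lft_isos_bij[OF f(2) l(1) S U pmap_in[OF pmap_rst[OF f(2) S] U h(2)]] by blast
  have "x = \<tau>" by (rule t[OF h(1)]) (use h(3) in simp)
  moreover have "y = \<tau>" by (rule t[OF h(2) refl])
  ultimately show "x = y" by simp
qed

text \<open>Applied above dimension k, this gives every map of k-groupoids the truncation condition
  in relative form, which then passes to pullbacks.\<close>

lemma fibr_isos_cancel:
  assumes "smap X Y f" "simp_psh X" "simp_psh Y" "fibr (isos C) N X point bang" "fibr (isos C) N Y point bang"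
  shows "fibr (isos C) N X Y f"
  using assms(4,5) lft_isos_cancel[OF assms(1-3) cx_hn cx_Dl hn_Dl] unfolding fibr_def by simp

section \<open>Points over simplicial sets and maps from finite complexes\<close>

definition transfer :: "nat set set \<Rightarrow> (nat \<Rightarrow> (nat \<Rightarrow> nat) \<Rightarrow> 'a) \<Rightarrow> (nat \<Rightarrow> 'a \<Rightarrow> 'x) \<Rightarrow> nat \<Rightarrow> (nat \<Rightarrow> nat) \<Rightarrow> 'x" where
  "transfer S d x = (\<lambda>k t. if t \<in> simplices S k then x k (d k t) else undefined)"

text \<open>The definitions use simplicial sets of several types, with pairs of maps for the prism;
  d identifies their simplices with those of a complex, compatibly with the operators.\<close>

definition iso_sset :: "'a sset \<Rightarrow> nat set set \<Rightarrow> (nat \<Rightarrow> (nat \<Rightarrow> nat) \<Rightarrow> 'a) \<Rightarrow> bool" where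
  "iso_sset T S d \<longleftrightarrow> fin_complex S \<and> (\<forall>k. bij_betw (d k) (simplices S k) (Smp T k)) \<and>
     (\<forall>m n \<theta> t. t \<in> simplices S n \<longrightarrow> delta_hom m n \<theta> \<longrightarrow> Act T m n \<theta> (d n t) = d m (dcomp m t \<theta>))"

lemma iso_ssetD:
  assumes "iso_sset T S d"
  shows "fin_complex S" "Smp T k = d k ` simplices S k" "inj_on (d k) (simplices S k)"
    "t \<in> simplices S n \<Longrightarrow> delta_hom m n \<theta> \<Longrightarrow> Act T m n \<theta> (d n t) = d m (dcomp m t \<theta>)"
  using assms unfolding iso_sset_def bij_betw_def by auto

lemma is_point_tr:
  assumes i: "iso_sset T S d" shows "is_point C T X U x \<longleftrightarrow> transfer S d x \<in> PE (Maps S (Yo C X)) U"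
proof
  note D = iso_ssetD[OF i]
  assume p: "is_point C T X U x"
  show "transfer S d x \<in> PE (Maps S (Yo C X)) U"
  proof (rule MpI)
    fix m t assume t: "t \<in> simplices S m"
    then show "transfer S d x m t \<in> PE (SE (Yo C X) m) U" using p D(2) unfolding is_point_def transfer_def Yo_simps by simp
  next
    fix m n \<theta> t assume t: "t \<in> simplices S n" and th: "delta_hom m n \<theta>"
    have "sM X m n \<theta> \<cdot> x n (d n t) = x m (Act T m n \<theta> (d n t))" using p t th D(2) unfolding is_point_def by blast
    then show "SA (Yo C X) m n \<theta> (transfer S d x n t) = transfer S d x m (dcomp m t \<theta>)"
      using t dcomp_Sx[OF D(1) t th] D(4)[OF t th] unfolding transfer_def Yo_simps by simp
  qed (simp add: transfer_def)
next
  note D = iso_ssetD[OF i]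
  assume p: "transfer S d x \<in> PE (Maps S (Yo C X)) U"
  show "is_point C T X U x"
    unfolding is_point_def
  proof (intro conjI allI ballI impI)
    fix n s assume "s \<in> Smp T n"
    then obtain t where t: "t \<in> simplices S n" "s = d n t" unfolding D(2) by blast
    then show "x n s \<in> H U (sO X n)" using MpD(1)[OF p t(1)] unfolding transfer_def Yo_simps by simp
  next
    fix m n \<theta> s assume "s \<in> Smp T n" and th: "delta_hom m n \<theta>"
    then obtain t where t: "t \<in> simplices S n" "s = d n t" unfolding D(2) by blast
    then show "sM X m n \<theta> \<cdot> x n s = x m (Act T m n \<theta> s)"
      using MpD(2)[OF p t(1) th] dcomp_Sx[OF D(1) t(1) th] D(4)[OF t(1) th] unfolding transfer_def Yo_simps by simp
  qed
qed

lemma tr_eq: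
  assumes i: "iso_sset T S d" shows "transfer S d x = transfer S d y \<longleftrightarrow> (\<forall>n. \<forall>s\<in>Smp T n. x n s = y n s)"
  unfolding iso_ssetD(2)[OF i] transfer_def fun_eq_iff by auto

lemma tr_surj:
  assumes i: "iso_sset T S d" and s: "\<sigma> \<in> PE (Maps S X) U" shows "\<exists>x. transfer S d x = \<sigma>"
proof -
  note D = iso_ssetD[OF i]
  have "transfer S d (\<lambda>k s. \<sigma> k (inv_into (simplices S k) (d k) s)) = \<sigma>"
    unfolding transfer_def using inv_into_f_f[OF D(3)] MpD(3)[OF s] by (intro ext) auto
  then show ?thesis by blast
qed

lemma PR_tr: "PR (Maps S (Yo C X)) u (transfer S d x) = transfer S d (\<lambda>k s. x k s \<cdot> u)"
  unfolding PR_Mp transfer_def post_def Yo_simps by (intro ext) simp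

lemma rep_Map_tr:
  assumes i: "iso_sset T S d" and X: "simplicial_object C X"
  shows "rep_Map C T X M \<tau> \<longleftrightarrow> rep (Maps S (Yo C X)) M (transfer S d \<tau>)"
proof
  assume r: "rep_Map C T X M \<tau>"
  have ex: "\<exists>!u. u \<in> H U M \<and> transfer S d (\<lambda>n t. \<tau> n t \<cdot> u) = transfer S d \<sigma>" if "U \<in> Ob" "is_point C T X U \<sigma>" for U \<sigma>
    using r that unfolding rep_Map_def tr_eq[OF i] by blast
  have point: "M \<in> Ob" "is_point C T X M \<tau>" using r unfolding rep_Map_def by auto
  show "rep (Maps S (Yo C X)) M (transfer S d \<tau>)"
  proof (rule repI[OF point(1) point(2)[unfolded is_point_tr[OF i]]])
    fix V x assume V: "V \<in> Ob" and x: "x \<in> PE (Maps S (Yo C X)) V"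
    obtain \<sigma> where s: "transfer S d \<sigma> = x" using tr_surj[OF i x] by blast
    then have "is_point C T X V \<sigma>" using x is_point_tr[OF i] by simp
    from ex[OF V this] show "\<exists>v. v \<in> H V M \<and> PR (Maps S (Yo C X)) v (transfer S d \<tau>) = x" unfolding PR_tr s by blast
  next
    fix V v w assume h: "v \<in> H V M" "w \<in> H V M" "PR (Maps S (Yo C X)) v (transfer S d \<tau>) = PR (Maps S (Yo C X)) w (transfer S d \<tau>)"
    have e: "transfer S d (\<lambda>k s. \<tau> k s \<cdot> v) = transfer S d (\<lambda>k s. \<tau> k s \<cdot> w)" using h(3) unfolding PR_tr .
    have "PR (Maps S (Yo C X)) w (transfer S d \<tau>) \<in> PE (Maps S (Yo C X)) V"
      by (rule psh_res[OF psh_Mp[OF sps_Yo[OF X] iso_ssetD(1)[OF i]] h(2) point(2)[unfolded is_point_tr[OF i]]])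
    then have "is_point C T X V (\<lambda>k s. \<tau> k s \<cdot> w)" unfolding is_point_tr[OF i] PR_tr .
    from ex[OF hom_dom[OF h(1)] this] show "v = w" using h(1,2) e by metis
  qed
next
  assume r: "rep (Maps S (Yo C X)) M (transfer S d \<tau>)"
  show "rep_Map C T X M \<tau>"
    unfolding rep_Map_def
  proof (intro conjI allI ballI impI repD(1)[OF r])
    show "is_point C T X M \<tau>" unfolding is_point_tr[OF i] by (rule repD(2)[OF r])
    fix U \<sigma> assume U: "U \<in> Ob" and s: "is_point C T X U \<sigma>"
    have s': "transfer S d \<sigma> \<in> PE (Maps S (Yo C X)) U" using s is_point_tr[OF i] by blast
    obtain v where v: "v \<in> H U M" "PR (Maps S (Yo C X)) v (transfer S d \<tau>) = transfer S d \<sigma>" using rep_lift[OF r U s'] .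
    show "\<exists>!u. u \<in> H U M \<and> (\<forall>n. \<forall>t\<in>Smp T n. \<tau> n t \<cdot> u = \<sigma> n t)"
    proof (rule ex1I[of _ v])
      show "v \<in> H U M \<and> (\<forall>n. \<forall>t\<in>Smp T n. \<tau> n t \<cdot> v = \<sigma> n t)" using v(1) v(2)[unfolded PR_tr tr_eq[OF i]] by blast
      fix u assume u: "u \<in> H U M \<and> (\<forall>n. \<forall>t\<in>Smp T n. \<tau> n t \<cdot> u = \<sigma> n t)"
      then have "PR (Maps S (Yo C X)) u (transfer S d \<tau>) = transfer S d \<sigma>" unfolding PR_tr tr_eq[OF i] by blast
      then show "u = v" using rep_eq[OF r _ v(1)] u v(2) by simp
    qed
  qed
qed

definition cxs :: "nat set set \<Rightarrow> (nat \<Rightarrow> nat) sset" where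
  "cxs S = \<lparr>Smp = simplices S, Act = (\<lambda>m k \<psi> \<theta>. dcomp m \<theta> \<psi>)\<rparr>"

lemma iso_cxs: "fin_complex S \<Longrightarrow> iso_sset (cxs S) S (\<lambda>k t. t)"
  unfolding iso_sset_def cxs_def by (simp add: bij_betw_def)

lemma tr_rst: "transfer S (\<lambda>k t. t) x = restr S x"
  unfolding transfer_def post_def ..

lemma std_simplex_cxs: "std_simplex n = cxs (simplex_cx n)"
proof -
  have "(\<lambda>m. {\<theta>. delta_hom m n \<theta>}) = simplices (simplex_cx n)" by (intro ext) (auto simp: delta_hom_Sx)
  then show ?thesis unfolding std_simplex_def cxs_def by simp
qed

lemma atMost_image: "\<theta> ` {0..m} = \<theta> ` {..m::nat}" by (simp add: atLeast0AtMost)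

lemma boundary_cxs: "boundary n = cxs (bdry n)"
proof -
  have "delta_hom m n \<theta> \<and> \<not> {0..n} \<subseteq> \<theta> ` {0..m} \<longleftrightarrow> \<theta> \<in> simplices (bdry n) m" for m \<theta>
    unfolding delta_hom_Sx atMost_image atLeast0AtMost by (auto simp: simplices_def bdry_def)
  then show ?thesis unfolding boundary_def cxs_def by simp
qed

lemma horn_cxs: "horn n i = cxs (horn_cx n i)"
proof -
  have "delta_hom m n \<theta> \<and> (\<exists>j\<le>n. j \<noteq> i \<and> j \<notin> \<theta> ` {0..m}) \<longleftrightarrow> \<theta> \<in> simplices (horn_cx n i) m" for m \<theta>
    unfolding delta_hom_Sx atMost_image by (auto simp: simplices_def horn_cx_def)
  then show ?thesis unfolding horn_def cxs_def by simp
qed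

lemma cxs_simps: "Smp (cxs S) n = simplices S n"
  unfolding cxs_def by simp

lemma is_point_cxs: "fin_complex S \<Longrightarrow> is_point C (cxs S) X U x \<longleftrightarrow> restr S x \<in> PE (Maps S (Yo C X)) U"
  using is_point_tr[OF iso_cxs] unfolding tr_rst .

lemma rel_point:
  assumes "fin_complex S" "fin_complex T" "S \<subseteq> T"
  shows "(restr S \<sigma>, restr T \<rho>) \<in> PE (RelMaps S T (Yo C X) (Yo C Y) (ym C f)) U \<longleftrightarrow>
    is_point C (cxs S) X U \<sigma> \<and> is_point C (cxs T) Y U \<rho> \<and> (\<forall>n. \<forall>t\<in>Smp (cxs S) n. f n \<cdot> \<sigma> n t = \<rho> n t)"
  unfolding PE_Rel fst_conv snd_conv is_point_cxs[OF assms(1)] is_point_cxs[OF assms(2)]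
    post_post[OF order_refl] post_post[OF assms(3)] post_eq_iff cxs_simps ym_def by auto

lemma PR_rst: "PR (Maps S (Yo C X)) u (restr S x) = restr S (\<lambda>k s. x k s \<cdot> u)"
  using PR_tr[of S X u "\<lambda>k t. t" x] unfolding tr_rst .

lemma rep_rel_iff:
  assumes X: "simplicial_object C X" "simplicial_object C Y" "smor C X Y f" and S: "fin_complex S" "fin_complex T" "S \<subseteq> T"
  shows "rep_rel C (cxs S) (cxs T) X Y f B \<sigma>0 \<rho>0 \<longleftrightarrow> rep (RelMaps S T (Yo C X) (Yo C Y) (ym C f)) B (restr S \<sigma>0, restr T \<rho>0)"
    (is "?L \<longleftrightarrow> rep ?R B ?b")
proof
  let ?point = "\<lambda>U \<sigma> \<rho>. is_point C (cxs S) X U \<sigma> \<and> is_point C (cxs T) Y U \<rho> \<and> (\<forall>n. \<forall>t\<in>Smp (cxs S) n. f n \<cdot> \<sigma> n t = \<rho> n t)"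
  note rp = rel_point[OF S, of _ _ X Y f]
  have pR: "psh ?R" by (rule psh_Rel[OF smap_ym[OF X] sps_Yo[OF X(1)] sps_Yo[OF X(2)] S])
  have eq: "PR ?R u ?b = (restr S \<sigma>, restr T \<rho>) \<longleftrightarrow>
      (\<forall>n. \<forall>t\<in>Smp (cxs S) n. \<sigma>0 n t \<cdot> u = \<sigma> n t) \<and> (\<forall>n. \<forall>t\<in>Smp (cxs T) n. \<rho>0 n t \<cdot> u = \<rho> n t)" for u \<sigma> \<rho>
    unfolding PR_Rel fst_conv snd_conv PR_rst prod.inject post_eq_iff cxs_simps by blast
  {
    assume L: ?L
    then have B: "B \<in> Ob" "?point B \<sigma>0 \<rho>0" unfolding rep_rel_def by auto
    have ex: "\<exists>!u. u \<in> H U B \<and> PR ?R u ?b = (restr S \<sigma>, restr T \<rho>)" if "U \<in> Ob" "?point U \<sigma> \<rho>" for U \<sigma> \<rho>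
      using L that unfolding rep_rel_def eq by simp
    show "rep ?R B ?b"
    proof (rule repI[OF B(1) B(2)[folded rp]])
      fix V x assume V: "V \<in> Ob" and x: "x \<in> PE ?R V"
      have x': "fst x \<in> PE (Maps S (Yo C X)) V" "snd x \<in> PE (Maps T (Yo C Y)) V" using x unfolding PE_Rel by auto
      have e: "(restr S (fst x), restr T (snd x)) = x" by (simp add: prod_eq_iff rst_id[OF x'(1)] rst_id[OF x'(2)])
      then have "?point V (fst x) (snd x)" using x rp[of "fst x" "snd x" V] by simp
      from ex[OF V this] show "\<exists>v. v \<in> H V B \<and> PR ?R v ?b = x" unfolding e by blast
    next
      fix V v w assume h: "v \<in> H V B" "w \<in> H V B" "PR ?R v ?b = PR ?R w ?b"
      have w: "PR ?R w ?b = (restr S (\<lambda>k s. \<sigma>0 k s \<cdot> w), restr T (\<lambda>k s. \<rho>0 k s \<cdot> w))"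
        unfolding PR_Rel fst_conv snd_conv PR_rst ..
      have "PR ?R w ?b \<in> PE ?R V" by (rule psh_res[OF pR h(2) B(2)[folded rp]])
      from ex[OF hom_dom[OF h(1)] this[unfolded w rp]] show "v = w" using h unfolding w[symmetric] by metis
    qed
  }
  assume r: "rep ?R B ?b"
  show ?L unfolding rep_rel_def
  proof (intro conjI ballI allI impI repD(1)[OF r])
    have p: "?point B \<sigma>0 \<rho>0" using repD(2)[OF r] unfolding rp .
    show "is_point C (cxs S) X B \<sigma>0" "is_point C (cxs T) Y B \<rho>0" using p by auto
    show "f n \<cdot> \<sigma>0 n t = \<rho>0 n t" if "t \<in> Smp (cxs S) n" for n t using p that by auto
    fix U \<sigma> \<rho> assume U: "U \<in> Ob" and s: "?point U \<sigma> \<rho>"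
    obtain v where v: "v \<in> H U B" "PR ?R v ?b = (restr S \<sigma>, restr T \<rho>)" using rep_lift[OF r U s[folded rp]] .
    show "\<exists>!u. u \<in> H U B \<and> (\<forall>n. \<forall>t\<in>Smp (cxs S) n. \<sigma>0 n t \<cdot> u = \<sigma> n t) \<and> (\<forall>n. \<forall>t\<in>Smp (cxs T) n. \<rho>0 n t \<cdot> u = \<rho> n t)"
      unfolding eq[symmetric]
    proof (rule ex1I[of _ v])
      show "v \<in> H U B \<and> PR ?R v ?b = (restr S \<sigma>, restr T \<rho>)" using v by blast
      fix u assume "u \<in> H U B \<and> PR ?R u ?b = (restr S \<sigma>, restr T \<rho>)"
      then show "u = v" using rep_eq[OF r _ v(1)] v(2) by simp
    qed
  qed
qed

lemma rep_Map_cxs: "simplicial_object C X \<Longrightarrow> fin_complex S \<Longrightarrow> rep_Map C (cxs S) X M \<tau> \<longleftrightarrow> rep (Maps S (Yo C X)) M (restr S \<tau>)"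
  using rep_Map_tr[OF iso_cxs] unfolding tr_rst .

text \<open>Maps into the point carry no information, so the relative mapping presheaf is Map(S,
  A).\<close>

lemma lft_pt_iff:
  fixes A :: "('o,'m,'a) spsh"
  assumes A: "simp_psh A" and S: "fin_complex S" "fin_complex T" "S \<subseteq> T"
  shows "rel_lift K A point bang S T \<longleftrightarrow> pcov K (Maps T A) (Maps S A) (restr S)"
proof
  let ?R = "RelMaps S T A point bang" and ?\<phi> = "\<lambda>\<tau>. (restr S \<tau>, post T bang \<tau>)"
  note p = psh_Mp[OF A S(2)] psh_Mp[OF A S(1)] psh_Rel[OF smap_bang A sps_pt S] pmap_rst[OF A S] pmap_to_Rel[OF smap_bang A sps_pt S]
  have in_R: "(\<sigma>, \<lambda>_ _. ()) \<in> PE ?R U" if "\<sigma> \<in> PE (Maps S A) U" for \<sigma> U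
    unfolding PE_Rel fst_conv snd_conv using that by (intro conjI Mp_pt unit_fun)
  have pi: "pmap (Maps S A) ?R (\<lambda>\<sigma>. (\<sigma>, \<lambda>_ _. ()))"
    by (rule pmapI[OF in_R]) (simp_all add: PR_Rel, rule unit_fun)
  have pf: "pmap ?R (Maps S A) fst" unfolding RelMaps_def by (rule pmap_fst)
  {
    assume l: "rel_lift K A point bang S T"
    have "pb_square (Maps T A) (Maps T A) (Maps S A) ?R (\<lambda>x. x) (\<lambda>\<sigma>. (\<sigma>, \<lambda>_ _. ())) (restr S) ?\<phi>"
    proof (rule pb_squareI[OF p(1,2) pmap_id pi p(4)])
      show "?\<phi> x = (restr S x, \<lambda>_ _. ())" for x :: "nat \<Rightarrow> (nat \<Rightarrow> nat) \<Rightarrow> 'a" by (rule prod_eqI, simp, rule unit_fun)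
    qed auto
    from pcov_pullback[OF this l[unfolded rel_lift_def]] show "pcov K (Maps T A) (Maps S A) (restr S)" .
  }
  assume l: "pcov K (Maps T A) (Maps S A) (restr S)"
  have "pb_square (Maps T A) (Maps T A) ?R (Maps S A) (\<lambda>x. x) fst ?\<phi> (restr S)"
  proof (rule pb_squareI[OF p(1,3) pmap_id pf p(5)])
    fix U and g :: "_ \<times> (nat \<Rightarrow> (nat \<Rightarrow> nat) \<Rightarrow> unit)" and x :: "nat \<Rightarrow> (nat \<Rightarrow> nat) \<Rightarrow> 'a" assume "x \<in> PE (Maps T A) U" "restr S x = fst g"
    then show "\<exists>x'. x' \<in> PE (Maps T A) U \<and> x' = x \<and> ?\<phi> x' = g"
      by (intro exI[of _ x] conjI refl prod_eqI unit_fun) simp_all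
  qed auto
  from pcov_pullback[OF this l] show "rel_lift K A point bang S T" unfolding rel_lift_def .
qed

end

section \<open>Representability from levels and translation of the definitions\<close>

context descent begin

lemma representable_bij:
  assumes F: "psh F" "psh G" "pmap F G \<phi>" and r: "representable G"
    and b: "\<And>U y. U \<in> Ob \<Longrightarrow> y \<in> PE G U \<Longrightarrow> \<exists>x. x \<in> PE F U \<and> \<phi> x = y"
      "\<And>U x y. U \<in> Ob \<Longrightarrow> x \<in> PE F U \<Longrightarrow> y \<in> PE F U \<Longrightarrow> \<phi> x = \<phi> y \<Longrightarrow> x = y"
  shows "representable F"
  by (rule representable_pcov[OF F pcov_bij[OF stable_arrows F(1,3,2) b] r])

text \<open>By Yoneda the k-th level is the presheaf of maps from the standard k-simplex.\<close>

lemma representable_level: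
  assumes X: "good X" shows "representable (SE X k)"
proof -
  note s = goodD(1)[OF X]
  show ?thesis
  proof (rule representable_bij[OF spsD(1)[OF s] psh_Mp[OF s cx_Dl] pmap_yon[OF s] srepD[OF goodD(2)[OF X] cx_Dl]])
    fix U y assume U: "U \<in> Ob" and y: "y \<in> PE (Maps (simplex_cx k) X) U"
    show "\<exists>x. x \<in> PE (SE X k) U \<and> yon X k x = y"
      by (rule exI[of _ "y k (delta_id k)"], rule conjI[OF MpD(1)[OF y delta_id_Sx] yon_eval(2)[OF s y]])
  next
    fix U x y assume h: "U \<in> Ob" "x \<in> PE (SE X k) U" "y \<in> PE (SE X k) U" "yon X k x = yon X k y"
    have "yon X k x k (delta_id k) = yon X k y k (delta_id k)" using h(4) by simp
    then show "x = y" unfolding yon_eval(1)[OF s h(1,2)] yon_eval(1)[OF s h(1,3)] .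
  qed
qed

lemma representable_Mp_empty:
  fixes X :: "('o,'m,'x) spsh"
  assumes X: "simp_psh X" shows "representable (Maps {{}} X)"
proof (rule representable_bij[OF psh_Mp[OF X cx_single] psh_Mp[OF sps_pt cx_single] pmap_post[OF smap_bang cx_single cx_single order_refl] srepD[OF goodD(2)[OF good_pt] cx_single]])
  show "\<exists>x. x \<in> PE (Maps {{}} X) U \<and> post {{}} bang x = y" for U y
    by (intro exI[of _ "\<lambda>_ _. undefined"] conjI unit_fun) (simp add: Mp_iff Sx_empty)
  show "x = y" if "x \<in> PE (Maps {{}} X) U" "y \<in> PE (Maps {{}} X) U" for U x y
    by (rule Mp_ext[OF that]) (simp add: Sx_empty)
qed

lemma lft_arrows_pt:
  assumes X: "simp_psh X" and r: "representable (Maps S X)" "representable (Maps T X)" and S: "fin_complex S" "fin_complex T" "S \<subseteq> T"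
  shows "rel_lift (cAr C) X point bang S T"
  unfolding lft_pt_iff[OF X S] by (rule pcov_arrows[OF psh_Mp[OF X S(2)] psh_Mp[OF X S(1)] pmap_rst[OF X S] r(2,1)])

lemma representable_Mp_lft:
  assumes X: "simp_psh X" and r: "representable (Maps S X)" and S: "fin_complex S" "fin_complex T" "S \<subseteq> T" and l: "rel_lift K X point bang S T"
  shows "representable (Maps T X)"
  by (rule representable_pcov[OF psh_Mp[OF X S(2)] psh_Mp[OF X S(1)] pmap_rst[OF X S] l[unfolded lft_pt_iff[OF X S]] r])

lemma representable_Mp_Dl:
  assumes X: "simp_psh X" and r: "representable (SE X k)" shows "representable (Maps (simplex_cx k) X)"
proof (rule representable_bij[OF psh_Mp[OF X cx_Dl] spsD(1)[OF X] pmap_eval r])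
  fix U y assume U: "U \<in> Ob" and y: "y \<in> PE (SE X k) U"
  show "\<exists>x. x \<in> PE (Maps (simplex_cx k) X) U \<and> x k (delta_id k) = y"
    by (rule exI[of _ "yon X k y"], rule conjI[OF pmap_in[OF pmap_yon[OF X] U y] yon_eval(1)[OF X U y]])
next
  fix U x y assume h: "x \<in> PE (Maps (simplex_cx k) X) U" "y \<in> PE (Maps (simplex_cx k) X) U" "x k (delta_id k) = y k (delta_id k)"
  have "yon X k (x k (delta_id k)) = yon X k (y k (delta_id k))" using h(3) by simp
  then show "x = y" unfolding yon_eval(2)[OF X h(1)] yon_eval(2)[OF X h(2)] .
qed

text \<open>A nonempty V is enumerated monotonically, which reduces the cell on V to a standard
  simplex.\<close>

lemma representable_Mp_Pow:
  assumes X: "simp_psh X" and r: "\<And>k. representable (SE X k)" and V: "finite V" shows "representable (Maps (Pow V) X)"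
proof (cases "V = {}")
  case True then show ?thesis using representable_Mp_empty[OF X] by simp
next
  case False
  then obtain k where k: "card V = Suc k" using V by (metis card_gt_0_iff gr0_implies_Suc)
  obtain e where e: "bij_betw e {..k} V" "\<And>i j. i < j \<Longrightarrow> j \<le> k \<Longrightarrow> e i < e j" using enum_strict[OF V k] by blast
  have "rel_lift (cAr C) X point bang {{}} (simplex_cx k)"
    by (rule lft_arrows_pt[OF X representable_Mp_empty[OF X] representable_Mp_Dl[OF X r] cx_single cx_Dl]) simp
  from lft_cell[OF smap_bang X sps_pt V e cx_single _ this]
  have "rel_lift (cAr C) X point bang {W. W \<subseteq> V \<and> inv_into {..k} e ` W \<in> {{}}} (Pow V)" by simp
  moreover have "{W. W \<subseteq> V \<and> inv_into {..k} e ` W \<in> {{}}} = {{}}" by auto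
  ultimately have "rel_lift (cAr C) X point bang {{}} (Pow V)" by simp
  then show ?thesis by (rule representable_Mp_lft[OF X representable_Mp_empty[OF X] cx_single cx_Pow[OF V], rotated]) simp
qed

text \<open>Removing a face V of largest cardinality leaves a smaller complex S, and Map(T, X) over
  Map(S, X) is a base change of the restriction from the simplex on V to its boundary. In this way a
  terminal object and pullbacks yield all finite mapping objects.\<close>

lemma srep_levels:
  assumes X: "simp_psh X" and r: "\<And>k. representable (SE X k)" shows "srep X"
  unfolding srep_def
proof (intro allI)
  fix T show "fin_complex T \<longrightarrow> representable (Maps T X)"
  proof (induction "card T" arbitrary: T rule: less_induct)
    case less
    show ?case
    proof
      assume T: "fin_complex T"
      show "representable (Maps T X)"
      proof (cases "\<exists>V. T = Pow V \<and> finite V")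
        case True then show ?thesis using representable_Mp_Pow[OF X r] by blast
      next
        case nP: False
        define V where "V = arg_max card (\<lambda>V. V \<in> T)"
        have bound: "\<forall>V. V \<in> T \<longrightarrow> card V < Suc (Max (card ` T))" using cx_fin[OF T] by (simp add: le_imp_less_Suc)
        have V: "V \<in> T" "\<And>W. W \<in> T \<Longrightarrow> card W \<le> card V"
          using arg_max_nat_lemma[of "\<lambda>V. V \<in> T" "{}" card, OF cx_empty[OF T] bound] unfolding V_def by auto
        have fV: "finite V" using cx_finite[OF T V(1)] .
        have PV: "Pow V \<subseteq> T" using cx_down[OF T V(1)] by blast
        have "Pow V \<noteq> T" using nP fV by blast
        then have V0: "V \<noteq> {}" using V(2) cx_finite[OF T] by (metis PV card.empty card_eq_0_iff le_zero_eq Pow_bottom subset_antisym subsetI)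
        define S where "S = T - {V}"
        have S: "fin_complex S"
        proof (rule cx_subset[OF T])
          show "S \<subseteq> T" "{} \<in> S" using cx_empty[OF T] V0 unfolding S_def by auto
          fix A B assume A: "A \<in> S" and B: "B \<subseteq> A"
          have "B \<noteq> V"
          proof
            assume "B = V"
            then have "card A \<le> card B" using V(2) A unfolding S_def by blast
            then have "B = A" using card_seteq[OF cx_finite[OF T] B] A unfolding S_def by blast
            then show False using A \<open>B = V\<close> unfolding S_def by blast
          qed
          then show "B \<in> S" using A B cx_down[OF T] unfolding S_def by blast
        qed
        have TS: "T = S \<union> Pow V" using V(1) PV unfolding S_def by blast
        have "S \<subset> T" using V(1) unfolding S_def by blast
        then have "card S < card T" using cx_fin[OF T] psubset_card_mono by blast
        then have rS: "representable (Maps S X)" using less S by blast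
        have "S \<inter> Pow V \<subset> T" using PV V(1) unfolding S_def by blast
        then have "card (S \<inter> Pow V) < card T" using cx_fin[OF T] psubset_card_mono by blast
        then have rI: "representable (Maps (S \<inter> Pow V) X)" using less cx_Int[OF S cx_Pow[OF fV]] by blast
        have "rel_lift (cAr C) X point bang (S \<inter> Pow V) (Pow V)"
          by (rule lft_arrows_pt[OF X rI representable_Mp_Pow[OF X r fV] cx_Int[OF S cx_Pow[OF fV]] cx_Pow[OF fV]]) simp
        from lft_union[OF smap_bang X sps_pt S cx_Pow[OF fV] this, folded TS]
        show ?thesis by (rule representable_Mp_lft[OF X rS S T, rotated]) (simp add: S_def)
      qed
    qed
  qed
qed

lemma rep_Yo:
  assumes X: "simplicial_object C X" shows "rep (SE (Yo C X) k) (sO X k) (ID (sO X k))"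
proof (rule repI[OF soD(1)[OF X]])
  show "ID (sO X k) \<in> PE (SE (Yo C X) k) (sO X k)" unfolding Yo_simps by (rule hom_IdI[OF soD(1)[OF X]])
  fix V x assume "x \<in> PE (SE (Yo C X) k) V"
  then show "\<exists>v. v \<in> H V (sO X k) \<and> PR (SE (Yo C X) k) v (ID (sO X k)) = x" unfolding Yo_simps using Id_comp by blast
next
  fix V v w assume h: "v \<in> H V (sO X k)" "w \<in> H V (sO X k)" "PR (SE (Yo C X) k) v (ID (sO X k)) = PR (SE (Yo C X) k) w (ID (sO X k))"
  then show "v = w" unfolding Yo_simps using Id_comp[OF h(1)] Id_comp[OF h(2)] by simp
qed

lemma good_Yo: "simplicial_object C X \<Longrightarrow> good (Yo C X)"
  unfolding good_def using sps_Yo srep_levels rep_Yo unfolding representable_def by blast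

text \<open>Representing objects are chosen level by level, and the structure arrows are determined
  by their universal elements. Outside \<open>delta_hom\<close> they are \<open>undefined\<close>,
  as \<open>simplicial_object\<close> demands.\<close>

lemma simplicial_object_of_good:
  assumes F: "good F"
  obtains X \<Phi> where "simplicial_object C X" "sbij (Yo C X) F \<Phi>"
proof -
  note s = goodD(1)[OF F]
  have "\<exists>A a. rep (SE F n) A a" for n using representable_level[OF F] unfolding representable_def .
  then obtain A a where r: "\<And>n. rep (SE F n) (A n) (a n)" by metis
  note rA = repD(1)[OF r] and ra = repD(2)[OF r]
  have "\<exists>v. v \<in> H (A n) (A m) \<and> PR (SE F m) v (a m) = SA F m n \<theta> (a n)" if t: "delta_hom m n \<theta>" for m n \<theta>
    using rep_lift[OF r rA pmap_in[OF spsD(2)[OF s t] rA ra]] by metis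
  note ex = this
  define M where "M m n \<theta> = (if delta_hom m n \<theta> then (SOME v. v \<in> H (A n) (A m) \<and> PR (SE F m) v (a m) = SA F m n \<theta> (a n)) else undefined)" for m n \<theta>
  have M: "M m n \<theta> \<in> H (A n) (A m)" "PR (SE F m) (M m n \<theta>) (a m) = SA F m n \<theta> (a n)" if t: "delta_hom m n \<theta>" for m n \<theta>
    using someI_ex[OF ex[OF t]] t unfolding M_def by auto
  define X where "X = \<lparr>sO = A, sM = M\<rparr>"
  have so: "simplicial_object C X"
    unfolding simplicial_object_def X_def sobj.simps
  proof (intro conjI allI impI)
    fix n show "M n n (delta_id n) = ID (A n)"
      by (rule rep_eq[OF r M(1)[OF delta_id_hom] hom_IdI[OF rA]])
         (simp add: M(2)[OF delta_id_hom] spsD(3)[OF s rA ra] psh_id[OF spsD(1)[OF s] rA ra])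
  next
    fix l m n \<theta> \<psi> assume "delta_hom m n \<theta> \<and> delta_hom l m \<psi>"
    then have t: "delta_hom m n \<theta>" "delta_hom l m \<psi>" by auto
    note t3 = dcomp_delta[OF t]
    show "M l n (dcomp l \<theta> \<psi>) = M l m \<psi> \<cdot> M m n \<theta>"
    proof (rule rep_eq[OF r M(1)[OF t3] hom_compI[OF M(1)[OF t(1)] M(1)[OF t(2)]]])
      have "PR (SE F l) (M l m \<psi> \<cdot> M m n \<theta>) (a l) = PR (SE F l) (M m n \<theta>) (SA F l m \<psi> (a m))"
        using psh_comp[OF spsD(1)[OF s] M(1)[OF t(2)] M(1)[OF t(1)] ra] M(2)[OF t(2)] by simp
      also have "\<dots> = SA F l m \<psi> (SA F m n \<theta> (a n))"
        using pmap_nat[OF spsD(2)[OF s t(2)] M(1)[OF t(1)] ra] M(2)[OF t(1)] by simp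
      finally show "PR (SE F l) (M l n (dcomp l \<theta> \<psi>)) (a l) = PR (SE F l) (M l m \<psi> \<cdot> M m n \<theta>) (a l)"
        using M(2)[OF t3] spsD(4)[OF s t rA ra] by simp
    qed
  qed (use rA M in \<open>auto simp: M_def\<close>)
  have "sbij (Yo C X) F (\<lambda>n x. PR (SE F n) x (a n))"
  proof (rule sbijI)
    show "smap (Yo C X) F (\<lambda>n x. PR (SE F n) x (a n))"
    proof (rule smapI)
      show "pmap (SE (Yo C X) n) (SE F n) (\<lambda>x. PR (SE F n) x (a n))" for n
        by (rule pmapI) (simp_all add: Yo_simps X_def psh_res[OF spsD(1)[OF s] _ ra] psh_comp[OF spsD(1)[OF s] _ _ ra])
      fix m n \<theta> U x assume t: "delta_hom m n \<theta>" and "x \<in> PE (SE (Yo C X) n) U"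
      then have x: "x \<in> H U (A n)" by (simp add: Yo_simps X_def)
      show "PR (SE F m) (SA (Yo C X) m n \<theta> x) (a m) = SA F m n \<theta> (PR (SE F n) x (a n))"
        using psh_comp[OF spsD(1)[OF s] M(1)[OF t] x ra] M(2)[OF t] pmap_nat[OF spsD(2)[OF s t] x ra]
        by (simp add: Yo_simps X_def)
    qed
    fix n U y assume "U \<in> Ob" "y \<in> PE (SE F n) U"
    then show "\<exists>x. x \<in> PE (SE (Yo C X) n) U \<and> PR (SE F n) x (a n) = y"
      using rep_lift[OF r] by (simp add: Yo_simps X_def) metis
  next
    fix n U x y assume "x \<in> PE (SE (Yo C X) n) U" "y \<in> PE (SE (Yo C X) n) U" "PR (SE F n) x (a n) = PR (SE F n) y (a n)"
    then show "x = y" using rep_eq[OF r] by (simp add: Yo_simps X_def) 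
  qed
  then show thesis using that so by blast
qed

text \<open>For any choice of representing objects a single arrow decides the condition. Since
  \<open>rel_restr_has\<close> quantifies over all choices, the direction to \<open>rel_lift\<close>
  rests on their existence, which goodness provides.\<close>

lemma rel_restr_iff:
  assumes K: "stable_class C K" and X: "simplicial_object C X" "simplicial_object C Y" "smor C X Y f"
    and S: "fin_complex S" "fin_complex T" "S \<subseteq> T"
  shows "rel_restr_has C (\<lambda>c. c \<in> K) (cxs S) (cxs T) X Y f \<longleftrightarrow> rel_lift K (Yo C X) (Yo C Y) (ym C f) S T"
proof -
  let ?R = "RelMaps S T (Yo C X) (Yo C Y) (ym C f)" and ?\<phi> = "\<lambda>\<tau>. (restr S \<tau>, post T (ym C f) \<tau>)"
  note g = good_Yo[OF X(1)] good_Yo[OF X(2)]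
  note m = smap_ym[OF X] goodD(1)[OF g(1)] goodD(1)[OF g(2)]
  note p = psh_Mp[OF m(2) S(2)] psh_Rel[OF m S] pmap_to_Rel[OF m S]
  have eq: "?\<phi> (restr T \<tau>) = PR ?R c (restr S \<sigma>0, restr T \<rho>0) \<longleftrightarrow>
      (\<forall>n. \<forall>t\<in>Smp (cxs S) n. \<sigma>0 n t \<cdot> c = \<tau> n t) \<and> (\<forall>n. \<forall>t\<in>Smp (cxs T) n. \<rho>0 n t \<cdot> c = f n \<cdot> \<tau> n t)" for \<tau> c \<sigma>0 \<rho>0
    unfolding PR_Rel fst_conv snd_conv PR_rst prod.inject post_post[OF S(3)] post_post[OF order_refl] post_eq_iff cxs_simps ym_def
    by (auto simp: eq_commute)
  show ?thesis
  proof
    assume l: "rel_lift K (Yo C X) (Yo C Y) (ym C f) S T"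
    show "rel_restr_has C (\<lambda>c. c \<in> K) (cxs S) (cxs T) X Y f"
      unfolding rel_restr_has_def
    proof (intro allI impI, elim conjE)
      fix M \<tau> B \<sigma>0 \<rho>0 c
      assume h: "rep_Map C (cxs T) X M \<tau>" "rep_rel C (cxs S) (cxs T) X Y f B \<sigma>0 \<rho>0" "c \<in> H M B"
        "\<forall>n. \<forall>t\<in>Smp (cxs S) n. \<sigma>0 n t \<cdot> c = \<tau> n t" "\<forall>n. \<forall>t\<in>Smp (cxs T) n. \<rho>0 n t \<cdot> c = f n \<cdot> \<tau> n t"
      have "?\<phi> (restr T \<tau>) = PR ?R c (restr S \<sigma>0, restr T \<rho>0)" unfolding eq using h(4,5) by blast
      from rep_pcov_iff[OF K p, OF h(1)[unfolded rep_Map_cxs[OF X(1) S(2)]] h(2)[unfolded rep_rel_iff[OF X S]] h(3) this] l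
      show "c \<in> K" unfolding rel_lift_def by blast
    qed
  next
    assume r: "rel_restr_has C (\<lambda>c. c \<in> K) (cxs S) (cxs T) X Y f"
    obtain M \<tau> where rM: "rep (Maps T (Yo C X)) M \<tau>"
      using srepD[OF goodD(2)[OF g(1)] S(2)] unfolding representable_def by blast
    obtain B \<beta> where rB: "rep ?R B \<beta>"
      using representable_Rel[OF m goodD(2)[OF g(1)] goodD(2)[OF g(2)] S] unfolding representable_def by blast
    obtain c where c: "c \<in> H M B" "?\<phi> \<tau> = PR ?R c \<beta>" using rep_map[OF p(3) rM rB] .
    have t: "restr T \<tau> = \<tau>" by (rule rst_id[OF repD(2)[OF rM]])
    have b': "fst \<beta> \<in> PE (Maps S (Yo C X)) B" "snd \<beta> \<in> PE (Maps T (Yo C Y)) B" using repD(2)[OF rB] unfolding PE_Rel by auto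
    have b: "(restr S (fst \<beta>), restr T (snd \<beta>)) = \<beta>" by (simp add: prod_eq_iff rst_id[OF b'(1)] rst_id[OF b'(2)])
    have 1: "rep_Map C (cxs T) X M \<tau>" unfolding rep_Map_cxs[OF X(1) S(2)] t by (rule rM)
    have 2: "rep_rel C (cxs S) (cxs T) X Y f B (fst \<beta>) (snd \<beta>)" unfolding rep_rel_iff[OF X S] b by (rule rB)
    have "?\<phi> (restr T \<tau>) = PR ?R c (restr S (fst \<beta>), restr T (snd \<beta>))" unfolding t b by (rule c(2))
    then have "c \<in> K" using r 1 2 c(1) unfolding rel_restr_has_def eq by blast
    then show "rel_lift K (Yo C X) (Yo C Y) (ym C f) S T" unfolding rel_lift_def using rep_pcov_iff[OF K p, OF rM rB c] by blast
  qed
qed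

lemma restr_iff:
  assumes K: "stable_class C K" and X: "simplicial_object C X" and S: "fin_complex S" "fin_complex T" "S \<subseteq> T"
  shows "restr_has C (\<lambda>c. c \<in> K) (cxs S) (cxs T) X \<longleftrightarrow> rel_lift K (Yo C X) point bang S T"
proof -
  note g = good_Yo[OF X] and s = goodD(1)[OF good_Yo[OF X]]
  note p = psh_Mp[OF s S(2)] psh_Mp[OF s S(1)] pmap_rst[OF s S]
  have eq: "restr S (restr T \<tau>) = PR (Maps S (Yo C X)) c (restr S \<mu>) \<longleftrightarrow> (\<forall>n. \<forall>t\<in>Smp (cxs S) n. \<mu> n t \<cdot> c = \<tau> n t)" for \<tau> c \<mu>
    unfolding PR_rst post_post[OF S(3)] post_eq_iff cxs_simps by (auto simp: eq_commute)
  show ?thesis unfolding lft_pt_iff[OF s S]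
  proof
    assume l: "pcov K (Maps T (Yo C X)) (Maps S (Yo C X)) (restr S)"
    show "restr_has C (\<lambda>c. c \<in> K) (cxs S) (cxs T) X"
      unfolding restr_has_def
    proof (intro allI impI, elim conjE)
      fix M \<tau> L \<mu> c
      assume h: "rep_Map C (cxs T) X M \<tau>" "rep_Map C (cxs S) X L \<mu>" "c \<in> H M L" "\<forall>n. \<forall>t\<in>Smp (cxs S) n. \<mu> n t \<cdot> c = \<tau> n t"
      from rep_pcov_iff[OF K p, OF h(1)[unfolded rep_Map_cxs[OF X S(2)]] h(2)[unfolded rep_Map_cxs[OF X S(1)]] h(3) h(4)[folded eq]] l
      show "c \<in> K" by blast
    qed
  next
    assume r: "restr_has C (\<lambda>c. c \<in> K) (cxs S) (cxs T) X"
    obtain M \<tau> where rM: "rep (Maps T (Yo C X)) M \<tau>" using srepD[OF goodD(2)[OF g] S(2)] unfolding representable_def by blast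
    obtain B \<beta> where rB: "rep (Maps S (Yo C X)) B \<beta>" using srepD[OF goodD(2)[OF g] S(1)] unfolding representable_def by blast
    obtain c where c: "c \<in> H M B" "restr S \<tau> = PR (Maps S (Yo C X)) c \<beta>" using rep_map[OF p(3) rM rB] .
    have t: "restr T \<tau> = \<tau>" "restr S \<beta> = \<beta>" using rst_id[OF repD(2)[OF rM]] rst_id[OF repD(2)[OF rB]] by auto
    have 1: "rep_Map C (cxs T) X M \<tau>" unfolding rep_Map_cxs[OF X S(2)] t by (rule rM)
    have 2: "rep_Map C (cxs S) X B \<beta>" unfolding rep_Map_cxs[OF X S(1)] t by (rule rB)
    have "restr S (restr T \<tau>) = PR (Maps S (Yo C X)) c (restr S \<beta>)" unfolding t by (rule c(2))
    then have "c \<in> K" using r 1 2 c(1) unfolding restr_has_def eq by blast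
    then show "pcov K (Maps T (Yo C X)) (Maps S (Yo C X)) (restr S)" using rep_pcov_iff[OF K p, OF rM rB c] by blast
  qed
qed

lemma hypercover_iff:
  assumes "simplicial_object C X" "simplicial_object C Y" "smor C X Y f"
  shows "hypercover C Cov X Y f \<longleftrightarrow> hcover Cov (Yo C X) (Yo C Y) (ym C f)"
  unfolding hypercover_def hcover_def boundary_cxs std_simplex_cxs rel_restr_iff[OF stable_Cov assms cx_bd cx_Dl bd_Dl] ..

lemma fibration_iff:
  assumes "simplicial_object C X" "simplicial_object C Y" "smor C X Y f"
  shows "fibration C Cov X Y f \<longleftrightarrow> fibr Cov 0 (Yo C X) (Yo C Y) (ym C f)"
  unfolding fibration_def fibr_def horn_cxs std_simplex_cxs using rel_restr_iff[OF stable_Cov assms cx_hn cx_Dl hn_Dl] by auto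

lemma kgroupoid_iff:
  "kgroupoid C Cov k X \<longleftrightarrow> simplicial_object C X \<and> Kan (Yo C X) \<and> fibr (isos C) (Suc k) (Yo C X) point bang"
proof (cases "simplicial_object C X")
  case True
  have 1: "restr_has C (\<lambda>c. c \<in> Cov) (horn n i) (std_simplex n) X \<longleftrightarrow> rel_lift Cov (Yo C X) point bang (horn_cx n i) (simplex_cx n)" if "0 < n" for n i
    unfolding horn_cxs std_simplex_cxs by (rule restr_iff[OF stable_Cov True cx_hn[OF that] cx_Dl hn_Dl])
  have 2: "restr_has C (is_iso C) (horn n i) (std_simplex n) X \<longleftrightarrow> rel_lift (isos C) (Yo C X) point bang (horn_cx n i) (simplex_cx n)" if "0 < n" for n i
    using restr_iff[OF stable_isos True cx_hn[OF that, of i] cx_Dl hn_Dl] unfolding horn_cxs std_simplex_cxs by simp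
  have a: "(\<forall>n i. 0 < n \<and> i \<le> n \<longrightarrow> restr_has C (\<lambda>c. c \<in> Cov) (horn n i) (std_simplex n) X) \<longleftrightarrow> Kan (Yo C X)"
    unfolding fibr_def by (auto simp: 1)
  have "(k < n \<and> i \<le> n \<longrightarrow> restr_has C (is_iso C) (horn n i) (std_simplex n) X) \<longleftrightarrow>
      (0 < n \<longrightarrow> Suc k \<le> n \<longrightarrow> i \<le> n \<longrightarrow> rel_lift (isos C) (Yo C X) point bang (horn_cx n i) (simplex_cx n))" for n i
    using 2[of n i] by (cases "k < n") (simp_all add: Suc_le_eq)
  then have b: "(\<forall>n i. k < n \<and> i \<le> n \<longrightarrow> restr_has C (is_iso C) (horn n i) (std_simplex n) X) \<longleftrightarrow> fibr (isos C) (Suc k) (Yo C X) point bang"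
    unfolding fibr_def by simp
  show ?thesis unfolding kgroupoid_def a b ..
qed (simp add: kgroupoid_def)

section \<open>Path spaces and weak equivalences of simplicial objects\<close>

definition prism_pair :: "nat \<Rightarrow> (nat \<Rightarrow> nat) \<Rightarrow> (nat \<Rightarrow> nat) \<times> (nat \<Rightarrow> nat)" where
  "prism_pair k t = (dv k t, dcomp k (\<lambda>v. v mod 2) t)"

lemma iso_prism: "iso_sset (prism m) (prism_cx m) prism_pair"
  unfolding iso_sset_def
proof (intro conjI allI impI cx_Pr)
  have dm: "delta_hom k m (dv k t) \<and> delta_hom k 1 (dcomp k (\<lambda>v. v mod 2) t)" if t: "t \<in> simplices (prism_cx m) k" for k t
  proof -
    have "t i mod 2 \<le> t j mod 2" if "i \<le> j" "j \<le> k" for i j using Sx_Xi_mod[OF t that] .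
    then show ?thesis using dv_delta[OF t] unfolding delta_hom_def[of k 1] dcomp_def by auto
  qed
  fix k
  show "bij_betw (prism_pair k) (simplices (prism_cx m) k) (Smp (prism m) k)"
    unfolding bij_betw_def
  proof
    show "inj_on (prism_pair k) (simplices (prism_cx m) k)"
    proof (rule inj_onI, rule ext)
      fix s t i assume s: "s \<in> simplices (prism_cx m) k" and t: "t \<in> simplices (prism_cx m) k" and e: "prism_pair k s = prism_pair k t"
      show "s i = t i"
      proof (cases "i \<le> k")
        case True
        have "dv k s i = dv k t i" "dcomp k (\<lambda>v. v mod 2) s i = dcomp k (\<lambda>v. v mod 2) t i" using e unfolding prism_pair_def by auto
        then have "s i div 2 = t i div 2" "s i mod 2 = t i mod 2" using True by (simp_all add: dcomp_def)
        then show ?thesis by (metis div_mult_mod_eq)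
      qed (use SxD(2)[OF s] SxD(2)[OF t] in simp)
    qed
    show "prism_pair k ` simplices (prism_cx m) k = Smp (prism m) k"
    proof
      show "prism_pair k ` simplices (prism_cx m) k \<subseteq> Smp (prism m) k" using dm unfolding prism_def prism_pair_def by auto
      show "Smp (prism m) k \<subseteq> prism_pair k ` simplices (prism_cx m) k"
      proof
        fix p assume p: "p \<in> Smp (prism m) k"
        obtain \<alpha> \<phi> where "p = (\<alpha>, \<phi>)" by (cases p)
        with p have a: "p = (\<alpha>, \<phi>)" "delta_hom k m \<alpha>" "delta_hom k 1 \<phi>" by (auto simp: prism_def)
        define t where "t i = (if i \<le> k then 2 * \<alpha> i + \<phi> i else 0)" for i
        have ph: "\<phi> i \<le> 1" if "i \<le> k" for i using a(3) that unfolding delta_hom_def by blast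
        have td: "t i div 2 = \<alpha> i" "t i mod 2 = \<phi> i" if "i \<le> k" for i using ph[OF that] that unfolding t_def by auto
        have mono: "\<alpha> i \<le> \<alpha> j" "\<phi> i \<le> \<phi> j" if "i \<le> j" "j \<le> k" for i j using a(2,3) that unfolding delta_hom_def by blast+
        have zero: "\<alpha> i = 0" "\<phi> i = 0" if "k < i" for i using a(2,3) that unfolding delta_hom_def by blast+
        have "t i mod 2 \<le> t j mod 2" if ij: "i \<le> k" "j \<le> k" "t i \<le> t j" for i j
        proof (cases "i \<le> j")
          case True then show ?thesis using mono(2)[OF True ij(2)] td ij by simp
        next
          case False
          then have "j \<le> i" by simp
          then have "\<alpha> j \<le> \<alpha> i" using mono(1) ij(1) by blast
          then have "\<phi> i \<le> \<phi> j" using ij unfolding t_def by simp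
          then show ?thesis using td ij by simp
        qed
        moreover have "\<alpha> i \<le> m" if "i \<le> k" for i using a(2) that unfolding delta_hom_def by blast
        ultimately have "t ` {..k} \<in> prism_cx m" unfolding Pr_iff using td by auto
        moreover have "t i \<le> t j" if "i \<le> j" "j \<le> k" for i j using mono[OF that] that unfolding t_def by simp
        ultimately have "t \<in> simplices (prism_cx m) k" unfolding simplices_def by (auto simp: t_def)
        moreover have "prism_pair k t = p" unfolding a(1) prism_pair_def dcomp_def using td zero by (auto simp: fun_eq_iff)
        ultimately show "p \<in> prism_pair k ` simplices (prism_cx m) k" by blast
      qed
    qed
  qed
next
  fix l n \<theta> t assume th: "delta_hom l n \<theta>"
  show "Act (prism m) l n \<theta> (prism_pair n t) = prism_pair l (dcomp l t \<theta>)"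
    unfolding prism_def prism_pair_def using dcomp_swap[OF th] by simp
qed

text \<open>The path in Y named by an arrow x into the m-th level of a path space, through the
  universal prism \<open>\<epsilon> m\<close>.\<close>

definition classify :: "(nat \<Rightarrow> nat \<Rightarrow> (nat \<Rightarrow> nat) \<times> (nat \<Rightarrow> nat) \<Rightarrow> 'm) \<Rightarrow> nat \<Rightarrow> 'm \<Rightarrow> nat \<Rightarrow> (nat \<Rightarrow> nat) \<Rightarrow> 'm" where
  "classify \<epsilon> m x = transfer (prism_cx m) prism_pair (\<lambda>k s. \<epsilon> m k s \<cdot> x)"

lemma Th_app: "t \<in> simplices (prism_cx m) k \<Longrightarrow> classify \<epsilon> m x k t = \<epsilon> m k (prism_pair k t) \<cdot> x"
  unfolding classify_def transfer_def by simp

lemma Th_PR: "classify \<epsilon> m x = PR (Maps (prism_cx m) (Yo C Y)) x (transfer (prism_cx m) prism_pair (\<epsilon> m))"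
  unfolding classify_def PR_tr ..

lemma pk_lev: "prism_pair m (lev 0 m) = (delta_id m, \<lambda>i. 0)" "prism_pair m (lev 1 m) = (delta_id m, \<lambda>i. if i \<le> m then 1 else 0)"
  unfolding prism_pair_def lev_def dcomp_def delta_id_def by (auto simp: fun_eq_iff)

lemma evp_Th: "evp 0 m (classify \<epsilon> m x) = ev0 \<epsilon> m \<cdot> x" "evp 1 m (classify \<epsilon> m x) = ev1 \<epsilon> m \<cdot> x"
  unfolding evp_def ev0_def ev1_def pk_lev[symmetric] by (simp_all add: Th_app[OF lev_Sx])

text \<open>The universal prisms make each level of Q represent the maps from the prism to Y, and
  the last clause of \<open>path_space\<close> says that the operators of Q act through
  \<open>prism_map\<close>.\<close>

lemma path_space_Th:
  assumes Y: "simplicial_object C Y" and p: "path_space C Y Q \<epsilon>"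
  shows "simplicial_object C Q" "sbij (Yo C Q) (PathSp (Yo C Y)) (classify \<epsilon>)"
proof -
  show Q: "simplicial_object C Q" using p unfolding path_space_def by blast
  have r: "rep (Maps (prism_cx m) (Yo C Y)) (sO Q m) (transfer (prism_cx m) prism_pair (\<epsilon> m))" for m
    using p rep_Map_tr[OF iso_prism Y] unfolding path_space_def by blast
  note rm = repD(2)[OF r]
  note pM = psh_Mp[OF sps_Yo[OF Y] cx_Pr]
  have e: "\<epsilon> m k s \<in> H (sO Q m) (sO Y k)" if "s \<in> Smp (prism m) k" for m k s
    using rm[of m] that unfolding is_point_tr[OF iso_prism, symmetric] is_point_def by blast
  have nat: "\<epsilon> l k (\<alpha>, \<phi>) \<cdot> sM Q l m \<theta> = \<epsilon> m k (dcomp k \<theta> \<alpha>, \<phi>)"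
    if "delta_hom l m \<theta>" "(\<alpha>, \<phi>) \<in> Smp (prism l) k" for l m k \<theta> \<alpha> \<phi>
    using p that unfolding path_space_def by blast
  show "sbij (Yo C Q) (PathSp (Yo C Y)) (classify \<epsilon>)"
  proof (rule sbijI)
    show "smap (Yo C Q) (PathSp (Yo C Y)) (classify \<epsilon>)"
    proof (rule smapI)
      show "pmap (SE (Yo C Q) m) (SE (PathSp (Yo C Y)) m) (classify \<epsilon> m)" for m
        unfolding P1_simps Th_PR[where Y = Y]
        by (rule pmapI) (simp_all add: Yo_simps psh_res[OF pM _ rm] psh_comp[OF pM _ _ rm])
      fix l m \<theta> U x assume th: "delta_hom l m \<theta>" and "x \<in> PE (SE (Yo C Q) m) U"
      then have x: "x \<in> H U (sO Q m)" by (simp add: Yo_simps)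
      show "classify \<epsilon> l (SA (Yo C Q) l m \<theta> x) = SA (PathSp (Yo C Y)) l m \<theta> (classify \<epsilon> m x)"
        unfolding P1_simps
      proof (intro ext)
        fix k t show "classify \<epsilon> l (SA (Yo C Q) l m \<theta> x) k t = reindex (prism_map \<theta>) (prism_cx l) (classify \<epsilon> m x) k t"
        proof (cases "t \<in> simplices (prism_cx l) k")
          case True
          have s: "prism_pair k t \<in> Smp (prism l) k" using iso_ssetD(2)[OF iso_prism] True by blast
          have "prism_pair k (dcomp k (prism_map \<theta>) t) = (dcomp k \<theta> (dv k t), dcomp k (\<lambda>v. v mod 2) t)"
            unfolding prism_pair_def dcomp_def prism_map_def by (auto simp: fun_eq_iff)
          then have "\<epsilon> l k (prism_pair k t) \<cdot> sM Q l m \<theta> = \<epsilon> m k (prism_pair k (dcomp k (prism_map \<theta>) t))"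
            using nat[OF th s[unfolded prism_pair_def]] unfolding prism_pair_def[of k t] by simp
          then show ?thesis
            using comp_assoc[OF x soD(2)[OF Q th] e[OF s]] vmap_Sx[OF vmap_delta[OF th] True] True
            by (simp add: Th_app re_app Yo_simps)
        qed (simp add: classify_def transfer_def reindex_def)
      qed
    qed
    fix m U y assume "U \<in> Ob" "y \<in> PE (SE (PathSp (Yo C Y)) m) U"
    then obtain v where "v \<in> H U (sO Q m)" "PR (Maps (prism_cx m) (Yo C Y)) v (transfer (prism_cx m) prism_pair (\<epsilon> m)) = y"
      using rep_lift[OF r] unfolding P1_simps by metis
    then show "\<exists>x. x \<in> PE (SE (Yo C Q) m) U \<and> classify \<epsilon> m x = y" unfolding Yo_simps Th_PR[where Y = Y] by blast
  next
    fix m U x y assume "x \<in> PE (SE (Yo C Q) m) U" "y \<in> PE (SE (Yo C Q) m) U" "classify \<epsilon> m x = classify \<epsilon> m y"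
    then show "x = y" unfolding Yo_simps Th_PR[where Y = Y] by (rule rep_eq[OF r])
  qed
qed

text \<open>\<open>weak_equiv\<close> quantifies over all path spaces, and existence keeps it from
  holding vacuously. The family \<epsilon> is read off from the universal elements of an object
  representing \<open>PathSp\<close>.\<close>

lemma ex_path_space:
  assumes Y: "simplicial_object C Y" obtains Q \<epsilon> where "path_space C Y Q \<epsilon>"
proof -
  obtain Q \<Theta> where Q: "simplicial_object C Q" and b: "sbij (Yo C Q) (PathSp (Yo C Y)) \<Theta>"
    using simplicial_object_of_good[OF good_P1[OF good_Yo[OF Y]]] by blast
  have sT: "smap (Yo C Q) (PathSp (Yo C Y)) \<Theta>" and bij: "\<And>n U. U \<in> Ob \<Longrightarrow> bij_betw (\<Theta> n) (H U (sO Q n)) (PE (Maps (prism_cx n) (Yo C Y)) U)"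
    using b unfolding sbij_def Yo_simps P1_simps by auto
  let ?g = "\<lambda>m. \<Theta> m (ID (sO Q m))"
  note i = hom_IdI[OF soD(1)[OF Q]]
  have gm: "?g m \<in> PE (Maps (prism_cx m) (Yo C Y)) (sO Q m)" for m
    using bij_betwE[OF bij[OF soD(1)[OF Q, of m], of m]] i[of m] by blast
  have nat: "\<Theta> m x = PR (Maps (prism_cx m) (Yo C Y)) x (?g m)" if x: "x \<in> H U (sO Q m)" for m x U
    using pmap_nat[OF smapD(1)[OF sT, of m] x, of "ID (sO Q m)"] i[of m] Id_comp[OF x] by (simp add: Yo_simps P1_simps)
  have r: "rep (Maps (prism_cx m) (Yo C Y)) (sO Q m) (?g m)" for m
  proof (rule repI[OF soD(1)[OF Q] gm])
    fix V x assume V: "V \<in> Ob" and x: "x \<in> PE (Maps (prism_cx m) (Yo C Y)) V"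
    have "x \<in> \<Theta> m ` H V (sO Q m)" unfolding bij_betw_imp_surj_on[OF bij[OF V]] by (rule x)
    then obtain v where v: "x = \<Theta> m v" "v \<in> H V (sO Q m)" by (rule imageE)
    have "PR (Maps (prism_cx m) (Yo C Y)) v (?g m) = x" unfolding v(1) by (rule nat[OF v(2), symmetric])
    then show "\<exists>v. v \<in> H V (sO Q m) \<and> PR (Maps (prism_cx m) (Yo C Y)) v (?g m) = x" using v(2) by blast
  next
    fix V v w assume h: "v \<in> H V (sO Q m)" "w \<in> H V (sO Q m)" "PR (Maps (prism_cx m) (Yo C Y)) v (?g m) = PR (Maps (prism_cx m) (Yo C Y)) w (?g m)"
    have "\<Theta> m v = \<Theta> m w" using h(3) unfolding nat[OF h(1), symmetric] nat[OF h(2), symmetric] .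
    then show "v = w" by (rule inj_onD[OF bij_betw_imp_inj_on[OF bij[OF hom_dom[OF h(1)]]] _ h(1,2)])
  qed
  define \<epsilon> where "\<epsilon> m = (SOME x. transfer (prism_cx m) prism_pair x = ?g m)" for m
  have e: "transfer (prism_cx m) prism_pair (\<epsilon> m) = ?g m" for m
    unfolding \<epsilon>_def by (rule someI_ex[OF tr_surj[OF iso_prism gm]])
  have "path_space C Y Q \<epsilon>"
    unfolding path_space_def
  proof (intro conjI allI impI Q)
    show "rep_Map C (prism m) Y (sO Q m) (\<epsilon> m)" for m unfolding rep_Map_tr[OF iso_prism Y] e by (rule r)
    fix l m \<theta> k assume th: "delta_hom l m \<theta>"
    show "\<forall>(\<alpha>, \<phi>)\<in>Smp (prism l) k. \<epsilon> l k (\<alpha>, \<phi>) \<cdot> sM Q l m \<theta> = \<epsilon> m k (dcomp k \<theta> \<alpha>, \<phi>)"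
    proof
      fix p assume "p \<in> Smp (prism l) k"
      then obtain t where t: "t \<in> simplices (prism_cx l) k" "p = prism_pair k t" using iso_ssetD(2)[OF iso_prism] by blast
      note t' = vmap_Sx[OF vmap_delta[OF th] t(1)]
      have pe: "prism_pair k (dcomp k (prism_map \<theta>) t) = (dcomp k \<theta> (dv k t), dcomp k (\<lambda>v. v mod 2) t)"
        unfolding prism_pair_def dcomp_def prism_map_def by (auto simp: fun_eq_iff)
      have "\<Theta> l (sM Q l m \<theta> \<cdot> ID (sO Q m)) = reindex (prism_map \<theta>) (prism_cx l) (?g m)"
        using smapD(2)[OF sT th soD(1)[OF Q, of m], of "ID (sO Q m)"] i[of m] by (simp add: Yo_simps P1_simps)
      then have "PR (Maps (prism_cx l) (Yo C Y)) (sM Q l m \<theta>) (?g l) = reindex (prism_map \<theta>) (prism_cx l) (?g m)"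
        unfolding comp_Id[OF soD(2)[OF Q th]] nat[OF soD(2)[OF Q th], symmetric] .
      from fun_cong[OF fun_cong[OF this, of k], of t]
      have "\<epsilon> l k (prism_pair k t) \<cdot> sM Q l m \<theta> = \<epsilon> m k (prism_pair k (dcomp k (prism_map \<theta>) t))"
        unfolding e[symmetric] PR_tr re_app[OF t(1)] using t(1) t' by (simp add: transfer_def)
      then show "case p of (\<alpha>, \<phi>) \<Rightarrow> \<epsilon> l k (\<alpha>, \<phi>) \<cdot> sM Q l m \<theta> = \<epsilon> m k (dcomp k \<theta> \<alpha>, \<phi>)"
        unfolding pe t(2) by (simp add: prism_pair_def)
    qed
  qed
  then show thesis using that by blast
qed

lemma smor_ev:
  assumes Y: "simplicial_object C Y" and p: "path_space C Y Q \<epsilon>"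
  shows "smor C Q Y (ev0 \<epsilon>)" "smor C Q Y (ev1 \<epsilon>)"
proof -
  note Q = path_space_Th[OF assms]
  note sT = Q(2)[unfolded sbij_def, THEN conjunct1]
  have e: "0 = (0::nat) \<or> 0 = (1::nat)" "1 = (0::nat) \<or> 1 = (1::nat)" by simp_all
  have *: "smor C Q Y g" if s: "smap (Yo C Q) (Yo C Y) (\<lambda>n x. g n \<cdot> x)" and gh: "\<And>n. g n \<in> H (sO Q n) (sO Y n)" for g
  proof -
    obtain f where f: "smor C Q Y f" "\<And>n U x. x \<in> H U (sO Q n) \<Longrightarrow> f n \<cdot> x = g n \<cdot> x" using yoneda[OF Q(1) Y s] by blast
    have "f = g"
    proof
      fix n show "f n = g n" using f(2)[OF hom_IdI[OF soD(1)[OF Q(1)]], of n] comp_Id[OF smorD(1)[OF f(1)]] comp_Id[OF gh] by simp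
    qed
    then show ?thesis using f(1) by simp
  qed
  have point: "is_point C (prism n) Y (sO Q n) (\<epsilon> n)" for n using p unfolding path_space_def rep_Map_def by blast
  have s: "prism_pair n (lev e n) \<in> Smp (prism n) n" if "e = 0 \<or> e = 1" for e n using iso_ssetD(2)[OF iso_prism] lev_Sx[OF that] by blast
  have "\<epsilon> n n (prism_pair n (lev e n)) \<in> H (sO Q n) (sO Y n)" if "e = 0 \<or> e = 1" for e n using point s[OF that] unfolding is_point_def by blast
  note h = this[OF e(1), unfolded pk_lev, folded ev0_def] this[OF e(2), unfolded pk_lev, folded ev1_def]
  show "smor C Q Y (ev0 \<epsilon>)" by (rule *[OF _ h(1)]) (use smap_comp[OF sT smap_evp[OF e(1)]] in \<open>simp add: evp_Th\<close>)
  show "smor C Q Y (ev1 \<epsilon>)" by (rule *[OF _ h(2)]) (use smap_comp[OF sT smap_evp[OF e(2)]] in \<open>simp only: evp_Th\<close>)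
qed

lemma levelwise_spb:
  assumes so: "simplicial_object C P" "simplicial_object C X" "simplicial_object C Z" "simplicial_object C Y"
    and m: "smor C P X p" "smor C P Z q" "smor C X Y f" "smor C Z Y g"
    and pb: "\<And>m. is_pullback C (f m) (g m) (p m) (q m)"
  shows "spb (Yo C P) (Yo C X) (Yo C Z) (Yo C Y) (ym C p) (ym C g) (ym C q) (ym C f)"
proof (rule spbI[OF sps_Yo[OF so(1)] sps_Yo[OF so(2)] sps_Yo[OF so(3)] sps_Yo[OF so(4)]
    smap_ym[OF so(1,2) m(1)] smap_ym[OF so(3,4) m(4)] smap_ym[OF so(1,3) m(2)] smap_ym[OF so(2,4) m(3)]])
  fix n
  note h = smorD(1)[OF m(1), of n] smorD(1)[OF m(2), of n] smorD(1)[OF m(3), of n] smorD(1)[OF m(4), of n]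
  have P: "cDom C (p n) = sO P n" using hom_arrow[OF h(1)] by blast
  have c: "f n \<cdot> p n = g n \<cdot> q n" using pb[of n] unfolding is_pullback_def by blast
  fix U x assume "x \<in> PE (SE (Yo C P) n) U"
  then have x: "x \<in> H U (sO P n)" unfolding Yo_simps .
  show fg: "ym C f n (ym C p n x) = ym C g n (ym C q n x)"
    unfolding ym_def using comp_assoc[OF x h(1,3)] comp_assoc[OF x h(2,4)] c by simp
  fix y assume "y \<in> PE (SE (Yo C P) n) U"
  then have y: "y \<in> H U (sO P n)" unfolding Yo_simps .
  assume e: "ym C p n x = ym C p n y" "ym C q n x = ym C q n y"
  show "x = y"
    using pullback_univ[OF pb h(3,4) hom_compI[OF x h(1)] hom_compI[OF x h(2)] fg[unfolded ym_def], unfolded P] x y e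
    unfolding ym_def by metis
next
  fix n U z x
  note h = smorD(1)[OF m(1), of n] smorD(1)[OF m(2), of n] smorD(1)[OF m(3), of n] smorD(1)[OF m(4), of n]
  have P: "cDom C (p n) = sO P n" using hom_arrow[OF h(1)] by blast
  assume "z \<in> PE (SE (Yo C Z) n) U" "x \<in> PE (SE (Yo C X) n) U" "ym C f n x = ym C g n z"
  then have a: "x \<in> H U (sO X n)" "z \<in> H U (sO Z n)" "f n \<cdot> x = g n \<cdot> z" unfolding Yo_simps ym_def by auto
  show "\<exists>x'. x' \<in> PE (SE (Yo C P) n) U \<and> ym C p n x' = x \<and> ym C q n x' = z"
    using pullback_univ[OF pb h(3,4) a, unfolded P] unfolding Yo_simps ym_def by blast
qed

lemma ex_levelwise_pullback:
  assumes so: "simplicial_object C X" "simplicial_object C Z" "simplicial_object C Y"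
    and m: "smor C X Y f" "smor C Z Y g"
  obtains P p q where "simplicial_object C P" "smor C P X p" "smor C P Z q" "\<And>m. is_pullback C (f m) (g m) (p m) (q m)"
proof -
  let ?F = "Pull (Yo C X) (Yo C Z) (ym C f) (ym C g)"
  note sm = smap_ym[OF so(1,3) m(1)] smap_ym[OF so(2,3) m(2)]
  obtain P \<Phi> where P: "simplicial_object C P" and b: "sbij (Yo C P) ?F \<Phi>"
    using simplicial_object_of_good[OF good_Pb[OF good_Yo[OF so(1)] good_Yo[OF so(2)] good_Yo[OF so(3)] sm]] by blast
  have sP: "smap (Yo C P) ?F \<Phi>" and bij: "\<And>n U. U \<in> Ob \<Longrightarrow> bij_betw (\<Phi> n) (H U (sO P n)) (PE (SE ?F n) U)"
    using b unfolding sbij_def Yo_simps by auto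
  obtain p where p: "smor C P X p" "\<And>n U x. x \<in> H U (sO P n) \<Longrightarrow> p n \<cdot> x = fst (\<Phi> n x)"
    using yoneda[OF P so(1) smap_comp[OF sP smap_fst]] by blast
  obtain q where q: "smor C P Z q" "\<And>n U x. x \<in> H U (sO P n) \<Longrightarrow> q n \<cdot> x = snd (\<Phi> n x)"
    using yoneda[OF P so(2) smap_comp[OF sP smap_snd]] by blast
  have "is_pullback C (f n) (g n) (p n) (q n)" for n
  proof (rule is_pullbackI[OF smorD(1)[OF m(1)] smorD(1)[OF m(2)] smorD(1)[OF p(1)] smorD(1)[OF q(1)]])
    note i = hom_IdI[OF soD(1)[OF P, of n]]
    have "\<Phi> n (ID (sO P n)) \<in> PE (SE ?F n) (sO P n)" using bij_betwE[OF bij[OF soD(1)[OF P, of n], of n]] i by blast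
    then have "f n \<cdot> fst (\<Phi> n (ID (sO P n))) = g n \<cdot> snd (\<Phi> n (ID (sO P n)))" by (simp add: Pb_simps PE_PBp ym_def)
    then show "f n \<cdot> p n = g n \<cdot> q n"
      using p(2)[OF i] q(2)[OF i] comp_Id[OF smorD(1)[OF p(1)]] comp_Id[OF smorD(1)[OF q(1)]] by simp
    fix v p' q' assume h: "p' \<in> H v (sO X n)" "q' \<in> H v (sO Z n)" "f n \<cdot> p' = g n \<cdot> q'"
    note B = bij[OF hom_dom[OF h(1)], of n]
    have "(p', q') \<in> PE (SE ?F n) v" using h by (simp add: Pb_simps PE_PBp Yo_simps ym_def)
    then obtain w where w: "w \<in> H v (sO P n)" "\<Phi> n w = (p', q')" using bij_betw_imp_surj_on[OF B] by (metis imageE)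
    show "\<exists>!h. h \<in> H v (sO P n) \<and> p n \<cdot> h = p' \<and> q n \<cdot> h = q'"
    proof (rule ex1I[of _ w])
      show "w \<in> H v (sO P n) \<and> p n \<cdot> w = p' \<and> q n \<cdot> w = q'" using w p(2)[OF w(1)] q(2)[OF w(1)] by simp
      fix u assume u: "u \<in> H v (sO P n) \<and> p n \<cdot> u = p' \<and> q n \<cdot> u = q'"
      then have "\<Phi> n u = (p', q')" using p(2)[of u v n] q(2)[of u v n] by (simp add: prod_eq_iff)
      then show "u = w" using inj_onD[OF bij_betw_imp_inj_on[OF B], of u w] u w by simp
    qed
  qed
  then show thesis using that P p(1) q(1) by blast
qed

lemma smor_comp:
  assumes so: "simplicial_object C X" "simplicial_object C Y" "simplicial_object C Z" and m: "smor C X Y f" "smor C Y Z g"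
  shows "smor C X Z (\<lambda>n. g n \<cdot> f n)"
  unfolding smor_def
proof (intro conjI allI impI)
  fix n show "g n \<cdot> f n \<in> H (sO X n) (sO Z n)" by (rule hom_compI[OF smorD(1)[OF m(1)] smorD(1)[OF m(2)]])
next
  fix l n \<theta> assume t: "delta_hom l n \<theta>"
  note f = smorD(1)[OF m(1)] and g = smorD(1)[OF m(2)]
  have "sM Z l n \<theta> \<cdot> (g n \<cdot> f n) = (sM Z l n \<theta> \<cdot> g n) \<cdot> f n" by (rule comp_assoc[OF f g soD(2)[OF so(3) t], symmetric])
  also have "\<dots> = g l \<cdot> (sM Y l n \<theta> \<cdot> f n)" unfolding smorD(2)[OF m(2) t] by (rule comp_assoc[OF f soD(2)[OF so(2) t] g])
  also have "\<dots> = (g l \<cdot> f l) \<cdot> sM X l n \<theta>" unfolding smorD(2)[OF m(1) t] by (rule comp_assoc[OF soD(2)[OF so(1) t] f g, symmetric])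
  finally show "sM Z l n \<theta> \<cdot> (g n \<cdot> f n) = (g l \<cdot> f l) \<cdot> sM X l n \<theta>" .
qed

lemma ym_comp: "smor C X Y f \<Longrightarrow> smor C Y Z g \<Longrightarrow> x \<in> H U (sO X n) \<Longrightarrow> ym C (\<lambda>n. g n \<cdot> f n) n x = ym C g n (ym C f n x)"
  unfolding ym_def by (rule comp_assoc[OF _ smorD(1) smorD(1)])

text \<open>Any path space and any levelwise pullback represent the presheaf P(f) compatibly with q
  f, and the comparison bijection can be composed with or cancelled.\<close>

lemma hypercover_path_W:
  assumes so: "simplicial_object C X" "simplicial_object C Y" and f: "smor C X Y f"
    and p: "path_space C Y Q \<epsilon>" and P: "simplicial_object C P" "smor C P X p1" "smor C P Q p2"
    and pb: "\<And>m. is_pullback C (f m) (ev0 \<epsilon> m) (p1 m) (p2 m)"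
  shows "hypercover C Cov P Y (\<lambda>m. ev1 \<epsilon> m \<cdot> p2 m) \<longleftrightarrow> W (Yo C X) (Yo C Y) (ym C f)"
proof -
  note Q = path_space_Th[OF so(2) p] and ev = smor_ev[OF so(2) p]
  note const_path = smap_ym[OF so f]
  note sT = Q(2)[unfolded sbij_def, THEN conjunct1]
  have bT: "bij_betw (classify \<epsilon> n) (H U (sO Q n)) (PE (SE (PathSp (Yo C Y)) n) U)" if "U \<in> Ob" for n U
    using Q(2) that unfolding sbij_def Yo_simps by blast
  have e: "0 = (0::nat) \<or> 0 = (1::nat)" "1 = (0::nat) \<or> 1 = (1::nat)" by simp_all
  have "spb (Yo C P) (Yo C X) (Yo C Q) (Yo C Y) (ym C p1) (ym C (ev0 \<epsilon>)) (ym C p2) (ym C f)"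
    by (rule levelwise_spb[OF P(1) so(1) Q(1) so(2) P(2,3) f ev(1) pb])
  then have sq: "pb_square (SE (Yo C P) n) (SE (Yo C X) n) (SE (Yo C Q) n) (SE (Yo C Y) n) (ym C p1 n) (ym C (ev0 \<epsilon>) n) (ym C p2 n) (ym C f n)" for n
    unfolding spb_def by blast
  note sq = pb_squareD[OF sq]
  let ?\<Psi> = "\<lambda>n x. (ym C p1 n x, classify \<epsilon> n (ym C p2 n x))" and ?F = "PathOver (Yo C X) (Yo C Y) (ym C f)"
  note s1 = smap_ym[OF P(1) so(1) P(2)] and s2 = smap_ym[OF P(1) Q(1) P(3)]
  have ev0': "evp 0 n (classify \<epsilon> n x) = ym C (ev0 \<epsilon>) n x" for n x unfolding ym_def by (rule evp_Th(1))
  have b: "sbij (Yo C P) ?F ?\<Psi>"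
  proof (rule sbijI)
    show "smap (Yo C P) ?F ?\<Psi>"
    proof (rule smap_Pb[OF s1 smap_comp[OF s2 sT]])
      fix n U w assume "U \<in> Ob" "w \<in> PE (SE (Yo C P) n) U"
      then show "ym C f n (ym C p1 n w) = evp 0 n (classify \<epsilon> n (ym C p2 n w))" unfolding ev0' by (rule sq(6))
    qed
    fix n U y assume U: "U \<in> Ob" and y: "y \<in> PE (SE ?F n) U"
    then have y': "fst y \<in> PE (SE (Yo C X) n) U" "snd y \<in> PE (SE (PathSp (Yo C Y)) n) U" "ym C f n (fst y) = evp 0 n (snd y)"
      by (simp_all add: Pb_simps PE_PBp)
    obtain z where z: "z \<in> H U (sO Q n)" "classify \<epsilon> n z = snd y" using bij_betw_imp_surj_on[OF bT[OF U]] y'(2) by (metis imageE)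
    have "ym C f n (fst y) = ym C (ev0 \<epsilon>) n z" using y'(3) unfolding z(2)[symmetric] ev0' .
    then obtain x where "x \<in> PE (SE (Yo C P) n) U" "ym C p1 n x = fst y" "ym C p2 n x = z"
      using sq(7)[OF U z(1)[folded Yo_simps(1)] y'(1)] by blast
    then show "\<exists>x. x \<in> PE (SE (Yo C P) n) U \<and> ?\<Psi> n x = y" using z(2) by (intro exI[of _ x]) (simp add: prod_eq_iff)
  next
    fix n U x y assume U: "U \<in> Ob" and h: "x \<in> PE (SE (Yo C P) n) U" "y \<in> PE (SE (Yo C P) n) U" "?\<Psi> n x = ?\<Psi> n y"
    have "ym C p2 n x = ym C p2 n y"
      by (rule inj_onD[OF bij_betw_imp_inj_on[OF bT[OF U]]])
         (use h pmap_in[OF smapD(1)[OF s2] U] in \<open>auto simp: Yo_simps\<close>)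
    then show "x = y" using sq(8)[OF U h(1,2)] h(3) by simp
  qed
  note sm = b[unfolded sbij_def, THEN conjunct1]
  note sF = sps_Pf[OF const_path sps_Yo[OF so(1)] sps_Yo[OF so(2)]] and sP = sps_Yo[OF P(1)] and sY = sps_Yo[OF so(2)]
  have hb: "hcover Cov (Yo C P) ?F ?\<Psi>" by (rule hcov_sbij[OF stable_Cov b sP sF])
  have m: "smor C P Y (\<lambda>m. ev1 \<epsilon> m \<cdot> p2 m)" by (rule smor_comp[OF P(1) Q(1) so(2) P(3) ev(2)])
  have eq: "qf n (?\<Psi> n x) = ym C (\<lambda>m. ev1 \<epsilon> m \<cdot> p2 m) n x" if "x \<in> PE (SE (Yo C P) n) U" for n x U
    using that comp_assoc[OF _ smorD(1)[OF P(3)] smorD(1)[OF ev(2)]] unfolding qf_def snd_conv evp_Th(2) by (simp add: ym_def Yo_simps)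
  show ?thesis unfolding hypercover_iff[OF P(1) so(2) m] W_def
  proof
    assume "hcover Cov ?F (Yo C Y) qf"
    note 1 = hcov_comp[OF stable_Cov sm smap_qf sP sF sY hb this]
    show "hcover Cov (Yo C P) (Yo C Y) (ym C (\<lambda>m. ev1 \<epsilon> m \<cdot> p2 m))"
      by (rule hcov_cong[OF 1 sP sY smap_comp[OF sm smap_qf] smap_ym[OF P(1) so(2) m]]) (rule eq)
  next
    assume h: "hcover Cov (Yo C P) (Yo C Y) (ym C (\<lambda>m. ev1 \<epsilon> m \<cdot> p2 m))"
    have "hcover Cov (Yo C P) (Yo C Y) (\<lambda>n x. qf n (?\<Psi> n x))"
      by (rule hcov_cong[OF h sP sY smap_ym[OF P(1) so(2) m] smap_comp[OF sm smap_qf]]) (rule eq[symmetric])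
    from hcov_cancel[OF sm smap_qf good_Yo[OF P(1)] good_Pf[OF const_path good_Yo[OF so(1)] good_Yo[OF so(2)]] good_Yo[OF so(2)] hb this]
    show "hcover Cov ?F (Yo C Y) qf" .
  qed
qed

lemma weak_equiv_iff:
  assumes so: "simplicial_object C X" "simplicial_object C Y" and f: "smor C X Y f"
  shows "weak_equiv C Cov X Y f \<longleftrightarrow> W (Yo C X) (Yo C Y) (ym C f)"
proof
  assume w: "weak_equiv C Cov X Y f"
  obtain Q \<epsilon> where p: "path_space C Y Q \<epsilon>" using ex_path_space[OF so(2)] .
  obtain P p1 p2 where P: "simplicial_object C P" "smor C P X p1" "smor C P Q p2" "\<And>m. is_pullback C (f m) (ev0 \<epsilon> m) (p1 m) (p2 m)"
    using ex_levelwise_pullback[OF so(1) path_space_Th(1)[OF so(2) p] so(2) f smor_ev(1)[OF so(2) p]] by blast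
  have "path_space C Y Q \<epsilon> \<and> simplicial_object C P \<and> smor C P X p1 \<and> smor C P Q p2 \<and>
      (\<forall>m. is_pullback C (f m) (ev0 \<epsilon> m) (p1 m) (p2 m))" using p P by simp
  then have "hypercover C Cov P Y (\<lambda>m. ev1 \<epsilon> m \<cdot> p2 m)" by (rule w[unfolded weak_equiv_def, rule_format])
  then show "W (Yo C X) (Yo C Y) (ym C f)" using hypercover_path_W[OF so f p P] by simp
next
  assume w: "W (Yo C X) (Yo C Y) (ym C f)"
  show "weak_equiv C Cov X Y f"
    unfolding weak_equiv_def
  proof (intro allI impI, elim conjE)
    fix Q \<epsilon> P p1 p2
    assume h: "path_space C Y Q \<epsilon>" "simplicial_object C P" "smor C P X p1" "smor C P Q p2"
      "\<forall>m. is_pullback C (f m) (ev0 \<epsilon> m) (p1 m) (p2 m)"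
    from hypercover_path_W[OF so f h(1-4) spec[OF h(5)]] w
    show "hypercover C Cov P Y (\<lambda>m. ev1 \<epsilon> m \<cdot> p2 m)" by blast
  qed
qed

end

section \<open>The category of higher groupoids\<close>

context cat_loc begin

lemma pullback_unique:
  assumes pb: "is_pullback C f g p q" "is_pullback C f g p' q'"
  obtains i where "is_iso C i" "i \<in> H (cDom C p') (cDom C p)" "q \<cdot> i = q'"
proof -
  define a b c where "a = cDom C f" and "b = cDom C g" and "c = cCod C f"
  have h: "f \<in> H a c" "g \<in> H b c" using pb(1) unfolding is_pullback_def a_def b_def c_def hom_def by auto
  define P where "P = cDom C p"
  define P' where "P' = cDom C p'"
  note h1 = pullback_hom[OF pb(1) h, folded P_def] and h2 = pullback_hom[OF pb(2) h, folded P'_def]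
  note u1 = pullback_univ[OF pb(1) h, folded P_def] and u2 = pullback_univ[OF pb(2) h, folded P'_def]
  obtain i where i: "i \<in> H P' P" "p \<cdot> i = p'" "q \<cdot> i = q'" using ex1_implies_ex[OF u1[OF h2]] by blast
  obtain j where j: "j \<in> H P P'" "p' \<cdot> j = p" "q' \<cdot> j = q" using ex1_implies_ex[OF u2[OF h1]] by blast
  have ob: "P \<in> Ob" "P' \<in> Ob" using i hom_dom hom_cod by blast+
  have un: "x = ID R" if u: "\<exists>!h. h \<in> H R R \<and> r \<cdot> h = r \<and> s \<cdot> h = s" and x: "x \<in> H R R" "r \<cdot> x = r" "s \<cdot> x = s"
    and rs: "r \<in> H R a" "s \<in> H R b" and R: "R \<in> Ob" for x R r s
  proof -
    have "ID R \<in> H R R \<and> r \<cdot> ID R = r \<and> s \<cdot> ID R = s" using hom_IdI[OF R] comp_Id[OF rs(1)] comp_Id[OF rs(2)] by simp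
    then show ?thesis using u x by metis
  qed
  have "i \<cdot> j = ID P"
  proof (rule un[OF u1[OF h1] hom_compI[OF j(1) i(1)] _ _ h1(1,2) ob(1)])
    show "p \<cdot> i \<cdot> j = p" using comp_assoc[OF j(1) i(1) h1(1)] i j by simp
    show "q \<cdot> i \<cdot> j = q" using comp_assoc[OF j(1) i(1) h1(2)] i j by simp
  qed
  moreover have "j \<cdot> i = ID P'"
  proof (rule un[OF u2[OF h2] hom_compI[OF i(1) j(1)] _ _ h2(1,2) ob(2)])
    show "p' \<cdot> j \<cdot> i = p'" using comp_assoc[OF i(1) j(1) h2(1)] i j by simp
    show "q' \<cdot> j \<cdot> i = q'" using comp_assoc[OF i(1) j(1) h2(2)] i j by simp
  qed
  ultimately show thesis using that[OF is_isoI[OF i(1) j(1)]] i unfolding P_def P'_def by blast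
qed

lemma smor_Id: "simplicial_object C X \<Longrightarrow> smor C X X (\<lambda>n. ID (sO X n))"
  unfolding smor_def using hom_IdI[OF soD(1)] comp_Id[OF soD(2)] Id_comp[OF soD(2)] by simp

end

section \<open>The axioms of a category of fibrant objects for k-groupoids\<close>

context descent begin

context
  fixes k :: nat
begin

abbreviation "kg \<equiv> kgroupoid C Cov k"
abbreviation "S \<equiv> skV C Cov k"

lemma kgD:
  assumes "kg X"
  shows "simplicial_object C X" "Kan (Yo C X)" "fibr (isos C) (Suc k) (Yo C X) point bang" "good (Yo C X)" "simp_psh (Yo C X)"
  using assms good_Yo sps_Yo unfolding kgroupoid_iff by auto

lemma S_simps: "cOb S = {X. kg X}" "cDom S (X, Y, f) = X" "cCod S (X, Y, f) = Y"
  "cId S X = (X, X, \<lambda>n. ID (sO X n))" "cComp S (Y', Z, g) (X, Y, f) = (X, Z, \<lambda>n. g n \<cdot> f n)"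
  "(X, Y, f) \<in> cAr S \<longleftrightarrow> kg X \<and> kg Y \<and> smor C X Y f"
  unfolding skV_def by auto

lemma hom_S: "(X', Y', f) \<in> hom S X Y \<longleftrightarrow> X' = X \<and> Y' = Y \<and> kg X \<and> kg Y \<and> smor C X Y f"
  unfolding hom_def by (auto simp: S_simps)

lemma smor_kg_comp: "kg X \<Longrightarrow> kg Y \<Longrightarrow> kg Z \<Longrightarrow> smor C X Y f \<Longrightarrow> smor C Y Z g \<Longrightarrow> smor C X Z (\<lambda>n. g n \<cdot> f n)"
  using smor_comp kgD(1) by blast

lemma category_S: "category S"
  unfolding category_def
proof (intro conjI ballI impI)
  fix a assume "a \<in> cAr S"
  then obtain X Y f where a: "a = (X, Y, f)" "kg X" "kg Y" "smor C X Y f" by (cases a) (auto simp: S_simps)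
  show "cDom S a \<in> cOb S" "cCod S a \<in> cOb S" using a by (auto simp: S_simps)
  show "cComp S a (cId S (cDom S a)) = a" "cComp S (cId S (cCod S a)) a = a"
    using comp_Id[OF smorD(1)[OF a(4)]] Id_comp[OF smorD(1)[OF a(4)]] by (simp_all add: a(1) S_simps)
  fix b assume "b \<in> cAr S" and c: "cCod S a = cDom S b"
  then obtain Z g where b: "b = (Y, Z, g)" "kg Z" "smor C Y Z g" unfolding a by (cases b) (auto simp: S_simps)
  show "cComp S b a \<in> hom S (cDom S a) (cCod S b)"
    using smor_kg_comp[OF a(2,3) b(2) a(4) b(3)] a b by (simp add: S_simps hom_S)
next
  fix a assume "a \<in> cOb S"
  then show "cId S a \<in> hom S a a" using smor_Id[OF kgD(1)] by (simp add: S_simps hom_S)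
next
  fix a b c assume "a \<in> cAr S" "b \<in> cAr S" "c \<in> cAr S" "cCod S a = cDom S b \<and> cCod S b = cDom S c"
  then obtain X Y Z V f g h where a: "a = (X, Y, f)" "b = (Y, Z, g)" "c = (Z, V, h)" "smor C X Y f" "smor C Y Z g" "smor C Z V h"
    by (cases a; cases b; cases c) (auto simp: S_simps)
  show "cComp S c (cComp S b a) = cComp S (cComp S c b) a"
    using comp_assoc[OF smorD(1)[OF a(4)] smorD(1)[OF a(5)] smorD(1)[OF a(6)]] unfolding a(1-3) by (simp add: S_simps)
qed

lemma skFib_iff: "(X, Y, f) \<in> skFib C Cov k \<longleftrightarrow> (X, Y, f) \<in> cAr S \<and> fibr Cov 0 (Yo C X) (Yo C Y) (ym C f)"
  unfolding skFib_def using fibration_iff[OF kgD(1) kgD(1)] by (auto simp: S_simps)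

lemma skW_iff: "(X, Y, f) \<in> skW C Cov k \<longleftrightarrow> (X, Y, f) \<in> cAr S \<and> W (Yo C X) (Yo C Y) (ym C f)"
  unfolding skW_def using weak_equiv_iff[OF kgD(1) kgD(1)] by (auto simp: S_simps)

lemma smap_kg: "(X, Y, f) \<in> cAr S \<Longrightarrow> smap (Yo C X) (Yo C Y) (ym C f)"
  unfolding S_simps using smap_ym kgD(1) by blast

lemma trivial_fibration_iff:
  assumes a: "(X, Y, f) \<in> cAr S"
  shows "(X, Y, f) \<in> skFib C Cov k \<and> (X, Y, f) \<in> skW C Cov k \<longleftrightarrow> hcover Cov (Yo C X) (Yo C Y) (ym C f)"
proof -
  have k: "kg X" "kg Y" using a unfolding S_simps by auto
  note g = kgD[OF k(1)] kgD[OF k(2)]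
  show ?thesis unfolding skFib_iff skW_iff
    using a W_hcov[OF smap_kg[OF a] g(5,10,7)] W_fibr_hcov[OF smap_kg[OF a] g(4,9,2)]
      hcov_fibr[OF stable_Cov smap_kg[OF a] g(5,10)] by blast
qed

lemma ym_smap_comp:
  assumes "(X, Y, f) \<in> cAr S" "(Y, Z, g) \<in> cAr S"
  shows "(X, Z, \<lambda>n. g n \<cdot> f n) \<in> cAr S"
    "\<And>n U x. x \<in> PE (SE (Yo C X) n) U \<Longrightarrow> ym C g n (ym C f n x) = ym C (\<lambda>n. g n \<cdot> f n) n x"
  using assms smor_kg_comp ym_comp unfolding S_simps Yo_simps by auto

lemma W_comp_cong:
  assumes a: "(X, Y, f) \<in> cAr S" "(Y, Z, g) \<in> cAr S"
  shows "W (Yo C X) (Yo C Z) (ym C (\<lambda>n. g n \<cdot> f n)) \<longleftrightarrow> W (Yo C X) (Yo C Z) (\<lambda>n x. ym C g n (ym C f n x))"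
proof -
  have k: "kg X" "kg Z" using a unfolding S_simps by auto
  show ?thesis
    by (rule W_cong[OF smap_comp[OF smap_kg[OF a(1)] smap_kg[OF a(2)]] smap_kg[OF ym_smap_comp(1)[OF a]] kgD(4)[OF k(1)] kgD(4)[OF k(2)]])
       (rule ym_smap_comp(2)[OF a, symmetric])
qed

lemma W_two_of_three:
  assumes a: "(X, Y, f) \<in> cAr S" "(Y, Z, g) \<in> cAr S"
  shows "(X, Y, f) \<in> skW C Cov k \<Longrightarrow> (X, Z, \<lambda>n. g n \<cdot> f n) \<in> skW C Cov k \<longleftrightarrow> (Y, Z, g) \<in> skW C Cov k"
    "(Y, Z, g) \<in> skW C Cov k \<Longrightarrow> (X, Z, \<lambda>n. g n \<cdot> f n) \<in> skW C Cov k \<longleftrightarrow> (X, Y, f) \<in> skW C Cov k"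
proof -
  have k: "kg X" "kg Y" "kg Z" using a unfolding S_simps by auto
  note g = kgD[OF k(1)] kgD[OF k(2)] kgD[OF k(3)]
  note c = ym_smap_comp(1)[OF a]
  show "(X, Y, f) \<in> skW C Cov k \<Longrightarrow> (X, Z, \<lambda>n. g n \<cdot> f n) \<in> skW C Cov k \<longleftrightarrow> (Y, Z, g) \<in> skW C Cov k"
    using a c W_comp_left[OF smap_kg[OF a(1)] smap_kg[OF a(2)] g(4,9,14,7,12)] unfolding skW_iff W_comp_cong[OF a] by simp
  show "(Y, Z, g) \<in> skW C Cov k \<Longrightarrow> (X, Z, \<lambda>n. g n \<cdot> f n) \<in> skW C Cov k \<longleftrightarrow> (X, Y, f) \<in> skW C Cov k"
    using a c W_comp_right[OF smap_kg[OF a(1)] smap_kg[OF a(2)] g(4,9,14,7,12)] unfolding skW_iff W_comp_cong[OF a] by simp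
qed

lemma fib_comp:
  assumes a: "(X, Y, f) \<in> cAr S" "(Y, Z, g) \<in> cAr S"
    and h: "fibr Cov 0 (Yo C X) (Yo C Y) (ym C f)" "fibr Cov 0 (Yo C Y) (Yo C Z) (ym C g)"
  shows "fibr Cov 0 (Yo C X) (Yo C Z) (ym C (\<lambda>n. g n \<cdot> f n))"
proof -
  have k: "kg X" "kg Y" "kg Z" using a unfolding S_simps by auto
  note s = kgD(5)[OF k(1)] kgD(5)[OF k(2)] kgD(5)[OF k(3)] and m = smap_kg[OF a(1)] smap_kg[OF a(2)]
  show ?thesis
    by (rule fibr_cong[OF fibr_comp[OF stable_Cov m s h] s(1,3) smap_comp[OF m] smap_kg[OF ym_smap_comp(1)[OF a]]])
       (rule ym_smap_comp(2)[OF a])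
qed

lemma hcov_comp_ym:
  assumes a: "(X, Y, f) \<in> cAr S" "(Y, Z, g) \<in> cAr S"
    and h: "hcover Cov (Yo C X) (Yo C Y) (ym C f)" "hcover Cov (Yo C Y) (Yo C Z) (ym C g)"
  shows "hcover Cov (Yo C X) (Yo C Z) (ym C (\<lambda>n. g n \<cdot> f n))"
proof -
  have k: "kg X" "kg Y" "kg Z" using a unfolding S_simps by auto
  note s = kgD(5)[OF k(1)] kgD(5)[OF k(2)] kgD(5)[OF k(3)] and m = smap_kg[OF a(1)] smap_kg[OF a(2)]
  show ?thesis
    by (rule hcov_cong[OF hcov_comp[OF stable_Cov m s h] s(1,3) smap_comp[OF m] smap_kg[OF ym_smap_comp(1)[OF a]]])
       (rule ym_smap_comp(2)[OF a])
qed

lemma iso_hcov: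
  assumes a: "(X, Y, f) \<in> cAr S" and i: "is_iso S (X, Y, f)"
  shows "hcover Cov (Yo C X) (Yo C Y) (ym C f)"
proof -
  have k: "kg X" "kg Y" "smor C X Y f" using a unfolding S_simps by auto
  obtain b where b: "b \<in> hom S Y X" "cComp S b (X, Y, f) = cId S X" "cComp S (X, Y, f) b = cId S Y"
    using i unfolding is_iso_def S_simps by blast
  obtain g where g: "b = (Y, X, g)" "smor C Y X g" using b(1) by (cases b) (auto simp: hom_S)
  have gf: "g n \<cdot> f n = ID (sO X n)" "f n \<cdot> g n = ID (sO Y n)" for n
    using b(2,3) unfolding g(1) S_simps by (simp_all add: fun_eq_iff)
  note hf = smorD(1)[OF k(3)] and hg = smorD(1)[OF g(2)]
  have "sbij (Yo C X) (Yo C Y) (ym C f)"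
  proof (rule sbijI[OF smap_kg[OF a]])
    fix n U y assume "y \<in> PE (SE (Yo C Y) n) U"
    then have y: "y \<in> H U (sO Y n)" unfolding Yo_simps .
    have "f n \<cdot> (g n \<cdot> y) = y" using comp_assoc[OF y hg hf] gf Id_comp[OF y] by simp
    then show "\<exists>x. x \<in> PE (SE (Yo C X) n) U \<and> ym C f n x = y"
      unfolding Yo_simps ym_def using hom_compI[OF y hg] by blast
  next
    fix n U x y assume "x \<in> PE (SE (Yo C X) n) U" "y \<in> PE (SE (Yo C X) n) U" "ym C f n x = ym C f n y"
    then have h: "x \<in> H U (sO X n)" "y \<in> H U (sO X n)" "f n \<cdot> x = f n \<cdot> y" unfolding Yo_simps ym_def by auto
    have "g n \<cdot> (f n \<cdot> x) = x" "g n \<cdot> (f n \<cdot> y) = y"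
      using comp_assoc[OF h(1) hf hg] comp_assoc[OF h(2) hf hg] gf Id_comp[OF h(1)] Id_comp[OF h(2)] by simp_all
    then show "x = y" using h(3) by metis
  qed
  then show ?thesis by (rule hcov_sbij[OF stable_Cov _ kgD(5)[OF k(1)] kgD(5)[OF k(2)]])
qed

text \<open>The levelwise pullback is again a k-groupoid: relative fillers of f are pulled back to
  the map to Z and composed with the fillers of Z.\<close>

lemma pullback_S:
  assumes a: "(X, Y, f) \<in> cAr S" "(Z, Y, g) \<in> cAr S" and h: "fibr Cov 0 (Yo C X) (Yo C Y) (ym C f)"
  obtains P p q where "is_pullback S (X, Y, f) (Z, Y, g) (P, X, p) (P, Z, q)" "(P, Z, q) \<in> cAr S"
    "spb (Yo C P) (Yo C X) (Yo C Z) (Yo C Y) (ym C p) (ym C g) (ym C q) (ym C f)"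
proof -
  have k: "kg X" "kg Y" "kg Z" "smor C X Y f" "smor C Z Y g" using a unfolding S_simps by auto
  note so = kgD(1)[OF k(1)] kgD(1)[OF k(2)] kgD(1)[OF k(3)]
  obtain P p q where P: "simplicial_object C P" "smor C P X p" "smor C P Z q" and pb: "\<And>m. is_pullback C (f m) (g m) (p m) (q m)"
    using ex_levelwise_pullback[OF so(1,3,2) k(4,5)] by blast
  note sq = levelwise_spb[OF P(1) so(1,3,2) P(2,3) k(4,5) pb]
  note sP = sps_Yo[OF P(1)] and mq = smap_ym[OF P(1) so(3) P(3)]
  note s = kgD(5)[OF k(1)] kgD(5)[OF k(2)] kgD(5)[OF k(3)]
  have 1: "Kan (Yo C P)"
    using fibr_comp[OF stable_Cov mq smap_bang sP s(3) sps_pt fibr_pullback[OF sq h] kgD(2)[OF k(3)]] .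
  \<comment> \<open>Above dimension k the horns in X and in Y have unique fillers, so f has unique
    relative ones, and the truncation condition passes to P.\<close>
  have "fibr (isos C) (Suc k) (Yo C X) (Yo C Y) (ym C f)"
    by (rule fibr_isos_cancel[OF smap_kg[OF a(1)] s(1,2) kgD(3)[OF k(1)] kgD(3)[OF k(2)]])
  from fibr_comp[OF stable_isos mq smap_bang sP s(3) sps_pt fibr_pullback[OF sq this] kgD(3)[OF k(3)]]
  have kP: "kg P" unfolding kgroupoid_iff using P(1) 1 by blast
  have ar: "(P, X, p) \<in> cAr S" "(P, Z, q) \<in> cAr S" unfolding S_simps using kP k P by auto
  have D: "cDom C (p n) = sO P n" for n using hom_arrow[OF smorD(1)[OF P(2)]] by blast
  interpret S: cat_loc S by unfold_locales (rule category_S)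
  have "is_pullback S (X, Y, f) (Z, Y, g) (P, X, p) (P, Z, q)"
  proof (rule S.is_pullbackI)
    show "(X, Y, f) \<in> hom S X Y" "(Z, Y, g) \<in> hom S Z Y" "(P, X, p) \<in> hom S P X" "(P, Z, q) \<in> hom S P Z"
      unfolding hom_S using k kP P by auto
    have fp: "f n \<cdot> p n = g n \<cdot> q n" for n using pb[of n] unfolding is_pullback_def by blast
    show "cComp S (X, Y, f) (P, X, p) = cComp S (Z, Y, g) (P, Z, q)" unfolding S_simps using fp by simp
    fix V u v assume uv: "u \<in> hom S V X" "v \<in> hom S V Z" "cComp S (X, Y, f) u = cComp S (Z, Y, g) v"
    obtain p' where p': "u = (V, X, p')" "kg V" "smor C V X p'" using uv(1) by (cases u) (auto simp: hom_S)
    obtain q' where q': "v = (V, Z, q')" "smor C V Z q'" using uv(2) by (cases v) (auto simp: hom_S)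
    have e: "f n \<cdot> p' n = g n \<cdot> q' n" for n using uv(3) unfolding p'(1) q'(1) S_simps by (simp add: fun_eq_iff)
    note U = pullback_univ[OF pb smorD(1)[OF k(4)] smorD(1)[OF k(5)], unfolded D]
    note hp = smorD(1)[OF P(2)] and hq = smorD(1)[OF P(3)]
    have ex: "\<exists>w. w \<in> H (sO V n) (sO P n) \<and> p n \<cdot> w = p' n \<and> q n \<cdot> w = q' n" for n
      using U[OF smorD(1)[OF p'(3)] smorD(1)[OF q'(2)] e] by blast
    have un: "w = w'" if w: "w \<in> H A (sO P n)" "w' \<in> H A (sO P n)" "p n \<cdot> w = p n \<cdot> w'" "q n \<cdot> w = q n \<cdot> w'" for w w' A n
    proof -
      have "f n \<cdot> (p n \<cdot> w') = g n \<cdot> (q n \<cdot> w')"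
        using comp_assoc[OF w(2) hp smorD(1)[OF k(4)]] comp_assoc[OF w(2) hq smorD(1)[OF k(5)]] fp by simp
      from U[OF hom_compI[OF w(2) hp] hom_compI[OF w(2) hq] this] show ?thesis using w by metis
    qed
    define w where "w n = (SOME w. w \<in> H (sO V n) (sO P n) \<and> p n \<cdot> w = p' n \<and> q n \<cdot> w = q' n)" for n
    have w: "w n \<in> H (sO V n) (sO P n)" "p n \<cdot> w n = p' n" "q n \<cdot> w n = q' n" for n
      using someI_ex[OF ex[of n]] unfolding w_def by auto
    note soV = kgD(1)[OF p'(2)]
    have "smor C V P w" unfolding smor_def
    proof (intro conjI allI impI w(1))
      fix m n \<theta> assume t: "delta_hom m n \<theta>"
      note MP = soD(2)[OF P(1) t] and MV = soD(2)[OF soV t]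
      show "sM P m n \<theta> \<cdot> w n = w m \<cdot> sM V m n \<theta>"
      proof (rule un[OF hom_compI[OF w(1) MP] hom_compI[OF MV w(1)]])
        show "p m \<cdot> sM P m n \<theta> \<cdot> w n = p m \<cdot> w m \<cdot> sM V m n \<theta>"
          using comp_assoc[OF w(1) MP hp] comp_assoc[OF MV w(1) hp] comp_assoc[OF w(1) hp soD(2)[OF so(1) t]]
            smorD(2)[OF P(2) t] smorD(2)[OF p'(3) t] w(2) by simp
        show "q m \<cdot> sM P m n \<theta> \<cdot> w n = q m \<cdot> w m \<cdot> sM V m n \<theta>"
          using comp_assoc[OF w(1) MP hq] comp_assoc[OF MV w(1) hq] comp_assoc[OF w(1) hq soD(2)[OF so(3) t]]
            smorD(2)[OF P(3) t] smorD(2)[OF q'(2) t] w(3) by simp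
      qed
    qed
    show "\<exists>!h. h \<in> hom S V P \<and> cComp S (P, X, p) h = u \<and> cComp S (P, Z, q) h = v"
    proof (rule ex1I[of _ "(V, P, w)"])
      show "(V, P, w) \<in> hom S V P \<and> cComp S (P, X, p) (V, P, w) = u \<and> cComp S (P, Z, q) (V, P, w) = v"
        unfolding hom_S S_simps p'(1) q'(1) using \<open>smor C V P w\<close> kP p'(2) w by simp
      fix h assume h: "h \<in> hom S V P \<and> cComp S (P, X, p) h = u \<and> cComp S (P, Z, q) h = v"
      then obtain w' where w': "h = (V, P, w')" "smor C V P w'" by (cases h) (auto simp: hom_S)
      have "p n \<cdot> w' n = p' n" "q n \<cdot> w' n = q' n" for n
        using h unfolding w'(1) p'(1) q'(1) S_simps by (simp_all add: fun_eq_iff)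
      then have "w' n = w n" for n by (intro un[OF smorD(1)[OF w'(2)] w(1)]) (simp_all add: w)
      then show "h = (V, P, w)" unfolding w'(1) by (simp add: fun_eq_iff)
    qed
  qed
  then show thesis using that ar(2) sq by blast
qed

text \<open>Any pullback differs from the constructed one by an isomorphism of k-groupoids, which is
  a hypercover and hence a fibration.\<close>

lemma pullback_S_any:
  assumes a: "(X, Y, f) \<in> cAr S" "(Z, Y, g) \<in> cAr S" and h: "fibr Cov 0 (Yo C X) (Yo C Y) (ym C f)"
    and pb: "is_pullback S (X, Y, f) (Z, Y, g) u v"
  shows "v \<in> skFib C Cov k" "hcover Cov (Yo C X) (Yo C Y) (ym C f) \<Longrightarrow> v \<in> skFib C Cov k \<inter> skW C Cov k"
proof -
  obtain P p q where P: "is_pullback S (X, Y, f) (Z, Y, g) (P, X, p) (P, Z, q)" "(P, Z, q) \<in> cAr S"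
    "spb (Yo C P) (Yo C X) (Yo C Z) (Yo C Y) (ym C p) (ym C g) (ym C q) (ym C f)"
    using pullback_S[OF a h] by blast
  interpret S: cat_loc S by unfold_locales (rule category_S)
  obtain i where i: "is_iso S i" "i \<in> hom S (cDom S u) (cDom S (P, X, p))" "cComp S (P, Z, q) i = v"
    using S.pullback_unique[OF P(1) pb] by blast
  obtain Q w where w: "i = (Q, P, w)" "(Q, P, w) \<in> cAr S" using i(2) by (cases i) (auto simp: hom_S S_simps)
  have v: "v = (Q, Z, \<lambda>n. q n \<cdot> w n)" using i(3) unfolding w(1) S_simps by simp
  have k: "kg Q" "kg P" using w(2) unfolding S_simps by auto
  note c = ym_smap_comp(1)[OF w(2) P(2)]
  have hi: "hcover Cov (Yo C Q) (Yo C P) (ym C w)" using iso_hcov[OF w(2)] i(1) w(1) by simp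
  have fi: "fibr Cov 0 (Yo C Q) (Yo C P) (ym C w)"
    by (rule hcov_fibr[OF stable_Cov smap_kg[OF w(2)] kgD(5)[OF k(1)] kgD(5)[OF k(2)] hi])
  show "v \<in> skFib C Cov k"
    unfolding v skFib_iff using c fib_comp[OF w(2) P(2) fi fibr_pullback[OF P(3) h]] by blast
  assume "hcover Cov (Yo C X) (Yo C Y) (ym C f)"
  from hcov_comp_ym[OF w(2) P(2) hi hcov_pullback[OF P(3) this]]
  show "v \<in> skFib C Cov k \<inter> skW C Cov k" unfolding v using trivial_fibration_iff[OF c] by blast
qed

lemma terminal_S: "\<exists>e. terminal S e \<and> (\<forall>f\<in>cAr S. cCod S f = e \<longrightarrow> f \<in> skFib C Cov k)"
proof -
  obtain e \<Phi> where e: "simplicial_object C e" "sbij (Yo C e) (point :: ('o,'m,unit) spsh) \<Phi>"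
    using simplicial_object_of_good[OF good_pt] by blast
  have Ph: "\<Phi> = bang" by (intro ext) simp
  note b = e(2)[unfolded Ph] and se = sps_Yo[OF e(1)]
  have ke: "kg e" unfolding kgroupoid_iff
    using e(1) fibr_sbij[OF stable_Cov b se sps_pt] fibr_sbij[OF stable_isos b se sps_pt] by blast
  have bij: "bij_betw (\<lambda>x. ()) (H U (sO e n)) (UNIV :: unit set)" if "U \<in> Ob" for U n
    using b that unfolding sbij_def Yo_simps point_def by (simp add: UNIV_unit)
  have un: "x = y" if "x \<in> H U (sO e n)" "y \<in> H U (sO e n)" for x y U n
    using inj_onD[OF bij_betw_imp_inj_on[OF bij[OF hom_dom[OF that(1)]]] _ that] by simp
  have "terminal S e"
    unfolding terminal_def
  proof (intro conjI ballI)
    show "e \<in> cOb S" using ke by (simp add: S_simps)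
    fix X assume "X \<in> cOb S"
    then have kX: "kg X" by (simp add: S_simps)
    obtain w where w: "smor C X e w"
      by (rule lift_smor[OF kgD(1)[OF kX] e(1) b smap_bang])
    show "\<exists>!f. f \<in> hom S X e"
    proof (rule ex1I[of _ "(X, e, w)"])
      show "(X, e, w) \<in> hom S X e" using kX ke w by (simp add: hom_S)
      fix f assume "f \<in> hom S X e"
      then obtain w' where w': "f = (X, e, w')" "smor C X e w'" by (cases f) (auto simp: hom_S)
      have "w' n = w n" for n by (rule un[OF smorD(1)[OF w'(2)] smorD(1)[OF w]])
      then show "f = (X, e, w)" using w'(1) by (simp add: fun_eq_iff)
    qed
  qed
  moreover have "f \<in> skFib C Cov k" if fe: "f \<in> cAr S" "cCod S f = e" for f
  proof -
    obtain X g where f: "f = (X, e, g)" using fe by (cases f) (auto simp: S_simps)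
    note a = fe(1)[unfolded f]
    have kX: "kg X" using a unfolding S_simps by blast
    note sX = kgD(5)[OF kX]
    \<comment> \<open>Both e and the point have exactly one element at every object and level, so a
      map to e inherits its lifting conditions from the fillers of X.\<close>
    have "spb (Yo C X) (Yo C X) (Yo C e) (point :: ('o,'m,unit) spsh) (\<lambda>n x. x) bang (ym C g) bang"
    proof (rule spbI[OF sX sX se sps_pt smap_id[OF sX] smap_bang smap_kg[OF a] smap_bang])
      fix n U z x assume U: "U \<in> Ob" and z: "z \<in> PE (SE (Yo C e) n) U" and x: "x \<in> PE (SE (Yo C X) n) U"
      have "ym C g n x = z"
        by (rule un[OF pmap_in[OF smapD(1)[OF smap_kg[OF a]] U x, unfolded Yo_simps] z[unfolded Yo_simps]])
      then show "\<exists>x'. x' \<in> PE (SE (Yo C X) n) U \<and> x' = x \<and> ym C g n x' = z" using x by blast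
    qed auto
    from fibr_pullback[OF this kgD(2)[OF kX]] show ?thesis unfolding f skFib_iff using a by blast
  qed
  ultimately show ?thesis by blast
qed

lemma factorization_S:
  assumes a: "(X, Y, f) \<in> cAr S"
  shows "\<exists>w p. w \<in> skW C Cov k \<and> p \<in> skFib C Cov k \<and> cCod S w = cDom S p \<and> cComp S p w = (X, Y, f)"
proof -
  have k: "kg X" "kg Y" "smor C X Y f" using a unfolding S_simps by auto
  note g = kgD[OF k(1)] kgD[OF k(2)]
  note m = smap_kg[OF a]
  let ?F = "PathOver (Yo C X) (Yo C Y) (ym C f)"
  note gF = good_Pf[OF m g(4,9)] and sF = sps_Pf[OF m g(5,10)]
  obtain P \<Phi> where P: "simplicial_object C P" and b: "sbij (Yo C P) ?F \<Phi>"
    using simplicial_object_of_good[OF gF] by blast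
  note sP = sps_Yo[OF P]
  have mP: "smap (Yo C P) ?F \<Phi>" using b unfolding sbij_def by blast
  \<comment> \<open>Used once with covers and once with isomorphisms and N = k + 1, the two
    conditions that make P a k-groupoid.\<close>
  have "fibr K N (Yo C P) point bang" if K: "stable_class C K" and h: "fibr K N (Yo C Y) point bang" "fibr K N (Yo C X) point bang" for K N
    using fibr_comp[OF K mP smap_bang sP sF sps_pt fibr_sbij[OF K b sP sF] fibr_Pf[OF K m g(5,10) h]] .
  then have kP: "kg P" unfolding kgroupoid_iff using P g stable_Cov stable_isos by blast
  obtain p where p: "smor C P Y p" "\<And>n U x. x \<in> H U (sO P n) \<Longrightarrow> p n \<cdot> x = qf n (\<Phi> n x)"
    using yoneda[OF P g(6) smap_comp[OF mP smap_qf]] by blast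
  obtain w where w: "smor C X P w" "\<And>n U x. x \<in> H U (sO X n) \<Longrightarrow> \<Phi> n (w n \<cdot> x) = const_path (Yo C Y) (ym C f) n x"
    using lift_smor[OF g(1) P b smap_sf[OF m g(5,10)]] by blast
  have ar: "(X, P, w) \<in> cAr S" "(P, Y, p) \<in> cAr S" unfolding S_simps using k kP p(1) w(1) by auto
  have "fibr Cov 0 (Yo C P) (Yo C Y) (ym C p)"
  proof (rule fibr_cong[OF fibr_comp[OF stable_Cov mP smap_qf sP sF g(10) fibr_sbij[OF stable_Cov b sP sF]
      fibr_qf[OF stable_Cov m g(5,10) g(7) g(2)]] sP g(10) smap_comp[OF mP smap_qf] smap_kg[OF ar(2)]])
    fix n U x assume "x \<in> PE (SE (Yo C P) n) U"
    then show "qf n (\<Phi> n x) = ym C p n x" unfolding Yo_simps ym_def using p(2) by simp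
  qed
  then have 1: "(P, Y, p) \<in> skFib C Cov k" unfolding skFib_iff using ar by blast
  have "W (Yo C X) ?F (\<lambda>n x. \<Phi> n (ym C w n x)) \<longleftrightarrow> W (Yo C X) ?F (const_path (Yo C Y) (ym C f))"
    by (rule W_cong[OF smap_sf[OF m g(5,10)] smap_comp[OF smap_kg[OF ar(1)] mP] g(4) gF])
       (simp add: Yo_simps ym_def w(2))
  moreover have "W (Yo C X) ?F (\<lambda>n x. \<Phi> n (ym C w n x)) \<longleftrightarrow> W (Yo C X) (Yo C P) (ym C w)"
    by (rule W_post[OF mP hcov_sbij[OF stable_Cov b sP sF] smap_kg[OF ar(1)] g(4) good_Yo[OF P] gF])
  ultimately have 2: "(X, P, w) \<in> skW C Cov k"
    unfolding skW_iff using ar W_sf[OF m g(4,9,2,7)] by blast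
  have "p n \<cdot> w n = f n" for n
  proof -
    note i = hom_IdI[OF soD(1)[OF g(1), of n]] and wn = smorD(1)[OF w(1), of n]
    have "p n \<cdot> w n = qf n (const_path (Yo C Y) (ym C f) n (ID (sO X n)))"
      using p(2)[OF wn] w(2)[OF i] comp_Id[OF wn] by simp
    also have "\<dots> = ym C f n (ID (sO X n))"
      by (rule qf_sf[OF m g(10) soD(1)[OF g(1), of n]]) (simp add: Yo_simps i)
    finally show ?thesis unfolding ym_def using comp_Id[OF smorD(1)[OF k(3)]] by simp
  qed
  then have "cComp S (P, Y, p) (X, P, w) = (X, Y, f)" unfolding S_simps by simp
  then show ?thesis using 1 2 by (intro exI[of _ "(X, P, w)"] exI[of _ "(P, Y, p)"]) (simp add: S_simps)
qed

lemma cat_fibrant_objects_S: "cat_fibrant_objects S (skW C Cov k) (skFib C Cov k)"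
proof -
  interpret S: cat_loc S by unfold_locales (rule category_S)
  have arW: "a \<in> cAr S" if "a \<in> skW C Cov k" for a using that by (cases a) (simp add: skW_iff)
  have arF: "a \<in> cAr S" if "a \<in> skFib C Cov k" for a using that by (cases a) (simp add: skFib_iff)
  have isoFW: "a \<in> skFib C Cov k \<and> a \<in> skW C Cov k" if i: "is_iso S a" for a
  proof -
    obtain X Y f where a: "a = (X, Y, f)" by (cases a)
    have "(X, Y, f) \<in> cAr S" using i unfolding a is_iso_def by blast
    then show ?thesis using trivial_fibration_iff iso_hcov i unfolding a by blast
  qed
  have IdFW: "cId S X \<in> skFib C Cov k \<and> cId S X \<in> skW C Cov k" if "X \<in> cOb S" for X
    using isoFW[OF S.Id_iso[OF that]] .
  have compat: "\<exists>X Y Z f g. a = (X, Y, f) \<and> b = (Y, Z, g)" if "cCod S a = cDom S b" for a b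
    using that by (cases a; cases b) (auto simp: S_simps)
  show ?thesis
    unfolding cat_fibrant_objects_def
  proof (intro conjI)
    show "category S" by (rule category_S)
    show "subcat S (skW C Cov k)"
      unfolding subcat_def
    proof (intro conjI ballI impI)
      show "skW C Cov k \<subseteq> cAr S" using arW by blast
      show "cId S X \<in> skW C Cov k" if "X \<in> cOb S" for X using IdFW[OF that] by blast
      fix a b assume h: "a \<in> skW C Cov k" "b \<in> skW C Cov k" "cCod S a = cDom S b"
      then obtain X Y Z f g where ab: "a = (X, Y, f)" "b = (Y, Z, g)" using compat by blast
      show "cComp S b a \<in> skW C Cov k"
        using W_two_of_three(1)[OF arW[OF h(1), unfolded ab] arW[OF h(2), unfolded ab] h(1)[unfolded ab]] h(2)
        unfolding ab S_simps by blast
    qed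
    show "\<forall>f\<in>cAr S. is_iso S f \<longrightarrow> f \<in> skW C Cov k" using isoFW by blast
    show "\<forall>f\<in>cAr S. \<forall>g\<in>cAr S. cCod S f = cDom S g \<and> cComp S g f \<in> skW C Cov k \<longrightarrow> (f \<in> skW C Cov k) = (g \<in> skW C Cov k)"
    proof (intro ballI impI, elim conjE)
      fix a b assume h: "a \<in> cAr S" "b \<in> cAr S" "cCod S a = cDom S b" "cComp S b a \<in> skW C Cov k"
      then obtain X Y Z f g where ab: "a = (X, Y, f)" "b = (Y, Z, g)" using compat by blast
      show "(a \<in> skW C Cov k) = (b \<in> skW C Cov k)"
        using W_two_of_three[OF h(1,2)[unfolded ab]] h(4) unfolding ab S_simps by blast
    qed
    show "subcat S (skFib C Cov k)"
      unfolding subcat_def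
    proof (intro conjI ballI impI)
      show "skFib C Cov k \<subseteq> cAr S" using arF by blast
      show "cId S X \<in> skFib C Cov k" if "X \<in> cOb S" for X using IdFW[OF that] by blast
      fix a b assume h: "a \<in> skFib C Cov k" "b \<in> skFib C Cov k" "cCod S a = cDom S b"
      then obtain X Y Z f g where ab: "a = (X, Y, f)" "b = (Y, Z, g)" using compat by blast
      note ar = arF[OF h(1), unfolded ab] arF[OF h(2), unfolded ab]
      show "cComp S b a \<in> skFib C Cov k"
        using fib_comp[OF ar] ym_smap_comp(1)[OF ar] h(1,2) unfolding ab S_simps(5) skFib_iff by blast
    qed
    show "\<exists>e. terminal S e \<and> (\<forall>f\<in>cAr S. cCod S f = e \<longrightarrow> f \<in> skFib C Cov k)" by (rule terminal_S)
    show "\<forall>p\<in>skFib C Cov k. \<forall>g\<in>cAr S. cCod S g = cCod S p \<longrightarrow>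
        (\<exists>a b. is_pullback S p g a b) \<and> (\<forall>a b. is_pullback S p g a b \<longrightarrow> b \<in> skFib C Cov k)"
    proof (intro ballI impI)
      fix a b assume h: "a \<in> skFib C Cov k" "b \<in> cAr S" "cCod S b = cCod S a"
      then obtain X Y Z f g where ab: "a = (X, Y, f)" "b = (Z, Y, g)" by (cases a; cases b) (auto simp: S_simps)
      note ar = arF[OF h(1), unfolded ab] h(2)[unfolded ab]
      have fb: "fibr Cov 0 (Yo C X) (Yo C Y) (ym C f)" using h(1) unfolding ab skFib_iff by blast
      have "\<exists>u v. is_pullback S (X, Y, f) (Z, Y, g) u v" by (rule pullback_S[OF ar fb]) blast
      then show "(\<exists>u v. is_pullback S a b u v) \<and> (\<forall>u v. is_pullback S a b u v \<longrightarrow> v \<in> skFib C Cov k)"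
        using pullback_S_any(1)[OF ar fb] unfolding ab by simp
    qed
    show "\<forall>p\<in>skFib C Cov k \<inter> skW C Cov k. \<forall>g\<in>cAr S. \<forall>a b. cCod S g = cCod S p \<and> is_pullback S p g a b \<longrightarrow>
        b \<in> skFib C Cov k \<inter> skW C Cov k"
    proof (intro ballI allI impI, elim conjE)
      fix a b u v assume h: "a \<in> skFib C Cov k \<inter> skW C Cov k" "b \<in> cAr S" "cCod S b = cCod S a" "is_pullback S a b u v"
      then obtain X Y Z f g where ab: "a = (X, Y, f)" "b = (Z, Y, g)" by (cases a; cases b) (auto simp: S_simps)
      have "a \<in> cAr S" using h(1) arF by blast
      note ar = this[unfolded ab] h(2)[unfolded ab]
      have fb: "fibr Cov 0 (Yo C X) (Yo C Y) (ym C f)" using h(1) unfolding ab Int_iff skFib_iff by blast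
      have hc: "hcover Cov (Yo C X) (Yo C Y) (ym C f)" using h(1) trivial_fibration_iff[OF ar(1)] unfolding ab by blast
      show "v \<in> skFib C Cov k \<inter> skW C Cov k" by (rule pullback_S_any(2)[OF ar fb h(4)[unfolded ab] hc])
    qed
    show "\<forall>f\<in>cAr S. \<exists>w p. w \<in> skW C Cov k \<and> p \<in> skFib C Cov k \<and> cCod S w = cDom S p \<and> cComp S p w = f"
      using factorization_S by (metis prod_cases3)
  qed
qed

lemma trivial_fibrations_S:
  "\<forall>a\<in>cAr S. (a \<in> skFib C Cov k \<and> a \<in> skW C Cov k) \<longleftrightarrow> (case a of (X, Y, f) \<Rightarrow> hypercover C Cov X Y f)"
proof
  fix a assume "a \<in> cAr S"
  moreover obtain X Y f where a: "a = (X, Y, f)" by (cases a)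
  ultimately have ar: "(X, Y, f) \<in> cAr S" by simp
  then have s: "simplicial_object C X" "simplicial_object C Y" "smor C X Y f" using kgD(1) unfolding S_simps by auto
  show "(a \<in> skFib C Cov k \<and> a \<in> skW C Cov k) \<longleftrightarrow> (case a of (X, Y, f) \<Rightarrow> hypercover C Cov X Y f)"
    unfolding a using trivial_fibration_iff[OF ar] hypercover_iff[OF s] by simp
qed

end

end

theorem theorem3p6:
  fixes C :: "('o,'m) cat" and Cov :: "'m set" and k :: nat
  assumes "descent_category C Cov"
  shows "cat_fibrant_objects (skV C Cov k) (skW C Cov k) (skFib C Cov k) \<and>
         (\<forall>a\<in>cAr (skV C Cov k).
            (a \<in> skFib C Cov k \<and> a \<in> skW C Cov k) \<longleftrightarrow>
            (case a of (X, Y, f) \<Rightarrow> hypercover C Cov X Y f))"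
proof -
  have "category C" using assms unfolding descent_category_def by (rule conjunct1)
  then interpret descent C Cov using assms by unfold_locales
  show ?thesis by (rule conjI[OF cat_fibrant_objects_S trivial_fibrations_S])
qed

end
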